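(* The functor $K^s\colon\mathrm{ShSkMulti}_{lr}\to\mathrm{SkMon}$ from left representable short skew multicategories to skew monoidal categories (defined in the context) is an equivalence of categories, and so is the forgetful functor $U^s\colon\mathrm{SkMulti}_{lr}\to\mathrm{ShSkMulti}_{lr}$ from left representable skew multicategories to left representable short skew multicategories.
   Context: For $x,y\in\{t,l\}$ put $x\circ_iy=t$ if ($x=y=t$ and $i=1$) or ($x=t$ and $i\ne1$), and $x\circ_iy=l$ otherwise. ($t$ = "tight", $l$ = "loose".) **Short skew multicategories.** A short skew multicategory $\mathbb C$ consists of a category $\mathcal C$; functors $\mathbb C^t_n(-;-)\colon(\mathcal C^n)^{op}\times\mathcal C\to\mathrm{Set}$ for $1\le n\le4$ with $\mathbb C^t_1(-;-)=\mathcal C(-,-)$; functors $\mathbb C^l_n(-;-)\colon(\mathcal C^n)^{op}\times\mathcal C\to\mathrm{Set}$ for $n=0,1,2$; natural transformations $j\colon\mathbb C^t_n\to\mathbb C^l_n$ for $n=1,2$. Nullary maps are loose. The functorial action of tight unary maps (morphisms of $\mathcal C$) is written $q\circ f$ (codomain) and $f\circ_ip$ ($i$-th input). Furthermore there are substitution functions $\circ_i\colon\mathbb C^x_n(\bar b;c)\times\mathbb C^y_m(\bar a;b_i)\to\mathbb C^{x\circ_iy}_{n+m-1}(\bar b_{<i},\bar a,\bar b_{>i};c)$, natural in all $a_k$, $b_k$ ($k\neq i$), $c$ and dinatural in $b_i$, in the following cases: tight binary into tight binary or tight ternary; tight ternary into tight binary; nullary into tight binary or tight ternary; nullary into loose unary;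 loose unary into tight binary; tight binary into loose unary. Axioms: for $f$ tight binary, $g$ $n$-ary, $h$ $p$-ary (all tight except that nullary maps are loose), (A) $f\circ_i(g\circ_jh)=(f\circ_ig)\circ_{j+i-1}h$ for $1\le i\le2$, $1\le j\le n$, when $(n,p)\in\{(2,2),(2,0)\}$; (B) $(f\circ_1g)\circ_{n+1}h=(f\circ_2h)\circ_1g$ when $(n,p)\in\{(2,2),(2,0),(0,2),(0,0)\}$; and compatibility of $j$: for $g$ tight binary, $p,q$ tight unary, $v$ nullary, $g\circ_2jp=g\circ_2p$, $g\circ_1jp=j(g\circ_1p)$, $q\circ jp=j(q\circ p)$, $jp\circ g=j(p\circ g)$, $jp\circ v=p\circ v$. A morphism $F\colon\mathbb C\to\mathbb D$ is a functor $F\colon\mathcal C\to\mathcal D$ with natural families $F^t_n\colon\mathbb C^t_n(\bar a;b)\to\mathbb D^t_n(F\bar a;Fb)$ ($1\le n\le4$, $F^t_1=F$) and $F^l_n\colon\mathbb C^l_n(\bar a;b)\to\mathbb D^l_n(F\bar a;Fb)$ ($0\le n\le2$) commuting with all substitutions and with $j$. **Left representability (short skew).** $\mathbb C$ is left representable if there are tight binary maps $\theta_{a,b}\colon a,b\to ab$ (all $a,b$) such that $-\circ_1\theta_{a,b}\colon\mathbb C^t_n(ab,\bar x;d)\to\mathbb C^t_{n+1}(a,b,\bar x;d)$ is bijective for $n=1,2,3$, and a nullary map $u\in\mathbb C^l_0(\,;i)$ such that $-\circ_1u\colon\mathbb C^t_{n+1}(i,\bar x;d)\to\mathbb C^l_n(\bar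 x;d)$ is bijective for $n=0,1,2$. $\mathrm{ShSkMulti}_{lr}$ is the category of these and all morphisms of short skew multicategories. **Skew multicategories.** A skew multicategory has objects, sets $\mathbb C^t_n(\bar a;b)$ ($n\ge1$) and $\mathbb C^l_n(\bar a;b)$ ($n\ge0$), functions $j\colon\mathbb C^t_n(\bar a;b)\to\mathbb C^l_n(\bar a;b)$ ($n\ge1$), identities $1_a\in\mathbb C^t_1(a;a)$, and substitutions $\circ_i\colon\mathbb C^x_n(\bar b;c)\times\mathbb C^y_m(\bar a;b_i)\to\mathbb C^{x\circ_iy}_{n+m-1}(\bar b_{<i},\bar a,\bar b_{>i};c)$ for all $n\ge1$, $m\ge 0$, $1\le i\le n$ and all types, satisfying the usual multicategory associativity, commutativity and identity axioms, and compatible with $j$: replacing a tight argument of $g\circ_if$ by its image under $j$ leaves $g\circ_i f$ unchanged if the type of the result does not change, and replaces it by $j(g\circ_if)$ if the type changes from $t$ to $l$. Its underlying category is that of tight unary maps. Skew multifunctors are functors on underlying categories with natural families $F^t_n$ ($n\ge1$), $F^l_n$ ($n\ge0$), $F_1^t=F$, commuting with substitution and $j$. A skew multicategory is left representable if for each $x\in\{t,l\}$ and each $\bar a$ of length $n$ ($n\ge1$ if $x=t$, $n\ge0$ if $x=l$) there is $\theta^x_{\bar a}\in\mathbb C^x_n(\bar a;m^x\bar a)$ such that $-\circ_1\theta^x_{\bar a}\colon\mathbb C^t_{1+r}(m^x\bar a,\bar y;b)\to\mathbb C^x_{n+r}(\bar a,\bar y;b)$ is bijective for all $r\ge0$, $\bar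 y$ of length $r$, $b$. $\mathrm{SkMulti}_{lr}$ is the category of these and skew multifunctors. $U^s$ keeps tight $n$-ary maps for $1\le n\le4$, loose $n$-ary maps for $0\le n\le2$ and the operations listed in the definition of short skew multicategory. **Skew monoidal categories.** A (left) skew monoidal category is a category $\mathcal C$ with a functor $(a,b)\mapsto ab$, $\mathcal C\times\mathcal C\to\mathcal C$, an object $i$, and natural families $\alpha_{a,b,c}\colon(ab)c\to a(bc)$, $\lambda_a\colon ia\to a$, $\rho_a\colon a\to ai$ (not necessarily invertible) satisfying $\alpha_{a,b,cd}\alpha_{ab,c,d}=(a\,\alpha_{b,c,d})\alpha_{a,bc,d}(\alpha_{a,b,c}\,d)$, $\lambda_{ab}\alpha_{i,a,b}=\lambda_a b$, $\alpha_{a,b,i}\rho_{ab}=a\rho_b$, $(a\lambda_b)\alpha_{a,i,b}(\rho_a b)=1_{ab}$, $\lambda_i\rho_i=1_i$. A lax monoidal functor is a functor $F$ with a map $f_0\colon i\to Fi$ and a natural family $f_2\colon FaFb\to F(ab)$ such that $F\alpha\circ f_2\circ(f_2\cdot Fc)=f_2\circ(Fa\cdot f_2)\circ\alpha$, $F\lambda\circ f_2\circ(f_0\cdot Fa)=\lambda$, $f_2\circ(Fa\cdot f_0)\circ\rho=F\rho$. $\mathrm{SkMon}$ is the category of skew monoidal categories and lax monoidal functors. **The functor $K^s$.** For each left representable short skew multicategory fix a choice of tight binary maps $\theta_{a,b}\colon a,b\to ab$ (all $a,b$) such that $-\circ_1\theta_{a,b}\colon\mathbb C^t_n(ab,\bar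 x;d)\to\mathbb C^t_{n+1}(a,b,\bar x;d)$ is bijective for $n=1,2,3$, and of a nullary map $u\in\mathbb C^l_0(\,;i)$ such that $-\circ_1u\colon\mathbb C^t_{n+1}(i,\bar x;d)\to\mathbb C^l_n(\bar x;d)$ is bijective for $n=0,1,2$. $K^s\mathbb C$ has underlying category $\mathcal C$, tensor $ab$, unit $i$; for tight unary $f\colon a\to b$, $g\colon c\to d$, $fg$ is the unique map with $(fg)\circ\theta_{a,c}=(\theta_{b,d}\circ_1f)\circ_2g$; $\alpha$ is the unique map with $(\alpha\circ\theta_{ab,c})\circ_1\theta_{a,b}=\theta_{a,bc}\circ_2\theta_{b,c}$; $\lambda_a$ is the unique map with $(\lambda_a\circ\theta_{i,a})\circ_1u=j(1_a)$; $\rho_a=\theta_{a,i}\circ_2u$. On a morphism $F$, $K^sF=(F,f_0,f_2)$ with $f_2$ unique such that $f_2\circ\theta_{Fa,Fb}=F^t_2(\theta_{a,b})$ and $f_0$ unique such that $f_0\circ u=F^l_0(u)$. *)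

theory Defs
  imports "HOL-Library.FuncSet"
begin

text \<open>
  Conventions.  An arrow carries its source and target and a multimap carries its type, list of
  inputs and output, so an operation need not be indexed by the objects involved, and
  the hom-sets are arbitrary subsets of the type \<open>'m\<close> of labels (no disjointness or size
  constraint on \<open>'m\<close>).  Structures are records with carrier sets; the values of their operations
  outside the carriers are irrelevant.  Morphisms of structures are extensional functions, so that
  equality of morphisms is equality on the carriers.
\<close>

section \<open>Categories, functors, equivalences\<close>

datatype ('o, 'm) arr = Arr (src: 'o) (tgt: 'o) (lab: 'm)

record ('o, 'm) cat =
  Ob :: "'o set"
  Ar :: "('o, 'm) arr set"
  Id :: "'o \<Rightarrow> ('o, 'm) arr"
  Comp :: "('o, 'm) arr \<Rightarrow> ('o, 'm) arr \<Rightarrow> ('o, 'm) arr" (infixl "\<cdot>\<index>" 65)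

definition hom :: "('o, 'm, 'x) cat_scheme \<Rightarrow> 'o \<Rightarrow> 'o \<Rightarrow> ('o, 'm) arr set" where
  "hom C a b = {f \<in> Ar C. src f = a \<and> tgt f = b}"

locale category =
  fixes C :: "('o, 'm, 'x) cat_scheme" (structure)
  assumes arr_ob: "f \<in> Ar C \<Longrightarrow> src f \<in> Ob C \<and> tgt f \<in> Ob C"
    and id_hom: "a \<in> Ob C \<Longrightarrow> Id C a \<in> hom C a a"
    and comp_hom: "\<lbrakk>g \<in> Ar C; f \<in> Ar C; tgt f = src g\<rbrakk> \<Longrightarrow> g \<cdot> f \<in> hom C (src f) (tgt g)"
    and id_left: "f \<in> Ar C \<Longrightarrow> Id C (tgt f) \<cdot> f = f"
    and id_right: "f \<in> Ar C \<Longrightarrow> f \<cdot> Id C (src f) = f"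
    and comp_assoc: "\<lbrakk>h \<in> Ar C; g \<in> Ar C; f \<in> Ar C; tgt f = src g; tgt g = src h\<rbrakk>
      \<Longrightarrow> (h \<cdot> g) \<cdot> f = h \<cdot> (g \<cdot> f)"

record ('o, 'm, 'p, 'n) fctr =
  fob :: "'o \<Rightarrow> 'p"
  far :: "('o, 'm) arr \<Rightarrow> ('p, 'n) arr"

definition is_functor ::
  "('o, 'm, 'x) cat_scheme \<Rightarrow> ('p, 'n, 'y) cat_scheme \<Rightarrow> ('o, 'm, 'p, 'n, 'z) fctr_scheme \<Rightarrow> bool"
where
  "is_functor C D F \<longleftrightarrow>
     (\<forall>a \<in> Ob C. fob F a \<in> Ob D) \<and>
     (\<forall>f \<in> Ar C. far F f \<in> hom D (fob F (src f)) (fob F (tgt f))) \<and>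
     (\<forall>a \<in> Ob C. far F (Id C a) = Id D (fob F a)) \<and>
     (\<forall>g \<in> Ar C. \<forall>f \<in> Ar C. tgt f = src g \<longrightarrow>
        far F (g \<cdot>\<^bsub>C\<^esub> f) = far F g \<cdot>\<^bsub>D\<^esub> far F f)"

definition id_fctr :: "('o, 'm, 'o, 'm) fctr" where
  "id_fctr = \<lparr>fob = \<lambda>a. a, far = \<lambda>f. f\<rparr>"

definition comp_fctr :: "('p, 'n, 'q, 'k) fctr \<Rightarrow> ('o, 'm, 'p, 'n) fctr \<Rightarrow> ('o, 'm, 'q, 'k) fctr"
where
  "comp_fctr G F = \<lparr>fob = fob G \<circ> fob F, far = far G \<circ> far F\<rparr>"

definition is_iso :: "('o, 'm, 'x) cat_scheme \<Rightarrow> ('o, 'm) arr \<Rightarrow> bool" where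
  "is_iso C f \<longleftrightarrow> f \<in> Ar C \<and>
     (\<exists>g \<in> hom C (tgt f) (src f). g \<cdot>\<^bsub>C\<^esub> f = Id C (src f) \<and> f \<cdot>\<^bsub>C\<^esub> g = Id C (tgt f))"

definition nat_iso ::
  "('o, 'm, 'x) cat_scheme \<Rightarrow> ('p, 'n, 'y) cat_scheme \<Rightarrow> ('o, 'm, 'p, 'n) fctr \<Rightarrow>
   ('o, 'm, 'p, 'n) fctr \<Rightarrow> ('o \<Rightarrow> ('p, 'n) arr) \<Rightarrow> bool"
where
  "nat_iso C D F G \<eta> \<longleftrightarrow>
     (\<forall>a \<in> Ob C. \<eta> a \<in> hom D (fob F a) (fob G a) \<and> is_iso D (\<eta> a)) \<and>
     (\<forall>f \<in> Ar C. far G f \<cdot>\<^bsub>D\<^esub> \<eta> (src f) = \<eta> (tgt f) \<cdot>\<^bsub>D\<^esub> far F f)"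

definition equivalence ::
  "('o, 'm, 'x) cat_scheme \<Rightarrow> ('p, 'n, 'y) cat_scheme \<Rightarrow> ('o, 'm, 'p, 'n) fctr \<Rightarrow> bool"
where
  "equivalence C D F \<longleftrightarrow>
     category C \<and> category D \<and> is_functor C D F \<and>
     (\<exists>G. is_functor D C G \<and>
        (\<exists>\<eta>. nat_iso C C id_fctr (comp_fctr G F) \<eta>) \<and>
        (\<exists>\<epsilon>. nat_iso D D (comp_fctr F G) id_fctr \<epsilon>))"


section \<open>Skew monoidal categories and lax monoidal functors\<close>

record ('o, 'm) skewmon = "('o, 'm) cat" +
  Ten :: "'o \<Rightarrow> 'o \<Rightarrow> 'o" (infixl "\<odot>\<index>" 75)
  TenA :: "('o, 'm) arr \<Rightarrow> ('o, 'm) arr \<Rightarrow> ('o, 'm) arr" (infixl "\<otimes>\<index>" 75)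
  Unit :: "'o" ("\<I>\<index>")
  Alpha :: "'o \<Rightarrow> 'o \<Rightarrow> 'o \<Rightarrow> ('o, 'm) arr" ("\<alpha>\<index>")
  Lam :: "'o \<Rightarrow> ('o, 'm) arr" ("\<lambda>\<lambda>\<index>")
  Rho :: "'o \<Rightarrow> ('o, 'm) arr" ("\<rho>\<index>")

locale skew_monoidal = category C
  for C :: "('o, 'm, 'x) skewmon_scheme" (structure) +
  assumes ten_ob: "\<lbrakk>a \<in> Ob C; b \<in> Ob C\<rbrakk> \<Longrightarrow> a \<odot> b \<in> Ob C"
    and ten_hom: "\<lbrakk>f \<in> Ar C; g \<in> Ar C\<rbrakk> \<Longrightarrow> f \<otimes> g \<in> hom C (src f \<odot> src g) (tgt f \<odot> tgt g)"
    and ten_id: "\<lbrakk>a \<in> Ob C; b \<in> Ob C\<rbrakk> \<Longrightarrow> Id C a \<otimes> Id C b = Id C (a \<odot> b)"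
    and ten_comp: "\<lbrakk>f \<in> Ar C; f' \<in> Ar C; g \<in> Ar C; g' \<in> Ar C; tgt f = src f'; tgt g = src g'\<rbrakk>
      \<Longrightarrow> (f' \<cdot> f) \<otimes> (g' \<cdot> g) = (f' \<otimes> g') \<cdot> (f \<otimes> g)"
    and unit_ob: "\<I> \<in> Ob C"
    and alpha_hom: "\<lbrakk>a \<in> Ob C; b \<in> Ob C; c \<in> Ob C\<rbrakk>
      \<Longrightarrow> \<alpha> a b c \<in> hom C ((a \<odot> b) \<odot> c) (a \<odot> (b \<odot> c))"
    and alpha_nat: "\<lbrakk>f \<in> Ar C; g \<in> Ar C; h \<in> Ar C\<rbrakk>
      \<Longrightarrow> \<alpha> (tgt f) (tgt g) (tgt h) \<cdot> ((f \<otimes> g) \<otimes> h) = (f \<otimes> (g \<otimes> h)) \<cdot> \<alpha> (src f) (src g) (src h)"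
    and lam_hom: "a \<in> Ob C \<Longrightarrow> \<lambda>\<lambda> a \<in> hom C (\<I> \<odot> a) a"
    and lam_nat: "f \<in> Ar C \<Longrightarrow> \<lambda>\<lambda> (tgt f) \<cdot> (Id C \<I> \<otimes> f) = f \<cdot> \<lambda>\<lambda> (src f)"
    and rho_hom: "a \<in> Ob C \<Longrightarrow> \<rho> a \<in> hom C a (a \<odot> \<I>)"
    and rho_nat: "f \<in> Ar C \<Longrightarrow> \<rho> (tgt f) \<cdot> f = (f \<otimes> Id C \<I>) \<cdot> \<rho> (src f)"
    and pentagon: "\<lbrakk>a \<in> Ob C; b \<in> Ob C; c \<in> Ob C; d \<in> Ob C\<rbrakk>
      \<Longrightarrow> \<alpha> a b (c \<odot> d) \<cdot> \<alpha> (a \<odot> b) c d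
        = (Id C a \<otimes> \<alpha> b c d) \<cdot> \<alpha> a (b \<odot> c) d \<cdot> (\<alpha> a b c \<otimes> Id C d)"
    and lam_alpha: "\<lbrakk>a \<in> Ob C; b \<in> Ob C\<rbrakk> \<Longrightarrow> \<lambda>\<lambda> (a \<odot> b) \<cdot> \<alpha> \<I> a b = \<lambda>\<lambda> a \<otimes> Id C b"
    and alpha_rho: "\<lbrakk>a \<in> Ob C; b \<in> Ob C\<rbrakk> \<Longrightarrow> \<alpha> a b \<I> \<cdot> \<rho> (a \<odot> b) = Id C a \<otimes> \<rho> b"
    and triangle: "\<lbrakk>a \<in> Ob C; b \<in> Ob C\<rbrakk>
      \<Longrightarrow> (Id C a \<otimes> \<lambda>\<lambda> b) \<cdot> \<alpha> a \<I> b \<cdot> (\<rho> a \<otimes> Id C b) = Id C (a \<odot> b)"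
    and lam_rho: "\<lambda>\<lambda> \<I> \<cdot> \<rho> \<I> = Id C \<I>"

record ('o, 'm) laxf = "('o, 'm, 'o, 'm) fctr" +
  f0 :: "('o, 'm) arr"
  f2 :: "'o \<Rightarrow> 'o \<Rightarrow> ('o, 'm) arr"

locale lax_monoidal =
  C: skew_monoidal C + D: skew_monoidal D
  for C :: "('o, 'm) skewmon" and D :: "('o, 'm) skewmon" +
  fixes F :: "('o, 'm) laxf"
  assumes fctr: "is_functor C D F"
    and ext: "fob F \<in> extensional (Ob C)" "far F \<in> extensional (Ar C)"
      "\<not> (a \<in> Ob C \<and> b \<in> Ob C) \<Longrightarrow> f2 F a b = undefined"
    and f0_hom: "f0 F \<in> hom D \<I>\<^bsub>D\<^esub> (fob F \<I>\<^bsub>C\<^esub>)"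
    and f2_hom: "\<lbrakk>a \<in> Ob C; b \<in> Ob C\<rbrakk>
      \<Longrightarrow> f2 F a b \<in> hom D (fob F a \<odot>\<^bsub>D\<^esub> fob F b) (fob F (a \<odot>\<^bsub>C\<^esub> b))"
    and f2_nat: "\<lbrakk>f \<in> Ar C; g \<in> Ar C\<rbrakk>
      \<Longrightarrow> far F (f \<otimes>\<^bsub>C\<^esub> g) \<cdot>\<^bsub>D\<^esub> f2 F (src f) (src g)
        = f2 F (tgt f) (tgt g) \<cdot>\<^bsub>D\<^esub> (far F f \<otimes>\<^bsub>D\<^esub> far F g)"
    and lax_alpha: "\<lbrakk>a \<in> Ob C; b \<in> Ob C; c \<in> Ob C\<rbrakk>
      \<Longrightarrow> far F (\<alpha>\<^bsub>C\<^esub> a b c) \<cdot>\<^bsub>D\<^esub> f2 F (a \<odot>\<^bsub>C\<^esub> b) c \<cdot>\<^bsub>D\<^esub> (f2 F a b \<otimes>\<^bsub>D\<^esub> Id D (fob F c))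
        = f2 F a (b \<odot>\<^bsub>C\<^esub> c) \<cdot>\<^bsub>D\<^esub> (Id D (fob F a) \<otimes>\<^bsub>D\<^esub> f2 F b c) \<cdot>\<^bsub>D\<^esub> \<alpha>\<^bsub>D\<^esub> (fob F a) (fob F b) (fob F c)"
    and lax_lam: "a \<in> Ob C
      \<Longrightarrow> far F (\<lambda>\<lambda>\<^bsub>C\<^esub> a) \<cdot>\<^bsub>D\<^esub> f2 F \<I>\<^bsub>C\<^esub> a \<cdot>\<^bsub>D\<^esub> (f0 F \<otimes>\<^bsub>D\<^esub> Id D (fob F a)) = \<lambda>\<lambda>\<^bsub>D\<^esub> (fob F a)"
    and lax_rho: "a \<in> Ob C
      \<Longrightarrow> f2 F a \<I>\<^bsub>C\<^esub> \<cdot>\<^bsub>D\<^esub> (Id D (fob F a) \<otimes>\<^bsub>D\<^esub> f0 F) \<cdot>\<^bsub>D\<^esub> \<rho>\<^bsub>D\<^esub> (fob F a) = far F (\<rho>\<^bsub>C\<^esub> a)"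

definition id_lax :: "('o, 'm) skewmon \<Rightarrow> ('o, 'm) laxf" where
  "id_lax C =
     \<lparr>fob = restrict (\<lambda>a. a) (Ob C), far = restrict (\<lambda>f. f) (Ar C), f0 = Id C \<I>\<^bsub>C\<^esub>,
      f2 = \<lambda>a b. if a \<in> Ob C \<and> b \<in> Ob C then Id C (a \<odot>\<^bsub>C\<^esub> b) else undefined\<rparr>"

text \<open>The composite of \<open>F\<close>, with source \<open>C\<close>, and \<open>G\<close>, with target \<open>E\<close>.\<close>

definition comp_lax ::
  "('o, 'm) skewmon \<Rightarrow> ('o, 'm) skewmon \<Rightarrow> ('o, 'm) laxf \<Rightarrow> ('o, 'm) laxf \<Rightarrow> ('o, 'm) laxf"
where
  "comp_lax C E G F =
     \<lparr>fob = compose (Ob C) (fob G) (fob F), far = compose (Ar C) (far G) (far F),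
      f0 = far G (f0 F) \<cdot>\<^bsub>E\<^esub> f0 G,
      f2 = \<lambda>a b. if a \<in> Ob C \<and> b \<in> Ob C
        then far G (f2 F a b) \<cdot>\<^bsub>E\<^esub> f2 G (fob F a) (fob F b) else undefined\<rparr>"

definition SkMon :: "(('o, 'm) skewmon, ('o, 'm) laxf) cat" where
  "SkMon =
     \<lparr>Ob = {C. skew_monoidal C},
      Ar = {Arr C D F | C D F. lax_monoidal C D F},
      Id = \<lambda>C. Arr C C (id_lax C),
      Comp = \<lambda>G F. Arr (src F) (tgt G) (comp_lax (src F) (tgt G) (lab G) (lab F))\<rparr>"


section \<open>Skew multicategories and short skew multicategories\<close>

datatype tightness = Tight | Loose

definition sub_type :: "tightness \<Rightarrow> nat \<Rightarrow> tightness \<Rightarrow> tightness" where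
  "sub_type x i y =
     (if (x = Tight \<and> y = Tight \<and> i = 1) \<or> (x = Tight \<and> i \<noteq> 1) then Tight else Loose)"

datatype ('o, 'm) mmap = MMap (ty: tightness) (ins: "'o list") (out: 'o) (mlab: 'm)

text \<open>
  The same signature serves for skew multicategories and for short ones.  Input positions are
  numbered from 1.  Composition in the underlying category and the functorial action of its
  morphisms on multimaps, written \<open>q \<circ> f\<close> and \<open>f \<circ>\<^sub>i p\<close> in both settings, are the substitutions
  \<open>q \<star>[1] f\<close> and \<open>f \<star>[i] p\<close> with \<open>q\<close>, \<open>p\<close> tight unary.
\<close>

record ('o, 'm) multi =
  Obj :: "'o set"
  Maps :: "('o, 'm) mmap set"
  Jay :: "('o, 'm) mmap \<Rightarrow> ('o, 'm) mmap" ("\<j>\<index>")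
  Idm :: "'o \<Rightarrow> ('o, 'm) mmap"
  Sub :: "('o, 'm) mmap \<Rightarrow> nat \<Rightarrow> ('o, 'm) mmap \<Rightarrow> ('o, 'm) mmap" ("(_/ \<star>[_]\<index>/ _)" [65, 0, 66] 65)

definition maps :: "('o, 'm) multi \<Rightarrow> tightness \<Rightarrow> 'o list \<Rightarrow> 'o \<Rightarrow> ('o, 'm) mmap set" where
  "maps C x as b = {f \<in> Maps C. ty f = x \<and> ins f = as \<and> out f = b}"

definition maps_n :: "('o, 'm) multi \<Rightarrow> tightness \<Rightarrow> nat \<Rightarrow> ('o, 'm) mmap set" where
  "maps_n C x n = {f \<in> Maps C. ty f = x \<and> length (ins f) = n}"

definition arity :: "('o, 'm) mmap \<Rightarrow> nat" where
  "arity f = length (ins f)"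

definition fits :: "('o, 'm) mmap \<Rightarrow> nat \<Rightarrow> ('o, 'm) mmap \<Rightarrow> bool" where
  "fits g i f \<longleftrightarrow> 1 \<le> i \<and> i \<le> arity g \<and> out f = ins g ! (i - 1)"

definition sub_ins :: "('o, 'm) mmap \<Rightarrow> nat \<Rightarrow> ('o, 'm) mmap \<Rightarrow> 'o list" where
  "sub_ins g i f = take (i - 1) (ins g) @ ins f @ drop i (ins g)"

locale skew_multicategory =
  fixes C :: "('o, 'm) multi" (structure)
  assumes map_wf: "f \<in> Maps C \<Longrightarrow>
        set (ins f) \<subseteq> Obj C \<and> out f \<in> Obj C \<and> (ty f = Tight \<longrightarrow> 1 \<le> arity f)"
    and idm: "a \<in> Obj C \<Longrightarrow> Idm C a \<in> maps C Tight [a] a"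
    and jay: "\<lbrakk>f \<in> Maps C; ty f = Tight\<rbrakk> \<Longrightarrow> \<j> f \<in> maps C Loose (ins f) (out f)"
    and sub: "\<lbrakk>g \<in> Maps C; f \<in> Maps C; fits g i f\<rbrakk>
      \<Longrightarrow> g \<star>[i] f \<in> maps C (sub_type (ty g) i (ty f)) (sub_ins g i f) (out g)"
    and id_sub: "f \<in> Maps C \<Longrightarrow> Idm C (out f) \<star>[1] f = f"
    and sub_id: "\<lbrakk>f \<in> Maps C; 1 \<le> i; i \<le> arity f\<rbrakk> \<Longrightarrow> f \<star>[i] Idm C (ins f ! (i - 1)) = f"
    and sub_assoc: "\<lbrakk>h \<in> Maps C; g \<in> Maps C; f \<in> Maps C; fits h i g; fits g j f\<rbrakk>
      \<Longrightarrow> h \<star>[i] (g \<star>[j] f) = (h \<star>[i] g) \<star>[j + i - 1] f"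
    and sub_commute: "\<lbrakk>h \<in> Maps C; g \<in> Maps C; f \<in> Maps C; fits h i g; fits h k f; i < k\<rbrakk>
      \<Longrightarrow> (h \<star>[i] g) \<star>[k + arity g - 1] f = (h \<star>[k] f) \<star>[i] g"
    and jay_sub_left: "\<lbrakk>g \<in> Maps C; f \<in> Maps C; fits g i f; ty g = Tight\<rbrakk>
      \<Longrightarrow> \<j> g \<star>[i] f =
        (if sub_type Loose i (ty f) = sub_type Tight i (ty f) then g \<star>[i] f else \<j> (g \<star>[i] f))"
    and jay_sub_right: "\<lbrakk>g \<in> Maps C; f \<in> Maps C; fits g i f; ty f = Tight\<rbrakk>
      \<Longrightarrow> g \<star>[i] \<j> f =
        (if sub_type (ty g) i Loose = sub_type (ty g) i Tight then g \<star>[i] f else \<j> (g \<star>[i] f))"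

definition short_arity :: "tightness \<Rightarrow> nat \<Rightarrow> bool" where
  "short_arity x n \<longleftrightarrow> (x = Tight \<and> 1 \<le> n \<and> n \<le> 4) \<or> (x = Loose \<and> n \<le> 2)"

text \<open>\<open>short_sub x n y m\<close>: multimaps of type \<open>y\<close> and arity \<open>m\<close> may be substituted into multimaps of
  type \<open>x\<close> and arity \<open>n\<close>, excluding the actions of tight unary maps.\<close>

definition short_sub :: "tightness \<Rightarrow> nat \<Rightarrow> tightness \<Rightarrow> nat \<Rightarrow> bool" where
  "short_sub x n y m \<longleftrightarrow>
     (x, n, y, m) \<in> {(Tight, 2, Tight, 2), (Tight, 3, Tight, 2),
                     (Tight, 2, Tight, 3),
                     (Tight, 2, Loose, 0), (Tight, 3, Loose, 0),
                     (Loose, 1, Loose, 0),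
                     (Tight, 2, Loose, 1),
                     (Loose, 1, Tight, 2)}"

definition short_op :: "tightness \<Rightarrow> nat \<Rightarrow> tightness \<Rightarrow> nat \<Rightarrow> bool" where
  "short_op x n y m \<longleftrightarrow> short_sub x n y m \<or>
     (x = Tight \<and> n = 1 \<and> short_arity y m) \<or> (short_arity x n \<and> y = Tight \<and> m = 1)"

abbreviation (input) sub_defined :: "('o, 'm) mmap \<Rightarrow> ('o, 'm) mmap \<Rightarrow> bool" where
  "sub_defined g f \<equiv> short_sub (ty g) (arity g) (ty f) (arity f)"

abbreviation (input) op_defined :: "('o, 'm) mmap \<Rightarrow> ('o, 'm) mmap \<Rightarrow> bool" where
  "op_defined g f \<equiv> short_op (ty g) (arity g) (ty f) (arity f)"

locale short_skew_multicategory =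
  fixes C :: "('o, 'm) multi" (structure)
  assumes map_wf: "f \<in> Maps C \<Longrightarrow>
        set (ins f) \<subseteq> Obj C \<and> out f \<in> Obj C \<and> short_arity (ty f) (arity f)"
    and idm: "a \<in> Obj C \<Longrightarrow> Idm C a \<in> maps C Tight [a] a"
    and jay: "\<lbrakk>f \<in> Maps C; ty f = Tight; arity f \<le> 2\<rbrakk> \<Longrightarrow> \<j> f \<in> maps C Loose (ins f) (out f)"
    and sub: "\<lbrakk>g \<in> Maps C; f \<in> Maps C; fits g i f; op_defined g f\<rbrakk>
      \<Longrightarrow> g \<star>[i] f \<in> maps C (sub_type (ty g) i (ty f)) (sub_ins g i f) (out g)"
    \<comment> \<open>the underlying category, and functoriality of each hom functor, expressed as functoriality
       in each variable together with interchange; for tight unary \<open>f\<close> these are the category axioms\<close>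
    and id_act: "f \<in> Maps C \<Longrightarrow> Idm C (out f) \<star>[1] f = f"
    and act_id: "\<lbrakk>f \<in> Maps C; 1 \<le> i; i \<le> arity f\<rbrakk> \<Longrightarrow> f \<star>[i] Idm C (ins f ! (i - 1)) = f"
    and comp_act: "\<lbrakk>f \<in> Maps C; q \<in> maps_n C Tight 1; q' \<in> maps_n C Tight 1; fits q 1 f; fits q' 1 q\<rbrakk>
      \<Longrightarrow> q' \<star>[1] (q \<star>[1] f) = (q' \<star>[1] q) \<star>[1] f"
    and act_comp: "\<lbrakk>f \<in> Maps C; p \<in> maps_n C Tight 1; p' \<in> maps_n C Tight 1; fits f i p; fits p 1 p'\<rbrakk>
      \<Longrightarrow> f \<star>[i] (p \<star>[1] p') = (f \<star>[i] p) \<star>[i] p'"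
    and act_act: "\<lbrakk>f \<in> Maps C; p \<in> maps_n C Tight 1; q \<in> maps_n C Tight 1; fits f i p; fits q 1 f\<rbrakk>
      \<Longrightarrow> q \<star>[1] (f \<star>[i] p) = (q \<star>[1] f) \<star>[i] p"
    and act_commute: "\<lbrakk>f \<in> Maps C; p \<in> maps_n C Tight 1; p' \<in> maps_n C Tight 1;
        fits f i p; fits f k p'; i \<noteq> k\<rbrakk>
      \<Longrightarrow> (f \<star>[i] p) \<star>[k] p' = (f \<star>[k] p') \<star>[i] p"
    \<comment> \<open>naturality of \<open>j\<close>\<close>
    and jay_nat_out: "\<lbrakk>f \<in> Maps C; ty f = Tight; arity f \<le> 2; q \<in> maps_n C Tight 1; fits q 1 f\<rbrakk>
      \<Longrightarrow> q \<star>[1] \<j> f = \<j> (q \<star>[1] f)"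
    and jay_nat_in: "\<lbrakk>f \<in> Maps C; ty f = Tight; arity f \<le> 2; p \<in> maps_n C Tight 1; fits f i p\<rbrakk>
      \<Longrightarrow> \<j> f \<star>[i] p = \<j> (f \<star>[i] p)"
    \<comment> \<open>(di)naturality of substitution\<close>
    and sub_nat_a: "\<lbrakk>g \<in> Maps C; f \<in> Maps C; fits g i f; sub_defined g f;
        p \<in> maps_n C Tight 1; fits f k p\<rbrakk>
      \<Longrightarrow> g \<star>[i] (f \<star>[k] p) = (g \<star>[i] f) \<star>[k + i - 1] p"
    and sub_nat_b: "\<lbrakk>g \<in> Maps C; f \<in> Maps C; fits g i f; sub_defined g f;
        p \<in> maps_n C Tight 1; fits g k p; k \<noteq> i\<rbrakk>
      \<Longrightarrow> (g \<star>[k] p) \<star>[i] f = (g \<star>[i] f) \<star>[if k < i then k else k + arity f - 1] p"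
    and sub_nat_c: "\<lbrakk>g \<in> Maps C; f \<in> Maps C; fits g i f; sub_defined g f;
        q \<in> maps_n C Tight 1; fits q 1 g\<rbrakk>
      \<Longrightarrow> (q \<star>[1] g) \<star>[i] f = q \<star>[1] (g \<star>[i] f)"
    and sub_dinat: "\<lbrakk>g \<in> Maps C; f \<in> Maps C; sub_defined g f;
        p \<in> maps_n C Tight 1; fits g i p; fits p 1 f\<rbrakk>
      \<Longrightarrow> (g \<star>[i] p) \<star>[i] f = g \<star>[i] (p \<star>[1] f)"
    \<comment> \<open>axioms (A) and (B)\<close>
    and axiom_A: "\<lbrakk>f \<in> maps_n C Tight 2; g \<in> maps_n C Tight 2;
        h \<in> maps_n C Tight 2 \<union> maps_n C Loose 0; fits f i g; fits g j h\<rbrakk>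
      \<Longrightarrow> f \<star>[i] (g \<star>[j] h) = (f \<star>[i] g) \<star>[j + i - 1] h"
    and axiom_B: "\<lbrakk>f \<in> maps_n C Tight 2; g \<in> maps_n C Tight 2 \<union> maps_n C Loose 0;
        h \<in> maps_n C Tight 2 \<union> maps_n C Loose 0; fits f 1 g; fits f 2 h\<rbrakk>
      \<Longrightarrow> (f \<star>[1] g) \<star>[arity g + 1] h = (f \<star>[2] h) \<star>[1] g"
    \<comment> \<open>compatibility of \<open>j\<close> with substitution; \<open>q \<circ> j p = j (q \<circ> p)\<close> is an instance of naturality\<close>
    and jay_sub_2: "\<lbrakk>g \<in> maps_n C Tight 2; p \<in> maps_n C Tight 1; fits g 2 p\<rbrakk>
      \<Longrightarrow> g \<star>[2] \<j> p = g \<star>[2] p"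
    and jay_sub_1: "\<lbrakk>g \<in> maps_n C Tight 2; p \<in> maps_n C Tight 1; fits g 1 p\<rbrakk>
      \<Longrightarrow> g \<star>[1] \<j> p = \<j> (g \<star>[1] p)"
    and jay_comp_2: "\<lbrakk>p \<in> maps_n C Tight 1; g \<in> maps_n C Tight 2; fits p 1 g\<rbrakk>
      \<Longrightarrow> \<j> p \<star>[1] g = \<j> (p \<star>[1] g)"
    and jay_comp_0: "\<lbrakk>p \<in> maps_n C Tight 1; v \<in> maps_n C Loose 0; fits p 1 v\<rbrakk>
      \<Longrightarrow> \<j> p \<star>[1] v = p \<star>[1] v"


section \<open>Morphisms\<close>

record ('o, 'm) multif =
  mob :: "'o \<Rightarrow> 'o"
  mmp :: "('o, 'm) mmap \<Rightarrow> ('o, 'm) mmap"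

definition multi_graph_map :: "('o, 'm) multi \<Rightarrow> ('o, 'm) multi \<Rightarrow> ('o, 'm) multif \<Rightarrow> bool" where
  "multi_graph_map C D F \<longleftrightarrow>
     mob F \<in> Obj C \<rightarrow>\<^sub>E Obj D \<and> mmp F \<in> extensional (Maps C) \<and>
     (\<forall>f \<in> Maps C. mmp F f \<in> maps D (ty f) (map (mob F) (ins f)) (mob F (out f)))"

definition multifunctor :: "('o, 'm) multi \<Rightarrow> ('o, 'm) multi \<Rightarrow> ('o, 'm) multif \<Rightarrow> bool" where
  "multifunctor C D F \<longleftrightarrow> multi_graph_map C D F \<and>
     (\<forall>a \<in> Obj C. mmp F (Idm C a) = Idm D (mob F a)) \<and>
     (\<forall>f \<in> Maps C. ty f = Tight \<longrightarrow> mmp F (\<j>\<^bsub>C\<^esub> f) = \<j>\<^bsub>D\<^esub> (mmp F f)) \<and>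
     (\<forall>g \<in> Maps C. \<forall>f \<in> Maps C. \<forall>i. fits g i f \<longrightarrow>
        mmp F (g \<star>[i]\<^bsub>C\<^esub> f) = mmp F g \<star>[i]\<^bsub>D\<^esub> mmp F f)"

definition short_multifunctor :: "('o, 'm) multi \<Rightarrow> ('o, 'm) multi \<Rightarrow> ('o, 'm) multif \<Rightarrow> bool" where
  "short_multifunctor C D F \<longleftrightarrow> multi_graph_map C D F \<and>
     (\<forall>a \<in> Obj C. mmp F (Idm C a) = Idm D (mob F a)) \<and>
     (\<forall>f \<in> Maps C. ty f = Tight \<and> arity f \<le> 2 \<longrightarrow> mmp F (\<j>\<^bsub>C\<^esub> f) = \<j>\<^bsub>D\<^esub> (mmp F f)) \<and>
     (\<forall>g \<in> Maps C. \<forall>f \<in> Maps C. \<forall>i. fits g i f \<and> op_defined g f \<longrightarrow>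
        mmp F (g \<star>[i]\<^bsub>C\<^esub> f) = mmp F g \<star>[i]\<^bsub>D\<^esub> mmp F f)"

definition id_multif :: "('o, 'm) multi \<Rightarrow> ('o, 'm) multif" where
  "id_multif C = \<lparr>mob = restrict (\<lambda>a. a) (Obj C), mmp = restrict (\<lambda>f. f) (Maps C)\<rparr>"

definition comp_multif :: "('o, 'm) multi \<Rightarrow> ('o, 'm) multif \<Rightarrow> ('o, 'm) multif \<Rightarrow> ('o, 'm) multif"
where
  "comp_multif C G F =
     \<lparr>mob = compose (Obj C) (mob G) (mob F), mmp = compose (Maps C) (mmp G) (mmp F)\<rparr>"


section \<open>Left representability\<close>

definition left_representable :: "('o, 'm) multi \<Rightarrow> bool" where
  "left_representable C \<longleftrightarrow>
     (\<forall>x as. set as \<subseteq> Obj C \<and> (x = Tight \<longrightarrow> 1 \<le> length as) \<longrightarrow>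
        (\<exists>m \<in> Obj C. \<exists>\<theta> \<in> maps C x as m. \<forall>ys b. set ys \<subseteq> Obj C \<and> b \<in> Obj C \<longrightarrow>
           bij_betw (\<lambda>f. f \<star>[1]\<^bsub>C\<^esub> \<theta>) (maps C Tight (m # ys) b) (maps C x (as @ ys) b)))"

record ('o, 'm) lr_data =
  prd :: "'o \<Rightarrow> 'o \<Rightarrow> 'o"
  theta :: "'o \<Rightarrow> 'o \<Rightarrow> ('o, 'm) mmap"
  uob :: "'o"
  umap :: "('o, 'm) mmap"

definition is_lr_data :: "('o, 'm) multi \<Rightarrow> ('o, 'm) lr_data \<Rightarrow> bool" where
  "is_lr_data C R \<longleftrightarrow>
     (\<forall>a \<in> Obj C. \<forall>b \<in> Obj C.
        prd R a b \<in> Obj C \<and> theta R a b \<in> maps C Tight [a, b] (prd R a b) \<and>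
        (\<forall>xs d. set xs \<subseteq> Obj C \<and> length xs \<le> 2 \<and> d \<in> Obj C \<longrightarrow>
           bij_betw (\<lambda>f. f \<star>[1]\<^bsub>C\<^esub> theta R a b)
             (maps C Tight (prd R a b # xs) d) (maps C Tight (a # b # xs) d))) \<and>
     uob R \<in> Obj C \<and> umap R \<in> maps C Loose [] (uob R) \<and>
     (\<forall>xs d. set xs \<subseteq> Obj C \<and> length xs \<le> 2 \<and> d \<in> Obj C \<longrightarrow>
        bij_betw (\<lambda>f. f \<star>[1]\<^bsub>C\<^esub> umap R) (maps C Tight (uob R # xs) d) (maps C Loose xs d))"

definition short_left_representable :: "('o, 'm) multi \<Rightarrow> bool" where
  "short_left_representable C \<longleftrightarrow> (\<exists>R. is_lr_data C R)"

definition SkMulti_lr :: "(('o, 'm) multi, ('o, 'm) multif) cat" where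
  "SkMulti_lr =
     \<lparr>Ob = {C. skew_multicategory C \<and> left_representable C},
      Ar = {Arr C D F | C D F. skew_multicategory C \<and> left_representable C \<and>
              skew_multicategory D \<and> left_representable D \<and> multifunctor C D F},
      Id = \<lambda>C. Arr C C (id_multif C),
      Comp = \<lambda>G F. Arr (src F) (tgt G) (comp_multif (src F) (lab G) (lab F))\<rparr>"

definition ShSkMulti_lr :: "(('o, 'm) multi, ('o, 'm) multif) cat" where
  "ShSkMulti_lr =
     \<lparr>Ob = {C. short_skew_multicategory C \<and> short_left_representable C},
      Ar = {Arr C D F | C D F. short_skew_multicategory C \<and> short_left_representable C \<and>
              short_skew_multicategory D \<and> short_left_representable D \<and> short_multifunctor C D F},
      Id = \<lambda>C. Arr C C (id_multif C),
      Comp = \<lambda>G F. Arr (src F) (tgt G) (comp_multif (src F) (lab G) (lab F))\<rparr>"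


section \<open>The functors \<open>U\<^sup>s\<close> and \<open>K\<^sup>s\<close>\<close>

definition Us_ob :: "('o, 'm) multi \<Rightarrow> ('o, 'm) multi" where
  "Us_ob C =
     \<lparr>Obj = Obj C,
      Maps = {f \<in> Maps C. short_arity (ty f) (arity f)},
      Jay = (\<lambda>f. if ty f = Tight \<and> arity f \<le> 2 then \<j>\<^bsub>C\<^esub> f else undefined),
      Idm = Idm C,
      Sub = (\<lambda>g i f. if op_defined g f then g \<star>[i]\<^bsub>C\<^esub> f else undefined)\<rparr>"

definition Us_mor :: "('o, 'm) multi \<Rightarrow> ('o, 'm) multif \<Rightarrow> ('o, 'm) multif" where
  "Us_mor C F = \<lparr>mob = mob F, mmp = restrict (mmp F) (Maps (Us_ob C))\<rparr>"

definition Us ::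
  "(('o, 'm) multi, ('o, 'm) multif, ('o, 'm) multi, ('o, 'm) multif) fctr"
where
  "Us = \<lparr>fob = Us_ob, far = \<lambda>F. Arr (Us_ob (src F)) (Us_ob (tgt F)) (Us_mor (src F) (lab F))\<rparr>"

text \<open>Arrows of the underlying category versus tight unary multimaps.\<close>

definition to_mmap :: "('o, 'm) arr \<Rightarrow> ('o, 'm) mmap" where
  "to_mmap f = MMap Tight [src f] (tgt f) (lab f)"

definition to_arr :: "('o, 'm) mmap \<Rightarrow> ('o, 'm) arr" where
  "to_arr p = Arr (hd (ins p)) (out p) (mlab p)"

definition Ks_ob :: "('o, 'm) lr_data \<Rightarrow> ('o, 'm) multi \<Rightarrow> ('o, 'm) skewmon" where
  "Ks_ob R C =
     \<lparr>Ob = Obj C,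
      Ar = to_arr ` maps_n C Tight 1,
      Id = (\<lambda>a. to_arr (Idm C a)),
      Comp = (\<lambda>g f. to_arr (to_mmap g \<star>[1]\<^bsub>C\<^esub> to_mmap f)),
      Ten = prd R,
      TenA = (\<lambda>f g. to_arr (THE h.
        h \<in> maps C Tight [prd R (src f) (src g)] (prd R (tgt f) (tgt g)) \<and>
        h \<star>[1]\<^bsub>C\<^esub> theta R (src f) (src g)
          = (theta R (tgt f) (tgt g) \<star>[1]\<^bsub>C\<^esub> to_mmap f) \<star>[2]\<^bsub>C\<^esub> to_mmap g)),
      Unit = uob R,
      Alpha = (\<lambda>a b c. to_arr (THE h.
        h \<in> maps C Tight [prd R (prd R a b) c] (prd R a (prd R b c)) \<and>
        (h \<star>[1]\<^bsub>C\<^esub> theta R (prd R a b) c) \<star>[1]\<^bsub>C\<^esub> theta R a b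
          = theta R a (prd R b c) \<star>[2]\<^bsub>C\<^esub> theta R b c)),
      Lam = (\<lambda>a. to_arr (THE h.
        h \<in> maps C Tight [prd R (uob R) a] a \<and>
        (h \<star>[1]\<^bsub>C\<^esub> theta R (uob R) a) \<star>[1]\<^bsub>C\<^esub> umap R = \<j>\<^bsub>C\<^esub> (Idm C a))),
      Rho = (\<lambda>a. to_arr (theta R a (uob R) \<star>[2]\<^bsub>C\<^esub> umap R))\<rparr>"

definition Ks_mor ::
  "('o, 'm) lr_data \<Rightarrow> ('o, 'm) multi \<Rightarrow> ('o, 'm) lr_data \<Rightarrow> ('o, 'm) multi \<Rightarrow>
   ('o, 'm) multif \<Rightarrow> ('o, 'm) laxf"
where
  "Ks_mor R C S D F =
     \<lparr>fob = mob F,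
      far = restrict (\<lambda>f. to_arr (mmp F (to_mmap f))) (Ar (Ks_ob R C)),
      f0 = to_arr (THE h. h \<in> maps D Tight [uob S] (mob F (uob R)) \<and>
        h \<star>[1]\<^bsub>D\<^esub> umap S = mmp F (umap R)),
      f2 = (\<lambda>a b. if a \<in> Obj C \<and> b \<in> Obj C then
        to_arr (THE h. h \<in> maps D Tight [prd S (mob F a) (mob F b)] (mob F (prd R a b)) \<and>
          h \<star>[1]\<^bsub>D\<^esub> theta S (mob F a) (mob F b) = mmp F (theta R a b)) else undefined)\<rparr>"

text \<open>\<open>Ks ch\<close> is the functor determined by a choice \<open>ch\<close> of representing data.\<close>

definition Ks ::
  "(('o, 'm) multi \<Rightarrow> ('o, 'm) lr_data) \<Rightarrow>
   (('o, 'm) multi, ('o, 'm) multif, ('o, 'm) skewmon, ('o, 'm) laxf) fctr"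
where
  "Ks ch =
     \<lparr>fob = (\<lambda>C. Ks_ob (ch C) C),
      far = (\<lambda>F. Arr (Ks_ob (ch (src F)) (src F)) (Ks_ob (ch (tgt F)) (tgt F))
        (Ks_mor (ch (src F)) (src F) (ch (tgt F)) (tgt F) (lab F)))\<rparr>"

end

theory Submission
  imports Defs
begin

text \<open>A left representable multicategory, short or not, is determined by its skew monoidal category.
  Write \<open>a \<cdot> x\<^sub>1 \<dots> x\<^sub>n\<close> for the left-bracketed product \<open>((a x\<^sub>1) \<dots>) x\<^sub>n\<close>.  Composing universal multimaps
  shows that tight multimaps \<open>a, x\<^sub>1, \<dots>, x\<^sub>n \<rightarrow> b\<close> correspond to arrows \<open>a \<cdot> x\<^sub>1 \<dots> x\<^sub>n \<rightarrow> b\<close>, and loose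
  multimaps \<open>x\<^sub>1, \<dots>, x\<^sub>n \<rightarrow> b\<close> to arrows \<open>i \<cdot> x\<^sub>1 \<dots> x\<^sub>n \<rightarrow> b\<close>.  Under this correspondence substitution and
  \<open>j\<close> are expressed by the tensor product, \<open>\<alpha>\<close>, \<open>\<lambda>\<close> and \<open>\<rho>\<close>.

  Conversely, every skew monoidal category \<open>K\<close> has a skew multicategory \<open>M K\<close> with these arrows as its
  multimaps (\<open>M_ob\<close>).  The difficulty is its associativity, where the rebracketing arrows accumulate.
  It disappears if one lets a multimap \<open>f\<close> with inputs \<open>as\<close> and output \<open>z\<close>, tight or loose, act behind
  other inputs with product \<open>p\<close>, as an arrow \<open>p \<cdot> as \<rightarrow> p z\<close> (\<open>plug\<close>).  This arrow is natural in \<open>p\<close>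
  (\<open>plug_nat\<close>), is compatible with \<open>\<alpha>\<close> by the pentagon and the axiom on \<open>\<alpha>\<close> and \<open>\<rho>\<close> (\<open>plug_lassoc\<close>),
  is not changed by \<open>j\<close> because of the triangle axiom (\<open>plug_jay\<close>), and \<open>\<lambda>\<close> recovers \<open>f\<close> from it (\<open>lam_plug\<close>).  Substitution is plugging,
  tensored with the inputs that follow, and then composition; the axioms of a skew multicategory
  follow from these four facts.  Lax monoidal functors induce multifunctors for the same reason, and
  \<open>M\<close> becomes a functor.

  For a left representable \<open>C\<close> with skew monoidal category \<open>K\<close>, composition with the universal
  multimaps is a bijection from the multimaps of \<open>M K\<close> to those of \<open>C\<close> (\<open>realize_bij\<close>).  It preserves
  substitution (\<open>realize_sub\<close>), because the equations that define \<open>\<alpha>\<close> and \<open>\<rho>\<close> say how the universal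
  multimaps compose, and it preserves \<open>j\<close> (\<open>realize_jay\<close>) by the definition of \<open>\<lambda>\<close>.  If the multimaps at
  the outset are short, then so are all the intermediate ones.  One argument therefore proves
  \<open>U\<^sup>s M K \<cong> C\<close> for short \<open>C\<close> and \<open>M K \<cong> C\<close> for the others; in the formal text a Boolean \<open>s\<close> says which
  of the two kinds is meant.

  The lax monoidal functor of a morphism is the only one that satisfies its defining equations
  (\<open>lax_spec\<close>).  So functor laws, the category laws of skew monoidal categories, independence of the
  chosen representing data and naturality all follow by verifying equations instead of comparing
  constructions, and the isomorphisms above are natural by \<open>realize_natural\<close>.  Altogether
  \<open>U\<^sup>s M K\<^sup>s\<close>, \<open>M K\<^sup>s U\<^sup>s\<close> and \<open>K\<^sup>s U\<^sup>s M\<close> are isomorphic to identity functors, so \<open>U\<^sup>s M\<close> is quasi-inverse to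
  \<open>K\<^sup>s\<close>, and \<open>M K\<^sup>s\<close> is quasi-inverse to \<open>U\<^sup>s\<close>.\<close>

section \<open>Calculating in skew monoidal categories\<close>

lemma hom_iff: "f \<in> hom C a b \<longleftrightarrow> f \<in> Ar C \<and> src f = a \<and> tgt f = b"
  by (auto simp: hom_def)

context category begin

lemma id_simps [simp]:
  assumes "a \<in> Ob C"
  shows "Id C a \<in> Ar C" "src (Id C a) = a" "tgt (Id C a) = a"
  using id_hom[OF assms] by (auto simp: hom_iff)

lemma comp_simps [simp]:
  assumes "g \<in> Ar C" "f \<in> Ar C" "tgt f = src g"
  shows "g \<cdot> f \<in> Ar C" "src (g \<cdot> f) = src f" "tgt (g \<cdot> f) = tgt g"
  using comp_hom[OF assms] by (auto simp: hom_iff)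

lemma src_ob [simp]: "f \<in> Ar C \<Longrightarrow> src f \<in> Ob C"
  and tgt_ob [simp]: "f \<in> Ar C \<Longrightarrow> tgt f \<in> Ob C"
  using arr_ob by auto

lemma id_left' [simp]: "f \<in> Ar C \<Longrightarrow> a = tgt f \<Longrightarrow> Id C a \<cdot> f = f"
  by (simp add: id_left)

lemma id_right' [simp]: "f \<in> Ar C \<Longrightarrow> a = src f \<Longrightarrow> f \<cdot> Id C a = f"
  by (simp add: id_right)

text \<open>An equation between composites of two arrows, in the form that rewrites inside a composite
  bracketed to the right.\<close>

lemma comp_cong_right:
  assumes "g \<cdot> f = k \<cdot> h" "g \<in> Ar C" "f \<in> Ar C" "k \<in> Ar C" "h \<in> Ar C" "x \<in> Ar C"
    "tgt f = src g" "tgt h = src k" "tgt x = src f" "src h = src f"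
  shows "g \<cdot> (f \<cdot> x) = k \<cdot> (h \<cdot> x)"
  using assms by (metis comp_assoc)

end

context skew_monoidal begin

lemma ten_simps [simp]:
  assumes "f \<in> Ar C" "g \<in> Ar C"
  shows "f \<otimes> g \<in> Ar C" "src (f \<otimes> g) = src f \<odot> src g" "tgt (f \<otimes> g) = tgt f \<odot> tgt g"
  using ten_hom[OF assms] by (auto simp: hom_iff)

lemma alpha_simps [simp]:
  assumes "a \<in> Ob C" "b \<in> Ob C" "c \<in> Ob C"
  shows "\<alpha> a b c \<in> Ar C" "src (\<alpha> a b c) = (a \<odot> b) \<odot> c" "tgt (\<alpha> a b c) = a \<odot> (b \<odot> c)"
  using alpha_hom[OF assms] by (auto simp: hom_iff)

lemma lam_simps [simp]:
  assumes "a \<in> Ob C"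
  shows "\<lambda>\<lambda> a \<in> Ar C" "src (\<lambda>\<lambda> a) = \<I> \<odot> a" "tgt (\<lambda>\<lambda> a) = a"
  using lam_hom[OF assms] by (auto simp: hom_iff)

lemma rho_simps [simp]:
  assumes "a \<in> Ob C"
  shows "\<rho> a \<in> Ar C" "src (\<rho> a) = a" "tgt (\<rho> a) = a \<odot> \<I>"
  using rho_hom[OF assms] by (auto simp: hom_iff)

declare ten_ob [simp] unit_ob [simp] ten_id [simp]

lemma ten_comp_left:
  "\<lbrakk>f \<in> Ar C; f' \<in> Ar C; a \<in> Ob C; tgt f = src f'\<rbrakk>
    \<Longrightarrow> (f' \<cdot> f) \<otimes> Id C a = (f' \<otimes> Id C a) \<cdot> (f \<otimes> Id C a)"
  using ten_comp[of f f' "Id C a" "Id C a"] by simp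

lemma ten_comp_right:
  "\<lbrakk>f \<in> Ar C; f' \<in> Ar C; a \<in> Ob C; tgt f = src f'\<rbrakk>
    \<Longrightarrow> Id C a \<otimes> (f' \<cdot> f) = (Id C a \<otimes> f') \<cdot> (Id C a \<otimes> f)"
  using ten_comp[of "Id C a" "Id C a" f f'] by simp

lemma ten_interchange:
  "\<lbrakk>f \<in> Ar C; g \<in> Ar C\<rbrakk> \<Longrightarrow> (Id C (tgt f) \<otimes> g) \<cdot> (f \<otimes> Id C (src g)) = f \<otimes> g"
  "\<lbrakk>f \<in> Ar C; g \<in> Ar C\<rbrakk> \<Longrightarrow> (f \<otimes> Id C (tgt g)) \<cdot> (Id C (src f) \<otimes> g) = f \<otimes> g"
  using ten_comp[of f "Id C (tgt f)" "Id C (src g)" g] ten_comp[of "Id C (src f)" f g "Id C (tgt g)"]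
  by simp_all

end

section \<open>Left-bracketed tensor products\<close>

definition lten :: "('o, 'm, 'x) skewmon_scheme \<Rightarrow> 'o \<Rightarrow> 'o list \<Rightarrow> 'o" where
  "lten C a xs = foldl (Ten C) a xs"

definition ltenA :: "('o, 'm, 'x) skewmon_scheme \<Rightarrow> ('o, 'm) arr \<Rightarrow> 'o list \<Rightarrow> ('o, 'm) arr" where
  "ltenA C f xs = foldl (\<lambda>g x. g \<otimes>\<^bsub>C\<^esub> Id C x) f xs"

lemma lten_simps [simp]:
  "lten C a [] = a" "lten C a (x # xs) = lten C (a \<odot>\<^bsub>C\<^esub> x) xs"
  "lten C a (xs @ ys) = lten C (lten C a xs) ys"
  by (simp_all add: lten_def)

lemma ltenA_simps [simp]:
  "ltenA C f [] = f" "ltenA C f (x # xs) = ltenA C (f \<otimes>\<^bsub>C\<^esub> Id C x) xs"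
  "ltenA C f (xs @ ys) = ltenA C (ltenA C f xs) ys"
  by (simp_all add: ltenA_def)

text \<open>The map \<open>((p a) x\<^sub>1) \<dots> x\<^sub>n \<rightarrow> p ((a x\<^sub>1) \<dots> x\<^sub>n)\<close> that moves \<open>p\<close> out of the product by repeated use
  of \<open>\<alpha>\<close>.\<close>

fun lassoc :: "('o, 'm, 'x) skewmon_scheme \<Rightarrow> 'o \<Rightarrow> 'o \<Rightarrow> 'o list \<Rightarrow> ('o, 'm) arr" where
  "lassoc C p a [] = Id C (p \<odot>\<^bsub>C\<^esub> a)"
| "lassoc C p a (x # xs) = lassoc C p (a \<odot>\<^bsub>C\<^esub> x) xs \<cdot>\<^bsub>C\<^esub> ltenA C (\<alpha>\<^bsub>C\<^esub> p a x) xs"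

context skew_monoidal begin

lemma lten_ob [simp]: "a \<in> Ob C \<Longrightarrow> set xs \<subseteq> Ob C \<Longrightarrow> lten C a xs \<in> Ob C"
  by (induction xs arbitrary: a) auto

lemma ltenA_arr [simp]:
  assumes "f \<in> Ar C" "set xs \<subseteq> Ob C"
  shows "ltenA C f xs \<in> Ar C" "src (ltenA C f xs) = lten C (src f) xs" "tgt (ltenA C f xs) = lten C (tgt f) xs"
  using assms by (induction xs arbitrary: f) auto

lemma ltenA_id [simp]: "a \<in> Ob C \<Longrightarrow> set xs \<subseteq> Ob C \<Longrightarrow> ltenA C (Id C a) xs = Id C (lten C a xs)"
  by (induction xs arbitrary: a) auto

lemma ltenA_comp:
  "\<lbrakk>g \<in> Ar C; f \<in> Ar C; tgt f = src g; set xs \<subseteq> Ob C\<rbrakk>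
    \<Longrightarrow> ltenA C (g \<cdot> f) xs = ltenA C g xs \<cdot> ltenA C f xs"
  by (induction xs arbitrary: f g) (auto simp: ten_comp_left)

lemma lassoc_arr [simp]:
  assumes "p \<in> Ob C" "a \<in> Ob C" "set xs \<subseteq> Ob C"
  shows "lassoc C p a xs \<in> Ar C" "src (lassoc C p a xs) = lten C (p \<odot> a) xs"
    "tgt (lassoc C p a xs) = p \<odot> lten C a xs"
  using assms by (induction xs arbitrary: a) auto

lemma lassoc_nat:
  "\<lbrakk>f \<in> Ar C; g \<in> Ar C; set xs \<subseteq> Ob C\<rbrakk>
    \<Longrightarrow> lassoc C (tgt g) (tgt f) xs \<cdot> ltenA C (g \<otimes> f) xs = (g \<otimes> ltenA C f xs) \<cdot> lassoc C (src g) (src f) xs"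
proof (induction xs arbitrary: f)
  case (Cons x xs)
  have "lassoc C (tgt g) (tgt f) (x # xs) \<cdot> ltenA C (g \<otimes> f) (x # xs)
      = lassoc C (tgt g) (tgt f \<odot> x) xs \<cdot> ltenA C (\<alpha> (tgt g) (tgt f) x \<cdot> ((g \<otimes> f) \<otimes> Id C x)) xs"
    using Cons.prems by (simp add: comp_assoc ltenA_comp)
  also have "\<dots> = lassoc C (tgt g) (tgt f \<odot> x) xs
      \<cdot> (ltenA C (g \<otimes> (f \<otimes> Id C x)) xs \<cdot> ltenA C (\<alpha> (src g) (src f) x) xs)"
    using Cons.prems alpha_nat[of g f "Id C x"] by (simp add: ltenA_comp)
  also have "\<dots> = (g \<otimes> ltenA C (f \<otimes> Id C x) xs) \<cdot>
      (lassoc C (src g) (src f \<odot> x) xs \<cdot> ltenA C (\<alpha> (src g) (src f) x) xs)"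
    using Cons.prems Cons.IH[of "f \<otimes> Id C x"] by (intro comp_cong_right) simp_all
  finally show ?case by simp
qed simp

lemma lassoc_append:
  "\<lbrakk>p \<in> Ob C; a \<in> Ob C; set xs \<subseteq> Ob C; set ys \<subseteq> Ob C\<rbrakk>
    \<Longrightarrow> lassoc C p a (xs @ ys) = lassoc C p (lten C a xs) ys \<cdot> ltenA C (lassoc C p a xs) ys"
  by (induction xs arbitrary: a) (simp_all add: comp_assoc ltenA_comp)

text \<open>Moving \<open>p\<close> and then \<open>q\<close> out of \<open>((p q) a) x\<^sub>1 \<dots> x\<^sub>n\<close> agrees with moving \<open>p q\<close> out at once; the induction
  step is the pentagon for \<open>p, q, a, x\<close>.\<close>

lemma lassoc_pentagon:
  "\<lbrakk>p \<in> Ob C; q \<in> Ob C; a \<in> Ob C; set xs \<subseteq> Ob C\<rbrakk>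
    \<Longrightarrow> (Id C p \<otimes> lassoc C q a xs) \<cdot> (lassoc C p (q \<odot> a) xs \<cdot> ltenA C (\<alpha> p q a) xs)
      = \<alpha> p q (lten C a xs) \<cdot> lassoc C (p \<odot> q) a xs"
proof (induction xs arbitrary: a)
  case (Cons x xs)
  let ?A = "\<alpha> q a x"
  have "(Id C p \<otimes> lassoc C q a (x # xs)) \<cdot> (lassoc C p (q \<odot> a) (x # xs) \<cdot> ltenA C (\<alpha> p q a) (x # xs))
     = (Id C p \<otimes> lassoc C q (a \<odot> x) xs) \<cdot> ((Id C p \<otimes> ltenA C ?A xs) \<cdot> (lassoc C p ((q \<odot> a) \<odot> x) xs \<cdot>
          ltenA C (\<alpha> p (q \<odot> a) x \<cdot> (\<alpha> p q a \<otimes> Id C x)) xs))"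
    using Cons.prems by (simp add: ten_comp_right comp_assoc ltenA_comp)
  also have "\<dots> = (Id C p \<otimes> lassoc C q (a \<odot> x) xs) \<cdot> (lassoc C p (q \<odot> (a \<odot> x)) xs \<cdot>
      (ltenA C (Id C p \<otimes> ?A) xs \<cdot> ltenA C (\<alpha> p (q \<odot> a) x \<cdot> (\<alpha> p q a \<otimes> Id C x)) xs))"
    using Cons.prems lassoc_nat[of ?A "Id C p" xs]
    by (intro arg_cong[where f = "\<lambda>z. _ \<cdot> z"] comp_cong_right) simp_all
  also have "\<dots> = (Id C p \<otimes> lassoc C q (a \<odot> x) xs) \<cdot> (lassoc C p (q \<odot> (a \<odot> x)) xs \<cdot>
      ltenA C (\<alpha> p q (a \<odot> x) \<cdot> \<alpha> (p \<odot> q) a x) xs)"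
    using Cons.prems pentagon[of p q a x] by (simp add: comp_assoc ltenA_comp[symmetric])
  also have "\<dots> = (Id C p \<otimes> lassoc C q (a \<odot> x) xs) \<cdot> (lassoc C p (q \<odot> (a \<odot> x)) xs \<cdot>
      ltenA C (\<alpha> p q (a \<odot> x)) xs) \<cdot> ltenA C (\<alpha> (p \<odot> q) a x) xs"
    using Cons.prems by (simp add: comp_assoc ltenA_comp)
  also have "\<dots> = \<alpha> p q (lten C (a \<odot> x) xs) \<cdot> lassoc C (p \<odot> q) (a \<odot> x) xs \<cdot> ltenA C (\<alpha> (p \<odot> q) a x) xs"
    using Cons.prems by (subst Cons.IH) simp_all
  finally show ?case using Cons.prems by (simp add: comp_assoc)
qed simp

text \<open>The analogue of \<open>\<lambda>\<^bsub>ab\<^esub> \<alpha>\<^bsub>i,a,b\<^esub> = \<lambda>\<^sub>a b\<close> for several factors.\<close>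

lemma lam_lassoc:
  "\<lbrakk>a \<in> Ob C; set xs \<subseteq> Ob C\<rbrakk> \<Longrightarrow> \<lambda>\<lambda> (lten C a xs) \<cdot> lassoc C \<I> a xs = ltenA C (\<lambda>\<lambda> a) xs"
proof (induction xs arbitrary: a)
  case (Cons x xs)
  have "\<lambda>\<lambda> (lten C a (x # xs)) \<cdot> lassoc C \<I> a (x # xs)
     = \<lambda>\<lambda> (lten C (a \<odot> x) xs) \<cdot> lassoc C \<I> (a \<odot> x) xs \<cdot> ltenA C (\<alpha> \<I> a x) xs"
    using Cons.prems by (simp add: comp_assoc)
  also have "\<dots> = ltenA C (\<lambda>\<lambda> a \<otimes> Id C x) xs"
    using Cons.prems by (simp add: Cons.IH ltenA_comp[symmetric] lam_alpha)
  finally show ?case by simp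
qed simp

text \<open>The triangle axiom, tensored with \<open>xs\<close>: a unit that is inserted behind \<open>p\<close> by \<open>\<rho>\<close> and absorbed into
  \<open>a\<close> by \<open>\<lambda>\<close> does not affect how \<open>p\<close> is moved out.\<close>

lemma lassoc_triangle:
  assumes "p \<in> Ob C" "a \<in> Ob C" "set xs \<subseteq> Ob C"
  shows "(Id C p \<otimes> ltenA C (\<lambda>\<lambda> a) xs) \<cdot> (lassoc C p \<I> (a # xs) \<cdot> ltenA C (\<rho> p) (a # xs)) = lassoc C p a xs"
proof -
  have "(Id C p \<otimes> ltenA C (\<lambda>\<lambda> a) xs) \<cdot> (lassoc C p \<I> (a # xs) \<cdot> ltenA C (\<rho> p) (a # xs))
      = (Id C p \<otimes> ltenA C (\<lambda>\<lambda> a) xs) \<cdot> (lassoc C p (\<I> \<odot> a) xs \<cdot>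
          ltenA C (\<alpha> p \<I> a \<cdot> (\<rho> p \<otimes> Id C a)) xs)"
    using assms by (simp add: comp_assoc ltenA_comp)
  also have "\<dots> = lassoc C p a xs \<cdot> (ltenA C (Id C p \<otimes> \<lambda>\<lambda> a) xs \<cdot>
          ltenA C (\<alpha> p \<I> a \<cdot> (\<rho> p \<otimes> Id C a)) xs)"
    using assms lassoc_nat[of "\<lambda>\<lambda> a" "Id C p" xs] by (intro comp_cong_right) simp_all
  also have "\<dots> = lassoc C p a xs"
    using assms triangle[of p a] by (simp add: comp_assoc ltenA_comp[symmetric])
  finally show ?thesis .
qed

end

section \<open>The skew multicategory of a skew monoidal category\<close>

text \<open>The value on the empty list is irrelevant; the products that occur have at least one factor.\<close>

definition prodl :: "('o, 'm, 'x) skewmon_scheme \<Rightarrow> 'o list \<Rightarrow> 'o" where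
  "prodl C as = lten C (hd as) (tl as)"

text \<open>A loose multimap is treated as a tight one with the unit as an additional first input.\<close>

definition uins :: "('o, 'm, 'x) skewmon_scheme \<Rightarrow> tightness \<Rightarrow> 'o list \<Rightarrow> 'o list" where
  "uins C x as = (if x = Tight then as else \<I>\<^bsub>C\<^esub> # as)"

text \<open>The arrow that constitutes a multimap of \<open>M_ob C\<close>.  Its source is recomputed from the type and the
  inputs, so that a multimap and its arrow share the label.\<close>

definition arr_of :: "('o, 'm, 'x) skewmon_scheme \<Rightarrow> ('o, 'm) mmap \<Rightarrow> ('o, 'm) arr" where
  "arr_of C f = Arr (prodl C (uins C (ty f) (ins f))) (out f) (mlab f)"

text \<open>The map \<open>p \<cdot> as \<rightarrow> p (product of as)\<close>.  For a loose multimap the product begins with the unit, which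
  \<open>\<rho>\<close> supplies.\<close>

definition gather :: "('o, 'm, 'x) skewmon_scheme \<Rightarrow> 'o \<Rightarrow> tightness \<Rightarrow> 'o list \<Rightarrow> ('o, 'm) arr" where
  "gather C p x as = (if x = Tight then lassoc C p (hd as) (tl as)
     else lassoc C p \<I>\<^bsub>C\<^esub> as \<cdot>\<^bsub>C\<^esub> ltenA C (\<rho>\<^bsub>C\<^esub> p) as)"

text \<open>The arrow \<open>L, as \<rightarrow> L, z\<close> between products that applies \<open>f\<close>, with inputs \<open>as\<close> and output \<open>z\<close>, behind
  the inputs \<open>L\<close>.  In first position nothing has to be rebracketed, and the result is \<open>f\<close> itself, with
  the unit in front if \<open>f\<close> is loose.\<close>

definition plug :: "('o, 'm, 'x) skewmon_scheme \<Rightarrow> 'o list \<Rightarrow> ('o, 'm) mmap \<Rightarrow> ('o, 'm) arr" where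
  "plug C L f = (if L = [] then arr_of C f
     else (Id C (prodl C L) \<otimes>\<^bsub>C\<^esub> arr_of C f) \<cdot>\<^bsub>C\<^esub> gather C (prodl C L) (ty f) (ins f))"

text \<open>To substitute \<open>f\<close> into \<open>g\<close>, apply \<open>f\<close> behind the inputs of \<open>g\<close> that precede it, tensor with those that
  follow it, and compose with \<open>g\<close>.  The unit of a loose \<open>g\<close> counts as a preceding input.  The result
  has the type of \<open>f\<close> if nothing precedes it, and that of \<open>g\<close> otherwise (\<open>sub_type_split\<close>).  The map \<open>j\<close> is
  precomposition with \<open>\<lambda>\<close> in the first factor.\<close>

definition M_ob :: "('o, 'm) skewmon \<Rightarrow> ('o, 'm) multi" where
  "M_ob C =
     \<lparr>Obj = Ob C,
      Maps = {f. set (ins f) \<subseteq> Ob C \<and> (ty f = Tight \<longrightarrow> ins f \<noteq> []) \<and> arr_of C f \<in> Ar C},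
      Jay = (\<lambda>f. MMap Loose (ins f) (out f)
        (lab (arr_of C f \<cdot>\<^bsub>C\<^esub> ltenA C (\<lambda>\<lambda>\<^bsub>C\<^esub> (hd (ins f))) (tl (ins f))))),
      Idm = (\<lambda>a. MMap Tight [a] a (lab (Id C a))),
      Sub = (\<lambda>g i f. MMap (sub_type (ty g) i (ty f)) (sub_ins g i f) (out g)
        (lab (arr_of C g \<cdot>\<^bsub>C\<^esub> ltenA C (plug C (uins C (ty g) (take (i - 1) (ins g))) f) (drop i (ins g)))))\<rparr>"

lemma M_ob_simps [simp]:
  "Obj (M_ob C) = Ob C"
  "ty (Sub (M_ob C) g i f) = sub_type (ty g) i (ty f)"
  "ins (Sub (M_ob C) g i f) = sub_ins g i f"
  "out (Sub (M_ob C) g i f) = out g"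
  "ty (Jay (M_ob C) f) = Loose" "ins (Jay (M_ob C) f) = ins f" "out (Jay (M_ob C) f) = out f"
  "ty (Idm (M_ob C) a) = Tight" "ins (Idm (M_ob C) a) = [a]" "out (Idm (M_ob C) a) = a"
  by (simp_all add: M_ob_def)

lemma M_ob_lab:
  "mlab (Jay (M_ob C) f) = lab (arr_of C f \<cdot>\<^bsub>C\<^esub> ltenA C (\<lambda>\<lambda>\<^bsub>C\<^esub> (hd (ins f))) (tl (ins f)))"
  "mlab (Idm (M_ob C) a) = lab (Id C a)"
  by (simp_all add: M_ob_def)

lemma prodl_simps [simp]:
  "prodl C (a # as) = lten C a as" "as \<noteq> [] \<Longrightarrow> prodl C (as @ bs) = lten C (prodl C as) bs"
  by (auto simp: prodl_def)

lemma prodl_snoc: "prodl C (as @ b # bs) = lten C (prodl C (as @ [b])) bs"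
  by (cases as) simp_all

lemma uins_append: "uins C x (as @ bs) = uins C x as @ bs"
  by (simp add: uins_def)

lemma uins_simps [simp]: "uins C Tight as = as" "uins C Loose as = \<I>\<^bsub>C\<^esub> # as"
  by (auto simp: uins_def)

lemma uins_Nil_iff: "uins C x as = [] \<longleftrightarrow> x = Tight \<and> as = []"
  by (simp add: uins_def)

lemma arr_of_simps [simp]:
  "src (arr_of C f) = prodl C (uins C (ty f) (ins f))" "tgt (arr_of C f) = out f" "lab (arr_of C f) = mlab f"
  by (simp_all add: arr_of_def)

lemma mmap_eqI:
  assumes "ty f = ty g" "ins f = ins g" "out f = out g" "arr_of C f = arr_of C g"
  shows "f = g"
  using assms by (auto simp: arr_of_def intro: mmap.expand)

lemma arr_eqI: "src f = src g \<Longrightarrow> tgt f = tgt g \<Longrightarrow> lab f = lab g \<Longrightarrow> f = g"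
  by (rule arr.expand) simp

lemma fits_split:
  assumes "fits g i f"
  obtains ys zs where "ins g = ys @ out f # zs" "i = Suc (length ys)"
proof
  have i: "i - 1 < length (ins g)" "i = Suc (i - 1)" "out f = ins g ! (i - 1)"
    using assms by (auto simp: fits_def arity_def)
  show "ins g = take (i - 1) (ins g) @ out f # drop i (ins g)"
    using i id_take_nth_drop by metis
  show "i = Suc (length (take (i - 1) (ins g)))" using i by simp
qed

lemma fits_append [simp]:
  assumes "ins g = ys @ z # zs"
  shows "fits g (Suc (length ys)) f \<longleftrightarrow> out f = z"
  using assms by (simp add: fits_def arity_def nth_append)

lemma sub_ins_append [simp]:
  "ins g = ys @ z # zs \<Longrightarrow> sub_ins g (Suc (length ys)) f = ys @ ins f @ zs"
  by (simp add: sub_ins_def)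

lemma sub_type_split: "sub_type x (Suc (length ys)) y = (if uins C x ys = [] then y else x)"
  by (cases x; cases y) (auto simp: sub_type_def uins_def)

context skew_monoidal begin

lemma prodl_ob [simp]: "as \<noteq> [] \<Longrightarrow> set as \<subseteq> Ob C \<Longrightarrow> prodl C as \<in> Ob C"
  by (cases as) auto

lemma uins_ob [simp]: "set (uins C x as) \<subseteq> Ob C \<longleftrightarrow> set as \<subseteq> Ob C"
  by (simp add: uins_def)

lemma gather_arr [simp]:
  assumes "p \<in> Ob C" "set as \<subseteq> Ob C" "uins C x as \<noteq> []"
  shows "gather C p x as \<in> Ar C" "src (gather C p x as) = lten C p as" "tgt (gather C p x as) = p \<odot> prodl C (uins C x as)"
  using assms by (cases as; auto simp: gather_def uins_def split: if_splits)+

lemma gather_nat: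
  assumes "g \<in> Ar C" "set as \<subseteq> Ob C" "uins C x as \<noteq> []"
  shows "gather C (tgt g) x as \<cdot> ltenA C g as = (g \<otimes> Id C (prodl C (uins C x as))) \<cdot> gather C (src g) x as"
proof (cases x)
  case Tight
  then obtain b bs where "as = b # bs" using assms by (cases as) auto
  then show ?thesis using assms Tight lassoc_nat[of "Id C b" g bs] by (simp add: gather_def)
next
  case Loose
  have "gather C (tgt g) x as \<cdot> ltenA C g as = lassoc C (tgt g) \<I> as \<cdot> (ltenA C (g \<otimes> Id C \<I>) as \<cdot> ltenA C (\<rho> (src g)) as)"
    using assms Loose by (simp add: gather_def comp_assoc ltenA_comp[symmetric] rho_nat)
  also have "\<dots> = (g \<otimes> Id C (lten C \<I> as)) \<cdot> (lassoc C (src g) \<I> as \<cdot> ltenA C (\<rho> (src g)) as)"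
    using assms lassoc_nat[of "Id C \<I>" g as] by (intro comp_cong_right) simp_all
  finally show ?thesis using Loose by (simp add: gather_def)
qed

lemma gather_append:
  assumes "p \<in> Ob C" "set as \<subseteq> Ob C" "set bs \<subseteq> Ob C" "uins C x as \<noteq> []"
  shows "gather C p x (as @ bs) = lassoc C p (prodl C (uins C x as)) bs \<cdot> ltenA C (gather C p x as) bs"
  using assms by (cases as; cases x) (simp_all add: gather_def lassoc_append comp_assoc ltenA_comp)

text \<open>By the iterated pentagon; for loose multimaps together with \<open>\<alpha>\<^bsub>p,q,i\<^esub> \<rho>\<^bsub>pq\<^esub> = p \<rho>\<^sub>q\<close>.\<close>

lemma gather_lassoc:
  assumes "p \<in> Ob C" "q \<in> Ob C" "set as \<subseteq> Ob C" "uins C x as \<noteq> []"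
  shows "(Id C p \<otimes> gather C q x as) \<cdot> lassoc C p q as = \<alpha> p q (prodl C (uins C x as)) \<cdot> gather C (p \<odot> q) x as"
proof (cases x)
  case Tight
  then obtain b bs where "as = b # bs" using assms by (cases as) auto
  then show ?thesis using assms Tight lassoc_pentagon[of p q b bs] by (simp add: gather_def)
next
  case Loose
  have "(Id C p \<otimes> gather C q x as) \<cdot> lassoc C p q as
      = (Id C p \<otimes> lassoc C q \<I> as) \<cdot> ((Id C p \<otimes> ltenA C (\<rho> q) as) \<cdot> lassoc C p q as)"
    using assms Loose by (simp add: gather_def comp_assoc ten_comp_right)
  also have "\<dots> = (Id C p \<otimes> lassoc C q \<I> as) \<cdot> (lassoc C p (q \<odot> \<I>) as \<cdot> ltenA C (\<alpha> p q \<I> \<cdot> \<rho> (p \<odot> q)) as)"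
    using assms lassoc_nat[of "\<rho> q" "Id C p" as] by (simp add: alpha_rho)
  also have "\<dots> = (Id C p \<otimes> lassoc C q \<I> as) \<cdot> (lassoc C p (q \<odot> \<I>) as \<cdot> ltenA C (\<alpha> p q \<I>) as) \<cdot> ltenA C (\<rho> (p \<odot> q)) as"
    using assms by (simp add: comp_assoc ltenA_comp)
  also have "\<dots> = \<alpha> p q (lten C \<I> as) \<cdot> lassoc C (p \<odot> q) \<I> as \<cdot> ltenA C (\<rho> (p \<odot> q)) as"
    using assms by (subst lassoc_pentagon) simp_all
  finally show ?thesis using Loose assms by (simp add: gather_def comp_assoc)
qed

end

locale skew_mon = skew_monoidal C for C :: "('o, 'm) skewmon" (structure)
begin

abbreviation "ismap f \<equiv> f \<in> Maps (M_ob C)"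

lemma ismapI:
  "\<lbrakk>set (ins f) \<subseteq> Ob C; ty f = Tight \<longrightarrow> ins f \<noteq> []; arr_of C f \<in> Ar C\<rbrakk> \<Longrightarrow> ismap f"
  by (simp add: M_ob_def)

lemma ismapD [simp]:
  assumes "ismap f"
  shows "set (ins f) \<subseteq> Ob C" "arr_of C f \<in> Ar C" "uins C (ty f) (ins f) \<noteq> []" "out f \<in> Ob C"
  using assms tgt_ob[of "arr_of C f"] by (auto simp: M_ob_def uins_def)

lemma plug_arr [simp]:
  assumes "ismap f" "set L \<subseteq> Ob C"
  shows "plug C L f \<in> Ar C"
    "src (plug C L f) = prodl C (L @ (if L = [] then uins C (ty f) (ins f) else ins f))"
    "tgt (plug C L f) = prodl C (L @ [out f])"
  using assms by (cases "L = []"; simp add: plug_def)+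

text \<open>This naturality is what makes substitutions at different positions commute.\<close>

lemma plug_nat:
  assumes "k \<in> Ar C" "ismap f" "L \<noteq> []" "L' \<noteq> []" "src k = prodl C L" "tgt k = prodl C L'"
  shows "plug C L' f \<cdot> ltenA C k (ins f) = (k \<otimes> Id C (out f)) \<cdot> plug C L f"
proof -
  have o: "prodl C L \<in> Ob C" "prodl C L' \<in> Ob C" using assms by (metis src_ob, metis tgt_ob)
  have "plug C L' f \<cdot> ltenA C k (ins f)
      = (Id C (tgt k) \<otimes> arr_of C f) \<cdot> ((k \<otimes> Id C (prodl C (uins C (ty f) (ins f)))) \<cdot> gather C (src k) (ty f) (ins f))"
    using assms o gather_nat[of k "ins f" "ty f"] by (simp add: plug_def comp_assoc)
  also have "\<dots> = (k \<otimes> Id C (out f)) \<cdot> ((Id C (src k) \<otimes> arr_of C f) \<cdot> gather C (src k) (ty f) (ins f))"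
    using assms o ten_interchange[of k "arr_of C f"] by (intro comp_cong_right) simp_all
  finally show ?thesis using assms by (simp add: plug_def)
qed

text \<open>Plugging \<open>f\<close> behind \<open>p\<close> and \<open>L\<close> amounts to plugging it behind \<open>L\<close> and tensoring with \<open>p\<close>, up to \<open>\<alpha>\<close>.\<close>

lemma plug_lassoc:
  assumes "ismap f" "p \<in> Ob C" "set L \<subseteq> Ob C" "L \<noteq> []" "L' \<noteq> []" "prodl C L' = p \<odot> prodl C L"
  shows "(Id C p \<otimes> plug C L f) \<cdot> lassoc C p (prodl C L) (ins f)
    = \<alpha> p (prodl C L) (out f) \<cdot> plug C L' f"
proof -
  let ?q = "prodl C L"
  have "(Id C p \<otimes> plug C L f) \<cdot> lassoc C p ?q (ins f)
      = (Id C p \<otimes> (Id C ?q \<otimes> arr_of C f)) \<cdot> ((Id C p \<otimes> gather C ?q (ty f) (ins f)) \<cdot> lassoc C p ?q (ins f))"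
    using assms by (simp add: plug_def ten_comp_right comp_assoc)
  also have "\<dots> = (Id C p \<otimes> (Id C ?q \<otimes> arr_of C f)) \<cdot> (\<alpha> p ?q (prodl C (uins C (ty f) (ins f))) \<cdot> gather C (p \<odot> ?q) (ty f) (ins f))"
    using assms by (simp add: gather_lassoc)
  also have "\<dots> = \<alpha> p ?q (out f) \<cdot> ((Id C (p \<odot> ?q) \<otimes> arr_of C f) \<cdot> gather C (p \<odot> ?q) (ty f) (ins f))"
    using assms alpha_nat[of "Id C p" "Id C ?q" "arr_of C f"] by (intro comp_cong_right) simp_all
  finally show ?thesis using assms by (simp add: plug_def)
qed

lemma sub_M:
  assumes "ismap g" "ismap f" "ins g = ys @ out f # zs" "i = Suc (length ys)"
  defines "r \<equiv> Sub (M_ob C) g i f"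
  shows "ismap r" "ins r = ys @ ins f @ zs" "out r = out g"
    "ty r = (if uins C (ty g) ys = [] then ty f else ty g)"
    "arr_of C r = arr_of C g \<cdot> ltenA C (plug C (uins C (ty g) ys) f) zs"
proof -
  have obs: "set ys \<subseteq> Ob C" "set zs \<subseteq> Ob C" using ismapD(1)[OF assms(1)] assms(3) by auto
  show 1: "ins r = ys @ ins f @ zs" "out r = out g" "ty r = (if uins C (ty g) ys = [] then ty f else ty g)"
    unfolding r_def M_ob_def assms(4) using assms(3) sub_type_split[of "ty g" ys "ty f" C]
    by simp_all
  let ?k = "arr_of C g \<cdot> ltenA C (plug C (uins C (ty g) ys) f) zs"
  have A: "src (arr_of C g) = lten C (prodl C (uins C (ty g) ys @ [out f])) zs"
    using assms(3) uins_append[of C "ty g" ys "out f # zs"] by (cases "uins C (ty g) ys = []") simp_all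
  have k: "?k \<in> Ar C" "tgt ?k = out g"
      "src ?k = lten C (src (plug C (uins C (ty g) ys) f)) zs"
    using assms(1-3) obs A by simp_all
  have "src ?k = prodl C (uins C (ty r) (ins r))"
    using assms(1-3) obs k(3) 1 uins_append[of C "ty g" ys "ins f @ zs"] uins_Nil_iff[of C "ty g" ys]
      uins_append[of C "ty f" "ins f" zs]
    by (cases "uins C (ty g) ys = []") auto
  moreover have "mlab r = lab ?k"
    unfolding r_def M_ob_def assms(4) using assms(3) by simp
  ultimately show b: "arr_of C r = ?k"
    using k(2) 1(2) by (intro arr_eqI) (simp_all del: comp_simps ltenA_arr)
  have "ty r = Tight \<longrightarrow> ins r \<noteq> []"
    using 1 ismapD(3)[OF assms(2)] by (auto simp: uins_Nil_iff split: if_splits)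
  moreover have "set (ins r) \<subseteq> Ob C" using 1 obs assms by simp
  ultimately show "ismap r"
    using b k(1) by (intro ismapI) simp_all
qed

text \<open>Plugging respects substitution.  The list \<open>L\<close> followed by the inputs of \<open>g\<close> before \<open>f\<close> is what \<open>f\<close> is
  plugged behind; the two ways to bracket it are compared by \<open>plug_lassoc\<close> and \<open>plug_nat\<close>.\<close>

lemma plug_sub:
  assumes "ismap g" "ismap f" "ins g = ys @ out f # zs" "i = Suc (length ys)" "set L \<subseteq> Ob C"
  shows "plug C L (Sub (M_ob C) g i f)
    = plug C L g \<cdot> ltenA C (plug C (L @ (if L = [] then uins C (ty g) ys else ys)) f) zs"
proof (cases "L = []")
  case True
  then show ?thesis using sub_M[OF assms(1-4)] by (simp add: plug_def)
next
  case L: False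
  define p where "p = prodl C L"
  define r where "r = Sub (M_ob C) g i f"
  note r = sub_M[OF assms(1-4), folded r_def]
  have obs: "set ys \<subseteq> Ob C" "set zs \<subseteq> Ob C" using ismapD(1)[OF assms(1)] assms(3) by auto
  have p: "p \<in> Ob C" using L assms by (simp add: p_def)
  let ?G = "uins C (ty g) ys"
  have A: "src (arr_of C g) = lten C (prodl C (?G @ [out f])) zs"
    using assms uins_append[of C "ty g" ys "out f # zs"] by (cases "?G = []") simp_all
  have "(Id C p \<otimes> ltenA C (plug C ?G f) zs) \<cdot> gather C p (ty r) (ins r)
      = gather C p (ty g) (ins g) \<cdot> ltenA C (plug C (L @ ys) f) zs"
  proof (cases "?G = []")
    case True
    then have ty: "ty g = Tight" "ys = []" by (auto simp: uins_Nil_iff)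
    have "(Id C p \<otimes> ltenA C (plug C ?G f) zs) \<cdot> gather C p (ty r) (ins r)
       = (Id C p \<otimes> ltenA C (arr_of C f) zs) \<cdot> (lassoc C p (prodl C (uins C (ty f) (ins f))) zs \<cdot>
          ltenA C (gather C p (ty f) (ins f)) zs)"
      using ty r p obs assms by (simp add: plug_def gather_append)
    also have "\<dots> = lassoc C p (out f) zs \<cdot> (ltenA C (Id C p \<otimes> arr_of C f) zs \<cdot> ltenA C (gather C p (ty f) (ins f)) zs)"
      using assms p obs lassoc_nat[of "arr_of C f" "Id C p" zs] by (intro comp_cong_right) simp_all
    also have "\<dots> = lassoc C p (out f) zs \<cdot> ltenA C (plug C L f) zs"
      using assms p obs L by (simp add: ltenA_comp[symmetric] plug_def p_def[symmetric])
    finally show ?thesis using ty assms by (simp add: gather_def)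
  next
    case False
    define q where "q = prodl C ?G"
    have q: "q \<in> Ob C" using False obs by (simp add: q_def)
    have "(Id C p \<otimes> ltenA C (plug C ?G f) zs) \<cdot> gather C p (ty r) (ins r)
       = (Id C p \<otimes> ltenA C (plug C ?G f) zs) \<cdot> (lassoc C p (lten C q (ins f)) zs \<cdot>
          (ltenA C (lassoc C p q (ins f)) zs \<cdot> ltenA C (gather C p (ty g) ys) (ins f @ zs)))"
      using r False p obs assms q
      by (simp add: gather_append lassoc_append q_def[symmetric] comp_assoc)
    also have "\<dots> = lassoc C p (q \<odot> out f) zs \<cdot> (ltenA C (Id C p \<otimes> plug C ?G f) zs \<cdot>
          (ltenA C (lassoc C p q (ins f)) zs \<cdot> ltenA C (gather C p (ty g) ys) (ins f @ zs)))"
      using assms p q obs False lassoc_nat[of "plug C ?G f" "Id C p" zs]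
      by (intro comp_cong_right) (simp_all add: q_def[symmetric])
    also have "ltenA C (Id C p \<otimes> plug C ?G f) zs \<cdot>
          (ltenA C (lassoc C p q (ins f)) zs \<cdot> ltenA C (gather C p (ty g) ys) (ins f @ zs))
        = ltenA C (((Id C p \<otimes> plug C ?G f) \<cdot> lassoc C p q (ins f)) \<cdot> ltenA C (gather C p (ty g) ys) (ins f)) zs"
      using assms p q obs False by (simp add: ltenA_comp comp_assoc q_def[symmetric])
    also have "((Id C p \<otimes> plug C ?G f) \<cdot> lassoc C p q (ins f)) \<cdot> ltenA C (gather C p (ty g) ys) (ins f)
       = \<alpha> p q (out f) \<cdot> (plug C [p \<odot> q] f \<cdot> ltenA C (gather C p (ty g) ys) (ins f))"
      using assms p q obs False plug_lassoc[of f p ?G "[p \<odot> q]"]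
      by (simp add: q_def[symmetric] comp_assoc)
    also have "\<dots> = \<alpha> p q (out f) \<cdot> ((gather C p (ty g) ys \<otimes> Id C (out f)) \<cdot> plug C (L @ ys) f)"
      using assms p q obs False L plug_nat[of "gather C p (ty g) ys" f "L @ ys" "[p \<odot> q]"]
      by (simp add: q_def[symmetric] p_def[symmetric])
    finally show ?thesis
      using assms p q obs False L
      by (simp add: gather_append ltenA_comp comp_assoc q_def[symmetric] p_def[symmetric])
  qed
  then have "(Id C p \<otimes> arr_of C g) \<cdot> ((Id C p \<otimes> ltenA C (plug C ?G f) zs) \<cdot> gather C p (ty r) (ins r))
      = (Id C p \<otimes> arr_of C g) \<cdot> (gather C p (ty g) (ins g) \<cdot> ltenA C (plug C (L @ ys) f) zs)" by simp
  moreover have "plug C L r = (Id C p \<otimes> arr_of C g) \<cdot> ((Id C p \<otimes> ltenA C (plug C ?G f) zs) \<cdot> gather C p (ty r) (ins r))"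
  proof -
    have "src (arr_of C r) = src (ltenA C (plug C ?G f) zs)"
      unfolding r(5) using assms(1,2) A obs p by (subst comp_simps) simp_all
    then have "prodl C (uins C (ty r) (ins r)) = src (ltenA C (plug C ?G f) zs)" by simp
    then show ?thesis
      using L p obs assms(1,2) A ismapD(1,3)[OF r(1)]
      by (simp add: plug_def[of C L] p_def[symmetric] r(5) ten_comp_right comp_assoc
          del: ltenA_arr(2) plug_arr(2))
  qed
  moreover have "plug C L g \<cdot> ltenA C (plug C (L @ ys) f) zs
      = (Id C p \<otimes> arr_of C g) \<cdot> (gather C p (ty g) (ins g) \<cdot> ltenA C (plug C (L @ ys) f) zs)"
    using L p obs assms(1,2,5) arg_cong[OF assms(3), of "lten C p"]
    by (simp add: plug_def[of C L g] p_def[symmetric] comp_assoc)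
  ultimately show ?thesis using L by (simp add: r_def)
qed


lemma idm_M:
  assumes "a \<in> Ob C"
  shows "arr_of C (Idm (M_ob C) a) = Id C a" "ismap (Idm (M_ob C) a)"
proof -
  show "arr_of C (Idm (M_ob C) a) = Id C a"
    using assms by (intro arr_eqI) (simp_all add: M_ob_lab)
  then show "ismap (Idm (M_ob C) a)"
    using assms by (intro ismapI) simp_all
qed

lemma jay_M:
  assumes "ismap f" "ty f = Tight"
  shows "arr_of C (Jay (M_ob C) f) = arr_of C f \<cdot> ltenA C (\<lambda>\<lambda> (hd (ins f))) (tl (ins f))" "ismap (Jay (M_ob C) f)"
proof -
  obtain a as where as: "ins f = a # as" using assms ismapD(3)[OF assms(1)] by (cases "ins f") auto
  have o: "a \<in> Ob C" "set as \<subseteq> Ob C" using ismapD(1)[OF assms(1)] as by auto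
  have k: "arr_of C f \<cdot> ltenA C (\<lambda>\<lambda> a) as \<in> Ar C" using assms as o by simp
  show b: "arr_of C (Jay (M_ob C) f) = arr_of C f \<cdot> ltenA C (\<lambda>\<lambda> (hd (ins f))) (tl (ins f))"
    using assms as o by (intro arr_eqI) (simp_all add: M_ob_lab)
  show "ismap (Jay (M_ob C) f)"
    using assms b as o k by (intro ismapI) simp_all
qed

lemma id_sub_M:
  assumes "ismap f"
  shows "Sub (M_ob C) (Idm (M_ob C) (out f)) 1 f = f"
proof -
  let ?i = "Idm (M_ob C) (out f)"
  have "ins ?i = [] @ out f # []" by simp
  from sub_M[OF idm_M(2) assms this] assms show ?thesis
    by (intro mmap_eqI[where C = C]) (simp_all add: plug_def idm_M)
qed

lemma sub_id_M:
  assumes "ismap f" "1 \<le> i" "i \<le> arity f"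
  shows "Sub (M_ob C) f i (Idm (M_ob C) (ins f ! (i - 1))) = f"
proof -
  define z where "z = ins f ! (i - 1)"
  let ?I = "Idm (M_ob C) z"
  have "fits f i ?I" using assms by (simp add: fits_def z_def)
  then obtain ys zs where "ins f = ys @ out ?I # zs" and i: "i = Suc (length ys)" by (rule fits_split)
  then have s: "ins f = ys @ z # zs" by simp
  have o: "z \<in> Ob C" "set ys \<subseteq> Ob C" "set zs \<subseteq> Ob C"
    using ismapD(1)[OF assms(1)] s by auto
  have "ins f = ys @ out ?I # zs" using s by simp
  note r = sub_M[OF assms(1) idm_M(2)[OF o(1)] this i]
  let ?G = "uins C (ty f) ys"
  have "plug C ?G ?I = Id C (prodl C (?G @ [z]))"
  proof (cases "?G = []")
    case False
    then have "prodl C ?G \<in> Ob C" using o by (intro prodl_ob) simp_all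
    then show ?thesis using False o by (simp add: plug_def idm_M gather_def)
  qed (simp add: plug_def idm_M o)
  moreover have "src (arr_of C f) = lten C (prodl C (?G @ [z])) zs"
    using s uins_append[of C "ty f" ys "z # zs"] by (cases "?G = []") simp_all
  moreover have "prodl C (?G @ [z]) \<in> Ob C" using o by (intro prodl_ob) simp_all
  ultimately have "arr_of C (Sub (M_ob C) f i ?I) = arr_of C f"
    unfolding r(5) using o assms(1) by (simp del: arr_of_simps(1))
  then show ?thesis unfolding z_def[symmetric] using r(2-4) s uins_Nil_iff[of C "ty f" ys]
    by (intro mmap_eqI[where C = C]) (auto simp del: M_ob_simps(2-4))
qed

text \<open>Expanding \<open>plug\<close> of a substitution by \<open>plug_sub\<close> turns one side into the other.\<close>

lemma sub_assoc_M:
  assumes m: "ismap h" "ismap g" "ismap f" and "fits h i g" "fits g j f"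
  shows "Sub (M_ob C) h i (Sub (M_ob C) g j f) = Sub (M_ob C) (Sub (M_ob C) h i g) (j + i - 1) f"
proof -
  obtain hs ht where h: "ins h = hs @ out g # ht" "i = Suc (length hs)"
    using assms(4) by (rule fits_split)
  obtain gs gt where g: "ins g = gs @ out f # gt" "j = Suc (length gs)"
    using assms(5) by (rule fits_split)
  let ?H = "uins C (ty h) hs"
  define gf where "gf = Sub (M_ob C) g j f"
  define hg where "hg = Sub (M_ob C) h i g"
  note gf = sub_M[OF m(2,3) g, folded gf_def]
  note hg = sub_M[OF m(1,2) h, folded hg_def]
  have o: "set hs \<subseteq> Ob C" "set ht \<subseteq> Ob C" "set gs \<subseteq> Ob C" "set gt \<subseteq> Ob C"
    using ismapD(1)[OF m(1)] h ismapD(1)[OF m(2)] g by auto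
  have h': "ins h = hs @ out gf # ht" using h gf by simp
  have hg': "ins hg = (hs @ gs) @ out f # (gt @ ht)" "j + i - 1 = Suc (length (hs @ gs))"
    using hg g h by simp_all
  note L = sub_M[OF m(1) gf(1) h' h(2)]
  note R = sub_M[OF hg(1) m(3) hg']
  let ?A = "?H @ (if ?H = [] then uins C (ty g) gs else gs)"
  have A: "uins C (ty hg) (hs @ gs) = ?A"
    using hg(4) uins_append[of C "ty h" hs gs] by (auto simp: uins_Nil_iff split: if_splits)
  have Asrc: "(?H = [] \<longrightarrow> uins C (ty g) (ins g) = ?A @ out f # gt) \<and> (?H \<noteq> [] \<longrightarrow> ?H @ ins g = ?A @ out f # gt)"
    using g uins_append[of C "ty g" gs "out f # gt"] by auto
  then have "src (plug C ?H g) = prodl C (?A @ out f # gt)"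
    using m o by (cases "?H = []") (simp_all del: prodl_simps(2))
  then have tA: "src (plug C ?H g) = lten C (prodl C (?A @ [out f])) gt" by (rule trans) (rule prodl_snoc)
  have sh: "src (arr_of C h) = lten C (prodl C (?H @ [out g])) ht"
    using h uins_append[of C "ty h" hs "out g # ht"] by (cases "?H = []") simp_all
  have o': "set ?H \<subseteq> Ob C" "set ?A \<subseteq> Ob C" using o by auto
  have "arr_of C (Sub (M_ob C) h i gf) = arr_of C h \<cdot> ltenA C (plug C ?H g \<cdot> ltenA C (plug C ?A f) gt) ht"
    using L(5) plug_sub[OF m(2,3) g o'(1)] by (simp add: gf_def)
  also have "\<dots> = arr_of C h \<cdot> ltenA C (plug C ?H g) ht \<cdot> ltenA C (plug C ?A f) (gt @ ht)"
  proof -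
    have "ltenA C (plug C ?H g \<cdot> ltenA C (plug C ?A f) gt) ht
        = ltenA C (plug C ?H g) ht \<cdot> ltenA C (ltenA C (plug C ?A f) gt) ht"
      using m o o' tA by (intro ltenA_comp) (simp_all del: plug_arr(2))
    then show ?thesis
      using m o o' tA sh by (simp add: comp_assoc del: plug_arr(2) arr_of_simps(1))
  qed
  also have "\<dots> = arr_of C (Sub (M_ob C) hg (j + i - 1) f)"
    using R(5) hg(5) A by simp
  finally have "arr_of C (Sub (M_ob C) h i gf) = arr_of C (Sub (M_ob C) hg (j + i - 1) f)" .
  moreover have "ty (Sub (M_ob C) h i gf) = ty (Sub (M_ob C) hg (j + i - 1) f)"
    unfolding L(4) R(4) gf(4) hg(4) by (auto simp: uins_Nil_iff)
  ultimately show ?thesis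
    unfolding gf_def[symmetric] hg_def[symmetric] using L(2,3) R(2,3) gf(2) hg(3)
    by (intro mmap_eqI[where C = C]) (simp_all del: M_ob_simps(2-4))
qed

text \<open>Naturality of plugging \<open>f\<close>, applied to the arrow that plugs \<open>g\<close> among the preceding inputs.\<close>

lemma sub_commute_M:
  assumes m: "ismap h" "ismap g" "ismap f" and "fits h i g" "fits h n f" "i < n"
  shows "Sub (M_ob C) (Sub (M_ob C) h i g) (n + arity g - 1) f = Sub (M_ob C) (Sub (M_ob C) h n f) i g"
proof -
  obtain hs ht where h: "ins h = hs @ out g # ht" "i = Suc (length hs)"
    using assms(4) by (rule fits_split)
  obtain ks kt where k: "ins h = ks @ out f # kt" "n = Suc (length ks)"
    using assms(5) by (rule fits_split)
  obtain ms where ms: "ks = hs @ out g # ms" "ht = ms @ out f # kt"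
  proof -
    have "take (length ks) (ins h) = ks" using k by simp
    then have "ks = take (length ks) (hs @ out g # ht)" using h by simp
    moreover have l: "length hs < length ks" using h k assms by simp
    ultimately have 1: "ks = hs @ out g # take (length ks - length hs - 1) ht"
      by (simp add: take_Cons')
    define ms where "ms = take (length ks - length hs - 1) ht"
    have 2: "ks = hs @ out g # ms" using 1 unfolding ms_def .
    have "hs @ out g # ht = (hs @ out g # ms) @ out f # kt" using h(1) k(1) 2 by metis
    then have "ht = ms @ out f # kt" by simp
    with 2 show ?thesis by (rule that)
  qed
  let ?H = "uins C (ty h) hs"
  define K where "K = ?H @ out g # ms"
  define hg where "hg = Sub (M_ob C) h i g"
  define hf where "hf = Sub (M_ob C) h n f"
  note hg = sub_M[OF m(1,2) h, folded hg_def]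
  note hf = sub_M[OF m(1,3) k, folded hf_def]
  have K: "uins C (ty h) ks = K" using ms by (simp add: uins_append K_def)
  have hg': "ins hg = (hs @ ins g @ ms) @ out f # kt" "n + arity g - 1 = Suc (length (hs @ ins g @ ms))"
    using hg ms k by (simp_all add: arity_def)
  have hf': "ins hf = hs @ out g # (ms @ ins f @ kt)" using hf ms by simp
  note L = sub_M[OF hg(1) m(3) hg']
  note R = sub_M[OF hf(1) m(2) hf' h(2)]
  have o: "set hs \<subseteq> Ob C" "set ms \<subseteq> Ob C" "set kt \<subseteq> Ob C" "out g \<in> Ob C" "out f \<in> Ob C"
    using ismapD(1)[OF m(1)] h ms by auto
  define A where "A = (?H @ (if ?H = [] then uins C (ty g) (ins g) else ins g)) @ ms"
  have A: "uins C (ty hg) (hs @ ins g @ ms) = A"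
    unfolding A_def using hg(4) uins_append[of C "ty h" hs "ins g @ ms"] uins_append[of C "ty g" "ins g" ms]
    by (auto simp: uins_Nil_iff split: if_splits)
  have ne: "A \<noteq> []" "K \<noteq> []" "?H @ (if ?H = [] then uins C (ty g) (ins g) else ins g) \<noteq> []"
    using m by (auto simp: A_def K_def)
  have oA: "set ?H \<subseteq> Ob C" "set A \<subseteq> Ob C" "set K \<subseteq> Ob C"
    using o m by (auto simp: A_def K_def)
  have sh: "src (arr_of C h) = lten C (prodl C (?H @ [out g])) (ms @ out f # kt)"
    using h ms uins_append[of C "ty h" hs "out g # ht"] by (cases "?H = []") simp_all
  have tyf: "ty hf = ty h" using hf(4) K ne by simp
  have prK: "prodl C K = lten C (prodl C (?H @ [out g])) ms"
    by (cases "?H = []") (simp_all add: K_def)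
  have prA: "prodl C A = lten C (src (plug C ?H g)) ms"
    unfolding A_def using ne(3) oA m by (subst prodl_simps(2)) simp_all
  have sh': "src (arr_of C h) = lten C (prodl C K \<odot> out f) kt" using sh prK by simp
  define u where "u = plug C ?H g"
  define k where "k = ltenA C u ms"
  have u: "u \<in> Ar C" "tgt u = prodl C (?H @ [out g])" using m oA by (simp_all add: u_def)
  have kk: "k \<in> Ar C" "src k = prodl C A" "tgt k = prodl C K"
    using m o u oA prK prA by (simp_all add: k_def u_def del: plug_arr(2))
  have nat: "plug C K f \<cdot> ltenA C k (ins f) = (k \<otimes> Id C (out f)) \<cdot> plug C A f"
    using kk m ne by (intro plug_nat) simp_all
  have a1: "src (plug C K f) = lten C (prodl C K) (ins f)" "tgt (plug C K f) = prodl C K \<odot> out f"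
    "src (plug C A f) = lten C (prodl C A) (ins f)" "tgt (plug C A f) = prodl C A \<odot> out f"
    "plug C K f \<in> Ar C" "plug C A f \<in> Ar C"
    using m oA ne by simp_all
  have "arr_of C (Sub (M_ob C) hg (n + arity g - 1) f)
      = arr_of C h \<cdot> ltenA C (k \<otimes> Id C (out f)) kt \<cdot> ltenA C (plug C A f) kt"
    using L(5) hg(5) A ms(2) by (simp add: k_def u_def)
  also have "\<dots> = arr_of C h \<cdot> ltenA C ((k \<otimes> Id C (out f)) \<cdot> plug C A f) kt"
    using m o sh' kk a1 by (simp add: ltenA_comp comp_assoc del: arr_of_simps(1) plug_arr)
  also have "\<dots> = arr_of C h \<cdot> ltenA C (plug C K f \<cdot> ltenA C k (ins f)) kt"
    by (simp only: nat)
  also have "\<dots> = arr_of C h \<cdot> ltenA C (plug C K f) kt \<cdot> ltenA C u (ms @ ins f @ kt)"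
    using m o sh' kk a1 by (simp add: ltenA_comp comp_assoc k_def[symmetric] del: arr_of_simps(1) plug_arr)
  also have "\<dots> = arr_of C (Sub (M_ob C) hf i g)"
    using R(5) hf(5) K tyf by (simp add: u_def)
  finally have "arr_of C (Sub (M_ob C) hg (n + arity g - 1) f) = arr_of C (Sub (M_ob C) hf i g)" .
  moreover have "ty (Sub (M_ob C) hg (n + arity g - 1) f) = ty (Sub (M_ob C) hf i g)"
    unfolding L(4) R(4) A tyf using ne hg(4) by simp
  ultimately show ?thesis
    unfolding hg_def[symmetric] hf_def[symmetric] using L(2,3) R(2,3) hg(3) hf(3)
    by (intro mmap_eqI[where C = C]) (simp_all del: M_ob_simps(2-4))
qed

lemma lam_gather:
  assumes "set as \<subseteq> Ob C" "uins C x as \<noteq> []"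
  shows "\<lambda>\<lambda> (prodl C (uins C x as)) \<cdot> gather C \<I> x as
    = (if x = Tight then ltenA C (\<lambda>\<lambda> (hd as)) (tl as) else Id C (prodl C (uins C x as)))"
proof (cases x)
  case Tight
  then show ?thesis using assms by (cases as) (simp_all add: gather_def lam_lassoc)
next
  case Loose
  have "\<lambda>\<lambda> (lten C \<I> as) \<cdot> (lassoc C \<I> \<I> as \<cdot> ltenA C (\<rho> \<I>) as)
      = ltenA C (\<lambda>\<lambda> \<I>) as \<cdot> ltenA C (\<rho> \<I>) as"
    using assms by (simp add: comp_assoc[symmetric] lam_lassoc)
  also have "\<dots> = Id C (lten C \<I> as)"
    using assms by (simp add: ltenA_comp[symmetric] lam_rho)
  finally show ?thesis using Loose by (simp add: gather_def)
qed

text \<open>The axioms \<open>\<lambda>\<^bsub>ab\<^esub> \<alpha>\<^bsub>i,a,b\<^esub> = \<lambda>\<^sub>a b\<close> and \<open>\<lambda>\<^sub>i \<rho>\<^sub>i = 1\<close> remove the unit behind which \<open>f\<close> is plugged.\<close>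

lemma lam_plug:
  assumes "ismap f"
  shows "\<lambda>\<lambda> (out f) \<cdot> plug C [\<I>] f
    = (if ty f = Tight then arr_of C f \<cdot> ltenA C (\<lambda>\<lambda> (hd (ins f))) (tl (ins f)) else arr_of C f)"
proof -
  have "\<lambda>\<lambda> (out f) \<cdot> plug C [\<I>] f = \<lambda>\<lambda> (out f) \<cdot> ((Id C \<I> \<otimes> arr_of C f) \<cdot> gather C \<I> (ty f) (ins f))"
    by (simp add: plug_def)
  also have "\<dots> = arr_of C f \<cdot> (\<lambda>\<lambda> (prodl C (uins C (ty f) (ins f))) \<cdot> gather C \<I> (ty f) (ins f))"
    using assms lam_nat[of "arr_of C f"] by (intro comp_cong_right) simp_all
  finally show ?thesis using assms by (simp add: lam_gather)
qed

text \<open>If \<open>f\<close> goes into the first position, then the claim is \<open>lam_plug\<close>.  Otherwise \<open>\<lambda>\<close> acts on the inputs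
  that precede \<open>f\<close>, and naturality of plugging moves it past \<open>f\<close>.\<close>

lemma jay_sub_left_M:
  assumes m: "ismap g" "ismap f" and "fits g i f" and tg: "ty g = Tight"
  shows "Sub (M_ob C) (Jay (M_ob C) g) i f =
    (if sub_type Loose i (ty f) = sub_type Tight i (ty f) then Sub (M_ob C) g i f
     else Jay (M_ob C) (Sub (M_ob C) g i f))"
proof -
  obtain ys zs where g: "ins g = ys @ out f # zs" "i = Suc (length ys)"
    using assms(3) by (rule fits_split)
  define gf where "gf = Sub (M_ob C) g i f"
  define jg where "jg = Jay (M_ob C) g"
  define jgf where "jgf = Sub (M_ob C) jg i f"
  have jg': "ins jg = ys @ out f # zs" "ty jg = Loose" "out jg = out g" using g by (simp_all add: jg_def)
  note jg = jay_M[OF m(1) tg, folded jg_def]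
  note gf = sub_M[OF m g, folded gf_def]
  note L = sub_M[OF jg(2) m(2) jg'(1) g(2), folded jgf_def]
  have o: "set ys \<subseteq> Ob C" "set zs \<subseteq> Ob C" using ismapD(1)[OF m(1)] g by auto
  have tyL: "ty jgf = Loose" using L(4) jg'(2) by simp
  show ?thesis
  proof (cases ys)
    case Nil
    then have b: "arr_of C jgf = arr_of C g \<cdot> ltenA C (\<lambda>\<lambda> (out f)) zs \<cdot> ltenA C (plug C [\<I>] f) zs"
      using L(5) jg(1) jg' g by simp
    have sg: "src (arr_of C g) = lten C (out f) zs" using g tg Nil by simp
    have b: "arr_of C jgf = arr_of C g \<cdot> ltenA C (if ty f = Tight then arr_of C f \<cdot> ltenA C (\<lambda>\<lambda> (hd (ins f))) (tl (ins f)) else arr_of C f) zs"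
      unfolding b using m o sg lam_plug[OF m(2)]
      by (simp add: comp_assoc ltenA_comp[symmetric] del: arr_of_simps(1))
    show ?thesis
    proof (cases "ty f")
      case Tight
      note jgf = jay_M[OF gf(1), folded gf_def]
      obtain a as where f: "ins f = a # as" using Tight ismapD(3)[OF m(2)] by (cases "ins f") auto
      have oa: "a \<in> Ob C" "set as \<subseteq> Ob C" using ismapD(1)[OF m(2)] f by auto
      have "arr_of C jgf = arr_of C g \<cdot> ltenA C (arr_of C f) zs \<cdot> ltenA C (ltenA C (\<lambda>\<lambda> a) as) zs"
        unfolding b using m o oa sg f Tight by (simp add: ltenA_comp comp_assoc)
      also have "\<dots> = arr_of C (Jay (M_ob C) gf)"
        using jgf gf Nil tg f Tight by (simp add: plug_def)
      finally have "jgf = Jay (M_ob C) gf"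
        using L(2,3) gf(2,3) tyL jg'(3) by (intro mmap_eqI[where C = C]) simp_all
      moreover have "sub_type Loose i (ty f) \<noteq> sub_type Tight i (ty f)"
        using Tight Nil g by (simp add: sub_type_def)
      ultimately show ?thesis by (simp add: gf_def jgf_def jg_def)
    next
      case Loose
      have "arr_of C jgf = arr_of C gf" unfolding b using gf(5) Nil tg Loose by (simp add: plug_def)
      then have "jgf = gf" using L(2,3) gf(2-4) tyL jg'(3) tg Nil Loose
        by (intro mmap_eqI[where C = C]) simp_all
      moreover have "sub_type Loose i (ty f) = sub_type Tight i (ty f)"
        using Loose Nil g by (simp add: sub_type_def)
      ultimately show ?thesis by (simp add: gf_def jgf_def jg_def)
    qed
  next
    case (Cons y ys')
    have oy: "y \<in> Ob C" "set ys' \<subseteq> Ob C" using o Cons by auto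
    have tgf: "ty gf = Tight" using gf(4) tg Cons by simp
    note jgf = jay_M[OF gf(1) tgf]
    define k where "k = ltenA C (\<lambda>\<lambda> y) ys'"
    have k: "k \<in> Ar C" "src k = prodl C (\<I> # ys)" "tgt k = prodl C ys" using Cons oy by (simp_all add: k_def)
    have nat: "plug C ys f \<cdot> ltenA C k (ins f) = (k \<otimes> Id C (out f)) \<cdot> plug C (\<I> # ys) f"
      using k m Cons by (intro plug_nat) simp_all
    have a: "plug C ys f \<in> Ar C" "tgt (plug C ys f) = prodl C ys \<odot> out f" "src (plug C ys f) = lten C (prodl C ys) (ins f)"
      "plug C (\<I> # ys) f \<in> Ar C" "tgt (plug C (\<I> # ys) f) = prodl C (\<I> # ys) \<odot> out f"
      using m o Cons by simp_all
    have sg: "src (arr_of C g) = lten C (prodl C ys \<odot> out f) zs" using g tg Cons by simp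
    have "arr_of C jgf = arr_of C g \<cdot> ltenA C (k \<otimes> Id C (out f)) zs \<cdot> ltenA C (plug C (\<I> # ys) f) zs"
      using L(5) jg(1) jg' g Cons by (simp add: k_def)
    also have "\<dots> = arr_of C g \<cdot> ltenA C (plug C ys f \<cdot> ltenA C k (ins f)) zs"
      unfolding nat using m o k a sg by (simp add: ltenA_comp comp_assoc del: arr_of_simps(1) plug_arr)
    also have "\<dots> = arr_of C g \<cdot> ltenA C (plug C ys f) zs \<cdot> ltenA C (\<lambda>\<lambda> (hd (ins gf))) (tl (ins gf))"
      using m o k a sg gf(2) Cons by (simp add: ltenA_comp comp_assoc k_def[symmetric] del: arr_of_simps(1) plug_arr)
    also have "\<dots> = arr_of C (Jay (M_ob C) gf)"
      using jgf gf(5) tg by simp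
    finally have "jgf = Jay (M_ob C) gf"
      using L(2,3) gf(2,3) tyL jg'(3) by (intro mmap_eqI[where C = C]) simp_all
    moreover have "sub_type Loose i (ty f) \<noteq> sub_type Tight i (ty f)"
      using Cons g by (simp add: sub_type_def)
    ultimately show ?thesis by (simp add: gf_def jgf_def jg_def)
  qed
qed

text \<open>Behind other inputs a tight map and the associated loose map act in the same way: the unit that
  \<open>\<rho>\<close> creates is absorbed by \<open>\<lambda>\<close>, by the triangle axiom.\<close>

lemma plug_jay:
  assumes m: "ismap f" and tf: "ty f = Tight" and L: "set L \<subseteq> Ob C" "L \<noteq> []"
  shows "plug C L (Jay (M_ob C) f) = plug C L f"
proof -
  obtain a as where as: "ins f = a # as" using assms ismapD(3)[OF assms(1)] by (cases "ins f") auto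
  have o: "a \<in> Ob C" "set as \<subseteq> Ob C" "prodl C L \<in> Ob C" using ismapD(1)[OF assms(1)] as L by auto
  have "plug C L (Jay (M_ob C) f)
     = (Id C (prodl C L) \<otimes> arr_of C f) \<cdot> ((Id C (prodl C L) \<otimes> ltenA C (\<lambda>\<lambda> a) as) \<cdot> (lassoc C (prodl C L) \<I> (a # as) \<cdot> ltenA C (\<rho> (prodl C L)) (a # as)))"
    using L o as m tf jay_M(1)[OF m tf]
    by (simp add: plug_def gather_def ten_comp_right comp_assoc del: ltenA_simps(2) lassoc.simps(2))
  also have "\<dots> = plug C L f" using lassoc_triangle[OF o(3,1,2)] L as tf by (simp add: plug_def gather_def)
  finally show ?thesis .
qed

lemma jay_sub_right_M:
  assumes m: "ismap g" "ismap f" and "fits g i f" and tf: "ty f = Tight"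
  shows "Sub (M_ob C) g i (Jay (M_ob C) f) =
    (if sub_type (ty g) i Loose = sub_type (ty g) i Tight then Sub (M_ob C) g i f
     else Jay (M_ob C) (Sub (M_ob C) g i f))"
proof -
  obtain ys zs where g: "ins g = ys @ out f # zs" "i = Suc (length ys)"
    using assms(3) by (rule fits_split)
  define gf where "gf = Sub (M_ob C) g i f"
  define jf where "jf = Jay (M_ob C) f"
  define gjf where "gjf = Sub (M_ob C) g i jf"
  note jf = jay_M[OF m(2) tf, folded jf_def]
  have jf': "ins g = ys @ out jf # zs" "ty jf = Loose" "ins jf = ins f" using g by (simp_all add: jf_def)
  note gf = sub_M[OF m g, folded gf_def]
  note L = sub_M[OF m(1) jf(2) jf'(1) g(2), folded gjf_def]
  have o: "set ys \<subseteq> Ob C" "set zs \<subseteq> Ob C" using ismapD(1)[OF m(1)] g by auto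
  show ?thesis
  proof (cases "uins C (ty g) ys = []")
    case True
    then have t: "ty g = Tight" "ys = []" by (auto simp: uins_Nil_iff)
    have tgf: "ty gf = Tight" using gf(4) tf True by simp
    note jgf = jay_M[OF gf(1) tgf]
    obtain a as where f: "ins f = a # as" using tf ismapD(3)[OF m(2)] by (cases "ins f") auto
    have oa: "a \<in> Ob C" "set as \<subseteq> Ob C" using ismapD(1)[OF m(2)] f by auto
    have sg: "src (arr_of C g) = lten C (out f) zs" using g t by simp
    have "arr_of C gjf = arr_of C g \<cdot> ltenA C (arr_of C f \<cdot> ltenA C (\<lambda>\<lambda> a) as) zs"
      using L(5) t jf f by (simp add: plug_def)
    also have "\<dots> = arr_of C g \<cdot> ltenA C (arr_of C f) zs \<cdot> ltenA C (\<lambda>\<lambda> a) (as @ zs)"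
      using m o oa sg f tf by (simp add: ltenA_comp comp_assoc)
    also have "\<dots> = arr_of C (Jay (M_ob C) gf)"
      using jgf(1) gf(2,5) t f by (simp add: plug_def)
    finally have "gjf = Jay (M_ob C) gf"
      using L(2-4) gf(2,3) t jf' True by (intro mmap_eqI[where C = C]) simp_all
    moreover have "sub_type (ty g) i Loose \<noteq> sub_type (ty g) i Tight"
      using t g by (simp add: sub_type_def)
    ultimately show ?thesis by (simp add: gf_def gjf_def jf_def)
  next
    case False
    have "set (uins C (ty g) ys) \<subseteq> Ob C" using o by simp
    then have "arr_of C gjf = arr_of C gf"
      using L(5) gf(5) plug_jay[OF m(2) tf _ False] by (simp add: jf_def)
    then have "gjf = gf" using L(2-4) gf(2-4) jf' False by (intro mmap_eqI[where C = C]) simp_all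
    moreover have "sub_type (ty g) i Loose = sub_type (ty g) i Tight"
      using False g sub_type_split[of "ty g" ys _ C] by simp
    ultimately show ?thesis by (simp add: gf_def gjf_def jf_def)
  qed
qed

theorem M_skew_multicategory: "skew_multicategory (M_ob C)"
proof
  show "set (ins f) \<subseteq> Obj (M_ob C) \<and> out f \<in> Obj (M_ob C) \<and> (ty f = Tight \<longrightarrow> 1 \<le> arity f)"
    if "ismap f" for f
    using ismapD[OF that] by (cases "ins f") (auto simp: arity_def)
  show "Idm (M_ob C) a \<in> maps (M_ob C) Tight [a] a" if "a \<in> Obj (M_ob C)" for a
    using that idm_M(2)[of a] by (simp add: maps_def)
  show "Jay (M_ob C) f \<in> maps (M_ob C) Loose (ins f) (out f)" if "ismap f" "ty f = Tight" for f
    using that jay_M(2)[of f] by (simp add: maps_def)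
  show "Sub (M_ob C) g i f \<in> maps (M_ob C) (sub_type (ty g) i (ty f)) (sub_ins g i f) (out g)"
    if m: "ismap g" "ismap f" "fits g i f" for g f i
  proof -
    obtain ys zs where "ins g = ys @ out f # zs" "i = Suc (length ys)"
      using m(3) by (rule fits_split)
    then show ?thesis using sub_M(1)[OF m(1,2)] by (simp add: maps_def)
  qed
qed (fact id_sub_M sub_id_M sub_assoc_M sub_commute_M jay_sub_left_M jay_sub_right_M)+

text \<open>A list is represented by its product, with the identity arrow as the universal multimap.\<close>

definition id_mmap :: "tightness \<Rightarrow> 'o list \<Rightarrow> ('o, 'm) mmap" where
  "id_mmap x as = MMap x as (prodl C (uins C x as)) (lab (Id C (prodl C (uins C x as))))"

lemma id_mmap_simps [simp]:
  "ty (id_mmap x as) = x" "ins (id_mmap x as) = as" "out (id_mmap x as) = prodl C (uins C x as)"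
  by (simp_all add: id_mmap_def)

lemma id_mmap_map:
  assumes "set as \<subseteq> Ob C" "uins C x as \<noteq> []"
  shows "arr_of C (id_mmap x as) = Id C (prodl C (uins C x as))" "ismap (id_mmap x as)"
proof -
  have m: "prodl C (uins C x as) \<in> Ob C" using assms by simp
  show b: "arr_of C (id_mmap x as) = Id C (prodl C (uins C x as))"
    using m by (intro arr_eqI) (simp_all, simp add: id_mmap_def)
  show "ismap (id_mmap x as)" using assms m b by (intro ismapI) (auto simp: uins_def)
qed

text \<open>Both sides have the same underlying arrows, as \<open>m \<cdot> ys\<close> for the product \<open>m\<close> of \<open>as\<close> is the product of
  \<open>as\<close> followed by \<open>ys\<close>.\<close>

lemma id_mmap_bij:
  assumes as: "set as \<subseteq> Ob C" "uins C x as \<noteq> []" and ys: "set ys \<subseteq> Ob C"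
  shows "bij_betw (\<lambda>f. Sub (M_ob C) f 1 (id_mmap x as))
    (maps (M_ob C) Tight (prodl C (uins C x as) # ys) b) (maps (M_ob C) x (as @ ys) b)"
proof -
  define t m where "t = id_mmap x as" and "m = prodl C (uins C x as)"
  have m: "m \<in> Ob C" using as by (simp add: m_def)
  note bt = id_mmap_map(1)[OF as, folded t_def m_def] and t = id_mmap_map(2)[OF as, folded t_def]
  have ti: "ty t = x" "ins t = as" "out t = m" by (simp_all add: t_def m_def)
  show ?thesis
    unfolding t_def[symmetric] m_def[symmetric]
  proof (rule bij_betwI[where g = "\<lambda>f. MMap Tight (m # ys) b (mlab f)"])
    have S: "Sub (M_ob C) f 1 t \<in> maps (M_ob C) x (as @ ys) b \<and> mlab (Sub (M_ob C) f 1 t) = mlab f"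
      if "f \<in> maps (M_ob C) Tight (m # ys) b" for f
    proof -
      have f: "ismap f" "ty f = Tight" "ins f = [] @ out t # ys" "out f = b"
        using that by (auto simp: maps_def ti)
      note r = sub_M[OF f(1) t f(3), of 1, simplified]
      have "arr_of C (Sub (M_ob C) f 1 t) = arr_of C f"
        using r(5) f m ys ti by (simp add: plug_def bt)
      then have "mlab (Sub (M_ob C) f 1 t) = mlab f" by (metis arr_of_simps(3))
      then show ?thesis using r(1-4) f ti by (simp add: maps_def)
    qed
    have T: "MMap Tight (m # ys) b (mlab f) \<in> maps (M_ob C) Tight (m # ys) b"
      if "f \<in> maps (M_ob C) x (as @ ys) b" for f
    proof -
      have "arr_of C (MMap Tight (m # ys) b (mlab f)) = arr_of C f"
        using that as by (intro arr_eqI) (auto simp: maps_def m_def uins_append)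
      moreover have "ismap f" using that by (simp add: maps_def)
      ultimately show ?thesis using that m ys
        by (auto simp: maps_def intro!: ismapI)
    qed
    show "(\<lambda>f. Sub (M_ob C) f 1 t) \<in> maps (M_ob C) Tight (m # ys) b \<rightarrow> maps (M_ob C) x (as @ ys) b"
      using S by auto
    show "(\<lambda>f. MMap Tight (m # ys) b (mlab f)) \<in> maps (M_ob C) x (as @ ys) b \<rightarrow> maps (M_ob C) Tight (m # ys) b"
      using T by auto
    show "MMap Tight (m # ys) b (mlab (Sub (M_ob C) f 1 t)) = f" if "f \<in> maps (M_ob C) Tight (m # ys) b" for f
      using S[OF that] that by (auto simp: maps_def intro: mmap.expand)
    show "Sub (M_ob C) (MMap Tight (m # ys) b (mlab f)) 1 t = f" if "f \<in> maps (M_ob C) x (as @ ys) b" for f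
      using S[OF T[OF that]] that by (auto simp: maps_def intro!: mmap.expand)
  qed
qed

theorem M_left_representable: "left_representable (M_ob C)"
  unfolding left_representable_def
proof (intro allI impI)
  fix x as assume "set as \<subseteq> Obj (M_ob C) \<and> (x = Tight \<longrightarrow> 1 \<le> length as)"
  then have as: "set as \<subseteq> Ob C" "uins C x as \<noteq> []" by (auto simp: uins_def)
  then show "\<exists>m \<in> Obj (M_ob C). \<exists>\<theta> \<in> maps (M_ob C) x as m. \<forall>ys b. set ys \<subseteq> Obj (M_ob C) \<and> b \<in> Obj (M_ob C) \<longrightarrow>
           bij_betw (\<lambda>f. Sub (M_ob C) f 1 \<theta>) (maps (M_ob C) Tight (m # ys) b) (maps (M_ob C) x (as @ ys) b)"
    using id_mmap_map(2)[OF as] id_mmap_bij[OF as]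
    by (intro bexI[of _ "prodl C (uins C x as)"] bexI[of _ "id_mmap x as"]) (auto simp: maps_def)
qed

end

section \<open>The skew multifunctor of a lax monoidal functor\<close>

text \<open>The comparison map \<open>F a \<cdot> F x\<^sub>1 \<dots> F x\<^sub>n \<rightarrow> F (a \<cdot> x\<^sub>1 \<dots> x\<^sub>n)\<close>, and below its form for the inputs of a
  multimap, where the unit in front of the inputs of a loose one is compared by \<open>f\<^sub>0\<close>.\<close>

fun f2_list :: "('o, 'm) skewmon \<Rightarrow> ('o, 'm) skewmon \<Rightarrow> ('o, 'm) laxf \<Rightarrow> 'o \<Rightarrow> 'o list \<Rightarrow> ('o, 'm) arr" where
  "f2_list C D F a [] = Id D (fob F a)"
| "f2_list C D F a (x # xs) = f2_list C D F (a \<odot>\<^bsub>C\<^esub> x) xs \<cdot>\<^bsub>D\<^esub> ltenA D (f2 F a x) (map (fob F) xs)"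

definition f2_ins :: "('o, 'm) skewmon \<Rightarrow> ('o, 'm) skewmon \<Rightarrow> ('o, 'm) laxf \<Rightarrow> tightness \<Rightarrow> 'o list \<Rightarrow> ('o, 'm) arr" where
  "f2_ins C D F x as = (if x = Tight then f2_list C D F (hd as) (tl as)
     else f2_list C D F \<I>\<^bsub>C\<^esub> as \<cdot>\<^bsub>D\<^esub> ltenA D (f0 F) (map (fob F) as))"

definition M_map :: "('o, 'm) skewmon \<Rightarrow> ('o, 'm) skewmon \<Rightarrow> ('o, 'm) laxf \<Rightarrow> ('o, 'm) mmap \<Rightarrow> ('o, 'm) mmap" where
  "M_map C D F f = MMap (ty f) (map (fob F) (ins f)) (fob F (out f))
     (lab (far F (arr_of C f) \<cdot>\<^bsub>D\<^esub> f2_ins C D F (ty f) (ins f)))"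

definition M_mor :: "('o, 'm) skewmon \<Rightarrow> ('o, 'm) skewmon \<Rightarrow> ('o, 'm) laxf \<Rightarrow> ('o, 'm) multif" where
  "M_mor C D F = \<lparr>mob = fob F, mmp = restrict (M_map C D F) (Maps (M_ob C))\<rparr>"

lemma skew_mon_iff: "skew_mon C \<longleftrightarrow> skew_monoidal C"
  by (simp add: skew_mon_def)

locale lax = C: skew_mon C + D: skew_mon D + lax_monoidal C D F
  for C :: "('o, 'm) skewmon" and D :: "('o, 'm) skewmon" and F :: "('o, 'm) laxf"
begin

abbreviation compD (infixl "\<bullet>" 65) where "g \<bullet> f \<equiv> g \<cdot>\<^bsub>D\<^esub> f"
abbreviation tenD (infixl "\<boxtimes>" 75) where "g \<boxtimes> f \<equiv> g \<otimes>\<^bsub>D\<^esub> f"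
abbreviation Fo where "Fo \<equiv> fob F"
abbreviation Fa where "Fa \<equiv> far F"

lemma Fo_ob [simp]: "a \<in> Ob C \<Longrightarrow> Fo a \<in> Ob D"
  using fctr by (simp add: is_functor_def)

lemma Fo_image [simp]: "A \<subseteq> Ob C \<Longrightarrow> Fo ` A \<subseteq> Ob D"
  by auto

lemma Fa_arr [simp]:
  assumes "f \<in> Ar C" shows "Fa f \<in> Ar D" "src (Fa f) = Fo (src f)" "tgt (Fa f) = Fo (tgt f)"
  using fctr assms by (auto simp: is_functor_def hom_iff)

lemma Fa_id [simp]: "a \<in> Ob C \<Longrightarrow> Fa (Id C a) = Id D (Fo a)"
  using fctr by (simp add: is_functor_def)

lemma Fa_comp: "g \<in> Ar C \<Longrightarrow> f \<in> Ar C \<Longrightarrow> tgt f = src g \<Longrightarrow> Fa (g \<cdot>\<^bsub>C\<^esub> f) = Fa g \<bullet> Fa f"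
  using fctr by (simp add: is_functor_def)

lemma f0_arr [simp]: "f0 F \<in> Ar D" "src (f0 F) = \<I>\<^bsub>D\<^esub>" "tgt (f0 F) = Fo \<I>\<^bsub>C\<^esub>"
  using f0_hom by (auto simp: hom_iff)

lemma f2_arr [simp]:
  assumes "a \<in> Ob C" "b \<in> Ob C"
  shows "f2 F a b \<in> Ar D" "src (f2 F a b) = Fo a \<odot>\<^bsub>D\<^esub> Fo b" "tgt (f2 F a b) = Fo (a \<odot>\<^bsub>C\<^esub> b)"
  using f2_hom[OF assms] by (auto simp: hom_iff)

lemma f2_list_arr [simp]:
  assumes "a \<in> Ob C" "set xs \<subseteq> Ob C"
  shows "f2_list C D F a xs \<in> Ar D" "src (f2_list C D F a xs) = lten D (Fo a) (map Fo xs)"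
    "tgt (f2_list C D F a xs) = Fo (lten C a xs)"
  using assms by (induction xs arbitrary: a) auto

lemma f2_list_nat:
  "\<lbrakk>f \<in> Ar C; set xs \<subseteq> Ob C\<rbrakk>
    \<Longrightarrow> Fa (ltenA C f xs) \<bullet> f2_list C D F (src f) xs = f2_list C D F (tgt f) xs \<bullet> ltenA D (Fa f) (map Fo xs)"
proof (induction xs arbitrary: f)
  case (Cons x xs)
  let ?e = "f \<otimes>\<^bsub>C\<^esub> Id C x"
  have "Fa (ltenA C f (x # xs)) \<bullet> f2_list C D F (src f) (x # xs)
      = Fa (ltenA C ?e xs) \<bullet> f2_list C D F (src ?e) xs \<bullet> ltenA D (f2 F (src f) x) (map Fo xs)"
    using Cons.prems by (simp add: D.comp_assoc)
  also have "\<dots> = f2_list C D F (tgt f \<odot>\<^bsub>C\<^esub> x) xs \<bullet> ltenA D (Fa ?e \<bullet> f2 F (src f) x) (map Fo xs)"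
    using Cons.prems by (subst Cons.IH) (simp_all add: D.ltenA_comp D.comp_assoc)
  also have "\<dots> = f2_list C D F (tgt f) (x # xs) \<bullet> ltenA D (Fa f) (map Fo (x # xs))"
    using Cons.prems f2_nat[of f "Id C x"] by (simp add: D.ltenA_comp D.comp_assoc)
  finally show ?case .
qed simp

lemma f2_list_append:
  "\<lbrakk>a \<in> Ob C; set xs \<subseteq> Ob C; set ys \<subseteq> Ob C\<rbrakk>
    \<Longrightarrow> f2_list C D F a (xs @ ys) = f2_list C D F (lten C a xs) ys \<bullet> ltenA D (f2_list C D F a xs) (map Fo ys)"
  by (induction xs arbitrary: a) (simp_all add: D.comp_assoc D.ltenA_comp)

text \<open>The coherence of \<open>f\<^sub>2\<close> with \<open>\<alpha>\<close>, for several factors.\<close>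

lemma f2_list_lassoc:
  "\<lbrakk>p \<in> Ob C; a \<in> Ob C; set xs \<subseteq> Ob C\<rbrakk>
    \<Longrightarrow> Fa (lassoc C p a xs) \<bullet> (f2_list C D F (p \<odot>\<^bsub>C\<^esub> a) xs \<bullet> ltenA D (f2 F p a) (map Fo xs))
      = f2 F p (lten C a xs) \<bullet> ((Id D (Fo p) \<boxtimes> f2_list C D F a xs) \<bullet> lassoc D (Fo p) (Fo a) (map Fo xs))"
proof (induction xs arbitrary: a)
  case (Cons x xs)
  let ?A = "\<alpha>\<^bsub>C\<^esub> p a x" and ?xs = "map Fo xs" and ?AD = "\<alpha>\<^bsub>D\<^esub> (Fo p) (Fo a) (Fo x)"
  let ?P = "Fa (lassoc C p (a \<odot>\<^bsub>C\<^esub> x) xs)" and ?Q = "f2_list C D F (p \<odot>\<^bsub>C\<^esub> (a \<odot>\<^bsub>C\<^esub> x)) xs"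
  have "Fa (lassoc C p a (x # xs)) \<bullet> (f2_list C D F (p \<odot>\<^bsub>C\<^esub> a) (x # xs) \<bullet> ltenA D (f2 F p a) (map Fo (x # xs)))
      = ?P \<bullet> (Fa (ltenA C ?A xs) \<bullet> (f2_list C D F (p \<odot>\<^bsub>C\<^esub> a \<odot>\<^bsub>C\<^esub> x) xs \<bullet>
          ltenA D (f2 F (p \<odot>\<^bsub>C\<^esub> a) x \<bullet> (f2 F p a \<boxtimes> Id D (Fo x))) ?xs))"
    using Cons.prems by (simp add: D.comp_assoc D.ltenA_comp Fa_comp)
  also have "\<dots> = ?P \<bullet> (?Q \<bullet> (ltenA D (Fa ?A) ?xs \<bullet>
          ltenA D (f2 F (p \<odot>\<^bsub>C\<^esub> a) x \<bullet> (f2 F p a \<boxtimes> Id D (Fo x))) ?xs))"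
    using Cons.prems f2_list_nat[of ?A xs]
    by (intro arg_cong[where f = "\<lambda>z. _ \<bullet> z"] D.comp_cong_right) simp_all
  also have "\<dots> = ?P \<bullet> (?Q \<bullet> ltenA D (Fa ?A \<bullet> f2 F (p \<odot>\<^bsub>C\<^esub> a) x \<bullet> (f2 F p a \<boxtimes> Id D (Fo x))) ?xs)"
    using Cons.prems by (simp add: D.ltenA_comp D.comp_assoc)
  also have "\<dots> = ?P \<bullet> (?Q \<bullet> ltenA D (f2 F p (a \<odot>\<^bsub>C\<^esub> x) \<bullet> (Id D (Fo p) \<boxtimes> f2 F a x) \<bullet> ?AD) ?xs)"
    using Cons.prems lax_alpha[of p a x] by simp
  also have "\<dots> = (?P \<bullet> (?Q \<bullet> ltenA D (f2 F p (a \<odot>\<^bsub>C\<^esub> x)) ?xs)) \<bullet> ltenA D ((Id D (Fo p) \<boxtimes> f2 F a x) \<bullet> ?AD) ?xs"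
    using Cons.prems by (simp add: D.ltenA_comp D.comp_assoc)
  also have "\<dots> = f2 F p (lten C a (x # xs)) \<bullet> ((Id D (Fo p) \<boxtimes> f2_list C D F (a \<odot>\<^bsub>C\<^esub> x) xs) \<bullet>
      (lassoc D (Fo p) (Fo (a \<odot>\<^bsub>C\<^esub> x)) ?xs \<bullet> (ltenA D (Id D (Fo p) \<boxtimes> f2 F a x) ?xs \<bullet> ltenA D ?AD ?xs)))"
    using Cons.prems by (subst Cons.IH) (simp_all add: D.ltenA_comp D.comp_assoc)
  also have "lassoc D (Fo p) (Fo (a \<odot>\<^bsub>C\<^esub> x)) ?xs \<bullet> (ltenA D (Id D (Fo p) \<boxtimes> f2 F a x) ?xs \<bullet> ltenA D ?AD ?xs)
     = (Id D (Fo p) \<boxtimes> ltenA D (f2 F a x) ?xs) \<bullet> (lassoc D (Fo p) (Fo a \<odot>\<^bsub>D\<^esub> Fo x) ?xs \<bullet> ltenA D ?AD ?xs)"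
    using Cons.prems D.lassoc_nat[of "f2 F a x" "Id D (Fo p)" ?xs] by (intro D.comp_cong_right) simp_all
  finally show ?case using Cons.prems by (simp add: D.ten_comp_right D.comp_assoc)
qed simp

lemma f2_ins_arr [simp]:
  assumes "set as \<subseteq> Ob C" "uins C x as \<noteq> []"
  shows "f2_ins C D F x as \<in> Ar D" "src (f2_ins C D F x as) = prodl D (uins D x (map Fo as))"
    "tgt (f2_ins C D F x as) = Fo (prodl C (uins C x as))"
  using assms by (cases as; cases x; simp add: f2_ins_def)+

lemma f2_ins_append:
  assumes "set as \<subseteq> Ob C" "set bs \<subseteq> Ob C" "uins C x as \<noteq> []"
  shows "f2_ins C D F x (as @ bs) = f2_list C D F (prodl C (uins C x as)) bs \<bullet> ltenA D (f2_ins C D F x as) (map Fo bs)"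
  using assms by (cases as; cases x) (simp_all add: f2_ins_def f2_list_append D.comp_assoc D.ltenA_comp)

text \<open>For loose multimaps the coherence of \<open>f\<^sub>0\<close> with \<open>\<rho>\<close> is used as well.\<close>

lemma f2_ins_gather:
  assumes "p \<in> Ob C" "set as \<subseteq> Ob C" "uins C x as \<noteq> []"
  shows "f2 F p (prodl C (uins C x as)) \<bullet> ((Id D (Fo p) \<boxtimes> f2_ins C D F x as) \<bullet> gather D (Fo p) x (map Fo as))
    = Fa (gather C p x as) \<bullet> f2_list C D F p as"
proof (cases x)
  case Tight
  then obtain b bs where "as = b # bs" using assms by (cases as) auto
  then show ?thesis using assms Tight f2_list_lassoc[of p b bs] by (simp add: gather_def f2_ins_def D.comp_assoc)
next
  case Loose
  let ?as = "map Fo as"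
  let ?p = "Id D (Fo p)"
  have "f2 F p (lten C \<I>\<^bsub>C\<^esub> as) \<bullet> ((?p \<boxtimes> f2_ins C D F x as) \<bullet> gather D (Fo p) x ?as)
    = f2 F p (lten C \<I>\<^bsub>C\<^esub> as) \<bullet> ((?p \<boxtimes> f2_list C D F \<I>\<^bsub>C\<^esub> as) \<bullet> ((?p \<boxtimes> ltenA D (f0 F) ?as) \<bullet>
        (lassoc D (Fo p) \<I>\<^bsub>D\<^esub> ?as \<bullet> ltenA D (\<rho>\<^bsub>D\<^esub> (Fo p)) ?as)))"
    using Loose assms by (simp add: gather_def f2_ins_def D.comp_assoc D.ten_comp_right)
  also have "(?p \<boxtimes> ltenA D (f0 F) ?as) \<bullet> (lassoc D (Fo p) \<I>\<^bsub>D\<^esub> ?as \<bullet> ltenA D (\<rho>\<^bsub>D\<^esub> (Fo p)) ?as)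
    = lassoc D (Fo p) (Fo \<I>\<^bsub>C\<^esub>) ?as \<bullet> (ltenA D (?p \<boxtimes> f0 F) ?as \<bullet> ltenA D (\<rho>\<^bsub>D\<^esub> (Fo p)) ?as)"
    using assms D.lassoc_nat[of "f0 F" ?p ?as] by (intro D.comp_cong_right) simp_all
  also have "f2 F p (lten C \<I>\<^bsub>C\<^esub> as) \<bullet> ((?p \<boxtimes> f2_list C D F \<I>\<^bsub>C\<^esub> as) \<bullet> (lassoc D (Fo p) (Fo \<I>\<^bsub>C\<^esub>) ?as \<bullet>
      (ltenA D (?p \<boxtimes> f0 F) ?as \<bullet> ltenA D (\<rho>\<^bsub>D\<^esub> (Fo p)) ?as)))
    = (f2 F p (lten C \<I>\<^bsub>C\<^esub> as) \<bullet> ((?p \<boxtimes> f2_list C D F \<I>\<^bsub>C\<^esub> as) \<bullet> lassoc D (Fo p) (Fo \<I>\<^bsub>C\<^esub>) ?as)) \<bullet>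
      ltenA D ((?p \<boxtimes> f0 F) \<bullet> \<rho>\<^bsub>D\<^esub> (Fo p)) ?as"
    using assms by (simp add: D.comp_assoc D.ltenA_comp)
  also have "\<dots> = Fa (lassoc C p \<I>\<^bsub>C\<^esub> as) \<bullet> (f2_list C D F (p \<odot>\<^bsub>C\<^esub> \<I>\<^bsub>C\<^esub>) as \<bullet>
      ltenA D (f2 F p \<I>\<^bsub>C\<^esub> \<bullet> (?p \<boxtimes> f0 F) \<bullet> \<rho>\<^bsub>D\<^esub> (Fo p)) ?as)"
    using assms by (subst f2_list_lassoc[symmetric]) (simp_all add: D.comp_assoc D.ltenA_comp)
  also have "\<dots> = Fa (lassoc C p \<I>\<^bsub>C\<^esub> as) \<bullet> (Fa (ltenA C (\<rho>\<^bsub>C\<^esub> p) as) \<bullet> f2_list C D F p as)"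
    using assms lax_rho[of p] f2_list_nat[of "\<rho>\<^bsub>C\<^esub> p" as] by simp
  finally show ?thesis using Loose assms by (simp add: gather_def Fa_comp D.comp_assoc)
qed

abbreviation "MF \<equiv> M_map C D F"

lemma M_map_simps [simp]:
  "ty (MF f) = ty f" "ins (MF f) = map Fo (ins f)" "out (MF f) = Fo (out f)"
  by (simp_all add: M_map_def)

lemma uins_map_Nil [simp]: "uins D x (map Fo as) = [] \<longleftrightarrow> uins C x as = []"
  by (simp add: uins_def)

lemma arr_of_M_map:
  assumes "C.ismap f"
  shows "arr_of D (MF f) = Fa (arr_of C f) \<bullet> f2_ins C D F (ty f) (ins f)" "D.ismap (MF f)"
proof -
  have k: "Fa (arr_of C f) \<bullet> f2_ins C D F (ty f) (ins f) \<in> Ar D" using assms by simp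
  show b: "arr_of D (MF f) = Fa (arr_of C f) \<bullet> f2_ins C D F (ty f) (ins f)"
    using assms by (intro arr_eqI) (simp_all, simp add: M_map_def)
  show "D.ismap (MF f)"
    using assms C.ismapD(3)[OF assms] b k by (intro D.ismapI) (auto simp: uins_def)
qed

text \<open>A lax monoidal functor is compatible with plugging, up to comparison maps; this reduces the
  preservation of substitution to naturality of the comparison maps.\<close>

lemma plug_M_map:
  assumes m: "C.ismap f" and L: "set L \<subseteq> Ob C" "L \<noteq> []" "L' \<noteq> []" "prodl D L' = Fo (prodl C L)"
  shows "f2 F (prodl C L) (out f) \<bullet> plug D L' (MF f) = Fa (plug C L f) \<bullet> f2_list C D F (prodl C L) (ins f)"
proof -
  let ?p = "prodl C L" and ?a = "prodl C (uins C (ty f) (ins f))"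
  have p: "?p \<in> Ob C" using L by simp
  have a: "?a \<in> Ob C" using m by simp
  have "f2 F ?p (out f) \<bullet> plug D L' (MF f)
     = f2 F ?p (out f) \<bullet> ((Id D (Fo ?p) \<boxtimes> Fa (arr_of C f)) \<bullet> ((Id D (Fo ?p) \<boxtimes> f2_ins C D F (ty f) (ins f)) \<bullet>
         gather D (Fo ?p) (ty f) (map Fo (ins f))))"
    using m p L arr_of_M_map[OF m] by (simp add: plug_def D.ten_comp_right D.comp_assoc)
  also have "\<dots> = Fa (Id C ?p \<otimes>\<^bsub>C\<^esub> arr_of C f) \<bullet> (f2 F ?p ?a \<bullet> ((Id D (Fo ?p) \<boxtimes> f2_ins C D F (ty f) (ins f)) \<bullet>
         gather D (Fo ?p) (ty f) (map Fo (ins f))))"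
    using m p a f2_nat[of "Id C ?p" "arr_of C f"] by (intro D.comp_cong_right) simp_all
  also have "\<dots> = Fa (Id C ?p \<otimes>\<^bsub>C\<^esub> arr_of C f) \<bullet> (Fa (gather C ?p (ty f) (ins f)) \<bullet> f2_list C D F ?p (ins f))"
    using m p by (simp add: f2_ins_gather)
  finally show ?thesis using m p L by (simp add: plug_def Fa_comp D.comp_assoc)
qed

lemma M_map_sub:
  assumes m: "C.ismap g" "C.ismap f" "fits g i f"
  shows "MF (Sub (M_ob C) g i f) = Sub (M_ob D) (MF g) i (MF f)"
proof -
  obtain ys zs where g: "ins g = ys @ out f # zs" "i = Suc (length ys)"
    using m(3) by (rule fits_split)
  have i': "i = Suc (length (map Fo ys))" using g by simp
  define r where "r = Sub (M_ob C) g i f"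
  note r = C.sub_M[OF m(1,2) g, folded r_def]
  have g': "ins (MF g) = map Fo ys @ out (MF f) # map Fo zs" using g by simp
  note R = D.sub_M[OF arr_of_M_map(2)[OF m(1)] arr_of_M_map(2)[OF m(2)] g' i']
  have o: "set ys \<subseteq> Ob C" "set zs \<subseteq> Ob C" "out f \<in> Ob C" using C.ismapD(1)[OF m(1)] g by auto
  let ?H = "uins C (ty g) ys" and ?H' = "uins D (ty g) (map Fo ys)"
  let ?A = "plug C ?H f" and ?A' = "plug D ?H' (MF f)"
  have Hob: "set ?H \<subseteq> Ob C" "set ?H' \<subseteq> Ob D" using o by simp_all
  have sg: "src (arr_of C g) = lten C (tgt ?A) zs"
    using m Hob g uins_append[of C "ty g" ys "out f # zs"] by (cases "?H = []") simp_all
  have A: "?A \<in> Ar C" "?A' \<in> Ar D" using m Hob arr_of_M_map by simp_all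
  have key: "Fa (ltenA C ?A zs) \<bullet> f2_ins C D F (ty r) (ins r) = f2_ins C D F (ty g) (ins g) \<bullet> ltenA D ?A' (map Fo zs)"
  proof (cases "?H = []")
    case True
    then have t: "ty g = Tight" "ys = []" by (auto simp: uins_Nil_iff)
    let ?a = "prodl C (uins C (ty f) (ins f))"
    have a: "?a \<in> Ob C" using m by simp
    have "Fa (ltenA C ?A zs) \<bullet> f2_ins C D F (ty r) (ins r)
      = (Fa (ltenA C (arr_of C f) zs) \<bullet> f2_list C D F (src (arr_of C f)) zs) \<bullet> ltenA D (f2_ins C D F (ty f) (ins f)) (map Fo zs)"
      using m o r t a by (simp add: plug_def f2_ins_append D.comp_assoc del: M_ob_simps)
    also have "\<dots> = f2_list C D F (out f) zs \<bullet> ltenA D (arr_of D (MF f)) (map Fo zs)"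
      using m o a f2_list_nat[of "arr_of C f" zs] arr_of_M_map[OF m(2)] by (simp add: D.ltenA_comp D.comp_assoc)
    finally show ?thesis using t g by (simp add: plug_def f2_ins_def)
  next
    case False
    let ?p = "prodl C ?H" and ?fs = "map Fo (ins f)"
    let ?K = "f2_ins C D F (ty g) ys"
    have p: "?p \<in> Ob C" using False Hob by (intro C.prodl_ob)
    have K: "?K \<in> Ar D" "src ?K = prodl D ?H'" "tgt ?K = Fo ?p" using False o by simp_all
    have tA: "tgt ?A = ?p \<odot>\<^bsub>C\<^esub> out f" "src ?A = lten C ?p (ins f)"
      "tgt ?A' = prodl D ?H' \<odot>\<^bsub>D\<^esub> Fo (out f)" "src ?A' = lten D (prodl D ?H') ?fs"
      using m False Hob arr_of_M_map by simp_all
    have "Fa (ltenA C ?A zs) \<bullet> f2_ins C D F (ty r) (ins r)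
      = (Fa (ltenA C ?A zs) \<bullet> f2_list C D F (src ?A) zs) \<bullet>
          ltenA D (f2_list C D F ?p (ins f) \<bullet> ltenA D ?K ?fs) (map Fo zs)"
      using m o r False p K A tA
      by (simp add: f2_ins_append f2_list_append D.ltenA_comp D.comp_assoc del: M_ob_simps C.plug_arr D.plug_arr f2_ins_arr(2))
    also have "\<dots> = f2_list C D F (tgt ?A) zs \<bullet> ltenA D (Fa ?A \<bullet> f2_list C D F ?p (ins f) \<bullet> ltenA D ?K ?fs) (map Fo zs)"
      unfolding f2_list_nat[OF A(1) o(2)] using m o p K A tA
      by (simp add: D.ltenA_comp D.comp_assoc del: C.plug_arr D.plug_arr f2_ins_arr(2))
    also have "Fa ?A \<bullet> f2_list C D F ?p (ins f) \<bullet> ltenA D ?K ?fs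
        = f2 F ?p (out f) \<bullet> (plug D [Fo ?p] (MF f) \<bullet> ltenA D ?K ?fs)"
      using plug_M_map[OF m(2) Hob(1) False, of "[Fo ?p]", symmetric] m p K arr_of_M_map[OF m(2)]
      by (simp add: D.comp_assoc)
    also have "plug D [Fo ?p] (MF f) \<bullet> ltenA D ?K ?fs = (?K \<boxtimes> Id D (Fo (out f))) \<bullet> ?A'"
      using D.plug_nat[of ?K "MF f" ?H' "[Fo ?p]"] K arr_of_M_map[OF m(2)] False by simp
    finally show ?thesis
      using m o g p K A tA False
      by (simp add: f2_ins_append D.ltenA_comp D.comp_assoc del: C.plug_arr D.plug_arr f2_ins_arr(2))
  qed
  have r3: "tgt (ltenA C ?A zs) = src (arr_of C g)" using A o sg by simp
  have "arr_of D (MF r) = Fa (arr_of C g) \<bullet> (Fa (ltenA C ?A zs) \<bullet> f2_ins C D F (ty r) (ins r))"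
  proof -
    have s: "src (ltenA C ?A zs) = prodl C (uins C (ty r) (ins r))"
      using arg_cong[OF r(5), of src] m A o r3 by (simp del: C.ltenA_arr(2,3) C.plug_arr)
    show ?thesis
      unfolding arr_of_M_map(1)[OF r(1)] r(5)
      using m A o r3 s C.ismapD(1,3)[OF r(1)]
      by (simp add: Fa_comp D.comp_assoc del: C.ltenA_arr(2,3) C.plug_arr arr_of_simps(1))
  qed
  also have "\<dots> = arr_of D (Sub (M_ob D) (MF g) i (MF f))"
    unfolding key R(5) arr_of_M_map(1)[OF m(1)]
  proof -
    have "src (f2_ins C D F (ty g) (ins g)) = lten D (tgt ?A') (map Fo zs)"
    proof -
      have "src (f2_ins C D F (ty g) (ins g)) = prodl D (uins D (ty g) (map Fo (ins g)))" using m by simp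
      also have "\<dots> = prodl D (?H' @ Fo (out f) # map Fo zs)" using g by (simp add: uins_append)
      also have "\<dots> = lten D (prodl D (?H' @ [Fo (out f)])) (map Fo zs)" by (rule prodl_snoc)
      finally show ?thesis using Hob arr_of_M_map(2)[OF m(2)] by simp
    qed
    then show "Fa (arr_of C g) \<bullet> (f2_ins C D F (ty g) (ins g) \<bullet> ltenA D ?A' (map Fo zs))
        = Fa (arr_of C g) \<bullet> f2_ins C D F (ty g) (ins g) \<bullet> ltenA D (plug D (uins D (ty (MF g)) (map Fo ys)) (MF f)) (map Fo zs)"
      using m A o by (simp add: D.comp_assoc del: f2_ins_arr(2) D.plug_arr)
  qed
  finally have b: "arr_of D (MF r) = arr_of D (Sub (M_ob D) (MF g) i (MF f))" .
  show ?thesis unfolding r_def[symmetric]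
    using b r(2-4) R(2-4) by (intro mmap_eqI[where C = D]) (simp_all del: M_ob_simps)
qed

text \<open>By the coherence of \<open>f\<^sub>0\<close> with \<open>\<lambda>\<close>.\<close>

lemma M_map_jay:
  assumes m: "C.ismap f" "ty f = Tight"
  shows "MF (Jay (M_ob C) f) = Jay (M_ob D) (MF f)"
proof -
  obtain a as where as: "ins f = a # as" using assms C.ismapD(3)[OF assms(1)] by (cases "ins f") auto
  have o: "a \<in> Ob C" "set as \<subseteq> Ob C" using C.ismapD(1)[OF assms(1)] as by auto
  note j = C.jay_M[OF m] and j' = D.jay_M[OF arr_of_M_map(2)[OF m(1)]]
  let ?L = "\<lambda>\<lambda>\<^bsub>C\<^esub> a" and ?I = "Id D (Fo a)"
  have "arr_of D (MF (Jay (M_ob C) f)) = Fa (arr_of C f) \<bullet> ((Fa (ltenA C ?L as) \<bullet> f2_list C D F (src ?L) as) \<bullet>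
      ltenA D (f2 F \<I>\<^bsub>C\<^esub> a \<bullet> (f0 F \<boxtimes> ?I)) (map Fo as))"
    unfolding arr_of_M_map(1)[OF j(2)] j(1) using m as o
    by (simp add: f2_ins_def Fa_comp D.comp_assoc D.ltenA_comp)
  also have "\<dots> = Fa (arr_of C f) \<bullet> (f2_list C D F a as \<bullet>
      ltenA D (Fa ?L \<bullet> f2 F \<I>\<^bsub>C\<^esub> a \<bullet> (f0 F \<boxtimes> ?I)) (map Fo as))"
    using m as o f2_list_nat[of ?L as] by (simp add: D.comp_assoc D.ltenA_comp)
  also have "\<dots> = arr_of D (Jay (M_ob D) (MF f))"
    using m as o lax_lam[of a] j'(1) arr_of_M_map(1)[OF m(1)] by (simp add: f2_ins_def D.comp_assoc)
  finally show ?thesis by (intro mmap_eqI[where C = D]) simp_all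
qed

lemma M_map_idm: "a \<in> Ob C \<Longrightarrow> MF (Idm (M_ob C) a) = Idm (M_ob D) (Fo a)"
  using arr_of_M_map(1)[OF C.idm_M(2)[of a]]
  by (intro mmap_eqI[where C = D]) (simp_all add: C.idm_M D.idm_M f2_ins_def)

theorem M_multifunctor: "multifunctor (M_ob C) (M_ob D) (M_mor C D F)"
proof -
  interpret CM: skew_multicategory "M_ob C" by (rule C.M_skew_multicategory)
  have "C.ismap (Sub (M_ob C) g i f)" if "C.ismap g" "C.ismap f" "fits g i f" for g i f
    using CM.sub[OF that] by (simp add: maps_def)
  then show ?thesis
    using ext(1) arr_of_M_map(2) C.jay_M(2) C.idm_M(2)
    by (auto simp: multifunctor_def multi_graph_map_def M_mor_def maps_def M_map_idm M_map_jay M_map_sub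
        PiE_def)
qed

end

lemma lax_iff: "lax C D F \<longleftrightarrow> lax_monoidal C D F"
  by (auto simp: lax_def skew_mon_iff lax_monoidal_def)


lemma f2_list_id:
  assumes "skew_monoidal C" "a \<in> Ob C" "set xs \<subseteq> Ob C"
  shows "f2_list C C (id_lax C) a xs = Id C (lten C a xs)"
proof -
  interpret skew_mon C using assms by (simp add: skew_mon_iff)
  have "map (fob (id_lax C)) xs = xs" if "set xs \<subseteq> Ob C" for xs
    using that by (intro map_idI) (auto simp: id_lax_def)
  then show ?thesis using assms(2,3)
    by (induction xs arbitrary: a) (auto simp: id_lax_def)
qed

lemma M_mor_id:
  assumes "skew_monoidal C"
  shows "M_mor C C (id_lax C) = id_multif (M_ob C)"
proof -
  interpret skew_mon C using assms by (simp add: skew_mon_iff)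
  have m: "map (fob (id_lax C)) xs = xs" if "set xs \<subseteq> Ob C" for xs
    using that by (intro map_idI) (auto simp: id_lax_def)
  have "M_map C C (id_lax C) f = f" if f: "ismap f" for f
  proof -
    have G: "f2_ins C C (id_lax C) (ty f) (ins f) = Id C (src (arr_of C f))"
    proof (cases "ty f")
      case Tight
      then show ?thesis using ismapD(1,3)[OF f] assms by (cases "ins f") (auto simp: f2_ins_def f2_list_id)
    next
      case Loose
      then show ?thesis using ismapD(1)[OF f] assms m[of "ins f"]
        by (simp add: f2_ins_def f2_list_id) (simp add: id_lax_def)
    qed
    have "M_map C C (id_lax C) f = MMap (ty f) (ins f) (out f) (mlab f)"
      unfolding M_map_def G using m[of "ins f"] f by (auto simp: id_lax_def simp del: arr_of_simps(1))
    then show ?thesis by simp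
  qed
  then show ?thesis
    by (auto simp: M_mor_def id_multif_def id_lax_def fun_eq_iff restrict_def)
qed

lemma M_mor_comp:
  assumes F: "lax_monoidal C D F" and G: "lax_monoidal D E G"
  shows "M_mor C E (comp_lax C E G F) = comp_multif (M_ob C) (M_mor D E G) (M_mor C D F)"
proof -
  interpret F: lax C D F using F by (simp add: lax_iff)
  interpret G: lax D E G using G by (simp add: lax_iff)
  define H where "H = comp_lax C E G F"
  have ob: "fob H a = fob G (fob F a)" if "a \<in> Ob C" for a
    using that by (simp add: H_def comp_lax_def compose_def)
  have far: "far H f = far G (far F f)" if "f \<in> Ar C" for f
    using that by (simp add: H_def comp_lax_def compose_def)
  have f0: "f0 H = far G (f0 F) \<cdot>\<^bsub>E\<^esub> f0 G" by (simp add: H_def comp_lax_def)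
  have f2: "f2 H a b = far G (f2 F a b) \<cdot>\<^bsub>E\<^esub> f2 G (fob F a) (fob F b)" if "a \<in> Ob C" "b \<in> Ob C" for a b
    using that by (simp add: H_def comp_lax_def)
  have mp: "map (fob H) xs = map (fob G) (map (fob F) xs)" if "set xs \<subseteq> Ob C" for xs
    using that ob by auto
  have f2_list: "f2_list C E H a xs = far G (f2_list C D F a xs) \<cdot>\<^bsub>E\<^esub> f2_list D E G (fob F a) (map (fob F) xs)"
    if "a \<in> Ob C" "set xs \<subseteq> Ob C" for a xs
    using that
  proof (induction xs arbitrary: a)
    case Nil
    then show ?case by (simp add: ob)
  next
    case (Cons x xs)
    let ?xs = "map (fob F) xs"
    have "f2_list C E H a (x # xs) = far G (f2_list C D F (a \<odot>\<^bsub>C\<^esub> x) xs) \<cdot>\<^bsub>E\<^esub>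
        (f2_list D E G (tgt (f2 F a x)) ?xs \<cdot>\<^bsub>E\<^esub> ltenA E (far G (f2 F a x)) (map (fob G) ?xs)) \<cdot>\<^bsub>E\<^esub>
        ltenA E (f2 G (fob F a) (fob F x)) (map (fob G) ?xs)"
      using Cons.prems by (simp add: Cons.IH f2 mp G.D.ltenA_comp G.D.comp_assoc del: map_map)
    also have "\<dots> = far G (f2_list C D F (a \<odot>\<^bsub>C\<^esub> x) xs) \<cdot>\<^bsub>E\<^esub>
        (far G (ltenA D (f2 F a x) ?xs) \<cdot>\<^bsub>E\<^esub> f2_list D E G (src (f2 F a x)) ?xs) \<cdot>\<^bsub>E\<^esub>
        ltenA E (f2 G (fob F a) (fob F x)) (map (fob G) ?xs)"
      using Cons.prems by (subst G.f2_list_nat) simp_all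
    finally show ?case using Cons.prems by (simp add: G.Fa_comp G.D.comp_assoc del: map_map)
  qed
  have "M_map C E H f = M_map D E G (M_map C D F f)" if f: "F.C.ismap f" for f
  proof -
    let ?as = "ins f"
    have f2_ins: "f2_ins C E H (ty f) ?as = far G (f2_ins C D F (ty f) ?as) \<cdot>\<^bsub>E\<^esub> f2_ins D E G (ty f) (map (fob F) ?as)"
    proof (cases "ty f")
      case Tight
      then show ?thesis using F.C.ismapD(1,3)[OF f] by (cases "ins f") (auto simp: f2_ins_def f2_list)
    next
      case Loose
      have "f2_ins C E H (ty f) ?as = far G (f2_list C D F \<I>\<^bsub>C\<^esub> ?as) \<cdot>\<^bsub>E\<^esub>
          (f2_list D E G (tgt (f0 F)) (map (fob F) ?as) \<cdot>\<^bsub>E\<^esub> ltenA E (far G (f0 F)) (map (fob G) (map (fob F) ?as))) \<cdot>\<^bsub>E\<^esub>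
          ltenA E (f0 G) (map (fob G) (map (fob F) ?as))"
        using f Loose by (simp add: f2_ins_def f2_list f0 mp G.D.ltenA_comp G.D.comp_assoc del: map_map)
      also have "\<dots> = far G (f2_list C D F \<I>\<^bsub>C\<^esub> ?as) \<cdot>\<^bsub>E\<^esub>
          (far G (ltenA D (f0 F) (map (fob F) ?as)) \<cdot>\<^bsub>E\<^esub> f2_list D E G (src (f0 F)) (map (fob F) ?as)) \<cdot>\<^bsub>E\<^esub>
          ltenA E (f0 G) (map (fob G) (map (fob F) ?as))"
        using f by (subst G.f2_list_nat) simp_all
      finally show ?thesis using f Loose by (simp add: f2_ins_def G.Fa_comp G.D.comp_assoc del: map_map)
    qed
    let ?r = "M_map D E G (M_map C D F f)"
    have "arr_of E ?r = far G (far F (arr_of C f) \<cdot>\<^bsub>D\<^esub> f2_ins C D F (ty f) ?as) \<cdot>\<^bsub>E\<^esub> f2_ins D E G (ty f) (map (fob F) ?as)"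
      using G.arr_of_M_map(1)[OF F.arr_of_M_map(2)[OF f]] F.arr_of_M_map(1)[OF f] by simp
    also have "\<dots> = far H (arr_of C f) \<cdot>\<^bsub>E\<^esub> f2_ins C E H (ty f) ?as"
      unfolding f2_ins using f F.C.ismapD(1,3)[OF f]
      by (simp add: G.Fa_comp G.D.comp_assoc far)
    finally have "mlab ?r = lab (far H (arr_of C f) \<cdot>\<^bsub>E\<^esub> f2_ins C E H (ty f) ?as)"
      by (metis arr_of_simps(3))
    then show ?thesis
      using f mp[of ?as] ob[of "out f"] by (intro mmap.expand) (simp add: M_map_def[of C E] del: map_map)
  qed
  then show ?thesis
    using F.arr_of_M_map(2)
    by (auto simp: M_mor_def comp_multif_def H_def comp_lax_def fun_eq_iff restrict_def compose_def)
qed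

section \<open>Left representable multicategories, short or not\<close>

text \<open>The flag \<open>s\<close> distinguishes short multicategories (true) from multicategories without bounds on the
  arities (false); \<open>op_ok s\<close> and \<open>arity_ok s\<close> are the bounds on substitutions and on multimaps.\<close>

definition op_ok :: "bool \<Rightarrow> tightness \<Rightarrow> nat \<Rightarrow> tightness \<Rightarrow> nat \<Rightarrow> bool" where
  "op_ok s x n y m \<longleftrightarrow> (s \<longrightarrow> short_op x n y m)"

definition arity_ok :: "bool \<Rightarrow> tightness \<Rightarrow> nat \<Rightarrow> bool" where
  "arity_ok s x n \<longleftrightarrow> (s \<longrightarrow> short_arity x n)"

text \<open>The list of substitutions of a short skew multicategory, together with the actions of tight unary
  maps, amounts to linear inequalities between the arities.\<close>

lemma op_ok_simps [simp]:
  "\<lbrakk>1 \<le> n; 1 \<le> m\<rbrakk> \<Longrightarrow> op_ok s Tight n Tight m \<longleftrightarrow> (s \<longrightarrow> n + m \<le> 5)"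
  "1 \<le> n \<Longrightarrow> op_ok s Tight n Loose m \<longleftrightarrow> (s \<longrightarrow> n + m \<le> 3)"
  "\<lbrakk>1 \<le> n; 1 \<le> m\<rbrakk> \<Longrightarrow> op_ok s Loose n Tight m \<longleftrightarrow> (s \<longrightarrow> n + m \<le> 3)"
  "1 \<le> n \<Longrightarrow> op_ok s Loose n Loose m \<longleftrightarrow> (s \<longrightarrow> n = 1 \<and> m = 0)"
  unfolding op_ok_def short_op_def short_sub_def short_arity_def by auto

lemma arity_ok_simps [simp]:
  "1 \<le> n \<Longrightarrow> arity_ok s Tight n \<longleftrightarrow> (s \<longrightarrow> n \<le> 4)" "arity_ok s Loose n \<longleftrightarrow> (s \<longrightarrow> n \<le> 2)"
  unfolding arity_ok_def short_arity_def by auto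

lemma sub_type_simps [simp]:
  "sub_type Tight (Suc 0) y = y" "sub_type Loose i y = Loose"
  "i \<noteq> Suc 0 \<Longrightarrow> sub_type Tight i y = Tight"
  by (cases y; simp add: sub_type_def)+

text \<open>The common part of the axioms of skew multicategories and of short ones.  Associativity is
  restricted to a tight middle map, commutation to a pair of positions one of which is the first, and
  the compatibility of \<open>j\<close> to identities, since \<open>j f\<close> is obtained from \<open>f\<close> by substituting \<open>j 1\<close>; in this
  form the axioms hold in the short case for all arities within the bounds.\<close>

locale bounded_multi =
  fixes s :: bool and C :: "('o, 'm) multi" (structure)
  assumes map_wf: "f \<in> Maps C \<Longrightarrow> set (ins f) \<subseteq> Obj C \<and> out f \<in> Obj C \<and>
        (ty f = Tight \<longrightarrow> 1 \<le> arity f) \<and> arity_ok s (ty f) (arity f)"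
    and idm: "a \<in> Obj C \<Longrightarrow> Idm C a \<in> maps C Tight [a] a"
    and jay: "\<lbrakk>f \<in> Maps C; ty f = Tight; arity_ok s Loose (arity f)\<rbrakk> \<Longrightarrow> \<j> f \<in> maps C Loose (ins f) (out f)"
    and sub: "\<lbrakk>g \<in> Maps C; f \<in> Maps C; fits g i f; op_ok s (ty g) (arity g) (ty f) (arity f)\<rbrakk>
      \<Longrightarrow> g \<star>[i] f \<in> maps C (sub_type (ty g) i (ty f)) (sub_ins g i f) (out g)"
    and id_sub: "f \<in> Maps C \<Longrightarrow> Idm C (out f) \<star>[1] f = f"
    and sub_id: "\<lbrakk>f \<in> Maps C; 1 \<le> i; i \<le> arity f\<rbrakk> \<Longrightarrow> f \<star>[i] Idm C (ins f ! (i - 1)) = f"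
    and sub_assoc: "\<lbrakk>h \<in> Maps C; g \<in> Maps C; f \<in> Maps C; ty g = Tight; fits h i g; fits g j f;
        op_ok s (ty h) (arity h) (ty g) (arity g); op_ok s (ty g) (arity g) (ty f) (arity f);
        op_ok s (ty h) (arity h) (sub_type (ty g) j (ty f)) (arity g + arity f - 1);
        op_ok s (sub_type (ty h) i (ty g)) (arity h + arity g - 1) (ty f) (arity f)\<rbrakk>
      \<Longrightarrow> h \<star>[i] (g \<star>[j] f) = (h \<star>[i] g) \<star>[j + i - 1] f"
    and sub_commute: "\<lbrakk>h \<in> Maps C; g \<in> Maps C; f \<in> Maps C; fits h 1 g; fits h k f; 1 < k;
        op_ok s (ty h) (arity h) (ty g) (arity g); op_ok s (ty h) (arity h) (ty f) (arity f);
        op_ok s (sub_type (ty h) 1 (ty g)) (arity h + arity g - 1) (ty f) (arity f);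
        op_ok s (sub_type (ty h) k (ty f)) (arity h + arity f - 1) (ty g) (arity g)\<rbrakk>
      \<Longrightarrow> (h \<star>[1] g) \<star>[k + arity g - 1] f = (h \<star>[k] f) \<star>[1] g"
    and jay_id_tight: "\<lbrakk>f \<in> Maps C; ty f = Tight; arity_ok s Loose (arity f)\<rbrakk>
      \<Longrightarrow> \<j> (Idm C (out f)) \<star>[1] f = \<j> f"
    and jay_id_null: "\<lbrakk>f \<in> Maps C; ty f = Loose; arity f = 0\<rbrakk> \<Longrightarrow> \<j> (Idm C (out f)) \<star>[1] f = f"
    and sub_jay_id_2: "\<lbrakk>f \<in> Maps C; ty f = Tight; arity f = 2\<rbrakk> \<Longrightarrow> f \<star>[2] \<j> (Idm C (ins f ! 1)) = f"
    and sub_jay_id_1: "\<lbrakk>f \<in> Maps C; ty f = Tight; arity_ok s Loose (arity f)\<rbrakk>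
      \<Longrightarrow> f \<star>[1] \<j> (Idm C (ins f ! 0)) = \<j> f"
begin

lemma mapsD:
  "f \<in> maps C x as b \<Longrightarrow> f \<in> Maps C \<and> ty f = x \<and> ins f = as \<and> out f = b \<and> arity f = length as \<and>
    set as \<subseteq> Obj C \<and> b \<in> Obj C \<and> (x = Tight \<longrightarrow> 1 \<le> length as) \<and> arity_ok s x (length as)"
  using map_wf[of f] by (auto simp: maps_def arity_def)

lemma sub_in:
  assumes "g \<in> maps C x as c" "f \<in> maps C y bs b" "1 \<le> i" "i \<le> length as" "as ! (i - 1) = b"
    "op_ok s x (length as) y (length bs)" "z = sub_type x i y" "cs = take (i - 1) as @ bs @ drop i as"
  shows "g \<star>[i] f \<in> maps C z cs c"
  using sub[of g f i] mapsD[OF assms(1)] mapsD[OF assms(2)] assms(3-)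
  by (auto simp: fits_def sub_ins_def)

lemma assocT:
  assumes "h \<in> maps C x as d" "g \<in> maps C Tight bs c" "f \<in> maps C y cs b"
    and "1 \<le> i" "i \<le> length as" "as ! (i - 1) = c" "1 \<le> j" "j \<le> length bs" "bs ! (j - 1) = b" "k = j + i - 1"
    and "op_ok s x (length as) Tight (length bs)" "op_ok s Tight (length bs) y (length cs)"
    and "op_ok s x (length as) (sub_type Tight j y) (length bs + length cs - 1)"
    and "op_ok s (sub_type x i Tight) (length as + length bs - 1) y (length cs)"
  shows "h \<star>[i] (g \<star>[j] f) = (h \<star>[i] g) \<star>[k] f"
  using sub_assoc[of h g f i j] mapsD[OF assms(1)] mapsD[OF assms(2)] mapsD[OF assms(3)] assms(4-)
  by (auto simp: fits_def)

lemma commT: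
  assumes "h \<in> maps C x (a # as) d" "g \<in> maps C y bs a" "f \<in> maps C z cs c"
    and "1 < k" "k \<le> Suc (length as)" "as ! (k - 2) = c" "k' = k + length bs - 1"
    and "op_ok s x (Suc (length as)) y (length bs)" "op_ok s x (Suc (length as)) z (length cs)"
    and "op_ok s (sub_type x 1 y) (length as + length bs) z (length cs)"
    and "op_ok s (sub_type x k z) (length as + length cs) y (length bs)"
  shows "(h \<star>[1] g) \<star>[k'] f = (h \<star>[k] f) \<star>[1] g"
proof -
  have "(a # as) ! (k - 1) = c" using assms(4,6) by (cases k) (auto simp: nth_Cons')
  then show ?thesis
    using sub_commute[of h g f k] mapsD[OF assms(1)] mapsD[OF assms(2)] mapsD[OF assms(3)] assms(4-)
    by (auto simp: fits_def)
qed

lemma id_subT: "f \<in> maps C x as b \<Longrightarrow> Idm C b \<star>[1] f = f"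
  using id_sub[of f] mapsD by fastforce

lemma sub_idT:
  assumes "f \<in> maps C x as b" "1 \<le> i" "i \<le> length as" "as ! (i - 1) = a"
  shows "f \<star>[i] Idm C a = f"
  using sub_id[of f i] mapsD[OF assms(1)] assms(2-) by auto

end

text \<open>The locale assumes chosen representing data for binary tight and nullary loose multimaps, universal
  for all arities within the bounds.\<close>

locale represented = bounded_multi s C for s and C :: "('o, 'm) multi" (structure) +
  fixes R :: "('o, 'm) lr_data"
  assumes prd_ob [simp]: "\<lbrakk>a \<in> Obj C; b \<in> Obj C\<rbrakk> \<Longrightarrow> prd R a b \<in> Obj C"
    and theta_in: "\<lbrakk>a \<in> Obj C; b \<in> Obj C\<rbrakk> \<Longrightarrow> theta R a b \<in> maps C Tight [a, b] (prd R a b)"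
    and theta_bij: "\<lbrakk>a \<in> Obj C; b \<in> Obj C; set xs \<subseteq> Obj C; d \<in> Obj C; arity_ok s Tight (Suc (Suc (length xs)))\<rbrakk>
      \<Longrightarrow> bij_betw (\<lambda>f. f \<star>[1] theta R a b) (maps C Tight (prd R a b # xs) d) (maps C Tight (a # b # xs) d)"
    and uob_ob [simp]: "uob R \<in> Obj C"
    and umap_in: "umap R \<in> maps C Loose [] (uob R)"
    and umap_bij: "\<lbrakk>set xs \<subseteq> Obj C; d \<in> Obj C; arity_ok s Loose (length xs)\<rbrakk>
      \<Longrightarrow> bij_betw (\<lambda>f. f \<star>[1] umap R) (maps C Tight (uob R # xs) d) (maps C Loose xs d)"

lemma to_mmap_simps [simp]:
  "ty (to_mmap f) = Tight" "ins (to_mmap f) = [src f]" "out (to_mmap f) = tgt f" "mlab (to_mmap f) = lab f"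
  by (simp_all add: to_mmap_def)

lemma to_mmap_inj [simp]: "to_mmap f = to_mmap g \<longleftrightarrow> f = g"
  by (auto simp: to_mmap_def intro: arr.expand)

lemma to_mmap_to_arr: "ty p = Tight \<Longrightarrow> ins p = [a] \<Longrightarrow> to_mmap (to_arr p) = p"
  by (simp add: to_mmap_def to_arr_def mmap.expand)

text \<open>The skew monoidal category \<open>K\<close> determined by the representing data.  It is characterised by the
  defining equations of its structure maps and not constructed by definite descriptions, so that the
  locale applies to \<open>Ks_ob\<close> and, with identities as universal maps, to the original skew monoidal
  category of \<open>M_ob\<close>.  Arrows of \<open>K\<close> are turned into tight unary multimaps by \<open>to_mmap\<close>, written \<open>T\<close>.\<close>

locale rep_skewmon = represented s C R for s and C :: "('o, 'm) multi" (structure) and R +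
  fixes K :: "('o, 'm) skewmon"
  assumes K_Ob: "Ob K = Obj C"
    and K_Ar: "f \<in> Ar K \<longleftrightarrow> to_mmap f \<in> Maps C"
    and K_Id: "a \<in> Obj C \<Longrightarrow> to_mmap (Id K a) = Idm C a"
    and K_Comp: "\<lbrakk>g \<in> Ar K; f \<in> Ar K; tgt f = src g\<rbrakk> \<Longrightarrow> to_mmap (g \<cdot>\<^bsub>K\<^esub> f) = to_mmap g \<star>[1] to_mmap f"
    and K_Ten: "Ten K = prd R"
    and K_Unit: "Unit K = uob R"
    and K_TenA: "\<lbrakk>f \<in> Ar K; g \<in> Ar K\<rbrakk>
      \<Longrightarrow> f \<otimes>\<^bsub>K\<^esub> g \<in> hom K (prd R (src f) (src g)) (prd R (tgt f) (tgt g)) \<and>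
        to_mmap (f \<otimes>\<^bsub>K\<^esub> g) \<star>[1] theta R (src f) (src g)
          = (theta R (tgt f) (tgt g) \<star>[1] to_mmap f) \<star>[2] to_mmap g"
    and K_Alpha: "\<lbrakk>a \<in> Obj C; b \<in> Obj C; c \<in> Obj C\<rbrakk>
      \<Longrightarrow> \<alpha>\<^bsub>K\<^esub> a b c \<in> hom K (prd R (prd R a b) c) (prd R a (prd R b c)) \<and>
        (to_mmap (\<alpha>\<^bsub>K\<^esub> a b c) \<star>[1] theta R (prd R a b) c) \<star>[1] theta R a b
          = theta R a (prd R b c) \<star>[2] theta R b c"
    and K_Lam: "a \<in> Obj C
      \<Longrightarrow> \<lambda>\<lambda>\<^bsub>K\<^esub> a \<in> hom K (prd R (uob R) a) a \<and>
        (to_mmap (\<lambda>\<lambda>\<^bsub>K\<^esub> a) \<star>[1] theta R (uob R) a) \<star>[1] umap R = \<j> (Idm C a)"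
    and K_Rho: "a \<in> Obj C \<Longrightarrow> to_mmap (\<rho>\<^bsub>K\<^esub> a) = theta R a (uob R) \<star>[2] umap R"
begin

abbreviation comp (infixl "\<bullet>" 65) where "g \<bullet> f \<equiv> g \<cdot>\<^bsub>K\<^esub> f"
abbreviation tenA (infixl "\<boxtimes>" 75) where "g \<boxtimes> f \<equiv> g \<otimes>\<^bsub>K\<^esub> f"
abbreviation ten (infixl "\<boxplus>" 75) where "a \<boxplus> b \<equiv> prd R a b"
abbreviation "T \<equiv> to_mmap"
abbreviation "\<theta> \<equiv> theta R"
abbreviation "u \<equiv> umap R"
abbreviation "\<iota> \<equiv> uob R"

lemma T_in: "f \<in> Ar K \<Longrightarrow> T f \<in> maps C Tight [src f] (tgt f)"
  by (simp add: K_Ar maps_def)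

lemma T_hom: "f \<in> hom K a b \<Longrightarrow> T f \<in> maps C Tight [a] b"
  using T_in[of f] by (auto simp: hom_iff)

lemma T_surj:
  assumes "p \<in> maps C Tight [a] b"
  obtains f where "f \<in> hom K a b" "T f = p"
proof
  show "T (to_arr p) = p" using assms by (auto simp: maps_def to_mmap_to_arr)
  then show "to_arr p \<in> hom K a b" using assms by (auto simp: hom_iff K_Ar maps_def to_arr_def)
qed

lemma arr_eqT: "T f = T g \<Longrightarrow> f = g"
  by simp

lemma hom_T: "T f \<in> maps C Tight [a] b \<Longrightarrow> f \<in> hom K a b"
  by (auto simp: hom_iff K_Ar maps_def)

lemma ob_arr [simp]: "f \<in> Ar K \<Longrightarrow> src f \<in> Obj C" "f \<in> Ar K \<Longrightarrow> tgt f \<in> Obj C"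
  using mapsD[OF T_in[of f]] by auto

lemma id_hom: "a \<in> Obj C \<Longrightarrow> Id K a \<in> hom K a a"
  using hom_T[of "Id K a" a a] by (simp add: K_Id idm)

lemma comp_hom: "\<lbrakk>g \<in> Ar K; f \<in> Ar K; tgt f = src g\<rbrakk> \<Longrightarrow> g \<bullet> f \<in> hom K (src f) (tgt g)"
  by (rule hom_T) (auto simp: K_Comp intro!: sub_in[OF T_in T_in])

lemma post_in [simp]: "q \<in> Ar K \<Longrightarrow> g \<in> maps C x as (src q) \<Longrightarrow> T q \<star>[1] g \<in> maps C x as (tgt q)"
  using mapsD[of g] by (intro sub_in[OF T_in]) (auto simp: op_ok_def short_op_def arity_ok_def sub_type_def, cases x, auto)

lemma post_assoc:
  assumes "q \<in> Ar K" "p \<in> Ar K" "tgt p = src q" "g \<in> maps C x as c" "src p = c"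
  shows "T (q \<bullet> p) \<star>[1] g = T q \<star>[1] (T p \<star>[1] g)"
proof -
  have "arity_ok s x (length as)" "x = Tight \<longrightarrow> 1 \<le> length as" using mapsD[OF assms(4)] by auto
  then have "op_ok s Tight 1 x (length as)" by (auto simp: op_ok_def short_op_def arity_ok_def)
  then show ?thesis
    using assms by (simp add: K_Comp assocT[OF T_in T_in assms(4)])
qed

lemma T_in': "\<lbrakk>f \<in> Ar K; src f = a; tgt f = b\<rbrakk> \<Longrightarrow> T f \<in> maps C Tight [a] b"
  using T_in by blast

lemma post_sub:
  assumes "q \<in> Ar K" "g \<in> maps C Tight bs c" "f \<in> maps C y cs b" "src q = c"
    and "1 \<le> j" "j \<le> length bs" "bs ! (j - 1) = b" "op_ok s Tight (length bs) y (length cs)"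
  shows "(T q \<star>[1] g) \<star>[j] f = T q \<star>[1] (g \<star>[j] f)"
proof -
  have "g \<star>[j] f \<in> maps C (sub_type Tight j y) (take (j - 1) bs @ cs @ drop j bs) c"
    using assms by (intro sub_in) auto
  moreover have "length (take (j - 1) bs @ cs @ drop j bs) = length bs + length cs - 1"
    using assms(5,6) by simp
  ultimately have "arity_ok s (sub_type Tight j y) (length bs + length cs - 1)" using mapsD by metis
  then have "op_ok s Tight 1 (sub_type Tight j y) (length bs + length cs - 1)"
    by (auto simp: op_ok_def short_op_def arity_ok_def)
  moreover have "op_ok s Tight 1 Tight (length bs)" using mapsD[OF assms(2)] by auto
  ultimately show ?thesis
    using assms(4-) by (intro assocT[OF T_in[OF assms(1)] assms(2,3), symmetric]) simp_all
qed

lemma pre_sub: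
  assumes "g \<in> maps C x as d" "p \<in> Ar K" "f \<in> maps C y cs c" "src p = c"
    and "1 \<le> i" "i \<le> length as" "as ! (i - 1) = tgt p" "op_ok s x (length as) y (length cs)"
  shows "g \<star>[i] (T p \<star>[1] f) = (g \<star>[i] T p) \<star>[i] f"
proof -
  have "op_ok s x (length as) Tight 1"
    using mapsD[OF assms(1)] by (auto simp: op_ok_def short_op_def arity_ok_def)
  moreover have "op_ok s Tight 1 y (length cs)"
    using mapsD[OF assms(3)] by (auto simp: op_ok_def short_op_def arity_ok_def)
  moreover have "sub_type x i Tight = x" by (cases x) (auto simp: sub_type_def)
  ultimately show ?thesis
    using assms(4-) by (intro assocT[OF assms(1) T_in[OF assms(2)] assms(3)]) simp_all
qed

lemma th_in [simp]: "\<lbrakk>a \<in> Obj C; b \<in> Obj C; d = a \<boxplus> b\<rbrakk> \<Longrightarrow> \<theta> a b \<in> maps C Tight [a, b] d"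
  using theta_in by simp

lemma u_in [simp]: "u \<in> maps C Loose [] \<iota>"
  by (rule umap_in)

lemma th_inj:
  assumes "f \<in> maps C Tight (a \<boxplus> b # xs) d" "g \<in> maps C Tight (a \<boxplus> b # xs) d" "a \<in> Obj C" "b \<in> Obj C"
    and "f \<star>[1] \<theta> a b = g \<star>[1] \<theta> a b" "s \<longrightarrow> length xs \<le> 2"
  shows "f = g"
  using theta_bij[of a b xs d] mapsD[OF assms(1)] assms by (auto simp: bij_betw_def dest: inj_onD)

lemma u_inj:
  assumes "f \<in> maps C Tight (\<iota> # xs) d" "g \<in> maps C Tight (\<iota> # xs) d" "f \<star>[1] u = g \<star>[1] u" "s \<longrightarrow> length xs \<le> 2"
  shows "f = g"
  using umap_bij[of xs d] mapsD[OF assms(1)] assms by (auto simp: bij_betw_def dest: inj_onD)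

lemma arr_inj2:
  assumes "f \<in> hom K (a \<boxplus> b) d" "g \<in> hom K (a \<boxplus> b) d" "a \<in> Obj C" "b \<in> Obj C"
    and "T f \<star>[1] \<theta> a b = T g \<star>[1] \<theta> a b"
  shows "f = g"
  using th_inj[OF T_hom[OF assms(1)] T_hom[OF assms(2)]] assms by simp

lemma arr_inj3:
  assumes "f \<in> hom K (a \<boxplus> b \<boxplus> c) d" "g \<in> hom K (a \<boxplus> b \<boxplus> c) d" "a \<in> Obj C" "b \<in> Obj C" "c \<in> Obj C"
    and "(T f \<star>[1] \<theta> (a \<boxplus> b) c) \<star>[1] \<theta> a b = (T g \<star>[1] \<theta> (a \<boxplus> b) c) \<star>[1] \<theta> a b"
  shows "f = g"
proof (rule arr_inj2[OF assms(1,2)])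
  have "T f \<star>[1] \<theta> (a \<boxplus> b) c \<in> maps C Tight [a \<boxplus> b, c] d" "T g \<star>[1] \<theta> (a \<boxplus> b) c \<in> maps C Tight [a \<boxplus> b, c] d"
    using assms post_in[of f "\<theta> (a \<boxplus> b) c"] post_in[of g "\<theta> (a \<boxplus> b) c"] by (auto simp: hom_iff)
  from th_inj[OF this assms(3,4,6)] show "T f \<star>[1] \<theta> (a \<boxplus> b) c = T g \<star>[1] \<theta> (a \<boxplus> b) c" by simp
qed (use assms in simp_all)

lemma K_TenA_hom [simp]: "\<lbrakk>f \<in> Ar K; g \<in> Ar K\<rbrakk> \<Longrightarrow> f \<boxtimes> g \<in> Ar K"
  "\<lbrakk>f \<in> Ar K; g \<in> Ar K\<rbrakk> \<Longrightarrow> src (f \<boxtimes> g) = src f \<boxplus> src g"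
  "\<lbrakk>f \<in> Ar K; g \<in> Ar K\<rbrakk> \<Longrightarrow> tgt (f \<boxtimes> g) = tgt f \<boxplus> tgt g"
  using K_TenA[of f g] by (auto simp: hom_iff)

lemma K_Alpha_hom [simp]:
  assumes "a \<in> Obj C" "b \<in> Obj C" "c \<in> Obj C"
  shows "\<alpha>\<^bsub>K\<^esub> a b c \<in> Ar K" "src (\<alpha>\<^bsub>K\<^esub> a b c) = a \<boxplus> b \<boxplus> c" "tgt (\<alpha>\<^bsub>K\<^esub> a b c) = a \<boxplus> (b \<boxplus> c)"
  using K_Alpha[OF assms] by (auto simp: hom_iff)

lemma K_Lam_hom [simp]:
  assumes "a \<in> Obj C"
  shows "\<lambda>\<lambda>\<^bsub>K\<^esub> a \<in> Ar K" "src (\<lambda>\<lambda>\<^bsub>K\<^esub> a) = \<iota> \<boxplus> a" "tgt (\<lambda>\<lambda>\<^bsub>K\<^esub> a) = a"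
  using K_Lam[OF assms] by (auto simp: hom_iff)

lemma K_Rho_hom [simp]:
  assumes "a \<in> Obj C"
  shows "\<rho>\<^bsub>K\<^esub> a \<in> Ar K" "src (\<rho>\<^bsub>K\<^esub> a) = a" "tgt (\<rho>\<^bsub>K\<^esub> a) = a \<boxplus> \<iota>"
proof -
  have "T (\<rho>\<^bsub>K\<^esub> a) \<in> maps C Tight [a] (a \<boxplus> \<iota>)"
    using assms by (simp add: K_Rho sub_in[OF th_in u_in])
  from hom_T[OF this] show "\<rho>\<^bsub>K\<^esub> a \<in> Ar K" "src (\<rho>\<^bsub>K\<^esub> a) = a" "tgt (\<rho>\<^bsub>K\<^esub> a) = a \<boxplus> \<iota>"
    by (auto simp: hom_iff)
qed

lemma K_Id_hom [simp]:
  assumes "a \<in> Obj C" shows "Id K a \<in> Ar K" "src (Id K a) = a" "tgt (Id K a) = a"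
  using id_hom[OF assms] by (auto simp: hom_iff)

lemma K_Comp_hom [simp]:
  assumes "g \<in> Ar K" "f \<in> Ar K" "tgt f = src g"
  shows "g \<bullet> f \<in> Ar K" "src (g \<bullet> f) = src f" "tgt (g \<bullet> f) = tgt g"
  using comp_hom[OF assms] by (auto simp: hom_iff)

text \<open>Naturality of \<open>\<theta>\<close> in each variable, from the defining equation of the tensor product of arrows.\<close>

lemma th_nat1:
  assumes "f \<in> Ar K" "b \<in> Obj C"
  shows "\<theta> (tgt f) b \<star>[1] T f = T (f \<boxtimes> Id K b) \<star>[1] \<theta> (src f) b"
proof -
  have "\<theta> (tgt f) b \<star>[1] T f \<in> maps C Tight [src f, b] (tgt f \<boxplus> b)"
    using assms by (intro sub_in[OF th_in T_in]) simp_all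
  then have "(\<theta> (tgt f) b \<star>[1] T f) \<star>[2] Idm C b = \<theta> (tgt f) b \<star>[1] T f"
    by (rule sub_idT) simp_all
  then show ?thesis using assms K_TenA[of f "Id K b"] by (simp add: K_Id)
qed

lemma th_nat2:
  assumes "f \<in> Ar K" "a \<in> Obj C"
  shows "\<theta> a (tgt f) \<star>[2] T f = T (Id K a \<boxtimes> f) \<star>[1] \<theta> a (src f)"
proof -
  have "\<theta> a (tgt f) \<star>[1] Idm C a = \<theta> a (tgt f)"
    using assms by (intro sub_idT[OF th_in]) simp_all
  then show ?thesis using assms K_TenA[of "Id K a" f] by (simp add: K_Id)
qed

end

section \<open>Representing data make the underlying category skew monoidal\<close>

text \<open>An arrow out of \<open>a b\<close> is determined by its composite with \<open>\<theta>\<close>, and an arrow out of \<open>(a b) c\<close> by its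
  composite with two of them; when \<open>a\<close> is the unit, a further substitution of \<open>u\<close> removes it.  Each
  axiom of a skew monoidal category thereby becomes an equation between multimaps, in which the
  structure maps can be eliminated by their defining equations; what remains is associativity and
  commutativity of substitution, and the behaviour of \<open>j\<close> on identities for the axioms with \<open>\<lambda>\<close>.\<close>

context rep_skewmon
begin

lemma post_in': "\<lbrakk>q \<in> Ar K; g \<in> maps C x as a; src q = a; tgt q = b\<rbrakk> \<Longrightarrow> T q \<star>[1] g \<in> maps C x as b"
  using post_in by blast

lemma post3:
  assumes "q \<in> Ar K" "p \<in> Ar K" "src q = tgt p" "src p = a \<boxplus> b \<boxplus> c" "a \<in> Obj C" "b \<in> Obj C" "c \<in> Obj C"
  shows "(T (q \<bullet> p) \<star>[1] \<theta> (a \<boxplus> b) c) \<star>[1] \<theta> a b = T q \<star>[1] ((T p \<star>[1] \<theta> (a \<boxplus> b) c) \<star>[1] \<theta> a b)"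
proof -
  have 1: "T p \<star>[1] \<theta> (a \<boxplus> b) c \<in> maps C Tight [a \<boxplus> b, c] (src q)"
    using assms by (intro post_in'[OF _ th_in]) simp_all
  have "T (q \<bullet> p) \<star>[1] \<theta> (a \<boxplus> b) c = T q \<star>[1] (T p \<star>[1] \<theta> (a \<boxplus> b) c)"
    using assms by (intro post_assoc[OF _ _ _ th_in]) simp_all
  then show ?thesis using assms post_sub[OF assms(1) 1 th_in[OF assms(5,6) refl], of 1] by simp
qed

lemma K_ten_id:
  assumes "a \<in> Obj C" "b \<in> Obj C"
  shows "Id K a \<boxtimes> Id K b = Id K (a \<boxplus> b)"
proof (rule arr_inj2[OF _ _ assms])
  have "\<theta> a b \<star>[2] Idm C b = \<theta> a b"
    using assms by (intro sub_idT[OF th_in]) simp_all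
  then show "T (Id K a \<boxtimes> Id K b) \<star>[1] \<theta> a b = T (Id K (a \<boxplus> b)) \<star>[1] \<theta> a b"
    using th_nat2[of "Id K b" a] assms by (simp add: K_Id id_subT[OF th_in, unfolded One_nat_def])
qed (use assms in \<open>simp_all add: hom_iff\<close>)

lemma K_ten_comp:
  assumes "f \<in> Ar K" "f' \<in> Ar K" "g \<in> Ar K" "g' \<in> Ar K" "tgt f = src f'" "tgt g = src g'"
  shows "(f' \<bullet> f) \<boxtimes> (g' \<bullet> g) = (f' \<boxtimes> g') \<bullet> (f \<boxtimes> g)"
proof (rule arr_inj2[where a = "src f" and b = "src g"])
  let ?th = "\<theta> (tgt f') (tgt g')" and ?th' = "\<theta> (tgt f) (tgt g)"
  let ?m = "?th \<star>[1] T f'"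
  note T = T_in[OF assms(1)] T_in[OF assms(2)] T_in[OF assms(3)] T_in[OF assms(4)]
  have f: "T f \<in> maps C Tight [src f] (src f')" and g: "T g \<in> maps C Tight [src g] (src g')"
    and g': "T g' \<in> maps C Tight [src g'] (tgt g')"
    using T assms by auto
  have th: "?th \<in> maps C Tight [tgt f', tgt g'] (tgt f' \<boxplus> tgt g')"
    and th': "?th' \<in> maps C Tight [src f', src g'] (src f' \<boxplus> src g')"
    and th0: "\<theta> (src f) (src g) \<in> maps C Tight [src f, src g] (src f \<boxplus> src g)"
    using assms by simp_all
  have m: "?m \<in> maps C Tight [src f', tgt g'] (tgt f' \<boxplus> tgt g')"
    using assms by (intro sub_in[OF th_in T_in]) simp_all
  have mf: "?m \<star>[1] T f \<in> maps C Tight [src f, tgt g'] (tgt f' \<boxplus> tgt g')"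
    using assms by (intro sub_in[OF m T_in]) simp_all
  have tf: "?th' \<star>[1] T f \<in> maps C Tight [src f, src g'] (src f' \<boxplus> src g')"
    by (intro sub_in[OF th' f]) simp_all
  have "T ((f' \<bullet> f) \<boxtimes> (g' \<bullet> g)) \<star>[1] \<theta> (src f) (src g) = (?th \<star>[1] (T f' \<star>[1] T f)) \<star>[2] (T g' \<star>[1] T g)"
    using assms K_TenA[of "f' \<bullet> f" "g' \<bullet> g"] by (simp add: K_Comp)
  also have "?th \<star>[1] (T f' \<star>[1] T f) = ?m \<star>[1] T f"
    using assms by (intro pre_sub[OF th _ f]) simp_all
  also have "(?m \<star>[1] T f) \<star>[2] (T g' \<star>[1] T g) = ((?m \<star>[1] T f) \<star>[2] T g') \<star>[2] T g"
    using assms by (intro pre_sub[OF mf _ g]) simp_all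
  also have "(?m \<star>[1] T f) \<star>[2] T g' = (?m \<star>[2] T g') \<star>[1] T f"
    using assms by (intro commT[OF m f g']) simp_all
  also have "?m \<star>[2] T g' = T (f' \<boxtimes> g') \<star>[1] ?th'"
    using assms K_TenA[of f' g'] by simp
  also have "(T (f' \<boxtimes> g') \<star>[1] ?th') \<star>[1] T f = T (f' \<boxtimes> g') \<star>[1] (?th' \<star>[1] T f)"
    using assms by (intro post_sub[OF _ th' f]) simp_all
  also have "(T (f' \<boxtimes> g') \<star>[1] (?th' \<star>[1] T f)) \<star>[2] T g = T (f' \<boxtimes> g') \<star>[1] ((?th' \<star>[1] T f) \<star>[2] T g)"
    using assms by (intro post_sub[OF _ tf g]) simp_all
  also have "(?th' \<star>[1] T f) \<star>[2] T g = T (f \<boxtimes> g) \<star>[1] \<theta> (src f) (src g)"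
    using assms K_TenA[of f g] by simp
  also have "T (f' \<boxtimes> g') \<star>[1] (T (f \<boxtimes> g) \<star>[1] \<theta> (src f) (src g)) = T ((f' \<boxtimes> g') \<bullet> (f \<boxtimes> g)) \<star>[1] \<theta> (src f) (src g)"
    using assms by (intro post_assoc[OF _ _ _ th0, symmetric]) simp_all
  finally show "T ((f' \<bullet> f) \<boxtimes> (g' \<bullet> g)) \<star>[1] \<theta> (src f) (src g) = T ((f' \<boxtimes> g') \<bullet> (f \<boxtimes> g)) \<star>[1] \<theta> (src f) (src g)" .
qed (use assms in \<open>simp_all add: hom_iff\<close>)

lemma K_alpha_nat:
  assumes "f \<in> Ar K" "g \<in> Ar K" "h \<in> Ar K"
  shows "\<alpha>\<^bsub>K\<^esub> (tgt f) (tgt g) (tgt h) \<bullet> ((f \<boxtimes> g) \<boxtimes> h) = (f \<boxtimes> (g \<boxtimes> h)) \<bullet> \<alpha>\<^bsub>K\<^esub> (src f) (src g) (src h)"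
proof -
  define a b c a' b' c' where o: "a = src f" "b = src g" "c = src h" "a' = tgt f" "b' = tgt g" "c' = tgt h"
  have ob: "a \<in> Obj C" "b \<in> Obj C" "c \<in> Obj C" "a' \<in> Obj C" "b' \<in> Obj C" "c' \<in> Obj C"
    using assms by (simp_all add: o)
  have f: "T f \<in> maps C Tight [a] a'" and g: "T g \<in> maps C Tight [b] b'" and h: "T h \<in> maps C Tight [c] c'"
    using assms T_in by (auto simp: o)
  have fg: "T (f \<boxtimes> g) \<in> maps C Tight [a \<boxplus> b] (a' \<boxplus> b')" and gh: "T (g \<boxtimes> h) \<in> maps C Tight [b \<boxplus> c] (b' \<boxplus> c')"
    using assms T_in[of "f \<boxtimes> g"] T_in[of "g \<boxtimes> h"] by (auto simp: o)
  let ?A = "\<alpha>\<^bsub>K\<^esub> a' b' c'"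
  let ?t = "\<theta> (a' \<boxplus> b') c'" and ?t1 = "\<theta> a' b'" and ?w = "\<theta> a' (b' \<boxplus> c')" and ?v = "\<theta> b' c'"
  have t: "?t \<in> maps C Tight [a' \<boxplus> b', c'] (a' \<boxplus> b' \<boxplus> c')" and t1: "?t1 \<in> maps C Tight [a', b'] (a' \<boxplus> b')"
    and w: "?w \<in> maps C Tight [a', b' \<boxplus> c'] (a' \<boxplus> (b' \<boxplus> c'))" and v: "?v \<in> maps C Tight [b', c'] (b' \<boxplus> c')"
    using ob by simp_all
  have tfg: "?t \<star>[1] T (f \<boxtimes> g) \<in> maps C Tight [a \<boxplus> b, c'] (a' \<boxplus> b' \<boxplus> c')"
    by (rule sub_in[OF t fg]) simp_all
  have t1f: "?t1 \<star>[1] T f \<in> maps C Tight [a, b'] (a' \<boxplus> b')" by (rule sub_in[OF t1 f]) simp_all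
  have tt: "?t \<star>[1] ?t1 \<in> maps C Tight [a', b', c'] (a' \<boxplus> b' \<boxplus> c')" by (rule sub_in[OF t t1]) simp_all
  have ttf: "(?t \<star>[1] ?t1) \<star>[1] T f \<in> maps C Tight [a, b', c'] (a' \<boxplus> b' \<boxplus> c')" by (rule sub_in[OF tt f]) simp_all
  have ttfg: "((?t \<star>[1] ?t1) \<star>[1] T f) \<star>[2] T g \<in> maps C Tight [a, b, c'] (a' \<boxplus> b' \<boxplus> c')"
    by (rule sub_in[OF ttf g]) simp_all
  have wf: "?w \<star>[1] T f \<in> maps C Tight [a, b' \<boxplus> c'] (a' \<boxplus> (b' \<boxplus> c'))" by (rule sub_in[OF w f]) simp_all
  have vg: "?v \<star>[1] T g \<in> maps C Tight [b, c'] (b' \<boxplus> c')" by (rule sub_in[OF v g]) simp_all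
  have A: "?A \<in> Ar K" "src ?A = a' \<boxplus> b' \<boxplus> c'" "tgt ?A = a' \<boxplus> (b' \<boxplus> c')" using ob by simp_all
  have thab: "\<theta> a b \<in> maps C Tight [a, b] (a \<boxplus> b)" and thbc: "\<theta> b c \<in> maps C Tight [b, c] (b \<boxplus> c)"
    and thabc: "\<theta> a (b \<boxplus> c) \<in> maps C Tight [a, b \<boxplus> c] (a \<boxplus> (b \<boxplus> c))" using ob by simp_all
  have "(T ((f \<boxtimes> g) \<boxtimes> h) \<star>[1] \<theta> (a \<boxplus> b) c) \<star>[1] \<theta> a b = ((?t \<star>[1] T (f \<boxtimes> g)) \<star>[2] T h) \<star>[1] \<theta> a b"
    using K_TenA[of "f \<boxtimes> g" h] assms by (simp add: o)
  also have "\<dots> = ((?t \<star>[1] T (f \<boxtimes> g)) \<star>[1] \<theta> a b) \<star>[3] T h"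
    by (rule commT[OF tfg thab h, symmetric]) simp_all
  also have "(?t \<star>[1] T (f \<boxtimes> g)) \<star>[1] \<theta> a b = ?t \<star>[1] (T (f \<boxtimes> g) \<star>[1] \<theta> a b)"
    using assms ob by (intro pre_sub[OF t _ thab, symmetric]) (simp_all add: o)
  also have "T (f \<boxtimes> g) \<star>[1] \<theta> a b = (?t1 \<star>[1] T f) \<star>[2] T g"
    using K_TenA[of f g] assms by (simp add: o)
  also have "?t \<star>[1] ((?t1 \<star>[1] T f) \<star>[2] T g) = (?t \<star>[1] (?t1 \<star>[1] T f)) \<star>[2] T g"
    by (rule assocT[OF t t1f g]) simp_all
  also have "?t \<star>[1] (?t1 \<star>[1] T f) = (?t \<star>[1] ?t1) \<star>[1] T f"
    by (rule assocT[OF t t1 f]) simp_all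
  finally have 1: "(T ((f \<boxtimes> g) \<boxtimes> h) \<star>[1] \<theta> (a \<boxplus> b) c) \<star>[1] \<theta> a b = (((?t \<star>[1] ?t1) \<star>[1] T f) \<star>[2] T g) \<star>[3] T h" .
  have "(T (?A \<bullet> ((f \<boxtimes> g) \<boxtimes> h)) \<star>[1] \<theta> (a \<boxplus> b) c) \<star>[1] \<theta> a b
      = T ?A \<star>[1] ((((?t \<star>[1] ?t1) \<star>[1] T f) \<star>[2] T g) \<star>[3] T h)"
    unfolding 1[symmetric] using assms ob by (intro post3) (simp_all add: o)
  also have "\<dots> = (T ?A \<star>[1] (((?t \<star>[1] ?t1) \<star>[1] T f) \<star>[2] T g)) \<star>[3] T h"
    using A by (intro post_sub[OF _ ttfg h, symmetric]) simp_all
  also have "T ?A \<star>[1] (((?t \<star>[1] ?t1) \<star>[1] T f) \<star>[2] T g) = (T ?A \<star>[1] ((?t \<star>[1] ?t1) \<star>[1] T f)) \<star>[2] T g"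
    using A by (intro post_sub[OF _ ttf g, symmetric]) simp_all
  also have "T ?A \<star>[1] ((?t \<star>[1] ?t1) \<star>[1] T f) = (T ?A \<star>[1] (?t \<star>[1] ?t1)) \<star>[1] T f"
    using A by (intro post_sub[OF _ tt f, symmetric]) simp_all
  also have "T ?A \<star>[1] (?t \<star>[1] ?t1) = (T ?A \<star>[1] ?t) \<star>[1] ?t1"
    using A by (intro post_sub[OF _ t t1, symmetric]) simp_all
  also have "\<dots> = ?w \<star>[2] ?v" using K_Alpha[OF ob(4-6)] by simp
  finally have L: "(T (?A \<bullet> ((f \<boxtimes> g) \<boxtimes> h)) \<star>[1] \<theta> (a \<boxplus> b) c) \<star>[1] \<theta> a b = (((?w \<star>[2] ?v) \<star>[1] T f) \<star>[2] T g) \<star>[3] T h" .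
  let ?q = "f \<boxtimes> (g \<boxtimes> h)"
  have "(T (?q \<bullet> \<alpha>\<^bsub>K\<^esub> a b c) \<star>[1] \<theta> (a \<boxplus> b) c) \<star>[1] \<theta> a b = T ?q \<star>[1] (\<theta> a (b \<boxplus> c) \<star>[2] \<theta> b c)"
    using assms ob K_Alpha[OF ob(1-3)] by (subst post3) (simp_all add: o)
  also have "\<dots> = (T ?q \<star>[1] \<theta> a (b \<boxplus> c)) \<star>[2] \<theta> b c"
    using assms ob by (intro post_sub[OF _ thabc thbc, symmetric]) (simp_all add: o)
  also have "T ?q \<star>[1] \<theta> a (b \<boxplus> c) = (?w \<star>[1] T f) \<star>[2] T (g \<boxtimes> h)"
    using K_TenA[of f "g \<boxtimes> h"] assms by (simp add: o)
  also have "\<dots> \<star>[2] \<theta> b c = (?w \<star>[1] T f) \<star>[2] (T (g \<boxtimes> h) \<star>[1] \<theta> b c)"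
    using assms ob by (intro pre_sub[OF wf _ thbc, symmetric]) (simp_all add: o)
  also have "T (g \<boxtimes> h) \<star>[1] \<theta> b c = (?v \<star>[1] T g) \<star>[2] T h"
    using K_TenA[of g h] assms by (simp add: o)
  also have "(?w \<star>[1] T f) \<star>[2] ((?v \<star>[1] T g) \<star>[2] T h) = ((?w \<star>[1] T f) \<star>[2] (?v \<star>[1] T g)) \<star>[3] T h"
    by (rule assocT[OF wf vg h]) simp_all
  also have "(?w \<star>[1] T f) \<star>[2] (?v \<star>[1] T g) = ((?w \<star>[1] T f) \<star>[2] ?v) \<star>[2] T g"
    by (rule assocT[OF wf v g]) simp_all
  also have "(?w \<star>[1] T f) \<star>[2] ?v = (?w \<star>[2] ?v) \<star>[1] T f"
    by (rule commT[OF w f v]) simp_all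
  finally have R: "(T (?q \<bullet> \<alpha>\<^bsub>K\<^esub> a b c) \<star>[1] \<theta> (a \<boxplus> b) c) \<star>[1] \<theta> a b = (((?w \<star>[2] ?v) \<star>[1] T f) \<star>[2] T g) \<star>[3] T h" .
  have "?A \<bullet> ((f \<boxtimes> g) \<boxtimes> h) = ?q \<bullet> \<alpha>\<^bsub>K\<^esub> a b c"
    by (rule arr_inj3[OF _ _ ob(1-3)]) (use assms ob L R in \<open>simp_all add: hom_iff o\<close>)
  then show ?thesis by (simp add: o)
qed

lemma j_id_in: "a \<in> Obj C \<Longrightarrow> \<j> (Idm C a) \<in> maps C Loose [a] a"
  using jay[of "Idm C a"] mapsD[OF idm[of a]] by auto

lemma K_lam_nat:
  assumes "f \<in> Ar K"
  shows "\<lambda>\<lambda>\<^bsub>K\<^esub> (tgt f) \<bullet> (Id K \<iota> \<boxtimes> f) = f \<bullet> \<lambda>\<lambda>\<^bsub>K\<^esub> (src f)"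
proof (rule arr_inj2[of _ \<iota> "src f" "tgt f"])
  let ?a = "src f" and ?b = "tgt f"
  have ob: "?a \<in> Obj C" "?b \<in> Obj C" using assms by auto
  have f: "T f \<in> maps C Tight [?a] ?b" using T_in[OF assms] .
  have tb: "\<theta> \<iota> ?b \<in> maps C Tight [\<iota>, ?b] (\<iota> \<boxplus> ?b)" and ta: "\<theta> \<iota> ?a \<in> maps C Tight [\<iota>, ?a] (\<iota> \<boxplus> ?a)" using ob by simp_all
  have lt: "T (\<lambda>\<lambda>\<^bsub>K\<^esub> ?b) \<star>[1] \<theta> \<iota> ?b \<in> maps C Tight [\<iota>, ?b] ?b"
    and lta: "T (\<lambda>\<lambda>\<^bsub>K\<^esub> ?a) \<star>[1] \<theta> \<iota> ?a \<in> maps C Tight [\<iota>, ?a] ?a"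
    using ob by (intro post_in'[OF _ tb] post_in'[OF _ ta]; simp)+
  have flt: "T f \<star>[1] (T (\<lambda>\<lambda>\<^bsub>K\<^esub> ?a) \<star>[1] \<theta> \<iota> ?a) \<in> maps C Tight [\<iota>, ?a] ?b"
    using assms by (intro post_in'[OF _ lta]) simp_all
  have ltf: "(T (\<lambda>\<lambda>\<^bsub>K\<^esub> ?b) \<star>[1] \<theta> \<iota> ?b) \<star>[2] T f \<in> maps C Tight [\<iota>, ?a] ?b"
    by (rule sub_in[OF lt f]) simp_all
  have "((T (\<lambda>\<lambda>\<^bsub>K\<^esub> ?b) \<star>[1] \<theta> \<iota> ?b) \<star>[2] T f) \<star>[1] u = ((T (\<lambda>\<lambda>\<^bsub>K\<^esub> ?b) \<star>[1] \<theta> \<iota> ?b) \<star>[1] u) \<star>[1] T f"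
    by (rule commT[OF lt u_in f, symmetric]) simp_all
  also have "\<dots> = \<j> (Idm C ?b) \<star>[1] T f" using K_Lam[OF ob(2)] by simp
  also have "\<dots> = T f \<star>[1] \<j> (Idm C ?a)"
    using jay_id_tight[of "T f"] sub_jay_id_1[of "T f"] mapsD[OF f] by simp
  also have "\<dots> = T f \<star>[1] ((T (\<lambda>\<lambda>\<^bsub>K\<^esub> ?a) \<star>[1] \<theta> \<iota> ?a) \<star>[1] u)" using K_Lam[OF ob(1)] by simp
  also have "\<dots> = (T f \<star>[1] (T (\<lambda>\<lambda>\<^bsub>K\<^esub> ?a) \<star>[1] \<theta> \<iota> ?a)) \<star>[1] u"
    using assms by (intro post_sub[OF _ lta u_in, symmetric]) simp_all
  finally have "(T (\<lambda>\<lambda>\<^bsub>K\<^esub> ?b) \<star>[1] \<theta> \<iota> ?b) \<star>[2] T f = T f \<star>[1] (T (\<lambda>\<lambda>\<^bsub>K\<^esub> ?a) \<star>[1] \<theta> \<iota> ?a)"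
    by (rule u_inj[OF ltf flt]) simp
  moreover have "(T (\<lambda>\<lambda>\<^bsub>K\<^esub> ?b) \<star>[1] \<theta> \<iota> ?b) \<star>[2] T f = T (\<lambda>\<lambda>\<^bsub>K\<^esub> ?b) \<star>[1] (T (Id K \<iota> \<boxtimes> f) \<star>[1] \<theta> \<iota> ?a)"
    using assms ob th_nat2[of f \<iota>] by (subst post_sub[OF _ tb f]) simp_all
  ultimately show "T (\<lambda>\<lambda>\<^bsub>K\<^esub> ?b \<bullet> (Id K \<iota> \<boxtimes> f)) \<star>[1] \<theta> \<iota> ?a = T (f \<bullet> \<lambda>\<lambda>\<^bsub>K\<^esub> ?a) \<star>[1] \<theta> \<iota> ?a"
    using assms ob by (simp add: post_assoc[OF _ _ _ ta, unfolded One_nat_def] post_assoc[OF _ _ _ th_in, unfolded One_nat_def])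
qed (use assms in \<open>simp_all add: hom_iff\<close>)

lemma K_rho_nat:
  assumes "f \<in> Ar K"
  shows "\<rho>\<^bsub>K\<^esub> (tgt f) \<bullet> f = (f \<boxtimes> Id K \<iota>) \<bullet> \<rho>\<^bsub>K\<^esub> (src f)"
proof (rule arr_eqT)
  let ?a = "src f" and ?b = "tgt f"
  have ob: "?a \<in> Obj C" "?b \<in> Obj C" using assms by auto
  have f: "T f \<in> maps C Tight [?a] ?b" using T_in[OF assms] .
  have tb: "\<theta> ?b \<iota> \<in> maps C Tight [?b, \<iota>] (?b \<boxplus> \<iota>)" and ta: "\<theta> ?a \<iota> \<in> maps C Tight [?a, \<iota>] (?a \<boxplus> \<iota>)"
    using ob by simp_all
  have "(\<theta> ?b \<iota> \<star>[2] u) \<star>[1] T f = (\<theta> ?b \<iota> \<star>[1] T f) \<star>[2] u"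
    by (rule commT[OF tb f u_in, symmetric]) simp_all
  also have "\<dots> = (T (f \<boxtimes> Id K \<iota>) \<star>[1] \<theta> ?a \<iota>) \<star>[2] u" using th_nat1[OF assms, of \<iota>] by simp
  also have "\<dots> = T (f \<boxtimes> Id K \<iota>) \<star>[1] (\<theta> ?a \<iota> \<star>[2] u)"
    using assms ob by (intro post_sub[OF _ ta u_in]) simp_all
  finally show "T (\<rho>\<^bsub>K\<^esub> ?b \<bullet> f) = T ((f \<boxtimes> Id K \<iota>) \<bullet> \<rho>\<^bsub>K\<^esub> ?a)"
    using assms ob by (simp add: K_Comp K_Rho)
qed

text \<open>Substituting the three universal maps that present \<open>((a b) c) d\<close> turns both sides into the composite
  of the three that present \<open>a (b (c d))\<close>.\<close>

lemma K_pentagon: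
  assumes ob: "a \<in> Obj C" "b \<in> Obj C" "c \<in> Obj C" "d \<in> Obj C"
  shows "\<alpha>\<^bsub>K\<^esub> a b (c \<boxplus> d) \<bullet> \<alpha>\<^bsub>K\<^esub> (a \<boxplus> b) c d
    = (Id K a \<boxtimes> \<alpha>\<^bsub>K\<^esub> b c d) \<bullet> \<alpha>\<^bsub>K\<^esub> a (b \<boxplus> c) d \<bullet> (\<alpha>\<^bsub>K\<^esub> a b c \<boxtimes> Id K d)"
proof -
  let ?A1 = "\<alpha>\<^bsub>K\<^esub> a b (c \<boxplus> d)" and ?A2 = "\<alpha>\<^bsub>K\<^esub> (a \<boxplus> b) c d" and ?A3 = "\<alpha>\<^bsub>K\<^esub> b c d"
    and ?A4 = "\<alpha>\<^bsub>K\<^esub> a (b \<boxplus> c) d" and ?A5 = "\<alpha>\<^bsub>K\<^esub> a b c"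
  let ?L = "?A1 \<bullet> ?A2" and ?R = "(Id K a \<boxtimes> ?A3) \<bullet> ?A4 \<bullet> (?A5 \<boxtimes> Id K d)"
  let ?t = "\<theta> (a \<boxplus> b \<boxplus> c) d" and ?e = "a \<boxplus> (b \<boxplus> (c \<boxplus> d))"
  have ab: "\<theta> a b \<in> maps C Tight [a, b] (a \<boxplus> b)" and cd: "\<theta> c d \<in> maps C Tight [c, d] (c \<boxplus> d)"
    and bc: "\<theta> b c \<in> maps C Tight [b, c] (b \<boxplus> c)"
    and abc: "\<theta> (a \<boxplus> b) c \<in> maps C Tight [a \<boxplus> b, c] (a \<boxplus> b \<boxplus> c)"
    and b'cd: "\<theta> b (c \<boxplus> d) \<in> maps C Tight [b, c \<boxplus> d] (b \<boxplus> (c \<boxplus> d))"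
    and a'bcd: "\<theta> a (b \<boxplus> (c \<boxplus> d)) \<in> maps C Tight [a, b \<boxplus> (c \<boxplus> d)] ?e"
    and bcd: "\<theta> (b \<boxplus> c) d \<in> maps C Tight [b \<boxplus> c, d] (b \<boxplus> c \<boxplus> d)"
    and a'bcd': "\<theta> a (b \<boxplus> c \<boxplus> d) \<in> maps C Tight [a, b \<boxplus> c \<boxplus> d] (a \<boxplus> (b \<boxplus> c \<boxplus> d))"
    and a'bc: "\<theta> a (b \<boxplus> c) \<in> maps C Tight [a, b \<boxplus> c] (a \<boxplus> (b \<boxplus> c))"
    and abcd: "\<theta> (a \<boxplus> b) (c \<boxplus> d) \<in> maps C Tight [a \<boxplus> b, c \<boxplus> d] (a \<boxplus> b \<boxplus> (c \<boxplus> d))"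
    and a'bc_d: "\<theta> (a \<boxplus> (b \<boxplus> c)) d \<in> maps C Tight [a \<boxplus> (b \<boxplus> c), d] (a \<boxplus> (b \<boxplus> c) \<boxplus> d)"
    and t: "?t \<in> maps C Tight [a \<boxplus> b \<boxplus> c, d] (a \<boxplus> b \<boxplus> c \<boxplus> d)"
    using ob by simp_all
  have abcdcd: "\<theta> (a \<boxplus> b) (c \<boxplus> d) \<star>[2] \<theta> c d \<in> maps C Tight [a \<boxplus> b, c, d] (a \<boxplus> b \<boxplus> (c \<boxplus> d))"
    by (rule sub_in[OF abcd cd]) simp_all
  have abcdab: "\<theta> (a \<boxplus> b) (c \<boxplus> d) \<star>[1] \<theta> a b \<in> maps C Tight [a, b, c \<boxplus> d] (a \<boxplus> b \<boxplus> (c \<boxplus> d))"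
    by (rule sub_in[OF abcd ab]) simp_all
  have "((T ?L \<star>[1] ?t) \<star>[1] \<theta> (a \<boxplus> b) c) \<star>[1] \<theta> a b = (T ?A1 \<star>[1] (\<theta> (a \<boxplus> b) (c \<boxplus> d) \<star>[2] \<theta> c d)) \<star>[1] \<theta> a b"
    using ob K_Alpha[of "a \<boxplus> b" c d] by (subst post3) simp_all
  also have "\<dots> = T ?A1 \<star>[1] ((\<theta> (a \<boxplus> b) (c \<boxplus> d) \<star>[2] \<theta> c d) \<star>[1] \<theta> a b)"
    using ob by (intro post_sub[OF _ abcdcd ab]) simp_all
  also have "(\<theta> (a \<boxplus> b) (c \<boxplus> d) \<star>[2] \<theta> c d) \<star>[1] \<theta> a b = (\<theta> (a \<boxplus> b) (c \<boxplus> d) \<star>[1] \<theta> a b) \<star>[3] \<theta> c d"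
    by (rule commT[OF abcd ab cd, symmetric]) simp_all
  also have "T ?A1 \<star>[1] \<dots> = (T ?A1 \<star>[1] (\<theta> (a \<boxplus> b) (c \<boxplus> d) \<star>[1] \<theta> a b)) \<star>[3] \<theta> c d"
    using ob by (intro post_sub[OF _ abcdab cd, symmetric]) simp_all
  also have "T ?A1 \<star>[1] (\<theta> (a \<boxplus> b) (c \<boxplus> d) \<star>[1] \<theta> a b) = (T ?A1 \<star>[1] \<theta> (a \<boxplus> b) (c \<boxplus> d)) \<star>[1] \<theta> a b"
    using ob by (intro post_sub[OF _ abcd ab, symmetric]) simp_all
  also have "\<dots> = \<theta> a (b \<boxplus> (c \<boxplus> d)) \<star>[2] \<theta> b (c \<boxplus> d)"
    using ob K_Alpha[of a b "c \<boxplus> d"] by simp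
  also have "\<dots> \<star>[3] \<theta> c d = \<theta> a (b \<boxplus> (c \<boxplus> d)) \<star>[2] (\<theta> b (c \<boxplus> d) \<star>[2] \<theta> c d)"
    by (rule assocT[OF a'bcd b'cd cd, symmetric]) simp_all
  finally have L: "((T ?L \<star>[1] ?t) \<star>[1] \<theta> (a \<boxplus> b) c) \<star>[1] \<theta> a b
    = \<theta> a (b \<boxplus> (c \<boxplus> d)) \<star>[2] (\<theta> b (c \<boxplus> d) \<star>[2] \<theta> c d)" .
  let ?X = "\<theta> (a \<boxplus> (b \<boxplus> c)) d" and ?P = "Id K a \<boxtimes> ?A3"
  have XA: "?X \<star>[1] T ?A5 \<in> maps C Tight [a \<boxplus> b \<boxplus> c, d] (a \<boxplus> (b \<boxplus> c) \<boxplus> d)"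
    using ob by (intro sub_in[OF a'bc_d T_in]) simp_all
  have XAt: "(?X \<star>[1] T ?A5) \<star>[1] \<theta> (a \<boxplus> b) c \<in> maps C Tight [a \<boxplus> b, c, d] (a \<boxplus> (b \<boxplus> c) \<boxplus> d)"
    by (rule sub_in[OF XA abc]) simp_all
  have Xabc: "?X \<star>[1] \<theta> a (b \<boxplus> c) \<in> maps C Tight [a, b \<boxplus> c, d] (a \<boxplus> (b \<boxplus> c) \<boxplus> d)"
    by (rule sub_in[OF a'bc_d a'bc]) simp_all
  have Abc: "T ?A5 \<star>[1] \<theta> (a \<boxplus> b) c \<in> maps C Tight [a \<boxplus> b, c] (a \<boxplus> (b \<boxplus> c))"
    using ob by (intro post_in'[OF _ abc]) simp_all
  have "((T ?R \<star>[1] ?t) \<star>[1] \<theta> (a \<boxplus> b) c) \<star>[1] \<theta> a b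
      = ((T (?P \<bullet> ?A4) \<star>[1] (T (?A5 \<boxtimes> Id K d) \<star>[1] ?t)) \<star>[1] \<theta> (a \<boxplus> b) c) \<star>[1] \<theta> a b"
    using ob by (subst post_assoc[OF _ _ _ t]) simp_all
  also have "T (?A5 \<boxtimes> Id K d) \<star>[1] ?t = ?X \<star>[1] T ?A5"
    using th_nat1[of ?A5 d] ob by simp
  also have "(T (?P \<bullet> ?A4) \<star>[1] (?X \<star>[1] T ?A5)) \<star>[1] \<theta> (a \<boxplus> b) c = T (?P \<bullet> ?A4) \<star>[1] ((?X \<star>[1] T ?A5) \<star>[1] \<theta> (a \<boxplus> b) c)"
    using ob by (intro post_sub[OF _ XA abc]) simp_all
  also have "(T (?P \<bullet> ?A4) \<star>[1] ((?X \<star>[1] T ?A5) \<star>[1] \<theta> (a \<boxplus> b) c)) \<star>[1] \<theta> a b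
      = T (?P \<bullet> ?A4) \<star>[1] (((?X \<star>[1] T ?A5) \<star>[1] \<theta> (a \<boxplus> b) c) \<star>[1] \<theta> a b)"
    using ob by (intro post_sub[OF _ XAt ab]) simp_all
  also have "(?X \<star>[1] T ?A5) \<star>[1] \<theta> (a \<boxplus> b) c = ?X \<star>[1] (T ?A5 \<star>[1] \<theta> (a \<boxplus> b) c)"
    using ob by (intro pre_sub[OF a'bc_d _ abc, symmetric]) simp_all
  also have "(?X \<star>[1] (T ?A5 \<star>[1] \<theta> (a \<boxplus> b) c)) \<star>[1] \<theta> a b = ?X \<star>[1] ((T ?A5 \<star>[1] \<theta> (a \<boxplus> b) c) \<star>[1] \<theta> a b)"
    by (rule assocT[OF a'bc_d Abc ab, symmetric]) simp_all
  also have "(T ?A5 \<star>[1] \<theta> (a \<boxplus> b) c) \<star>[1] \<theta> a b = \<theta> a (b \<boxplus> c) \<star>[2] \<theta> b c"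
    using K_Alpha[OF ob(1-3)] by simp
  also have "?X \<star>[1] (\<theta> a (b \<boxplus> c) \<star>[2] \<theta> b c) = (?X \<star>[1] \<theta> a (b \<boxplus> c)) \<star>[2] \<theta> b c"
    by (rule assocT[OF a'bc_d a'bc bc]) simp_all
  also have "T (?P \<bullet> ?A4) \<star>[1] \<dots> = (T (?P \<bullet> ?A4) \<star>[1] (?X \<star>[1] \<theta> a (b \<boxplus> c))) \<star>[2] \<theta> b c"
    using ob by (intro post_sub[OF _ Xabc bc, symmetric]) simp_all
  also have "T (?P \<bullet> ?A4) \<star>[1] (?X \<star>[1] \<theta> a (b \<boxplus> c)) = (T (?P \<bullet> ?A4) \<star>[1] ?X) \<star>[1] \<theta> a (b \<boxplus> c)"
    using ob by (intro post_sub[OF _ a'bc_d a'bc, symmetric]) simp_all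
  also have "\<dots> = T ?P \<star>[1] (\<theta> a (b \<boxplus> c \<boxplus> d) \<star>[2] \<theta> (b \<boxplus> c) d)"
    using ob K_Alpha[of a "b \<boxplus> c" d] by (subst post3) simp_all
  also have "\<dots> = (T ?P \<star>[1] \<theta> a (b \<boxplus> c \<boxplus> d)) \<star>[2] \<theta> (b \<boxplus> c) d"
    using ob by (intro post_sub[OF _ a'bcd' bcd, symmetric]) simp_all
  also have "T ?P \<star>[1] \<theta> a (b \<boxplus> c \<boxplus> d) = \<theta> a (b \<boxplus> (c \<boxplus> d)) \<star>[2] T ?A3"
    using th_nat2[of ?A3 a] ob by simp
  also have "\<dots> \<star>[2] \<theta> (b \<boxplus> c) d = \<theta> a (b \<boxplus> (c \<boxplus> d)) \<star>[2] (T ?A3 \<star>[1] \<theta> (b \<boxplus> c) d)"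
    using ob by (intro pre_sub[OF a'bcd _ bcd, symmetric]) simp_all
  also have "\<dots> \<star>[2] \<theta> b c = \<theta> a (b \<boxplus> (c \<boxplus> d)) \<star>[2] ((T ?A3 \<star>[1] \<theta> (b \<boxplus> c) d) \<star>[1] \<theta> b c)"
    using ob by (intro assocT[OF a'bcd post_in'[OF _ bcd] bc, symmetric]) simp_all
  also have "(T ?A3 \<star>[1] \<theta> (b \<boxplus> c) d) \<star>[1] \<theta> b c = \<theta> b (c \<boxplus> d) \<star>[2] \<theta> c d"
    using K_Alpha[OF ob(2-4)] by simp
  finally have R: "((T ?R \<star>[1] ?t) \<star>[1] \<theta> (a \<boxplus> b) c) \<star>[1] \<theta> a b
    = \<theta> a (b \<boxplus> (c \<boxplus> d)) \<star>[2] (\<theta> b (c \<boxplus> d) \<star>[2] \<theta> c d)" .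
  have h: "?L \<in> hom K (a \<boxplus> b \<boxplus> c \<boxplus> d) ?e" "?R \<in> hom K (a \<boxplus> b \<boxplus> c \<boxplus> d) ?e"
    using ob by (simp_all add: hom_iff)
  have "(T q \<star>[1] ?t) \<star>[1] \<theta> (a \<boxplus> b) c \<in> maps C Tight [a \<boxplus> b, c, d] ?e" if "q \<in> hom K (a \<boxplus> b \<boxplus> c \<boxplus> d) ?e" for q
    using that ob by (intro sub_in[OF post_in'[OF _ t] abc]) (simp_all add: hom_iff)
  from th_inj[OF this[OF h(1)] this[OF h(2)] ob(1,2)] L R
  have "(T ?L \<star>[1] ?t) \<star>[1] \<theta> (a \<boxplus> b) c = (T ?R \<star>[1] ?t) \<star>[1] \<theta> (a \<boxplus> b) c" by simp
  then show ?thesis using ob by (intro arr_inj3[OF h]) simp_all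
qed

text \<open>After the substitution of \<open>u\<close> both sides become \<open>j \<theta>\<^bsub>a,b\<^esub>\<close>, once as \<open>j(1) \<circ> \<theta>\<close> and once as \<open>\<theta> \<circ>\<^sub>1 j(1)\<close>.\<close>

lemma K_lam_alpha:
  assumes ob: "a \<in> Obj C" "b \<in> Obj C"
  shows "\<lambda>\<lambda>\<^bsub>K\<^esub> (a \<boxplus> b) \<bullet> \<alpha>\<^bsub>K\<^esub> \<iota> a b = \<lambda>\<lambda>\<^bsub>K\<^esub> a \<boxtimes> Id K b"
proof (rule arr_inj3[of _ \<iota> a b "a \<boxplus> b"])
  let ?l = "\<lambda>\<lambda>\<^bsub>K\<^esub> (a \<boxplus> b)" and ?m = "\<lambda>\<lambda>\<^bsub>K\<^esub> a"
  have ab: "\<theta> a b \<in> maps C Tight [a, b] (a \<boxplus> b)" and iab: "\<theta> \<iota> (a \<boxplus> b) \<in> maps C Tight [\<iota>, a \<boxplus> b] (\<iota> \<boxplus> (a \<boxplus> b))"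
    and ia: "\<theta> \<iota> a \<in> maps C Tight [\<iota>, a] (\<iota> \<boxplus> a)" using ob by simp_all
  have lt: "T ?l \<star>[1] \<theta> \<iota> (a \<boxplus> b) \<in> maps C Tight [\<iota>, a \<boxplus> b] (a \<boxplus> b)"
    using ob by (intro post_in'[OF _ iab]) simp_all
  have mt: "T ?m \<star>[1] \<theta> \<iota> a \<in> maps C Tight [\<iota>, a] a"
    using ob by (intro post_in'[OF _ ia]) simp_all
  have X: "(T ?l \<star>[1] \<theta> \<iota> (a \<boxplus> b)) \<star>[2] \<theta> a b \<in> maps C Tight [\<iota>, a, b] (a \<boxplus> b)"
    by (rule sub_in[OF lt ab]) simp_all
  have Y: "\<theta> a b \<star>[1] (T ?m \<star>[1] \<theta> \<iota> a) \<in> maps C Tight [\<iota>, a, b] (a \<boxplus> b)"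
    by (rule sub_in[OF ab mt]) simp_all
  have jab: "\<j> (Idm C (a \<boxplus> b)) \<star>[1] \<theta> a b = \<theta> a b \<star>[1] \<j> (Idm C a)"
    using jay_id_tight[of "\<theta> a b"] sub_jay_id_1[of "\<theta> a b"] mapsD[OF ab] by simp
  have 1: "(T (?l \<bullet> \<alpha>\<^bsub>K\<^esub> \<iota> a b) \<star>[1] \<theta> (\<iota> \<boxplus> a) b) \<star>[1] \<theta> \<iota> a = (T ?l \<star>[1] \<theta> \<iota> (a \<boxplus> b)) \<star>[2] \<theta> a b"
    using ob K_Alpha[of \<iota> a b] post_sub[OF _ iab ab, of ?l 2] by (subst post3) simp_all
  have 2: "(T (?m \<boxtimes> Id K b) \<star>[1] \<theta> (\<iota> \<boxplus> a) b) \<star>[1] \<theta> \<iota> a = \<theta> a b \<star>[1] (T ?m \<star>[1] \<theta> \<iota> a)"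
    using ob th_nat1[of ?m b] by (subst pre_sub[OF ab _ ia]) simp_all
  have "((T ?l \<star>[1] \<theta> \<iota> (a \<boxplus> b)) \<star>[2] \<theta> a b) \<star>[1] u = ((T ?l \<star>[1] \<theta> \<iota> (a \<boxplus> b)) \<star>[1] u) \<star>[1] \<theta> a b"
    by (rule commT[OF lt u_in ab, symmetric]) simp_all
  also have "\<dots> = \<theta> a b \<star>[1] ((T ?m \<star>[1] \<theta> \<iota> a) \<star>[1] u)"
    using ob jab K_Lam[of "a \<boxplus> b"] K_Lam[of a] by simp
  also have "\<dots> = (\<theta> a b \<star>[1] (T ?m \<star>[1] \<theta> \<iota> a)) \<star>[1] u"
    by (rule assocT[OF ab mt u_in]) simp_all
  finally have "(T ?l \<star>[1] \<theta> \<iota> (a \<boxplus> b)) \<star>[2] \<theta> a b = \<theta> a b \<star>[1] (T ?m \<star>[1] \<theta> \<iota> a)"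
    by (rule u_inj[OF X Y]) simp
  then show "(T (?l \<bullet> \<alpha>\<^bsub>K\<^esub> \<iota> a b) \<star>[1] \<theta> (\<iota> \<boxplus> a) b) \<star>[1] \<theta> \<iota> a = (T (?m \<boxtimes> Id K b) \<star>[1] \<theta> (\<iota> \<boxplus> a) b) \<star>[1] \<theta> \<iota> a"
    using 1 2 by simp
qed (use ob in \<open>simp_all add: hom_iff\<close>)

text \<open>Both sides become the substitution of \<open>u\<close> into the last input of \<open>\<theta>\<^bsub>a,bi\<^esub> \<circ>\<^sub>2 \<theta>\<^bsub>b,i\<^esub>\<close>.\<close>

lemma K_alpha_rho:
  assumes ob: "a \<in> Obj C" "b \<in> Obj C"
  shows "\<alpha>\<^bsub>K\<^esub> a b \<iota> \<bullet> \<rho>\<^bsub>K\<^esub> (a \<boxplus> b) = Id K a \<boxtimes> \<rho>\<^bsub>K\<^esub> b"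
proof (rule arr_inj2[of _ a b "a \<boxplus> (b \<boxplus> \<iota>)"])
  let ?A = "\<alpha>\<^bsub>K\<^esub> a b \<iota>"
  have ab: "\<theta> a b \<in> maps C Tight [a, b] (a \<boxplus> b)" and abi: "\<theta> (a \<boxplus> b) \<iota> \<in> maps C Tight [a \<boxplus> b, \<iota>] (a \<boxplus> b \<boxplus> \<iota>)"
    and bi: "\<theta> b \<iota> \<in> maps C Tight [b, \<iota>] (b \<boxplus> \<iota>)" and a'bi: "\<theta> a (b \<boxplus> \<iota>) \<in> maps C Tight [a, b \<boxplus> \<iota>] (a \<boxplus> (b \<boxplus> \<iota>))"
    using ob by simp_all
  have abiab: "\<theta> (a \<boxplus> b) \<iota> \<star>[1] \<theta> a b \<in> maps C Tight [a, b, \<iota>] (a \<boxplus> b \<boxplus> \<iota>)" by (rule sub_in[OF abi ab]) simp_all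
  have r: "\<theta> (a \<boxplus> b) \<iota> \<star>[2] u \<in> maps C Tight [a \<boxplus> b] (a \<boxplus> b \<boxplus> \<iota>)" by (rule sub_in[OF abi u_in]) simp_all
  have "T (?A \<bullet> \<rho>\<^bsub>K\<^esub> (a \<boxplus> b)) \<star>[1] \<theta> a b = T ?A \<star>[1] ((\<theta> (a \<boxplus> b) \<iota> \<star>[2] u) \<star>[1] \<theta> a b)"
    using ob by (simp add: post_assoc[OF _ _ _ ab, unfolded One_nat_def] K_Rho[symmetric])
  also have "(\<theta> (a \<boxplus> b) \<iota> \<star>[2] u) \<star>[1] \<theta> a b = (\<theta> (a \<boxplus> b) \<iota> \<star>[1] \<theta> a b) \<star>[3] u"
    by (rule commT[OF abi ab u_in, symmetric]) simp_all
  also have "T ?A \<star>[1] \<dots> = (T ?A \<star>[1] (\<theta> (a \<boxplus> b) \<iota> \<star>[1] \<theta> a b)) \<star>[3] u"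
    using ob by (intro post_sub[OF _ abiab u_in, symmetric]) simp_all
  also have "T ?A \<star>[1] (\<theta> (a \<boxplus> b) \<iota> \<star>[1] \<theta> a b) = \<theta> a (b \<boxplus> \<iota>) \<star>[2] \<theta> b \<iota>"
    using ob K_Alpha[of a b \<iota>] by (subst post_sub[OF _ abi ab, symmetric]) simp_all
  also have "\<dots> \<star>[3] u = \<theta> a (b \<boxplus> \<iota>) \<star>[2] (\<theta> b \<iota> \<star>[2] u)"
    by (rule assocT[OF a'bi bi u_in, symmetric]) simp_all
  also have "\<dots> = T (Id K a \<boxtimes> \<rho>\<^bsub>K\<^esub> b) \<star>[1] \<theta> a b"
    using ob th_nat2[of "\<rho>\<^bsub>K\<^esub> b" a] by (simp add: K_Rho)
  finally show "T (?A \<bullet> \<rho>\<^bsub>K\<^esub> (a \<boxplus> b)) \<star>[1] \<theta> a b = T (Id K a \<boxtimes> \<rho>\<^bsub>K\<^esub> b) \<star>[1] \<theta> a b" .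
qed (use ob in \<open>simp_all add: hom_iff\<close>)

text \<open>The composite becomes \<open>\<theta>\<^bsub>a,b\<^esub> \<circ>\<^sub>2 j(1\<^sub>b)\<close>, and \<open>j(1)\<close> has no effect in the second input of a tight map.\<close>

lemma K_triangle:
  assumes ob: "a \<in> Obj C" "b \<in> Obj C"
  shows "(Id K a \<boxtimes> \<lambda>\<lambda>\<^bsub>K\<^esub> b) \<bullet> \<alpha>\<^bsub>K\<^esub> a \<iota> b \<bullet> (\<rho>\<^bsub>K\<^esub> a \<boxtimes> Id K b) = Id K (a \<boxplus> b)"
proof (rule arr_inj2[of _ a b "a \<boxplus> b"])
  let ?A = "\<alpha>\<^bsub>K\<^esub> a \<iota> b" and ?r = "\<rho>\<^bsub>K\<^esub> a" and ?l = "\<lambda>\<lambda>\<^bsub>K\<^esub> b"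
  let ?q = "(Id K a \<boxtimes> ?l) \<bullet> ?A"
  have aib: "\<theta> (a \<boxplus> \<iota>) b \<in> maps C Tight [a \<boxplus> \<iota>, b] (a \<boxplus> \<iota> \<boxplus> b)" and ai: "\<theta> a \<iota> \<in> maps C Tight [a, \<iota>] (a \<boxplus> \<iota>)"
    and a'ib: "\<theta> a (\<iota> \<boxplus> b) \<in> maps C Tight [a, \<iota> \<boxplus> b] (a \<boxplus> (\<iota> \<boxplus> b))" and ib: "\<theta> \<iota> b \<in> maps C Tight [\<iota>, b] (\<iota> \<boxplus> b)"
    and ab: "\<theta> a b \<in> maps C Tight [a, b] (a \<boxplus> b)"
    using ob by simp_all
  have aibai: "\<theta> (a \<boxplus> \<iota>) b \<star>[1] \<theta> a \<iota> \<in> maps C Tight [a, \<iota>, b] (a \<boxplus> \<iota> \<boxplus> b)" by (rule sub_in[OF aib ai]) simp_all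
  have lib: "T ?l \<star>[1] \<theta> \<iota> b \<in> maps C Tight [\<iota>, b] b" using ob by (intro post_in'[OF _ ib]) simp_all
  have "T (?q \<bullet> (?r \<boxtimes> Id K b)) \<star>[1] \<theta> a b = T ?q \<star>[1] (\<theta> (a \<boxplus> \<iota>) b \<star>[1] (\<theta> a \<iota> \<star>[2] u))"
    using ob th_nat1[of ?r b] by (simp add: post_assoc[OF _ _ _ ab, unfolded One_nat_def] K_Rho[symmetric])
  also have "\<theta> (a \<boxplus> \<iota>) b \<star>[1] (\<theta> a \<iota> \<star>[2] u) = (\<theta> (a \<boxplus> \<iota>) b \<star>[1] \<theta> a \<iota>) \<star>[2] u"
    by (rule assocT[OF aib ai u_in]) simp_all
  also have "T ?q \<star>[1] \<dots> = (T ?q \<star>[1] (\<theta> (a \<boxplus> \<iota>) b \<star>[1] \<theta> a \<iota>)) \<star>[2] u"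
    using ob by (intro post_sub[OF _ aibai u_in, symmetric]) simp_all
  also have "T ?q \<star>[1] (\<theta> (a \<boxplus> \<iota>) b \<star>[1] \<theta> a \<iota>) = (T ?q \<star>[1] \<theta> (a \<boxplus> \<iota>) b) \<star>[1] \<theta> a \<iota>"
    using ob by (intro post_sub[OF _ aib ai, symmetric]) simp_all
  also have "\<dots> = T (Id K a \<boxtimes> ?l) \<star>[1] (\<theta> a (\<iota> \<boxplus> b) \<star>[2] \<theta> \<iota> b)"
    using ob K_Alpha[of a \<iota> b] by (subst post3) simp_all
  also have "\<dots> = (T (Id K a \<boxtimes> ?l) \<star>[1] \<theta> a (\<iota> \<boxplus> b)) \<star>[2] \<theta> \<iota> b"
    using ob by (intro post_sub[OF _ a'ib ib, symmetric]) simp_all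
  also have "\<dots> = (\<theta> a b \<star>[2] T ?l) \<star>[2] \<theta> \<iota> b"
    using th_nat2[of ?l a] ob by simp
  also have "\<dots> = \<theta> a b \<star>[2] (T ?l \<star>[1] \<theta> \<iota> b)"
    using ob by (intro pre_sub[OF ab _ ib, symmetric]) simp_all
  also have "\<dots> \<star>[2] u = \<theta> a b \<star>[2] ((T ?l \<star>[1] \<theta> \<iota> b) \<star>[1] u)"
    by (rule assocT[OF ab lib u_in, symmetric]) simp_all
  also have "\<dots> = \<theta> a b"
    using K_Lam[OF ob(2)] sub_jay_id_2[of "\<theta> a b"] mapsD[OF ab] by simp
  also have "\<dots> = T (Id K (a \<boxplus> b)) \<star>[1] \<theta> a b" using ob by (simp add: K_Id id_subT[OF ab, unfolded One_nat_def])
  finally show "T (?q \<bullet> (?r \<boxtimes> Id K b)) \<star>[1] \<theta> a b = T (Id K (a \<boxplus> b)) \<star>[1] \<theta> a b" .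
qed (use ob in \<open>simp_all add: hom_iff\<close>)

text \<open>After substituting \<open>u\<close> for the remaining input both sides are \<open>u\<close>, since \<open>j(1) \<circ> u = u\<close>.\<close>

lemma K_lam_rho: "\<lambda>\<lambda>\<^bsub>K\<^esub> \<iota> \<bullet> \<rho>\<^bsub>K\<^esub> \<iota> = Id K \<iota>"
proof (rule arr_eqT, rule u_inj[of _ "[]" \<iota>])
  let ?l = "\<lambda>\<lambda>\<^bsub>K\<^esub> \<iota>"
  have t: "\<theta> \<iota> \<iota> \<in> maps C Tight [\<iota>, \<iota>] (\<iota> \<boxplus> \<iota>)" by simp
  have lt: "T ?l \<star>[1] \<theta> \<iota> \<iota> \<in> maps C Tight [\<iota>, \<iota>] \<iota>" by (rule post_in'[OF _ t]) simp_all
  have "T (?l \<bullet> \<rho>\<^bsub>K\<^esub> \<iota>) \<star>[1] u = ((T ?l \<star>[1] \<theta> \<iota> \<iota>) \<star>[2] u) \<star>[1] u"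
    by (simp add: K_Comp K_Rho post_sub[OF _ t u_in, unfolded One_nat_def])
  also have "\<dots> = ((T ?l \<star>[1] \<theta> \<iota> \<iota>) \<star>[1] u) \<star>[1] u"
    by (rule commT[OF lt u_in u_in, symmetric]) simp_all
  also have "\<dots> = u" using K_Lam[of \<iota>] jay_id_null[of u] mapsD[OF u_in] by simp
  also have "\<dots> = T (Id K \<iota>) \<star>[1] u" by (simp add: K_Id id_subT[OF u_in, unfolded One_nat_def])
  finally show "T (?l \<bullet> \<rho>\<^bsub>K\<^esub> \<iota>) \<star>[1] u = T (Id K \<iota>) \<star>[1] u" .
qed (use T_in[of "\<lambda>\<lambda>\<^bsub>K\<^esub> \<iota> \<bullet> \<rho>\<^bsub>K\<^esub> \<iota>"] T_in[of "Id K \<iota>"] in simp_all)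

lemma K_id_left: "f \<in> Ar K \<Longrightarrow> Id K (tgt f) \<bullet> f = f"
  using id_subT[OF T_in[of f]] by (intro arr_eqT) (simp add: K_Comp K_Id)

lemma K_id_right: "f \<in> Ar K \<Longrightarrow> f \<bullet> Id K (src f) = f"
  using sub_idT[OF T_in[of f], of 1 "src f"] by (intro arr_eqT) (simp add: K_Comp K_Id)

theorem K_skew_monoidal: "skew_monoidal K"
proof (unfold_locales, goal_cases)
  case (6 h g f)
  then show ?case
    by (intro arr_eqT) (simp add: K_Comp assocT[OF T_in T_in T_in])
qed (simp_all add: K_Ob K_Ten K_Unit hom_iff K_id_left K_id_right K_ten_id K_ten_comp K_alpha_nat K_lam_nat K_rho_nat
    K_pentagon K_lam_alpha K_alpha_rho K_triangle K_lam_rho)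

end

section \<open>Multimaps as arrows out of left-bracketed products\<close>

text \<open>The universal multimaps \<open>a, x\<^sub>1, \<dots>, x\<^sub>n \<rightarrow> a \<cdot> x\<^sub>1 \<dots> x\<^sub>n\<close>; below they are written \<open>\<Theta>\<close>, and \<open>\<Theta>\<Theta>\<close> for the
  inputs of a tight or loose multimap.\<close>

fun theta_list :: "('o, 'm) multi \<Rightarrow> ('o, 'm) lr_data \<Rightarrow> 'o \<Rightarrow> 'o list \<Rightarrow> ('o, 'm) mmap" where
  "theta_list C R a [] = Idm C a"
| "theta_list C R a (x # xs) = theta_list C R (prd R a x) xs \<star>[1]\<^bsub>C\<^esub> theta R a x"

definition universal :: "('o, 'm) multi \<Rightarrow> ('o, 'm) lr_data \<Rightarrow> tightness \<Rightarrow> 'o list \<Rightarrow> ('o, 'm) mmap" where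
  "universal C R x as = (if x = Tight then theta_list C R (hd as) (tl as) else theta_list C R (uob R) as \<star>[1]\<^bsub>C\<^esub> umap R)"

text \<open>The comparison from \<open>M_ob K\<close> to the multicategory itself, below also \<open>EE\<close>: compose the arrow of a
  multimap with the universal multimap of its inputs.\<close>

definition realize :: "('o, 'm) multi \<Rightarrow> ('o, 'm) lr_data \<Rightarrow> ('o, 'm) skewmon \<Rightarrow> ('o, 'm) mmap \<Rightarrow> ('o, 'm) mmap" where
  "realize C R K f = to_mmap (arr_of K f) \<star>[1]\<^bsub>C\<^esub> universal C R (ty f) (ins f)"

lemma universal_simps [simp]:
  "universal C R Tight (a # as) = theta_list C R a as"
  "universal C R Loose as = theta_list C R (uob R) as \<star>[1]\<^bsub>C\<^esub> umap R"
  by (simp_all add: universal_def)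

sublocale rep_skewmon \<subseteq> KM: skew_mon K
  using K_skew_monoidal by (simp add: skew_mon_iff)

context rep_skewmon
begin

declare K_Ob [simp] K_Ten [simp] K_Unit [simp]

abbreviation "\<Theta> \<equiv> theta_list C R"
abbreviation "\<Theta>\<Theta> \<equiv> universal C R"
abbreviation "EE \<equiv> realize C R K"
abbreviation "fo \<equiv> lten K"

lemma fo_ob: "a \<in> Obj C \<Longrightarrow> set xs \<subseteq> Obj C \<Longrightarrow> fo a xs \<in> Obj C"
  using KM.lten_ob by simp

lemma theta_list_in:
  assumes "a \<in> Obj C" "set xs \<subseteq> Obj C" "s \<longrightarrow> length xs \<le> 3"
  shows "\<Theta> a xs \<in> maps C Tight (a # xs) (fo a xs)"
  using assms
proof (induction xs arbitrary: a)
  case Nil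
  then show ?case by (simp add: idm)
next
  case (Cons x xs)
  have 1: "\<Theta> (a \<boxplus> x) xs \<in> maps C Tight (a \<boxplus> x # xs) (fo (a \<boxplus> x) xs)"
    using Cons.prems by (intro Cons.IH) auto
  have 2: "\<theta> a x \<in> maps C Tight [a, x] (a \<boxplus> x)" using Cons.prems by simp
  have "\<Theta> (a \<boxplus> x) xs \<star>[1] \<theta> a x \<in> maps C Tight (a # x # xs) (fo (a \<boxplus> x) xs)"
    using Cons.prems by (intro sub_in[OF 1 2]) auto
  then show ?case by simp
qed

lemma theta_list_snoc1: "a \<in> Obj C \<Longrightarrow> x \<in> Obj C \<Longrightarrow> \<Theta> a [x] = \<theta> a x"
  using id_subT[OF th_in[of a x]] by simp

lemma universal_in:
  assumes "set as \<subseteq> Obj C" "uins K x as \<noteq> []" "arity_ok s x (length as)"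
  shows "\<Theta>\<Theta> x as \<in> maps C x as (prodl K (uins K x as))"
proof (cases x)
  case Tight
  then show ?thesis using assms by (cases as) (auto intro!: theta_list_in)
next
  case Loose
  have 1: "\<Theta> \<iota> as \<in> maps C Tight (\<iota> # as) (fo \<iota> as)"
    using assms Loose by (intro theta_list_in) auto
  have "\<Theta> \<iota> as \<star>[1] u \<in> maps C Loose as (fo \<iota> as)"
    using assms Loose by (intro sub_in[OF 1 u_in]) auto
  then show ?thesis using Loose by simp
qed

lemma theta_list_append:
  assumes "a \<in> Obj C" "set xs \<subseteq> Obj C" "set ys \<subseteq> Obj C" "s \<longrightarrow> length xs + length ys \<le> 3"
  shows "\<Theta> a (xs @ ys) = \<Theta> (fo a xs) ys \<star>[1] \<Theta> a xs"
  using assms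
proof (induction xs arbitrary: a)
  case Nil
  have "\<Theta> a ys \<in> maps C Tight (a # ys) (fo a ys)" using Nil by (intro theta_list_in) auto
  then have "\<Theta> a ys \<star>[1] Idm C a = \<Theta> a ys" by (rule sub_idT) simp_all
  then show ?case by simp
next
  case (Cons x xs)
  have 1: "\<Theta> (fo (a \<boxplus> x) xs) ys \<in> maps C Tight (fo (a \<boxplus> x) xs # ys) (fo (fo (a \<boxplus> x) xs) ys)"
    using Cons.prems by (intro theta_list_in fo_ob) auto
  have 2: "\<Theta> (a \<boxplus> x) xs \<in> maps C Tight (a \<boxplus> x # xs) (fo (a \<boxplus> x) xs)"
    using Cons.prems by (intro theta_list_in) auto
  have 3: "\<theta> a x \<in> maps C Tight [a, x] (a \<boxplus> x)" using Cons.prems by simp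
  have "\<Theta> a ((x # xs) @ ys) = (\<Theta> (fo (a \<boxplus> x) xs) ys \<star>[1] \<Theta> (a \<boxplus> x) xs) \<star>[1] \<theta> a x"
    using Cons.prems Cons.IH[of "a \<boxplus> x"] by auto
  also have "\<dots> = \<Theta> (fo (a \<boxplus> x) xs) ys \<star>[1] (\<Theta> (a \<boxplus> x) xs \<star>[1] \<theta> a x)"
    using Cons.prems by (intro assocT[OF 1 2 3, symmetric]) auto
  finally show ?case by simp
qed

lemma universal_append:
  assumes "set as \<subseteq> Obj C" "set bs \<subseteq> Obj C" "uins K x as \<noteq> []" "arity_ok s x (length as + length bs)"
  shows "\<Theta>\<Theta> x (as @ bs) = \<Theta> (prodl K (uins K x as)) bs \<star>[1] \<Theta>\<Theta> x as"
proof (cases x)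
  case Tight
  then obtain a as' where "as = a # as'" using assms(3) by (cases as) auto
  then show ?thesis using Tight assms by (auto intro!: theta_list_append[unfolded One_nat_def])
next
  case Loose
  have 1: "\<Theta> (fo \<iota> as) bs \<in> maps C Tight (fo \<iota> as # bs) (fo (fo \<iota> as) bs)"
    using assms Loose by (intro theta_list_in fo_ob) auto
  have 2: "\<Theta> \<iota> as \<in> maps C Tight (\<iota> # as) (fo \<iota> as)"
    using assms Loose by (intro theta_list_in) auto
  have "\<Theta> \<iota> (as @ bs) = \<Theta> (fo \<iota> as) bs \<star>[1] \<Theta> \<iota> as"
    using assms Loose by (intro theta_list_append) auto
  moreover have "(\<Theta> (fo \<iota> as) bs \<star>[1] \<Theta> \<iota> as) \<star>[1] u = \<Theta> (fo \<iota> as) bs \<star>[1] (\<Theta> \<iota> as \<star>[1] u)"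
    using assms Loose by (intro assocT[OF 1 2 u_in, symmetric]) auto
  ultimately show ?thesis using Loose by simp
qed

lemma uins_ob [simp]: "set (uins K x as) \<subseteq> Obj C \<longleftrightarrow> set as \<subseteq> Obj C"
  by (simp add: uins_def)

lemma prodl_uins_ob: "set as \<subseteq> Obj C \<Longrightarrow> uins K x as \<noteq> [] \<Longrightarrow> prodl K (uins K x as) \<in> Obj C"
  using KM.prodl_ob[of "uins K x as"] by simp

lemma prodl_uins_snoc: "uins K x as \<noteq> [] \<Longrightarrow> prodl K (uins K x (as @ [y])) = prodl K (uins K x as) \<boxplus> y"
  by (simp add: uins_append)

lemma uins_snoc_ne [simp]: "uins K x (as @ y # ys) \<noteq> []"
  by (simp add: uins_def)

text \<open>Naturality of \<open>\<theta>\<close> in its first variable, iterated: an arrow moves past \<open>\<Theta>\<close> when it is tensored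
  with the remaining inputs.\<close>

lemma theta_list_post:
  assumes "n \<in> Ar K" "src n = prodl K (uins K x as)" "uins K x as \<noteq> []" "set as \<subseteq> Obj C" "set ys \<subseteq> Obj C"
    "arity_ok s x (length as + length ys)"
  shows "\<Theta> (tgt n) ys \<star>[1] (T n \<star>[1] \<Theta>\<Theta> x as) = T (ltenA K n ys) \<star>[1] \<Theta>\<Theta> x (as @ ys)"
  using assms
proof (induction ys arbitrary: n as)
  case Nil
  have "\<Theta>\<Theta> x as \<in> maps C x as (src n)" using Nil universal_in[of as x] by auto
  then have "T n \<star>[1] \<Theta>\<Theta> x as \<in> maps C x as (tgt n)" using Nil by (intro post_in') auto
  from id_subT[OF this] show ?case by simp
next
  case (Cons y ys)
  let ?n = "n \<boxtimes> Id K y" and ?b = "tgt n" and ?a = "src n"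
  have o: "?b \<in> Obj C" "?a \<in> Obj C" "y \<in> Obj C" "set ys \<subseteq> Obj C"
    using Cons.prems ob_arr[of n] by auto
  have len: "s \<longrightarrow> x = Tight \<longrightarrow> Suc (length as + length ys) \<le> 4" "s \<longrightarrow> x = Loose \<longrightarrow> Suc (length as + length ys) \<le> 2"
    using Cons.prems by auto
  have la: "x = Tight \<longrightarrow> 1 \<le> length as" using Cons.prems by (cases as) auto
  have ops: "op_ok s Tight (Suc (Suc 0)) x (length as)" "op_ok s Tight (Suc (length ys)) x (Suc (length as))"
    "op_ok s Tight (Suc (Suc (length ys))) x (length as)" "arity_ok s x (length as)" "arity_ok s x (length (as @ [y]) + length ys)"
    "s \<longrightarrow> length ys \<le> 2"
    using len la by (cases x; auto)+
  have 0: "\<Theta>\<Theta> x as \<in> maps C x as ?a" using Cons.prems ops universal_in[of as x] by auto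
  have 1: "T n \<star>[1] \<Theta>\<Theta> x as \<in> maps C x as ?b" using Cons.prems 0 by (intro post_in') auto
  have 2: "\<theta> ?b y \<in> maps C Tight [?b, y] (?b \<boxplus> y)" and t2: "\<theta> ?a y \<in> maps C Tight [?a, y] (?a \<boxplus> y)" using o by simp_all
  have 3: "\<Theta> (?b \<boxplus> y) ys \<in> maps C Tight (?b \<boxplus> y # ys) (fo (?b \<boxplus> y) ys)"
    using Cons.prems o len by (intro theta_list_in) (cases x; auto)+
  have snoc: "\<Theta>\<Theta> x (as @ [y]) = \<theta> ?a y \<star>[1] \<Theta>\<Theta> x as"
    using Cons.prems o ops universal_append[of as "[y]" x] theta_list_snoc1[of ?a y] len by (cases x) auto
  have "\<Theta> ?b (y # ys) \<star>[1] (T n \<star>[1] \<Theta>\<Theta> x as) = (\<Theta> (?b \<boxplus> y) ys \<star>[1] \<theta> ?b y) \<star>[1] (T n \<star>[1] \<Theta>\<Theta> x as)"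
    by simp
  also have "\<dots> = \<Theta> (?b \<boxplus> y) ys \<star>[1] (\<theta> ?b y \<star>[1] (T n \<star>[1] \<Theta>\<Theta> x as))"
    using len ops by (intro assocT[OF 3 2 1, symmetric]) simp_all
  also have "\<theta> ?b y \<star>[1] (T n \<star>[1] \<Theta>\<Theta> x as) = (\<theta> ?b y \<star>[1] T n) \<star>[1] \<Theta>\<Theta> x as"
    using Cons.prems ops by (intro pre_sub[OF 2 _ 0]) simp_all
  also have "\<theta> ?b y \<star>[1] T n = T ?n \<star>[1] \<theta> ?a y" using th_nat1[of n y] Cons.prems o by simp
  also have "\<dots> \<star>[1] \<Theta>\<Theta> x as = T ?n \<star>[1] \<Theta>\<Theta> x (as @ [y])"
    unfolding snoc using Cons.prems o ops by (intro post_sub[OF _ t2 0]) simp_all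
  also have "\<Theta> (?b \<boxplus> y) ys \<star>[1] (T ?n \<star>[1] \<Theta>\<Theta> x (as @ [y])) = T (ltenA K ?n ys) \<star>[1] \<Theta>\<Theta> x ((as @ [y]) @ ys)"
    using Cons.IH[of ?n "as @ [y]"] Cons.prems o ops prodl_uins_snoc[of x as y] by simp
  finally show ?case by simp
qed

text \<open>The defining equation of \<open>\<alpha>\<close>, for several factors.\<close>

lemma th_lassoc:
  assumes "p \<in> Obj C" "a \<in> Obj C" "set xs \<subseteq> Obj C" "s \<longrightarrow> length xs \<le> 2"
  shows "\<theta> p (fo a xs) \<star>[2] \<Theta> a xs = T (lassoc K p a xs) \<star>[1] \<Theta> p (a # xs)"
  using assms
proof (induction xs arbitrary: a)
  case Nil
  have 1: "\<theta> p a \<in> maps C Tight [p, a] (p \<boxplus> a)" using Nil by simp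
  have "\<theta> p a \<star>[2] Idm C a = \<theta> p a" by (rule sub_idT[OF 1]) simp_all
  then show ?case using Nil id_subT[OF 1] by (simp add: K_Id)
next
  case (Cons x xs)
  have o: "x \<in> Obj C" "set xs \<subseteq> Obj C" "a \<boxplus> x \<in> Obj C" "fo (a \<boxplus> x) xs \<in> Obj C" using Cons.prems by (auto intro: fo_ob)
  let ?z = "fo (a \<boxplus> x) xs" and ?f = "lassoc K p (a \<boxplus> x) xs" and ?A = "\<alpha>\<^bsub>K\<^esub> p a x"
  have 1: "\<theta> p ?z \<in> maps C Tight [p, ?z] (p \<boxplus> ?z)" using Cons.prems o by simp
  have 2: "\<Theta> (a \<boxplus> x) xs \<in> maps C Tight (a \<boxplus> x # xs) ?z" using Cons.prems o by (intro theta_list_in) auto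
  have 3: "\<theta> a x \<in> maps C Tight [a, x] (a \<boxplus> x)" using Cons.prems by simp
  have 4: "\<Theta> p (a \<boxplus> x # xs) \<in> maps C Tight (p # a \<boxplus> x # xs) (fo p (a \<boxplus> x # xs))"
    using Cons.prems o by (intro theta_list_in) auto
  have 5: "\<Theta> (p \<boxplus> (a \<boxplus> x)) xs \<in> maps C Tight (p \<boxplus> (a \<boxplus> x) # xs) (fo (p \<boxplus> (a \<boxplus> x)) xs)"
    using Cons.prems o by (intro theta_list_in) auto
  have 6: "\<theta> p (a \<boxplus> x) \<in> maps C Tight [p, a \<boxplus> x] (p \<boxplus> (a \<boxplus> x))" and 7: "\<theta> (p \<boxplus> a) x \<in> maps C Tight [p \<boxplus> a, x] (p \<boxplus> a \<boxplus> x)"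
    and 8: "\<theta> p a \<in> maps C Tight [p, a] (p \<boxplus> a)"
    using Cons.prems o by simp_all
  have A: "?A \<in> Ar K" "src ?A = p \<boxplus> a \<boxplus> x" "tgt ?A = p \<boxplus> (a \<boxplus> x)" using Cons.prems o by simp_all
  have f: "?f \<in> Ar K" "src ?f = fo p (a \<boxplus> x # xs)" "tgt ?f = p \<boxplus> ?z" using Cons.prems o by simp_all
  have \<Theta>3: "\<Theta> p [a, x] = \<theta> (p \<boxplus> a) x \<star>[1] \<theta> p a" using Cons.prems o theta_list_snoc1[of "p \<boxplus> a" x] by simp
  have "\<theta> p ?z \<star>[2] \<Theta> a (x # xs) = \<theta> p ?z \<star>[2] (\<Theta> (a \<boxplus> x) xs \<star>[1] \<theta> a x)" by simp
  also have "\<dots> = (\<theta> p ?z \<star>[2] \<Theta> (a \<boxplus> x) xs) \<star>[2] \<theta> a x"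
    using Cons.prems by (intro assocT[OF 1 2 3]) auto
  also have "\<dots> = (T ?f \<star>[1] \<Theta> p (a \<boxplus> x # xs)) \<star>[2] \<theta> a x"
    using Cons.prems o Cons.IH[of "a \<boxplus> x"] by auto
  also have "\<dots> = T ?f \<star>[1] (\<Theta> p (a \<boxplus> x # xs) \<star>[2] \<theta> a x)"
    using Cons.prems f by (intro post_sub[OF _ 4 3]) auto
  also have "\<Theta> p (a \<boxplus> x # xs) \<star>[2] \<theta> a x = (\<Theta> (p \<boxplus> (a \<boxplus> x)) xs \<star>[1] \<theta> p (a \<boxplus> x)) \<star>[2] \<theta> a x" by simp
  also have "\<dots> = \<Theta> (p \<boxplus> (a \<boxplus> x)) xs \<star>[1] (\<theta> p (a \<boxplus> x) \<star>[2] \<theta> a x)"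
    using Cons.prems by (intro assocT[OF 5 6 3, symmetric]) auto
  also have "\<theta> p (a \<boxplus> x) \<star>[2] \<theta> a x = (T ?A \<star>[1] \<theta> (p \<boxplus> a) x) \<star>[1] \<theta> p a"
    using Cons.prems K_Alpha[of p a x] by simp
  also have "\<dots> = T ?A \<star>[1] \<Theta> p [a, x]"
    unfolding \<Theta>3 using A by (intro post_sub[OF _ 7 8]) simp_all
  also have "\<Theta> (p \<boxplus> (a \<boxplus> x)) xs \<star>[1] (T ?A \<star>[1] \<Theta> p [a, x]) = T (ltenA K ?A xs) \<star>[1] \<Theta> p ([a, x] @ xs)"
    using theta_list_post[of ?A Tight "[p, a, x]" xs] A Cons.prems o by simp
  also have "T ?f \<star>[1] \<dots> = T (?f \<bullet> ltenA K ?A xs) \<star>[1] \<Theta> p ([a, x] @ xs)"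
  proof (rule post_assoc[symmetric])
    show "\<Theta> p ([a, x] @ xs) \<in> maps C Tight (p # [a, x] @ xs) (fo p ([a, x] @ xs))"
      using Cons.prems o by (intro theta_list_in) auto
  qed (use A f Cons.prems o in simp_all)
  finally show ?case by simp
qed

text \<open>For loose multimaps the definition of \<open>\<rho>\<close> as \<open>\<theta> \<circ>\<^sub>2 u\<close> enters.\<close>

lemma th_gather:
  assumes "p \<in> Obj C" "set as \<subseteq> Obj C" "uins K x as \<noteq> []" "op_ok s Tight (Suc (Suc 0)) x (length as)"
  shows "\<theta> p (prodl K (uins K x as)) \<star>[2] \<Theta>\<Theta> x as = T (gather K p x as) \<star>[1] \<Theta> p as"
proof (cases x)
  case Tight
  then obtain a as' where "as = a # as'" using assms(3) by (cases as) auto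
  then show ?thesis using Tight assms th_lassoc[of p a as'] by (simp add: gather_def)
next
  case Loose
  have len: "s \<longrightarrow> length as \<le> 1" using assms(4) Loose by auto
  let ?z = "fo \<iota> as" and ?f = "lassoc K p \<iota> as" and ?r = "\<rho>\<^bsub>K\<^esub> p"
  have z: "?z \<in> Obj C" using assms by (simp add: fo_ob)
  have 1: "\<theta> p ?z \<in> maps C Tight [p, ?z] (p \<boxplus> ?z)" using assms z by simp
  have 2: "\<Theta> \<iota> as \<in> maps C Tight (\<iota> # as) ?z" using assms len by (intro theta_list_in) auto
  have 3: "\<Theta> p (\<iota> # as) \<in> maps C Tight (p # \<iota> # as) (fo p (\<iota> # as))" using assms len by (intro theta_list_in) auto
  have 4: "\<Theta> (p \<boxplus> \<iota>) as \<in> maps C Tight (p \<boxplus> \<iota> # as) (fo (p \<boxplus> \<iota>) as)" using assms len by (intro theta_list_in) auto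
  have 5: "\<theta> p \<iota> \<in> maps C Tight [p, \<iota>] (p \<boxplus> \<iota>)" using assms by simp
  have 6: "\<Theta> p as \<in> maps C Tight (p # as) (fo p as)" using assms len by (intro theta_list_in) auto
  have f: "?f \<in> Ar K" "src ?f = fo p (\<iota> # as)" "tgt ?f = p \<boxplus> ?z" using assms by simp_all
  have r: "?r \<in> Ar K" "src ?r = p" "tgt ?r = p \<boxplus> \<iota>" using assms by simp_all
  have "\<theta> p ?z \<star>[2] (\<Theta> \<iota> as \<star>[1] u) = (\<theta> p ?z \<star>[2] \<Theta> \<iota> as) \<star>[2] u"
    using len by (intro assocT[OF 1 2 u_in]) auto
  also have "\<dots> = (T ?f \<star>[1] \<Theta> p (\<iota> # as)) \<star>[2] u" using assms len th_lassoc[of p \<iota> as] by auto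
  also have "\<dots> = T ?f \<star>[1] (\<Theta> p (\<iota> # as) \<star>[2] u)"
    using len f by (intro post_sub[OF _ 3 u_in]) auto
  also have "\<Theta> p (\<iota> # as) \<star>[2] u = (\<Theta> (p \<boxplus> \<iota>) as \<star>[1] \<theta> p \<iota>) \<star>[2] u" by simp
  also have "\<dots> = \<Theta> (p \<boxplus> \<iota>) as \<star>[1] (\<theta> p \<iota> \<star>[2] u)"
    using len by (intro assocT[OF 4 5 u_in, symmetric]) auto
  also have "\<theta> p \<iota> \<star>[2] u = T ?r \<star>[1] \<Theta>\<Theta> Tight [p]"
    using assms sub_idT[OF T_in[OF r(1)], of 1 p] r by (simp add: K_Rho)
  also have "\<Theta> (p \<boxplus> \<iota>) as \<star>[1] (T ?r \<star>[1] \<Theta>\<Theta> Tight [p]) = T (ltenA K ?r as) \<star>[1] \<Theta> p as"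
    using theta_list_post[of ?r Tight "[p]" as] r assms len by auto
  also have "T ?f \<star>[1] \<dots> = T (?f \<bullet> ltenA K ?r as) \<star>[1] \<Theta> p as"
    using f r assms by (intro post_assoc[OF _ _ _ 6, symmetric]) simp_all
  finally show ?thesis using Loose by (simp add: gather_def)
qed

lemma realize_in:
  assumes "KM.ismap f" "arity_ok s (ty f) (arity f)"
  shows "\<Theta>\<Theta> (ty f) (ins f) \<in> maps C (ty f) (ins f) (prodl K (uins K (ty f) (ins f)))"
    "EE f \<in> maps C (ty f) (ins f) (out f)"
proof -
  show 1: "\<Theta>\<Theta> (ty f) (ins f) \<in> maps C (ty f) (ins f) (prodl K (uins K (ty f) (ins f)))"
    using KM.ismapD[OF assms(1)] assms(2) by (intro universal_in) (simp_all add: arity_def)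
  show "EE f \<in> maps C (ty f) (ins f) (out f)"
    unfolding realize_def using assms by (intro post_in'[OF _ 1]) simp_all
qed

text \<open>The arrow \<open>plug\<close> represents substitution into the second input of \<open>\<theta>\<close>.  All substitutions behind the
  first input reduce to this one.\<close>

lemma th_realize:
  assumes f: "KM.ismap f" and op: "op_ok s Tight (Suc (Suc 0)) (ty f) (arity f)" and p: "p \<in> Obj C"
  shows "\<theta> p (out f) \<star>[2] EE f = T (plug K [p] f) \<star>[1] \<Theta> p (ins f)"
proof -
  let ?a = "prodl K (uins K (ty f) (ins f))" and ?b = "arr_of K f" and ?n = "gather K p (ty f) (ins f)"
  have la: "ty f = Tight \<longrightarrow> 1 \<le> arity f" using KM.ismapD(3)[OF f] by (cases "ins f") (auto simp: arity_def)
  have ar: "arity_ok s (ty f) (arity f)" using op la by (cases "ty f") auto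
  have len: "s \<longrightarrow> arity f \<le> 3" using op la by (cases "ty f") auto
  have ob: "?a \<in> Obj C" "out f \<in> Obj C" "set (ins f) \<subseteq> Obj C" using KM.ismapD[OF f] prodl_uins_ob[of "ins f" "ty f"] by auto
  have 1: "\<Theta>\<Theta> (ty f) (ins f) \<in> maps C (ty f) (ins f) ?a" by (rule realize_in[OF f ar])
  have 2: "\<theta> p (out f) \<in> maps C Tight [p, out f] (p \<boxplus> out f)" and 3: "\<theta> p ?a \<in> maps C Tight [p, ?a] (p \<boxplus> ?a)"
    using ob p by simp_all
  have 4: "\<Theta> p (ins f) \<in> maps C Tight (p # ins f) (fo p (ins f))"
    using ob p len by (intro theta_list_in) (auto simp: arity_def)
  have b: "?b \<in> Ar K" "src ?b = ?a" "tgt ?b = out f" using f by simp_all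
  have n: "?n \<in> Ar K" "src ?n = fo p (ins f)" "tgt ?n = p \<boxplus> ?a" using f ob p by simp_all
  have "\<theta> p (out f) \<star>[2] EE f = (\<theta> p (out f) \<star>[2] T ?b) \<star>[2] \<Theta>\<Theta> (ty f) (ins f)"
    unfolding realize_def using b op by (intro pre_sub[OF 2 _ 1]) (simp_all add: arity_def)
  also have "\<theta> p (out f) \<star>[2] T ?b = T (Id K p \<boxtimes> ?b) \<star>[1] \<theta> p ?a"
    using th_nat2[of ?b p] b p by simp
  also have "\<dots> \<star>[2] \<Theta>\<Theta> (ty f) (ins f) = T (Id K p \<boxtimes> ?b) \<star>[1] (\<theta> p ?a \<star>[2] \<Theta>\<Theta> (ty f) (ins f))"
    using b p op by (intro post_sub[OF _ 3 1]) (simp_all add: arity_def)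
  also have "\<theta> p ?a \<star>[2] \<Theta>\<Theta> (ty f) (ins f) = T ?n \<star>[1] \<Theta> p (ins f)"
    using th_gather[of p "ins f" "ty f"] KM.ismapD[OF f] p op by (simp add: arity_def)
  also have "T (Id K p \<boxtimes> ?b) \<star>[1] \<dots> = T ((Id K p \<boxtimes> ?b) \<bullet> ?n) \<star>[1] \<Theta> p (ins f)"
    using b n p by (intro post_assoc[OF _ _ _ 4, symmetric]) simp_all
  finally show ?thesis by (simp add: plug_def)
qed

text \<open>The counterpart for the first input.\<close>

lemma theta_list_realize:
  assumes f: "KM.ismap f" and ys: "set ys \<subseteq> Obj C" "arity_ok s (ty f) (arity f + length ys)"
  shows "\<Theta> (out f) ys \<star>[1] EE f = T (ltenA K (arr_of K f) ys) \<star>[1] \<Theta>\<Theta> (ty f) (ins f @ ys)"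
  using theta_list_post[of "arr_of K f" "ty f" "ins f" ys] KM.ismapD[OF f] ys
  by (simp add: realize_def arity_def)

lemma realize_sub_head:
  assumes m: "KM.ismap g" "KM.ismap f" and g: "ins g = out f # zs" "ty g = Tight"
    and op: "op_ok s (ty g) (arity g) (ty f) (arity f)"
  shows "EE (Sub (M_ob K) g 1 f) = EE g \<star>[1] EE f"
proof -
  note r = KM.sub_M[OF m, of "[]" zs 1, simplified]
  have o: "out f \<in> Obj C" "set zs \<subseteq> Obj C" using KM.ismapD(1)[OF m(1)] g by auto
  have la: "ty f = Tight \<longrightarrow> 1 \<le> arity f" using KM.ismapD(3)[OF m(2)] by (cases "ins f") (auto simp: arity_def)
  have ar: "arity_ok s (ty f) (arity f + length zs)" "arity_ok s (ty f) (arity f)" "s \<longrightarrow> length zs \<le> 3"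
    using op g la by (cases "ty f"; auto simp: arity_def)+
  have 1: "\<Theta> (out f) zs \<in> maps C Tight (out f # zs) (fo (out f) zs)"
    using o ar by (intro theta_list_in) auto
  have 2: "EE f \<in> maps C (ty f) (ins f) (out f)" by (rule realize_in[OF m(2) ar(2)])
  let ?b = "arr_of K g" and ?A = "ltenA K (arr_of K f) zs"
  have b: "?b \<in> Ar K" "src ?b = fo (out f) zs" using m g by simp_all
  have A: "?A \<in> Ar K" "tgt ?A = fo (out f) zs" "src ?A = fo (prodl K (uins K (ty f) (ins f))) zs" using m o by simp_all
  have 3: "\<Theta>\<Theta> (ty f) (ins f @ zs) \<in> maps C (ty f) (ins f @ zs) (prodl K (uins K (ty f) (ins f @ zs)))"
    using KM.ismapD[OF m(2)] o ar by (intro universal_in) (simp_all add: arity_def uins_append)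
  have "EE g \<star>[1] EE f = (T ?b \<star>[1] \<Theta> (out f) zs) \<star>[1] EE f" using g by (simp add: realize_def)
  also have "\<dots> = T ?b \<star>[1] (\<Theta> (out f) zs \<star>[1] EE f)"
    using b op g by (intro post_sub[OF _ 1 2]) (simp_all add: arity_def)
  also have "\<dots> = T (?b \<bullet> ?A) \<star>[1] \<Theta>\<Theta> (ty f) (ins f @ zs)"
    unfolding theta_list_realize[OF m(2) o(2) ar(1)] using A b KM.ismapD(3)[OF m(2)]
    by (intro post_assoc[OF _ _ _ 3, symmetric]) (simp_all add: uins_append)
  also have "\<dots> = EE (Sub (M_ob K) g 1 f)"
    using r g unfolding realize_def by (simp add: plug_def)
  finally show ?thesis ..
qed

text \<open>The universal multimap of the inputs \<open>ys, z, zs\<close> of \<open>g\<close> is composed of the one for \<open>ys\<close>, with product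
  \<open>p\<close>, of \<open>\<theta>\<^bsub>p,z\<^esub>\<close>, and of the one for \<open>pz\<close> followed by \<open>zs\<close>.  Substituting for \<open>z\<close> thus is a substitution
  into the second input of \<open>\<theta>\<^bsub>p,z\<^esub>\<close>.\<close>

lemma realize_sub_tight:
  assumes m: "KM.ismap g" "KM.ismap f" and g: "ins g = ys @ out f # zs" "ty g = Tight" "ys \<noteq> []"
    and op: "op_ok s (ty g) (arity g) (ty f) (arity f)"
  shows "EE (Sub (M_ob K) g (Suc (length ys)) f) = EE g \<star>[Suc (length ys)] EE f"
proof -
  let ?k = "Suc (length ys)" and ?z = "out f" and ?P = "prodl K ys"
  note r = KM.sub_M[OF m g(1) refl]
  have o: "?z \<in> Obj C" "set ys \<subseteq> Obj C" "set zs \<subseteq> Obj C" "set (ins f) \<subseteq> Obj C"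
    using KM.ismapD(1)[OF m(1)] KM.ismapD(1)[OF m(2)] g by auto
  have P: "?P \<in> Obj C" using KM.prodl_ob[OF g(3)] o by simp
  have la: "ty f = Tight \<longrightarrow> 1 \<le> arity f" using KM.ismapD(3)[OF m(2)] by (cases "ins f") (auto simp: arity_def)
  have lf: "length (ins f) = arity f" by (simp add: arity_def)
  have ly: "1 \<le> length ys" using g(3) by (cases ys) auto
  obtain n where n: "length ys = Suc n" using ly by (cases "length ys") auto
  have len: "s \<longrightarrow> (if ty f = Tight then length ys + length zs + arity f \<le> 4 else length ys + length zs + arity f \<le> 2)"
    using op g la ly by (cases "ty f") (auto simp: arity_def)
  have ar: "arity_ok s (ty f) (arity f)" using len la by (cases "ty f") auto
  have ops: "op_ok s Tight (Suc (Suc 0)) (ty f) (arity f)" "op_ok s Tight (Suc (length ys)) (ty f) (arity f)"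
    "op_ok s Tight (Suc (length ys + length zs)) (ty f) (arity f)"
    using len la ly by (cases "ty f"; auto)+
  have l3: "s \<longrightarrow> length ys + length zs + arity f \<le> 4" "s \<longrightarrow> length ys + length zs \<le> 3"
    using len la by (cases "ty f"; auto)+
  let ?N = "plug K ys f" and ?e = "EE f"
  have e: "?e \<in> maps C (ty f) (ins f) ?z" by (rule realize_in[OF m(2) ar])
  have N: "?N \<in> Ar K" "src ?N = fo ?P (ins f)" "tgt ?N = ?P \<boxplus> ?z" using m o g by simp_all
  have actP: "plug K [?P] f = ?N" using g(3) by (simp add: plug_def)
  have th: "\<theta> ?P ?z \<in> maps C Tight [?P, ?z] (?P \<boxplus> ?z)" using P o by simp
  have Y: "\<Theta>\<Theta> Tight ys \<in> maps C Tight ys ?P"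
    using o g(3) l3 ly universal_in[of ys Tight] by auto
  define X where "X = \<theta> ?P ?z \<star>[1] \<Theta>\<Theta> Tight ys"
  have X: "X \<in> maps C Tight (ys @ [?z]) (?P \<boxplus> ?z)"
    unfolding X_def using l3 ly by (intro sub_in[OF th Y]) auto
  have Z: "\<Theta> (?P \<boxplus> ?z) zs \<in> maps C Tight (?P \<boxplus> ?z # zs) (fo (?P \<boxplus> ?z) zs)"
    using P o l3 by (intro theta_list_in) auto
  have thz: "\<Theta>\<Theta> Tight (ys @ [?z]) = X"
    unfolding X_def using universal_append[of ys "[?z]" Tight] g(3) o P l3 ly theta_list_snoc1[of ?P ?z] by auto
  have TG: "\<Theta>\<Theta> Tight (ins g) = \<Theta> (?P \<boxplus> ?z) zs \<star>[1] X"
    using universal_append[of "ys @ [?z]" zs Tight] g thz o P l3 by auto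
  have TGin: "\<Theta>\<Theta> Tight (ins g) \<in> maps C Tight (ins g) (fo (?P \<boxplus> ?z) zs)"
    using universal_in[of "ins g" Tight] g o l3 by auto
  have If: "\<Theta> ?P (ins f) \<in> maps C Tight (?P # ins f) (fo ?P (ins f))"
    using P o l3 ly by (intro theta_list_in) (auto simp: arity_def)
  have Yf: "\<Theta>\<Theta> Tight (ys @ ins f) = \<Theta> ?P (ins f) \<star>[1] \<Theta>\<Theta> Tight ys"
    using universal_append[of ys "ins f" Tight] g(3) o l3 ly by (auto simp: arity_def)
  \<comment> \<open>first \<open>\<theta>\<close> and \<open>ys\<close> alone, without the inputs \<open>zs\<close>\<close>
  have "X \<star>[?k] ?e = (\<theta> ?P ?z \<star>[2] ?e) \<star>[1] \<Theta>\<Theta> Tight ys"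
    unfolding X_def using l3 ly ops la lf by (intro commT[OF th Y e]) auto
  also have "\<theta> ?P ?z \<star>[2] ?e = T ?N \<star>[1] \<Theta> ?P (ins f)"
    using th_realize[OF m(2) ops(1) P] by (simp add: actP)
  also have "\<dots> \<star>[1] \<Theta>\<Theta> Tight ys = T ?N \<star>[1] \<Theta>\<Theta> Tight (ys @ ins f)"
    unfolding Yf using N l3 ly lf by (intro post_sub[OF _ If Y]) auto
  finally have Xe: "X \<star>[?k] ?e = T ?N \<star>[1] \<Theta>\<Theta> Tight (ys @ ins f)" .
  let ?b = "arr_of K g" and ?A = "ltenA K ?N zs"
  have b: "?b \<in> Ar K" "src ?b = fo (?P \<boxplus> ?z) zs" using m g by simp_all
  have A: "?A \<in> Ar K" "src ?A = fo (fo ?P (ins f)) zs" "tgt ?A = fo (?P \<boxplus> ?z) zs" using N o by simp_all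
  have W: "\<Theta>\<Theta> Tight (ys @ ins f @ zs) \<in> maps C Tight (ys @ ins f @ zs) (fo (fo ?P (ins f)) zs)"
    using universal_in[of "ys @ ins f @ zs" Tight] g(3) o l3 ly lf by auto
  have "EE g \<star>[?k] ?e = (T ?b \<star>[1] \<Theta>\<Theta> Tight (ins g)) \<star>[?k] ?e" using g by (simp add: realize_def)
  also have "\<dots> = T ?b \<star>[1] (\<Theta>\<Theta> Tight (ins g) \<star>[?k] ?e)"
    using b ops lf g(1) by (intro post_sub[OF _ TGin e]) (simp_all add: nth_append)
  also have "\<Theta>\<Theta> Tight (ins g) \<star>[?k] ?e = \<Theta> (?P \<boxplus> ?z) zs \<star>[1] (X \<star>[?k] ?e)"
    unfolding TG using l3 ly ops la lf n
    by (intro assocT[OF Z X e, symmetric]) (auto simp: nth_append add.commute)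
  also have "\<dots> = T ?A \<star>[1] \<Theta>\<Theta> Tight ((ys @ ins f) @ zs)"
    unfolding Xe using theta_list_post[of ?N Tight "ys @ ins f" zs] N g(3) o l3 ly lf by (auto simp: add_ac)
  also have "T ?b \<star>[1] \<dots> = T (?b \<bullet> ?A) \<star>[1] \<Theta>\<Theta> Tight (ys @ ins f @ zs)"
    unfolding append_assoc using b A by (intro post_assoc[OF _ _ _ W, symmetric]) simp_all
  also have "\<dots> = EE (Sub (M_ob K) g ?k f)"
    using r g unfolding realize_def by (simp del: M_ob_simps)
  finally show ?thesis ..
qed

text \<open>A loose map is a tight one with an extra first input, the unit, filled by \<open>u\<close>; in this way the
  claim is reduced to tight \<open>g\<close>, and \<open>u\<close> is moved past \<open>f\<close> by commutation.\<close>

lemma realize_sub_loose: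
  assumes m: "KM.ismap g" "KM.ismap f" and g: "ins g = ys @ out f # zs" "ty g = Loose"
    and op: "op_ok s (ty g) (arity g) (ty f) (arity f)"
  shows "EE (Sub (M_ob K) g (Suc (length ys)) f) = EE g \<star>[Suc (length ys)] EE f"
proof -
  let ?k = "Suc (length ys)"
  have la: "ty f = Tight \<longrightarrow> 1 \<le> arity f" using KM.ismapD(3)[OF m(2)] by (cases "ins f") (auto simp: arity_def)
  have lf: "length (ins f) = arity f" by (simp add: arity_def)
  have o: "out f \<in> Obj C" "set ys \<subseteq> Obj C" "set zs \<subseteq> Obj C" "set (ins f) \<subseteq> Obj C"
    using KM.ismapD(1)[OF m(1)] KM.ismapD(1)[OF m(2)] g by auto
  have len: "s \<longrightarrow> length ys + length zs + arity f \<le> 2" "s \<longrightarrow> ty f = Loose \<longrightarrow> ys = [] \<and> zs = [] \<and> arity f = 0"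
    using op g la by (cases "ty f"; auto simp: arity_def)+
  have ar: "arity_ok s (ty f) (arity f)" "arity_ok s (ty g) (arity g)" using len la g by (cases "ty f"; auto simp: arity_def)+
  \<comment> \<open>\<open>t h\<close> is the tight multimap with the same arrow as the loose \<open>h\<close>\<close>
  define t where "t h = MMap Tight (\<iota> # ins h) (out h) (mlab h)" for h :: "('o, 'm) mmap"
  have t: "ty (t h) = Tight \<and> ins (t h) = \<iota> # ins h \<and> out (t h) = out h" for h by (simp add: t_def)
  have bt: "arr_of K (t h) = arr_of K h" if "ty h = Loose" for h
    using that by (intro arr_eqI) (simp_all add: t_def)
  have mt: "KM.ismap (t h)" if "KM.ismap h" "ty h = Loose" for h
    using KM.ismapD[OF that(1)] bt[OF that(2)] by (intro KM.ismapI) (simp_all add: t)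
  have EEt: "EE h = EE (t h) \<star>[1] u" if h: "KM.ismap h" "ty h = Loose" "s \<longrightarrow> arity h \<le> 2" for h
  proof -
    have 1: "\<Theta> \<iota> (ins h) \<in> maps C Tight (\<iota> # ins h) (fo \<iota> (ins h))"
      using KM.ismapD[OF h(1)] h(3) by (intro theta_list_in) (auto simp: arity_def)
    have "(T (arr_of K h) \<star>[1] \<Theta> \<iota> (ins h)) \<star>[1] u = T (arr_of K h) \<star>[1] (\<Theta> \<iota> (ins h) \<star>[1] u)"
      using KM.ismapD[OF h(1)] h by (intro post_sub[OF _ 1 u_in]) (auto simp: arity_def)
    then show ?thesis using h by (simp add: realize_def t bt)
  qed
  have tg: "ins (t g) = (\<iota> # ys) @ out f # zs" using g by (simp add: t)
  note r = KM.sub_M[OF m g(1) refl]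
  note r' = KM.sub_M[OF mt[OF m(1) g(2)] m(2) tg refl]
  let ?r = "Sub (M_ob K) g ?k f" and ?r' = "Sub (M_ob K) (t g) (Suc (length (\<iota> # ys))) f"
  have tr: "ty ?r = Loose" "arity ?r = length ys + length zs + arity f" using r(2,4) g by (simp_all add: arity_def)
  have "?r' = t ?r"
  proof (rule mmap_eqI[where C = K])
    show "arr_of K ?r' = arr_of K (t ?r)"
      unfolding bt[OF tr(1)] r(5) r'(5) bt[OF g(2)] using g by (simp add: t)
  qed (use r'(2-4) r(2-4) t g in simp_all)
  then have "EE ?r = EE ?r' \<star>[1] u" using EEt[OF r(1) tr(1)] tr(2) len by simp
  also have "EE ?r' = EE (t g) \<star>[Suc ?k] EE f"
    using realize_sub_tight[OF mt[OF m(1) g(2)] m(2) tg] len la t g by (cases "ty f") (auto simp: arity_def)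
  also have "\<dots> \<star>[1] u = (EE (t g) \<star>[1] u) \<star>[?k] EE f"
  proof -
    have ga: "arity_ok s (ty (t g)) (arity (t g))" using len t g by (auto simp: arity_def arity_ok_def short_arity_def)
    have 1: "EE (t g) \<in> maps C Tight (\<iota> # ins g) (out g)" using realize_in(2)[OF mt[OF m(1) g(2)] ga] t by simp
    have 2: "EE f \<in> maps C (ty f) (ins f) (out f)" by (rule realize_in[OF m(2) ar(1)])
    show ?thesis using len la g lf
      by (intro commT[OF 1 u_in 2, symmetric]; cases "ty f") (auto simp: nth_append)
  qed
  also have "EE (t g) \<star>[1] u = EE g" using EEt[OF m(1) g(2)] ar(2) g by simp
  finally show ?thesis .
qed

theorem realize_sub:
  assumes "KM.ismap g" "KM.ismap f" "fits g i f" "op_ok s (ty g) (arity g) (ty f) (arity f)"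
  shows "EE (Sub (M_ob K) g i f) = EE g \<star>[i] EE f"
proof -
  obtain ys zs where g: "ins g = ys @ out f # zs" "i = Suc (length ys)"
    using assms(3) by (rule fits_split)
  show ?thesis
  proof (cases "ty g")
    case Tight
    then show ?thesis
      using realize_sub_head[OF assms(1,2) _ _ assms(4)] realize_sub_tight[OF assms(1,2) _ _ _ assms(4)] g
      by (cases "ys = []") auto
  next
    case Loose
    then show ?thesis using realize_sub_loose[OF assms(1,2) _ _ assms(4)] g by auto
  qed
qed

lemma realize_idm: "a \<in> Obj C \<Longrightarrow> EE (Idm (M_ob K) a) = Idm C a"
  using id_subT[OF idm[of a]] by (simp add: realize_def KM.idm_M K_Id)

text \<open>Since \<open>j f = f \<circ>\<^sub>1 j(1)\<close>, and \<open>j(1) = (\<lambda> \<circ> \<theta>) \<circ>\<^sub>1 u\<close> defines \<open>\<lambda>\<close>.\<close>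

lemma realize_jay:
  assumes m: "KM.ismap f" "ty f = Tight" "arity_ok s Loose (arity f)"
  shows "EE (Jay (M_ob K) f) = \<j> (EE f)"
proof -
  obtain a as where f: "ins f = a # as" using m KM.ismapD(3)[OF m(1)] by (cases "ins f") auto
  have o: "a \<in> Obj C" "set as \<subseteq> Obj C" using KM.ismapD(1)[OF m(1)] f by auto
  have len: "s \<longrightarrow> length as \<le> 1" using m f by (auto simp: arity_def)
  let ?l = "\<lambda>\<lambda>\<^bsub>K\<^esub> a" and ?b = "arr_of K f"
  have b: "?b \<in> Ar K" "src ?b = fo a as" "tgt ?b = out f" using m f by simp_all
  have 1: "\<Theta> a as \<in> maps C Tight (a # as) (fo a as)" using o len by (intro theta_list_in) auto
  have 2: "\<theta> \<iota> a \<in> maps C Tight [\<iota>, a] (\<iota> \<boxplus> a)" using o by simp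
  have e: "EE f \<in> maps C Tight (a # as) (out f)" using realize_in(2)[OF m(1)] m len f by (auto simp: arity_def)
  have 3: "\<Theta>\<Theta> Loose (a # as) \<in> maps C Loose (a # as) (fo \<iota> (a # as))"
    using universal_in[of "a # as" Loose] o len by auto
  have "\<j> (EE f) = EE f \<star>[1] \<j> (Idm C a)" using sub_jay_id_1[of "EE f"] mapsD[OF e] len by simp
  also have "\<dots> = (T ?b \<star>[1] \<Theta> a as) \<star>[1] \<j> (Idm C a)" using m f by (simp add: realize_def)
  also have "\<dots> = T ?b \<star>[1] (\<Theta> a as \<star>[1] \<j> (Idm C a))"
    using b len by (intro post_sub[OF _ 1 j_id_in[OF o(1)]]) auto
  also have "\<j> (Idm C a) = T ?l \<star>[1] (\<theta> \<iota> a \<star>[1] u)"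
    using K_Lam[OF o(1)] o post_sub[OF _ 2 u_in, of ?l 1] by simp
  also have "\<theta> \<iota> a \<star>[1] u = \<Theta>\<Theta> Loose [a]" using theta_list_snoc1[of \<iota> a] o by simp
  also have "\<Theta> a as \<star>[1] (T ?l \<star>[1] \<Theta>\<Theta> Loose [a]) = T (ltenA K ?l as) \<star>[1] \<Theta>\<Theta> Loose (a # as)"
    using theta_list_post[of ?l Loose "[a]" as] o len by auto
  also have "T ?b \<star>[1] \<dots> = T (?b \<bullet> ltenA K ?l as) \<star>[1] \<Theta>\<Theta> Loose (a # as)"
    using b o by (intro post_assoc[OF _ _ _ 3, symmetric]) simp_all
  also have "\<dots> = EE (Jay (M_ob K) f)"
    unfolding realize_def KM.jay_M(1)[OF m(1,2)] using f by simp
  finally show ?thesis ..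
qed

text \<open>The bijections given by \<open>\<theta>\<close> and \<open>u\<close> are composed.\<close>

lemma universal_bij:
  assumes "set as \<subseteq> Obj C" "uins K x as \<noteq> []" "arity_ok s x (length as)" "d \<in> Obj C"
  shows "bij_betw (\<lambda>p. T p \<star>[1] \<Theta>\<Theta> x as) (hom K (prodl K (uins K x as)) d) (maps C x as d)"
proof -
  have tight: "bij_betw (\<lambda>p. T p \<star>[1] \<Theta> a as) (hom K (fo a as) d) (maps C Tight (a # as) d)"
    if "a \<in> Obj C" "set as \<subseteq> Obj C" "s \<longrightarrow> length as \<le> 3" for a as
    using that
  proof (induction as arbitrary: a)
    case Nil
    have 1: "T p \<star>[1] Idm C a = T p" if "p \<in> hom K a d" for p
      by (rule sub_idT[OF T_hom[OF that]]) simp_all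
    have "bij_betw T (hom K a d) (maps C Tight [a] d)"
      unfolding bij_betw_def
    proof
      show "T ` hom K a d = maps C Tight [a] d"
        using T_hom by (auto elim: T_surj)
    qed (simp add: inj_on_def)
    then show ?case using 1 by (subst bij_betw_cong[where g = T]) simp_all
  next
    case (Cons x as)
    have 1: "bij_betw (\<lambda>p. T p \<star>[1] \<Theta> (a \<boxplus> x) as) (hom K (fo (a \<boxplus> x) as) d) (maps C Tight (a \<boxplus> x # as) d)"
      using Cons.prems by (intro Cons.IH) auto
    have 2: "bij_betw (\<lambda>f. f \<star>[1] \<theta> a x) (maps C Tight (a \<boxplus> x # as) d) (maps C Tight (a # x # as) d)"
      using Cons.prems assms(4) by (intro theta_bij) auto
    have 3: "\<Theta> (a \<boxplus> x) as \<in> maps C Tight (a \<boxplus> x # as) (fo (a \<boxplus> x) as)"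
      using Cons.prems by (intro theta_list_in) auto
    have 4: "\<theta> a x \<in> maps C Tight [a, x] (a \<boxplus> x)" using Cons.prems by simp
    have "((\<lambda>f. f \<star>[1] \<theta> a x) \<circ> (\<lambda>p. T p \<star>[1] \<Theta> (a \<boxplus> x) as)) p = T p \<star>[1] \<Theta> a (x # as)"
      if "p \<in> hom K (fo (a \<boxplus> x) as) d" for p
      using that Cons.prems post_sub[OF _ 3 4, of p 1] by (auto simp: hom_iff)
    then show ?case using bij_betw_trans[OF 1 2] by (subst bij_betw_cong) auto
  qed
  show ?thesis
  proof (cases x)
    case Tight
    then show ?thesis using assms tight by (cases as) auto
  next
    case Loose
    have 1: "bij_betw (\<lambda>p. T p \<star>[1] \<Theta> \<iota> as) (hom K (fo \<iota> as) d) (maps C Tight (\<iota> # as) d)"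
      using assms Loose by (intro tight) auto
    have 2: "bij_betw (\<lambda>f. f \<star>[1] u) (maps C Tight (\<iota> # as) d) (maps C Loose as d)"
      using assms Loose by (intro umap_bij) auto
    have 3: "\<Theta> \<iota> as \<in> maps C Tight (\<iota> # as) (fo \<iota> as)"
      using assms Loose by (intro theta_list_in) auto
    have "((\<lambda>f. f \<star>[1] u) \<circ> (\<lambda>p. T p \<star>[1] \<Theta> \<iota> as)) p = T p \<star>[1] (\<Theta> \<iota> as \<star>[1] u)"
      if "p \<in> hom K (fo \<iota> as) d" for p
      using that assms Loose post_sub[OF _ 3 u_in, of p 1] by (auto simp: hom_iff)
    then show ?thesis using bij_betw_trans[OF 1 2] Loose by (subst bij_betw_cong) auto
  qed
qed

theorem realize_bij: "bij_betw EE {f. KM.ismap f \<and> arity_ok s (ty f) (arity f)} (Maps C)"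
  unfolding bij_betw_def
proof
  show "inj_on EE {f. KM.ismap f \<and> arity_ok s (ty f) (arity f)}"
  proof (rule inj_onI, clarify)
    fix f g assume f: "KM.ismap f" "arity_ok s (ty f) (arity f)" and g: "KM.ismap g" "arity_ok s (ty g) (arity g)"
      and eq: "EE f = EE g"
    have 1: "ty f = ty g" "ins f = ins g" "out f = out g"
      using realize_in(2)[OF f] realize_in(2)[OF g] eq by (auto simp: maps_def)
    have "bij_betw (\<lambda>p. T p \<star>[1] \<Theta>\<Theta> (ty f) (ins f)) (hom K (prodl K (uins K (ty f) (ins f))) (out f)) (maps C (ty f) (ins f) (out f))"
      using f KM.ismapD[OF f(1)] by (intro universal_bij) (simp_all add: arity_def)
    then have "arr_of K f = arr_of K g"
      using eq 1 f g by (auto simp: bij_betw_def realize_def hom_iff dest!: inj_onD)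
    then show "f = g" using 1 by (intro mmap_eqI[where C = K])
  qed
  show "EE ` {f. KM.ismap f \<and> arity_ok s (ty f) (arity f)} = Maps C"
  proof
    show "EE ` {f. KM.ismap f \<and> arity_ok s (ty f) (arity f)} \<subseteq> Maps C"
      using realize_in(2) by (auto simp: maps_def)
    show "Maps C \<subseteq> EE ` {f. KM.ismap f \<and> arity_ok s (ty f) (arity f)}"
    proof
      fix f assume f: "f \<in> Maps C"
      then have w: "set (ins f) \<subseteq> Obj C" "out f \<in> Obj C" "ty f = Tight \<longrightarrow> 1 \<le> arity f" "arity_ok s (ty f) (arity f)"
        using map_wf[OF f] by auto
      have ne: "uins K (ty f) (ins f) \<noteq> []" using w(3) by (auto simp: uins_def arity_def)
      have "bij_betw (\<lambda>p. T p \<star>[1] \<Theta>\<Theta> (ty f) (ins f)) (hom K (prodl K (uins K (ty f) (ins f))) (out f)) (maps C (ty f) (ins f) (out f))"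
        using w ne by (intro universal_bij) (simp_all add: arity_def)
      moreover have "f \<in> maps C (ty f) (ins f) (out f)" using f by (simp add: maps_def)
      ultimately obtain p where p: "p \<in> hom K (prodl K (uins K (ty f) (ins f))) (out f)" "f = T p \<star>[1] \<Theta>\<Theta> (ty f) (ins f)"
        by (auto simp: bij_betw_def)
      define e where "e = MMap (ty f) (ins f) (out f) (lab p)"
      have b: "arr_of K e = p" using p(1) by (intro arr_eqI) (auto simp: e_def hom_iff)
      have "KM.ismap e" using p(1) b w ne by (intro KM.ismapI) (auto simp: e_def hom_iff arity_def)
      moreover have "EE e = f" using p(2) b by (simp add: realize_def) (simp add: e_def)
      ultimately show "f \<in> EE ` {f. KM.ismap f \<and> arity_ok s (ty f) (arity f)}"
        using w(4) by (auto simp: e_def arity_def intro!: image_eqI[of _ _ e])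
    qed
  qed
qed

end

section \<open>The lax monoidal functor of a morphism\<close>

text \<open>Skew multifunctors and morphisms of short skew multicategories in one definition.\<close>

definition morphism :: "bool \<Rightarrow> ('o, 'm) multi \<Rightarrow> ('o, 'm) multi \<Rightarrow> ('o, 'm) multif \<Rightarrow> bool" where
  "morphism s C D F \<longleftrightarrow> multi_graph_map C D F \<and>
     (\<forall>a \<in> Obj C. mmp F (Idm C a) = Idm D (mob F a)) \<and>
     (\<forall>f \<in> Maps C. ty f = Tight \<and> arity_ok s Loose (arity f) \<longrightarrow> mmp F (\<j>\<^bsub>C\<^esub> f) = \<j>\<^bsub>D\<^esub> (mmp F f)) \<and>
     (\<forall>g \<in> Maps C. \<forall>f \<in> Maps C. \<forall>i. fits g i f \<and> op_ok s (ty g) (arity g) (ty f) (arity f) \<longrightarrow>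
        mmp F (g \<star>[i]\<^bsub>C\<^esub> f) = mmp F g \<star>[i]\<^bsub>D\<^esub> mmp F f)"

lemma short_multifunctor_iff: "short_multifunctor C D F \<longleftrightarrow> morphism True C D F"
  by (simp add: short_multifunctor_def morphism_def op_ok_def)

lemma multifunctor_iff: "multifunctor C D F \<longleftrightarrow> morphism False C D F"
  by (simp add: multifunctor_def morphism_def op_ok_def)

text \<open>The equations that determine the lax monoidal functor \<open>H\<close> of a morphism \<open>F\<close>, for given representing
  data and skew monoidal categories of its source and target.\<close>

definition lax_spec where
  "lax_spec C R K D S L F H \<longleftrightarrow>
     fob H = mob F \<and> far H \<in> extensional (Ar K) \<and>
     (\<forall>f \<in> Ar K. to_mmap (far H f) = mmp F (to_mmap f)) \<and>
     f0 H \<in> hom L (uob S) (mob F (uob R)) \<and> to_mmap (f0 H) \<star>[1]\<^bsub>D\<^esub> umap S = mmp F (umap R) \<and>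
     (\<forall>a \<in> Obj C. \<forall>b \<in> Obj C. f2 H a b \<in> hom L (prd S (mob F a) (mob F b)) (mob F (prd R a b)) \<and>
        to_mmap (f2 H a b) \<star>[1]\<^bsub>D\<^esub> theta S (mob F a) (mob F b) = mmp F (theta R a b)) \<and>
     (\<forall>a b. \<not> (a \<in> Obj C \<and> b \<in> Obj C) \<longrightarrow> f2 H a b = undefined)"

locale rep_morphism = A: rep_skewmon s C R K + B: rep_skewmon s D S L
  for s :: bool and C :: "('o, 'm) multi" and R :: "('o, 'm) lr_data" and K :: "('o, 'm) skewmon"
    and D :: "('o, 'm) multi" and S :: "('o, 'm) lr_data" and L :: "('o, 'm) skewmon" +
  fixes F :: "('o, 'm) multif"
  assumes F: "morphism s C D F"
begin

abbreviation "Fo \<equiv> mob F"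
abbreviation "Fm \<equiv> mmp F"

lemma Fm_in: "f \<in> maps C x as b \<Longrightarrow> Fm f \<in> maps D x (map Fo as) (Fo b)"
  using F by (auto simp: morphism_def multi_graph_map_def maps_def)

lemma Fo_ob [simp]: "a \<in> Obj C \<Longrightarrow> Fo a \<in> Obj D"
  using F by (auto simp: morphism_def multi_graph_map_def)

lemma Fo_obs [simp]: "as \<subseteq> Obj C \<Longrightarrow> Fo ` as \<subseteq> Obj D"
  by auto

lemma Fm_sub:
  assumes "g \<in> maps C x as c" "f \<in> maps C y bs b" "1 \<le> i" "i \<le> length as" "as ! (i - 1) = b"
    "op_ok s x (length as) y (length bs)"
  shows "Fm (g \<star>[i]\<^bsub>C\<^esub> f) = Fm g \<star>[i]\<^bsub>D\<^esub> Fm f"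
  using F A.mapsD[OF assms(1)] A.mapsD[OF assms(2)] assms(3-) by (auto simp: morphism_def fits_def)

lemma Fm_id: "a \<in> Obj C \<Longrightarrow> Fm (Idm C a) = Idm D (Fo a)"
  using F by (auto simp: morphism_def)

lemma Fm_jay: "f \<in> Maps C \<Longrightarrow> ty f = Tight \<Longrightarrow> arity_ok s Loose (arity f) \<Longrightarrow> Fm (\<j>\<^bsub>C\<^esub> f) = \<j>\<^bsub>D\<^esub> (Fm f)"
  using F by (auto simp: morphism_def)

lemma Fm_T: "f \<in> hom K a b \<Longrightarrow> Fm (to_mmap f) \<in> maps D Tight [Fo a] (Fo b)"
  using Fm_in[OF A.T_hom[of f a b]] by simp

lemma Fm_post:
  assumes "q \<in> Ar K" "g \<in> maps C x as c" "src q = c"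
  shows "Fm (to_mmap q \<star>[1]\<^bsub>C\<^esub> g) = Fm (to_mmap q) \<star>[1]\<^bsub>D\<^esub> Fm g"
proof -
  have "op_ok s Tight (length [c]) x (length as)"
    using A.mapsD[OF assms(2)] by (auto simp: op_ok_def short_op_def arity_ok_def)
  then show ?thesis by (intro Fm_sub[OF A.T_in'[OF assms(1,3) refl] assms(2)]) simp_all
qed

text \<open>The definite descriptions in \<open>Ks_mor\<close> denote, because \<open>\<theta>\<close> and \<open>u\<close> are universal.\<close>

lemma Ks_mor_spec: "lax_spec C R K D S L F (Ks_mor R C S D F)"
proof -
  let ?H = "Ks_mor R C S D F"
  have Ar: "Ar (Ks_ob R C) = Ar K"
  proof -
    have "f \<in> Ar K \<longleftrightarrow> f \<in> to_arr ` maps_n C Tight 1" for f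
    proof
      assume "f \<in> Ar K"
      then have "to_mmap f \<in> maps_n C Tight 1" using A.T_in[of f] by (auto simp: maps_n_def maps_def)
      moreover have "f = to_arr (to_mmap f)" by (simp add: to_arr_def arr.expand)
      ultimately show "f \<in> to_arr ` maps_n C Tight 1" by blast
    next
      assume "f \<in> to_arr ` maps_n C Tight 1"
      then obtain p where p: "f = to_arr p" "p \<in> Maps C" "ty p = Tight" "length (ins p) = 1"
        by (auto simp: maps_n_def)
      then obtain a where "ins p = [a]" by (cases "ins p") auto
      then show "f \<in> Ar K" using p by (simp add: A.K_Ar to_mmap_to_arr)
    qed
    then show ?thesis by (auto simp: Ks_ob_def)
  qed
  have T: "to_arr p \<in> hom L a b \<and> to_mmap (to_arr p) = p" if "p \<in> maps D Tight [a] b" for p a b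
    using B.mapsD[OF that] that by (metis B.hom_T to_mmap_to_arr)
  have ex1: "\<exists>!h. h \<in> maps D Tight [m] c \<and> h \<star>[1]\<^bsub>D\<^esub> t = g"
    if "bij_betw (\<lambda>f. f \<star>[1]\<^bsub>D\<^esub> t) (maps D Tight [m] c) X" "g \<in> X" for m c t g X
    using that by (auto simp: bij_betw_def inj_on_def image_iff)
  have far: "to_mmap (far ?H f) = Fm (to_mmap f)" if f: "f \<in> Ar K" for f
    using T[OF Fm_T[of f "src f" "tgt f"]] f by (simp add: Ks_mor_def Ar hom_iff)
  have uu: "Fm (umap R) \<in> maps D Loose [] (Fo (uob R))" using Fm_in[OF A.u_in] by simp
  let ?h0 = "THE h. h \<in> maps D Tight [uob S] (Fo (uob R)) \<and> h \<star>[1]\<^bsub>D\<^esub> umap S = Fm (umap R)"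
  have 0: "?h0 \<in> maps D Tight [uob S] (Fo (uob R)) \<and> ?h0 \<star>[1]\<^bsub>D\<^esub> umap S = Fm (umap R)"
    by (rule theI', rule ex1[OF B.umap_bij uu]) simp_all
  have f0: "f0 ?H = to_arr ?h0" by (simp add: Ks_mor_def)
  have f2: "f2 ?H a b \<in> hom L (prd S (Fo a) (Fo b)) (Fo (prd R a b)) \<and>
      to_mmap (f2 ?H a b) \<star>[1]\<^bsub>D\<^esub> theta S (Fo a) (Fo b) = Fm (theta R a b)"
    if ab: "a \<in> Obj C" "b \<in> Obj C" for a b
  proof -
    have tt: "Fm (theta R a b) \<in> maps D Tight [Fo a, Fo b] (Fo (prd R a b))"
      using Fm_in[OF A.th_in[OF ab refl]] by simp
    let ?h = "THE h. h \<in> maps D Tight [prd S (Fo a) (Fo b)] (Fo (prd R a b)) \<and>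
        h \<star>[1]\<^bsub>D\<^esub> theta S (Fo a) (Fo b) = Fm (theta R a b)"
    have 2: "?h \<in> maps D Tight [prd S (Fo a) (Fo b)] (Fo (prd R a b)) \<and>
        ?h \<star>[1]\<^bsub>D\<^esub> theta S (Fo a) (Fo b) = Fm (theta R a b)"
      by (rule theI', rule ex1[OF B.theta_bij tt]) (use ab in simp_all)
    have "f2 ?H a b = to_arr ?h" using ab by (simp add: Ks_mor_def)
    then show ?thesis using 2 T[of ?h] by auto
  qed
  show ?thesis
    unfolding lax_spec_def using far 0 f0 T[of ?h0] f2
    by (auto simp: Ks_mor_def[of R C S D F] Ar)
qed

end

locale rep_laxf = rep_morphism s C R K D S L F
  for s :: bool and C :: "('o, 'm) multi" and R :: "('o, 'm) lr_data" and K :: "('o, 'm) skewmon"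
    and D :: "('o, 'm) multi" and S :: "('o, 'm) lr_data" and L :: "('o, 'm) skewmon"
    and F :: "('o, 'm) multif" +
  fixes H :: "('o, 'm) laxf"
  assumes H: "lax_spec C R K D S L F H"
begin

abbreviation "ff \<equiv> far H"
abbreviation "h2 \<equiv> f2 H"
abbreviation cmp (infixl "\<ast>" 65) where "g \<ast> f \<equiv> g \<cdot>\<^bsub>L\<^esub> f"
abbreviation tns (infixl "\<diamond>" 75) where "g \<diamond> f \<equiv> g \<otimes>\<^bsub>L\<^esub> f"
abbreviation tn (infixl "\<oplus>" 75) where "a \<oplus> b \<equiv> prd S a b"

lemma H_ob [simp]: "fob H = Fo" using H by (simp add: lax_spec_def)

lemma H_far: "f \<in> Ar K \<Longrightarrow> to_mmap (ff f) = Fm (to_mmap f)" using H by (simp add: lax_spec_def)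

lemma H_far_hom [simp]:
  assumes "f \<in> Ar K" shows "ff f \<in> Ar L" "src (ff f) = Fo (src f)" "tgt (ff f) = Fo (tgt f)"
  using B.hom_T[of "ff f" "Fo (src f)" "Fo (tgt f)"] Fm_T[of f "src f" "tgt f"] assms H_far[OF assms]
  by (auto simp: hom_iff)

lemma H_f0: "f0 H \<in> Ar L" "src (f0 H) = uob S" "tgt (f0 H) = Fo (uob R)"
  "to_mmap (f0 H) \<star>[1]\<^bsub>D\<^esub> umap S = Fm (umap R)"
  using H by (auto simp: lax_spec_def hom_iff)

lemma H_f2:
  assumes "a \<in> Obj C" "b \<in> Obj C"
  shows "h2 a b \<in> Ar L" "src (h2 a b) = Fo a \<oplus> Fo b" "tgt (h2 a b) = Fo (prd R a b)"
    "to_mmap (h2 a b) \<star>[1]\<^bsub>D\<^esub> theta S (Fo a) (Fo b) = Fm (theta R a b)"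
  using H assms by (auto simp: lax_spec_def hom_iff)

lemmas [simp] = H_f0(1-3) H_f2(1-3)

lemma H_Fm_post:
  assumes "q \<in> Ar K" "g \<in> maps C x as c" "src q = c"
  shows "to_mmap (ff q) \<star>[1]\<^bsub>D\<^esub> Fm g = Fm (to_mmap q \<star>[1]\<^bsub>C\<^esub> g)"
  using Fm_post[OF assms] H_far[OF assms(1)] by simp

lemma H_functor: "is_functor K L H"
proof -
  have "ff (Id K a) = Id L (Fo a)" if "a \<in> Obj C" for a
    using that by (intro B.arr_eqT) (simp add: H_far A.K_Id B.K_Id Fm_id)
  moreover have "ff (g \<cdot>\<^bsub>K\<^esub> f) = ff g \<ast> ff f" if "g \<in> Ar K" "f \<in> Ar K" "tgt f = src g" for f g
  proof (rule B.arr_eqT)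
    have "Fm (to_mmap g \<star>[1]\<^bsub>C\<^esub> to_mmap f) = Fm (to_mmap g) \<star>[1]\<^bsub>D\<^esub> Fm (to_mmap f)"
      using that by (intro Fm_post[OF _ A.T_in]) simp_all
    then show "to_mmap (ff (g \<cdot>\<^bsub>K\<^esub> f)) = to_mmap (ff g \<ast> ff f)"
      using that by (simp add: H_far A.K_Comp B.K_Comp)
  qed
  ultimately show ?thesis by (auto simp: is_functor_def hom_iff)
qed

lemma th_Fm: "a \<in> Obj C \<Longrightarrow> b \<in> Obj C \<Longrightarrow> Fm (theta R a b) \<in> maps D Tight [Fo a, Fo b] (Fo (prd R a b))"
  using Fm_in[OF A.th_in[of a b]] by simp

lemma u_Fm: "Fm (umap R) \<in> maps D Loose [] (Fo (uob R))"
  using Fm_in[OF A.u_in] by simp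

text \<open>As for the axioms of a skew monoidal category, the axioms of a lax monoidal functor are checked
  after substituting universal multimaps; the defining equations of \<open>H\<close> then turn both sides into
  images under \<open>F\<close> of equal multimaps.\<close>

lemma H_f2_nat:
  assumes fg: "f \<in> Ar K" "g \<in> Ar K"
  shows "ff (f \<otimes>\<^bsub>K\<^esub> g) \<ast> h2 (src f) (src g) = h2 (tgt f) (tgt g) \<ast> (ff f \<diamond> ff g)"
proof -
  define a b c d where o: "a = src f" "b = tgt f" "c = src g" "d = tgt g"
  have ob: "a \<in> Obj C" "b \<in> Obj C" "c \<in> Obj C" "d \<in> Obj C" using fg by (simp_all add: o)
  have f: "to_mmap f \<in> maps C Tight [a] b" and g: "to_mmap g \<in> maps C Tight [c] d"
    using fg A.T_in by (auto simp: o)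
  have f': "to_mmap (ff f) \<in> maps D Tight [Fo a] (Fo b)" and g': "to_mmap (ff g) \<in> maps D Tight [Fo c] (Fo d)"
    using Fm_in[OF f] Fm_in[OF g] fg by (simp_all add: H_far)
  have th: "theta R b d \<in> maps C Tight [b, d] (prd R b d)" and th0: "theta R a c \<in> maps C Tight [a, c] (prd R a c)"
    and th': "theta S (Fo b) (Fo d) \<in> maps D Tight [Fo b, Fo d] (Fo b \<oplus> Fo d)"
    and th0': "theta S (Fo a) (Fo c) \<in> maps D Tight [Fo a, Fo c] (Fo a \<oplus> Fo c)"
    using ob by simp_all
  have thf: "theta R b d \<star>[1]\<^bsub>C\<^esub> to_mmap f \<in> maps C Tight [a, d] (prd R b d)"
    by (rule A.sub_in[OF th f]) simp_all
  have thf': "theta S (Fo b) (Fo d) \<star>[1]\<^bsub>D\<^esub> to_mmap (ff f) \<in> maps D Tight [Fo a, Fo d] (Fo b \<oplus> Fo d)"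
    by (rule B.sub_in[OF th' f']) simp_all
  let ?fg = "f \<otimes>\<^bsub>K\<^esub> g" and ?fg' = "ff f \<diamond> ff g"
  have "to_mmap (ff ?fg \<ast> h2 a c) \<star>[1]\<^bsub>D\<^esub> theta S (Fo a) (Fo c) = to_mmap (ff ?fg) \<star>[1]\<^bsub>D\<^esub> Fm (theta R a c)"
    using ob fg H_f2[OF ob(1,3)] by (subst B.post_assoc[OF _ _ _ th0']) (simp_all add: o)
  also have "\<dots> = Fm ((theta R b d \<star>[1]\<^bsub>C\<^esub> to_mmap f) \<star>[2]\<^bsub>C\<^esub> to_mmap g)"
    using fg A.K_TenA[OF fg] by (subst H_Fm_post[OF _ th0]) (simp_all add: o)
  also have "\<dots> = (Fm (theta R b d) \<star>[1]\<^bsub>D\<^esub> to_mmap (ff f)) \<star>[2]\<^bsub>D\<^esub> to_mmap (ff g)"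
    using fg Fm_sub[OF thf g, of 2] Fm_sub[OF th f, of 1] by (simp add: H_far)
  also have "Fm (theta R b d) \<star>[1]\<^bsub>D\<^esub> to_mmap (ff f) = to_mmap (h2 b d) \<star>[1]\<^bsub>D\<^esub> (theta S (Fo b) (Fo d) \<star>[1]\<^bsub>D\<^esub> to_mmap (ff f))"
    unfolding H_f2(4)[OF ob(2,4), symmetric] using ob by (intro B.post_sub[OF _ th' f']) simp_all
  also have "\<dots> \<star>[2]\<^bsub>D\<^esub> to_mmap (ff g) = to_mmap (h2 b d) \<star>[1]\<^bsub>D\<^esub> ((theta S (Fo b) (Fo d) \<star>[1]\<^bsub>D\<^esub> to_mmap (ff f)) \<star>[2]\<^bsub>D\<^esub> to_mmap (ff g))"
    using ob by (intro B.post_sub[OF _ thf' g']) simp_all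
  also have "(theta S (Fo b) (Fo d) \<star>[1]\<^bsub>D\<^esub> to_mmap (ff f)) \<star>[2]\<^bsub>D\<^esub> to_mmap (ff g) = to_mmap ?fg' \<star>[1]\<^bsub>D\<^esub> theta S (Fo a) (Fo c)"
    using B.K_TenA[of "ff f" "ff g"] fg by (simp add: o)
  also have "to_mmap (h2 b d) \<star>[1]\<^bsub>D\<^esub> \<dots> = to_mmap (h2 b d \<ast> ?fg') \<star>[1]\<^bsub>D\<^esub> theta S (Fo a) (Fo c)"
    using ob fg by (intro B.post_assoc[OF _ _ _ th0', symmetric]) (simp_all add: o)
  finally have eq: "to_mmap (ff ?fg \<ast> h2 a c) \<star>[1]\<^bsub>D\<^esub> theta S (Fo a) (Fo c) = to_mmap (h2 b d \<ast> ?fg') \<star>[1]\<^bsub>D\<^esub> theta S (Fo a) (Fo c)" .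
  have "ff ?fg \<ast> h2 a c = h2 b d \<ast> ?fg'"
    by (rule B.arr_inj2[OF _ _ _ _ eq, of "Fo (prd R b d)"]) (use ob fg in \<open>simp_all add: hom_iff o\<close>)
  then show ?thesis by (simp add: o)
qed

lemma H_alpha:
  assumes ob: "a \<in> Obj C" "b \<in> Obj C" "c \<in> Obj C"
  shows "ff (\<alpha>\<^bsub>K\<^esub> a b c) \<ast> h2 (prd R a b) c \<ast> (h2 a b \<diamond> Id L (Fo c))
    = h2 a (prd R b c) \<ast> (Id L (Fo a) \<diamond> h2 b c) \<ast> \<alpha>\<^bsub>L\<^esub> (Fo a) (Fo b) (Fo c)"
proof -
  let ?A = "\<alpha>\<^bsub>K\<^esub> a b c" and ?A' = "\<alpha>\<^bsub>L\<^esub> (Fo a) (Fo b) (Fo c)"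
  let ?ab = "theta S (Fo a) (Fo b)" and ?t = "theta S (Fo a \<oplus> Fo b) (Fo c)" and ?w = "theta S (Fo (prd R a b)) (Fo c)"
  let ?P = "h2 a b \<diamond> Id L (Fo c)" and ?Q = "Id L (Fo a) \<diamond> h2 b c"
  have fob: "Fo a \<in> Obj D" "Fo b \<in> Obj D" "Fo c \<in> Obj D" using ob by simp_all
  have ab: "?ab \<in> maps D Tight [Fo a, Fo b] (Fo a \<oplus> Fo b)" and w: "?w \<in> maps D Tight [Fo (prd R a b), Fo c] (Fo (prd R a b) \<oplus> Fo c)"
    and t: "?t \<in> maps D Tight [Fo a \<oplus> Fo b, Fo c] (Fo a \<oplus> Fo b \<oplus> Fo c)"
    and bc: "theta S (Fo b) (Fo c) \<in> maps D Tight [Fo b, Fo c] (Fo b \<oplus> Fo c)"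
    and a'bc: "theta S (Fo a) (Fo (prd R b c)) \<in> maps D Tight [Fo a, Fo (prd R b c)] (Fo a \<oplus> Fo (prd R b c))"
    and a'b'c': "theta S (Fo a) (Fo b \<oplus> Fo c) \<in> maps D Tight [Fo a, Fo b \<oplus> Fo c] (Fo a \<oplus> (Fo b \<oplus> Fo c))"
    using ob by simp_all
  have Cab: "theta R a b \<in> maps C Tight [a, b] (prd R a b)" and Cabc: "theta R (prd R a b) c \<in> maps C Tight [prd R a b, c] (prd R (prd R a b) c)"
    and Cbc: "theta R b c \<in> maps C Tight [b, c] (prd R b c)" and Ca'bc: "theta R a (prd R b c) \<in> maps C Tight [a, prd R b c] (prd R a (prd R b c))"
    using ob by simp_all
  have Fab: "Fm (theta R a b) \<in> maps D Tight [Fo a, Fo b] (Fo (prd R a b))" using th_Fm ob by simp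
  have Cc: "theta R (prd R a b) c \<star>[1]\<^bsub>C\<^esub> theta R a b \<in> maps C Tight [a, b, c] (prd R (prd R a b) c)"
    by (rule A.sub_in[OF Cabc Cab]) simp_all
  have wh: "?w \<star>[1]\<^bsub>D\<^esub> to_mmap (h2 a b) \<in> maps D Tight [Fo a \<oplus> Fo b, Fo c] (Fo (prd R a b) \<oplus> Fo c)"
    using ob by (intro B.sub_in[OF w B.T_in]) simp_all
  let ?X = "ff ?A \<ast> h2 (prd R a b) c"
  have X: "?X \<in> Ar L" "src ?X = Fo (prd R a b) \<oplus> Fo c" using ob by simp_all
  have P: "?P \<in> Ar L" "tgt ?P = Fo (prd R a b) \<oplus> Fo c" "src ?P = Fo a \<oplus> Fo b \<oplus> Fo c" using ob by simp_all
  have "(to_mmap (?X \<ast> ?P) \<star>[1]\<^bsub>D\<^esub> ?t) \<star>[1]\<^bsub>D\<^esub> ?ab = to_mmap ?X \<star>[1]\<^bsub>D\<^esub> ((to_mmap ?P \<star>[1]\<^bsub>D\<^esub> ?t) \<star>[1]\<^bsub>D\<^esub> ?ab)"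
    using X P fob by (intro B.post3) simp_all
  also have "to_mmap ?P \<star>[1]\<^bsub>D\<^esub> ?t = ?w \<star>[1]\<^bsub>D\<^esub> to_mmap (h2 a b)"
    using B.th_nat1[of "h2 a b" "Fo c"] ob by simp
  also have "\<dots> \<star>[1]\<^bsub>D\<^esub> ?ab = ?w \<star>[1]\<^bsub>D\<^esub> (to_mmap (h2 a b) \<star>[1]\<^bsub>D\<^esub> ?ab)"
    using ob by (intro B.pre_sub[OF w _ ab, symmetric]) simp_all
  also have "\<dots> = ?w \<star>[1]\<^bsub>D\<^esub> Fm (theta R a b)" using H_f2[OF ob(1,2)] by simp
  also have "to_mmap ?X \<star>[1]\<^bsub>D\<^esub> \<dots> = to_mmap (ff ?A) \<star>[1]\<^bsub>D\<^esub> (to_mmap (h2 (prd R a b) c) \<star>[1]\<^bsub>D\<^esub> (?w \<star>[1]\<^bsub>D\<^esub> Fm (theta R a b)))"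
    using ob by (intro B.post_assoc[OF _ _ _ B.sub_in[OF w Fab]]) simp_all
  also have "to_mmap (h2 (prd R a b) c) \<star>[1]\<^bsub>D\<^esub> (?w \<star>[1]\<^bsub>D\<^esub> Fm (theta R a b))
      = (to_mmap (h2 (prd R a b) c) \<star>[1]\<^bsub>D\<^esub> ?w) \<star>[1]\<^bsub>D\<^esub> Fm (theta R a b)"
    using ob by (intro B.post_sub[OF _ w Fab, symmetric]) simp_all
  also have "\<dots> = Fm (theta R (prd R a b) c \<star>[1]\<^bsub>C\<^esub> theta R a b)"
    using H_f2(4)[of "prd R a b" c] Fm_sub[OF Cabc Cab, of 1] ob by simp
  also have "to_mmap (ff ?A) \<star>[1]\<^bsub>D\<^esub> \<dots> = Fm (to_mmap ?A \<star>[1]\<^bsub>C\<^esub> (theta R (prd R a b) c \<star>[1]\<^bsub>C\<^esub> theta R a b))"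
    using ob by (intro H_Fm_post[OF _ Cc]) simp_all
  also have "to_mmap ?A \<star>[1]\<^bsub>C\<^esub> (theta R (prd R a b) c \<star>[1]\<^bsub>C\<^esub> theta R a b)
      = theta R a (prd R b c) \<star>[2]\<^bsub>C\<^esub> theta R b c"
    using ob A.post_sub[OF _ Cabc Cab, of ?A 1] A.K_Alpha[OF ob] by simp
  also have "Fm \<dots> = Fm (theta R a (prd R b c)) \<star>[2]\<^bsub>D\<^esub> Fm (theta R b c)"
    by (rule Fm_sub[OF Ca'bc Cbc]) simp_all
  finally have Leq: "(to_mmap (?X \<ast> ?P) \<star>[1]\<^bsub>D\<^esub> ?t) \<star>[1]\<^bsub>D\<^esub> ?ab = Fm (theta R a (prd R b c)) \<star>[2]\<^bsub>D\<^esub> Fm (theta R b c)" .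
  let ?Y = "h2 a (prd R b c)"
  have "(to_mmap (?Y \<ast> ?Q \<ast> ?A') \<star>[1]\<^bsub>D\<^esub> ?t) \<star>[1]\<^bsub>D\<^esub> ?ab
      = to_mmap (?Y \<ast> ?Q) \<star>[1]\<^bsub>D\<^esub> (theta S (Fo a) (Fo b \<oplus> Fo c) \<star>[2]\<^bsub>D\<^esub> theta S (Fo b) (Fo c))"
    using ob fob B.K_Alpha[OF fob] by (subst B.post3) simp_all
  also have "\<dots> = to_mmap ?Y \<star>[1]\<^bsub>D\<^esub> (to_mmap ?Q \<star>[1]\<^bsub>D\<^esub> (theta S (Fo a) (Fo b \<oplus> Fo c) \<star>[2]\<^bsub>D\<^esub> theta S (Fo b) (Fo c)))"
    using ob by (intro B.post_assoc[OF _ _ _ B.sub_in[OF a'b'c' bc]]) simp_all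
  also have "to_mmap ?Q \<star>[1]\<^bsub>D\<^esub> (theta S (Fo a) (Fo b \<oplus> Fo c) \<star>[2]\<^bsub>D\<^esub> theta S (Fo b) (Fo c))
      = (to_mmap ?Q \<star>[1]\<^bsub>D\<^esub> theta S (Fo a) (Fo b \<oplus> Fo c)) \<star>[2]\<^bsub>D\<^esub> theta S (Fo b) (Fo c)"
    using ob by (intro B.post_sub[OF _ a'b'c' bc, symmetric]) simp_all
  also have "to_mmap ?Q \<star>[1]\<^bsub>D\<^esub> theta S (Fo a) (Fo b \<oplus> Fo c) = theta S (Fo a) (Fo (prd R b c)) \<star>[2]\<^bsub>D\<^esub> to_mmap (h2 b c)"
    using B.th_nat2[of "h2 b c" "Fo a"] ob by simp
  also have "\<dots> \<star>[2]\<^bsub>D\<^esub> theta S (Fo b) (Fo c) = theta S (Fo a) (Fo (prd R b c)) \<star>[2]\<^bsub>D\<^esub> Fm (theta R b c)"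
    using ob H_f2[OF ob(2,3)] B.pre_sub[OF a'bc _ bc, of "h2 b c" 2] by simp
  also have "to_mmap ?Y \<star>[1]\<^bsub>D\<^esub> \<dots> = Fm (theta R a (prd R b c)) \<star>[2]\<^bsub>D\<^esub> Fm (theta R b c)"
    using ob H_f2[of a "prd R b c"] B.post_sub[OF _ a'bc th_Fm[OF ob(2,3)], of ?Y 2] by simp
  finally have Req: "(to_mmap (?Y \<ast> ?Q \<ast> ?A') \<star>[1]\<^bsub>D\<^esub> ?t) \<star>[1]\<^bsub>D\<^esub> ?ab = Fm (theta R a (prd R b c)) \<star>[2]\<^bsub>D\<^esub> Fm (theta R b c)" .
  show ?thesis
    by (rule B.arr_inj3[OF _ _ fob, of _ "Fo (prd R a (prd R b c))"]) (use ob Leq Req in \<open>simp_all add: hom_iff\<close>)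
qed

lemma H_lam:
  assumes a: "a \<in> Obj C"
  shows "ff (\<lambda>\<lambda>\<^bsub>K\<^esub> a) \<ast> h2 (uob R) a \<ast> (f0 H \<diamond> Id L (Fo a)) = \<lambda>\<lambda>\<^bsub>L\<^esub> (Fo a)"
proof -
  let ?l = "\<lambda>\<lambda>\<^bsub>K\<^esub> a" and ?l' = "\<lambda>\<lambda>\<^bsub>L\<^esub> (Fo a)" and ?P = "f0 H \<diamond> Id L (Fo a)" and ?t = "theta S (uob S) (Fo a)"
  let ?X = "ff ?l \<ast> h2 (uob R) a" and ?w = "theta S (Fo (uob R)) (Fo a)"
  have t: "?t \<in> maps D Tight [uob S, Fo a] (uob S \<oplus> Fo a)" and w: "?w \<in> maps D Tight [Fo (uob R), Fo a] (Fo (uob R) \<oplus> Fo a)"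
    using a by simp_all
  have Ct: "theta R (uob R) a \<in> maps C Tight [uob R, a] (prd R (uob R) a)" using a by simp
  have Clt: "to_mmap ?l \<star>[1]\<^bsub>C\<^esub> theta R (uob R) a \<in> maps C Tight [uob R, a] a"
    using a by (intro A.post_in'[OF _ Ct]) simp_all
  have wf: "?w \<star>[1]\<^bsub>D\<^esub> to_mmap (f0 H) \<in> maps D Tight [uob S, Fo a] (Fo (uob R) \<oplus> Fo a)"
    using a by (intro B.sub_in[OF w B.T_in]) simp_all
  have X: "?X \<in> Ar L" "src ?X = Fo (uob R) \<oplus> Fo a" "tgt ?X = Fo a" using a by simp_all
  have Xw: "to_mmap ?X \<star>[1]\<^bsub>D\<^esub> ?w = Fm (to_mmap ?l \<star>[1]\<^bsub>C\<^esub> theta R (uob R) a)"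
    using a H_f2[of "uob R" a] H_Fm_post[OF _ Ct, of ?l] by (subst B.post_assoc[OF _ _ _ w]) simp_all
  have 1: "to_mmap (?X \<ast> ?P) \<star>[1]\<^bsub>D\<^esub> ?t = Fm (to_mmap ?l \<star>[1]\<^bsub>C\<^esub> theta R (uob R) a) \<star>[1]\<^bsub>D\<^esub> to_mmap (f0 H)"
  proof -
    have "to_mmap (?X \<ast> ?P) \<star>[1]\<^bsub>D\<^esub> ?t = to_mmap ?X \<star>[1]\<^bsub>D\<^esub> (to_mmap ?P \<star>[1]\<^bsub>D\<^esub> ?t)"
      using a X by (intro B.post_assoc[OF _ _ _ t]) simp_all
    also have "to_mmap ?P \<star>[1]\<^bsub>D\<^esub> ?t = ?w \<star>[1]\<^bsub>D\<^esub> to_mmap (f0 H)"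
      using B.th_nat1[of "f0 H" "Fo a"] a by simp
    also have "to_mmap ?X \<star>[1]\<^bsub>D\<^esub> \<dots> = (to_mmap ?X \<star>[1]\<^bsub>D\<^esub> ?w) \<star>[1]\<^bsub>D\<^esub> to_mmap (f0 H)"
      using a X by (intro B.post_sub[OF _ w B.T_in, symmetric]) simp_all
    finally show ?thesis using Xw by simp
  qed
  have FClt: "Fm (to_mmap ?l \<star>[1]\<^bsub>C\<^esub> theta R (uob R) a) \<in> maps D Tight [Fo (uob R), Fo a] (Fo a)"
    using Fm_in[OF Clt] by simp
  have "(to_mmap (?X \<ast> ?P) \<star>[1]\<^bsub>D\<^esub> ?t) \<star>[1]\<^bsub>D\<^esub> umap S = Fm (to_mmap ?l \<star>[1]\<^bsub>C\<^esub> theta R (uob R) a) \<star>[1]\<^bsub>D\<^esub> Fm (umap R)"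
    unfolding 1 H_f0(4)[symmetric] by (rule B.pre_sub[OF FClt _ B.u_in, symmetric]) simp_all
  also have "\<dots> = Fm ((to_mmap ?l \<star>[1]\<^bsub>C\<^esub> theta R (uob R) a) \<star>[1]\<^bsub>C\<^esub> umap R)"
    by (rule Fm_sub[OF Clt A.u_in, symmetric]) simp_all
  also have "\<dots> = \<j>\<^bsub>D\<^esub> (Idm D (Fo a))"
    using A.K_Lam[OF a] Fm_jay[of "Idm C a"] A.mapsD[OF A.idm[OF a]] Fm_id[OF a] by simp
  also have "\<dots> = (to_mmap ?l' \<star>[1]\<^bsub>D\<^esub> ?t) \<star>[1]\<^bsub>D\<^esub> umap S" using B.K_Lam[of "Fo a"] a by simp
  finally have eq: "(to_mmap (?X \<ast> ?P) \<star>[1]\<^bsub>D\<^esub> ?t) \<star>[1]\<^bsub>D\<^esub> umap S = (to_mmap ?l' \<star>[1]\<^bsub>D\<^esub> ?t) \<star>[1]\<^bsub>D\<^esub> umap S" .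
  have "to_mmap (?X \<ast> ?P) \<star>[1]\<^bsub>D\<^esub> ?t \<in> maps D Tight [uob S, Fo a] (Fo a)"
    "to_mmap ?l' \<star>[1]\<^bsub>D\<^esub> ?t \<in> maps D Tight [uob S, Fo a] (Fo a)"
    using a X by (intro B.post_in'[OF _ t]; simp)+
  from B.u_inj[OF this eq] have eq2: "to_mmap (?X \<ast> ?P) \<star>[1]\<^bsub>D\<^esub> ?t = to_mmap ?l' \<star>[1]\<^bsub>D\<^esub> ?t" by simp
  show ?thesis
    by (rule B.arr_inj2[OF _ _ _ _ eq2, of "Fo a"]) (use a in \<open>simp_all add: hom_iff\<close>)
qed

lemma H_rho:
  assumes a: "a \<in> Obj C"
  shows "h2 a (uob R) \<ast> (Id L (Fo a) \<diamond> f0 H) \<ast> \<rho>\<^bsub>L\<^esub> (Fo a) = ff (\<rho>\<^bsub>K\<^esub> a)"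
proof (rule B.arr_eqT)
  let ?Q = "Id L (Fo a) \<diamond> f0 H" and ?t = "theta S (Fo a) (uob S)" and ?w = "theta S (Fo a) (Fo (uob R))"
  have t: "?t \<in> maps D Tight [Fo a, uob S] (Fo a \<oplus> uob S)" and w: "?w \<in> maps D Tight [Fo a, Fo (uob R)] (Fo a \<oplus> Fo (uob R))"
    using a by simp_all
  have Ct: "theta R a (uob R) \<in> maps C Tight [a, uob R] (prd R a (uob R))" using a by simp
  have r: "?t \<star>[2]\<^bsub>D\<^esub> umap S \<in> maps D Tight [Fo a] (Fo a \<oplus> uob S)" by (rule B.sub_in[OF t B.u_in]) simp_all
  have "to_mmap (h2 a (uob R) \<ast> ?Q \<ast> \<rho>\<^bsub>L\<^esub> (Fo a)) = to_mmap (h2 a (uob R) \<ast> ?Q) \<star>[1]\<^bsub>D\<^esub> (?t \<star>[2]\<^bsub>D\<^esub> umap S)"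
    using a by (simp add: B.K_Comp B.K_Rho)
  also have "\<dots> = to_mmap (h2 a (uob R)) \<star>[1]\<^bsub>D\<^esub> (to_mmap ?Q \<star>[1]\<^bsub>D\<^esub> (?t \<star>[2]\<^bsub>D\<^esub> umap S))"
    using a by (intro B.post_assoc[OF _ _ _ r]) simp_all
  also have "to_mmap ?Q \<star>[1]\<^bsub>D\<^esub> (?t \<star>[2]\<^bsub>D\<^esub> umap S) = (to_mmap ?Q \<star>[1]\<^bsub>D\<^esub> ?t) \<star>[2]\<^bsub>D\<^esub> umap S"
    using a by (intro B.post_sub[OF _ t B.u_in, symmetric]) simp_all
  also have "to_mmap ?Q \<star>[1]\<^bsub>D\<^esub> ?t = ?w \<star>[2]\<^bsub>D\<^esub> to_mmap (f0 H)" using B.th_nat2[of "f0 H" "Fo a"] a by simp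
  also have "\<dots> \<star>[2]\<^bsub>D\<^esub> umap S = ?w \<star>[2]\<^bsub>D\<^esub> Fm (umap R)"
    unfolding H_f0(4)[symmetric] by (rule B.pre_sub[OF w _ B.u_in, symmetric]) simp_all
  also have "to_mmap (h2 a (uob R)) \<star>[1]\<^bsub>D\<^esub> \<dots> = (to_mmap (h2 a (uob R)) \<star>[1]\<^bsub>D\<^esub> ?w) \<star>[2]\<^bsub>D\<^esub> Fm (umap R)"
    using a by (intro B.post_sub[OF _ w u_Fm, symmetric]) simp_all
  also have "\<dots> = Fm (theta R a (uob R) \<star>[2]\<^bsub>C\<^esub> umap R)"
    using a H_f2[of a "uob R"] Fm_sub[OF Ct A.u_in, of 2] by simp
  finally show "to_mmap (h2 a (uob R) \<ast> ?Q \<ast> \<rho>\<^bsub>L\<^esub> (Fo a)) = to_mmap (ff (\<rho>\<^bsub>K\<^esub> a))"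
    using a by (simp add: H_far A.K_Rho)
qed

theorem H_lax: "lax_monoidal K L H"
proof -
  have "fob H \<in> extensional (Obj C)"
    using F by (simp add: morphism_def multi_graph_map_def PiE_def)
  moreover have "far H \<in> extensional (Ar K)" "\<not> (a \<in> Obj C \<and> b \<in> Obj C) \<Longrightarrow> f2 H a b = undefined" for a b
    using H by (auto simp: lax_spec_def)
  ultimately show ?thesis
    using A.K_skew_monoidal B.K_skew_monoidal H_functor
    by (auto simp: lax_monoidal_def lax_monoidal_axioms_def hom_iff H_f2_nat H_alpha H_lam H_rho)
qed

sublocale HL: lax K L H
  using H_lax by (simp add: lax_iff)

text \<open>The iterated comparison maps of \<open>H\<close> are the factorisations of the images of universal multimaps
  through universal multimaps.\<close>

lemma Fm_theta_list:
  assumes "a \<in> Obj C" "set xs \<subseteq> Obj C" "s \<longrightarrow> length xs \<le> 3"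
  shows "Fm (theta_list C R a xs) = to_mmap (f2_list K L H a xs) \<star>[1]\<^bsub>D\<^esub> theta_list D S (Fo a) (map Fo xs)"
  using assms
proof (induction xs arbitrary: a)
  case Nil
  then show ?case using B.id_subT[OF B.idm[of "Fo a"]] by (simp add: Fm_id B.K_Id)
next
  case (Cons x xs)
  let ?xs = "map Fo xs" and ?ax = "prd R a x" and ?f = "f2_list K L H (prd R a x) xs"
  have o: "x \<in> Obj C" "set xs \<subseteq> Obj C" "?ax \<in> Obj C" using Cons.prems by auto
  have 1: "theta_list C R ?ax xs \<in> maps C Tight (?ax # xs) (lten K ?ax xs)"
    using Cons.prems by (intro A.theta_list_in) auto
  have 2: "theta R a x \<in> maps C Tight [a, x] ?ax" using Cons.prems by simp
  have 3: "theta_list D S (Fo ?ax) ?xs \<in> maps D Tight (Fo ?ax # ?xs) (lten L (Fo ?ax) ?xs)"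
    using Cons.prems by (intro B.theta_list_in) auto
  have 4: "theta_list D S (Fo a) (map Fo (x # xs)) \<in> maps D Tight (Fo a # map Fo (x # xs)) (lten L (Fo a) (map Fo (x # xs)))"
    using Cons.prems by (intro B.theta_list_in) auto
  have f: "?f \<in> Ar L" "src ?f = lten L (Fo ?ax) ?xs" using o HL.f2_list_arr[of ?ax xs] by simp_all
  have "Fm (theta_list C R a (x # xs)) = Fm (theta_list C R ?ax xs) \<star>[1]\<^bsub>D\<^esub> Fm (theta R a x)"
    using Cons.prems Fm_sub[OF 1 2, of 1] by auto
  also have "\<dots> = (to_mmap ?f \<star>[1]\<^bsub>D\<^esub> theta_list D S (Fo ?ax) ?xs) \<star>[1]\<^bsub>D\<^esub> Fm (theta R a x)"
    using Cons.prems Cons.IH[of ?ax] by auto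
  also have "\<dots> = to_mmap ?f \<star>[1]\<^bsub>D\<^esub> (theta_list D S (Fo ?ax) ?xs \<star>[1]\<^bsub>D\<^esub> Fm (theta R a x))"
    using Cons.prems f by (intro B.post_sub[OF _ 3 th_Fm[of a x]]) auto
  also have "Fm (theta R a x) = to_mmap (h2 a x) \<star>[1]\<^bsub>D\<^esub> universal D S Tight [Fo a, Fo x]"
    using Cons.prems H_f2(4)[of a x] B.theta_list_snoc1[of "Fo a" "Fo x"] by simp
  also have "theta_list D S (Fo ?ax) ?xs \<star>[1]\<^bsub>D\<^esub> \<dots> = to_mmap (ltenA L (h2 a x) ?xs) \<star>[1]\<^bsub>D\<^esub> theta_list D S (Fo a) (map Fo (x # xs))"
    using B.theta_list_post[of "h2 a x" Tight "[Fo a, Fo x]" ?xs] Cons.prems by auto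
  also have "to_mmap ?f \<star>[1]\<^bsub>D\<^esub> \<dots> = to_mmap (?f \<ast> ltenA L (h2 a x) ?xs) \<star>[1]\<^bsub>D\<^esub> theta_list D S (Fo a) (map Fo (x # xs))"
    using f Cons.prems by (intro B.post_assoc[OF _ _ _ 4, symmetric]) simp_all
  finally show ?case by simp
qed

lemma Fm_universal:
  assumes "set as \<subseteq> Obj C" "uins K x as \<noteq> []" "arity_ok s x (length as)"
  shows "Fm (universal C R x as) = to_mmap (f2_ins K L H x as) \<star>[1]\<^bsub>D\<^esub> universal D S x (map Fo as)"
proof (cases x)
  case Tight
  then show ?thesis using assms Fm_theta_list by (cases as) (auto simp: f2_ins_def)
next
  case Loose
  let ?as = "map Fo as" and ?i = "uob R" and ?f = "f2_list K L H (uob R) as"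
  have len: "s \<longrightarrow> length as \<le> 2" using assms Loose by simp
  have 1: "theta_list C R ?i as \<in> maps C Tight (?i # as) (lten K ?i as)" using assms len by (intro A.theta_list_in) auto
  have 3: "theta_list D S (Fo ?i) ?as \<in> maps D Tight (Fo ?i # ?as) (lten L (Fo ?i) ?as)"
    using assms len by (intro B.theta_list_in) auto
  have 4: "universal D S Loose ?as \<in> maps D Loose ?as (lten L (uob S) ?as)"
    using B.universal_in[of ?as Loose] assms len by auto
  have f: "?f \<in> Ar L" "src ?f = lten L (Fo ?i) ?as" using assms HL.f2_list_arr[of ?i as] by simp_all
  have "Fm (universal C R x as) = Fm (theta_list C R ?i as) \<star>[1]\<^bsub>D\<^esub> Fm (umap R)"
    using Loose len Fm_sub[OF 1 A.u_in, of 1] by auto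
  also have "\<dots> = (to_mmap ?f \<star>[1]\<^bsub>D\<^esub> theta_list D S (Fo ?i) ?as) \<star>[1]\<^bsub>D\<^esub> Fm (umap R)"
    using assms len Fm_theta_list[of ?i as] by auto
  also have "\<dots> = to_mmap ?f \<star>[1]\<^bsub>D\<^esub> (theta_list D S (Fo ?i) ?as \<star>[1]\<^bsub>D\<^esub> Fm (umap R))"
    using len f by (intro B.post_sub[OF _ 3 u_Fm]) auto
  also have "Fm (umap R) = to_mmap (f0 H) \<star>[1]\<^bsub>D\<^esub> universal D S Loose []"
    using H_f0(4) B.id_subT[OF B.u_in] by simp
  also have "theta_list D S (Fo ?i) ?as \<star>[1]\<^bsub>D\<^esub> \<dots> = to_mmap (ltenA L (f0 H) ?as) \<star>[1]\<^bsub>D\<^esub> universal D S Loose ?as"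
    using B.theta_list_post[of "f0 H" Loose "[]" ?as] assms len by auto
  also have "to_mmap ?f \<star>[1]\<^bsub>D\<^esub> \<dots> = to_mmap (?f \<ast> ltenA L (f0 H) ?as) \<star>[1]\<^bsub>D\<^esub> universal D S Loose ?as"
    using f assms by (intro B.post_assoc[OF _ _ _ 4, symmetric]) simp_all
  finally show ?thesis using Loose by (simp add: f2_ins_def)
qed

theorem realize_natural:
  assumes f: "A.KM.ismap f" "arity_ok s (ty f) (arity f)"
  shows "Fm (realize C R K f) = realize D S L (M_map K L H f)"
proof -
  let ?b = "arr_of K f" and ?G = "f2_ins K L H (ty f) (ins f)"
  have w: "set (ins f) \<subseteq> Obj C" "uins K (ty f) (ins f) \<noteq> []" using A.KM.ismapD[OF f(1)] by auto
  have t: "universal C R (ty f) (ins f) \<in> maps C (ty f) (ins f) (prodl K (uins K (ty f) (ins f)))" by (rule A.realize_in[OF f])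
  have b: "arr_of L (M_map K L H f) = ff ?b \<ast> ?G" by (rule HL.arr_of_M_map[OF f(1)])
  have b2: "?b \<in> Ar K" "src ?b = prodl K (uins K (ty f) (ins f))" using f by simp_all
  have G: "?G \<in> Ar L" "tgt ?G = Fo (prodl K (uins K (ty f) (ins f)))" "src ?G = prodl L (uins L (ty f) (map Fo (ins f)))"
    using HL.f2_ins_arr[of "ins f" "ty f"] w by simp_all
  have t': "universal D S (ty f) (map Fo (ins f)) \<in> maps D (ty f) (map Fo (ins f)) (prodl L (uins L (ty f) (map Fo (ins f))))"
    using w f(2) by (intro B.universal_in) (auto simp: arity_def uins_def)
  have "Fm (realize C R K f) = to_mmap (ff ?b) \<star>[1]\<^bsub>D\<^esub> Fm (universal C R (ty f) (ins f))"
    unfolding realize_def using b2 by (intro H_Fm_post[OF _ t, symmetric]) simp_all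
  also have "Fm (universal C R (ty f) (ins f)) = to_mmap ?G \<star>[1]\<^bsub>D\<^esub> universal D S (ty f) (map Fo (ins f))"
    using w f by (intro Fm_universal) (simp_all add: arity_def)
  also have "to_mmap (ff ?b) \<star>[1]\<^bsub>D\<^esub> \<dots> = to_mmap (ff ?b \<ast> ?G) \<star>[1]\<^bsub>D\<^esub> universal D S (ty f) (map Fo (ins f))"
    using b2 G by (intro B.post_assoc[OF _ _ _ t', symmetric]) simp_all
  also have "\<dots> = realize D S L (M_map K L H f)" unfolding realize_def b by simp
  finally show ?thesis .
qed

text \<open>Equations of arrows follow from those of \<open>lax_spec\<close> by universality, and outside the carriers both
  functors are undefined.\<close>

lemma H_unique:
  assumes "lax_spec C R K D S L F H'"
  shows "H' = H"
proof -
  have "far H' f = ff f" for f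
  proof (cases "f \<in> Ar K")
    case True
    then have "to_mmap (far H' f) = to_mmap (ff f)" using assms H_far by (simp add: lax_spec_def)
    then show ?thesis by simp
  next
    case False
    then show ?thesis using assms H by (auto simp: lax_spec_def extensional_def)
  qed
  moreover have "f2 H' a b = h2 a b" for a b
  proof (cases "a \<in> Obj C \<and> b \<in> Obj C")
    case True
    then show ?thesis using assms H
      by (intro B.arr_inj2[of _ "Fo a" "Fo b" "Fo (prd R a b)"]) (auto simp: lax_spec_def)
  next
    case False
    then show ?thesis using assms H by (simp add: lax_spec_def)
  qed
  moreover have "f0 H' = f0 H"
  proof -
    have h: "f0 H' \<in> hom L (uob S) (Fo (uob R))" "f0 H \<in> hom L (uob S) (Fo (uob R))"
      and eq: "to_mmap (f0 H') \<star>[1]\<^bsub>D\<^esub> umap S = to_mmap (f0 H) \<star>[1]\<^bsub>D\<^esub> umap S"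
      using assms H by (auto simp: lax_spec_def)
    from B.u_inj[OF B.T_hom[OF h(1)] B.T_hom[OF h(2)] eq] show ?thesis by simp
  qed
  moreover have "fob H' = fob H" using assms by (simp add: lax_spec_def)
  ultimately show ?thesis by (intro laxf.equality) (auto simp: fun_eq_iff)
qed

end

lemma morphism_comp:
  assumes "morphism s C D F" "morphism s D E G"
    "\<And>g f i. \<lbrakk>g \<in> Maps C; f \<in> Maps C; fits g i f; op_ok s (ty g) (arity g) (ty f) (arity f)\<rbrakk> \<Longrightarrow> g \<star>[i]\<^bsub>C\<^esub> f \<in> Maps C"
    "\<And>f. \<lbrakk>f \<in> Maps C; ty f = Tight; arity_ok s Loose (arity f)\<rbrakk> \<Longrightarrow> \<j>\<^bsub>C\<^esub> f \<in> Maps C"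
    "\<And>a. a \<in> Obj C \<Longrightarrow> Idm C a \<in> Maps C" "\<And>f. f \<in> Maps C \<Longrightarrow> set (ins f) \<subseteq> Obj C \<and> out f \<in> Obj C"
  shows "morphism s C E (comp_multif C G F)"
proof -
  have ob: "mob F a \<in> Obj D" if "a \<in> Obj C" for a
    using that assms(1) by (auto simp: morphism_def multi_graph_map_def)
  have mp: "mmp F f \<in> Maps D \<and> ty (mmp F f) = ty f \<and> ins (mmp F f) = map (mob F) (ins f) \<and> out (mmp F f) = mob F (out f) \<and> arity (mmp F f) = arity f"
    if "f \<in> Maps C" for f
    using that assms(1) by (auto simp: morphism_def multi_graph_map_def maps_def arity_def)
  have ob': "mob G a \<in> Obj E" if "a \<in> Obj D" for a
    using that assms(2) by (auto simp: morphism_def multi_graph_map_def)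
  have mp': "mmp G f \<in> Maps E \<and> ty (mmp G f) = ty f \<and> ins (mmp G f) = map (mob G) (ins f) \<and> out (mmp G f) = mob G (out f)"
    if "f \<in> Maps D" for f
    using that assms(2) by (auto simp: morphism_def multi_graph_map_def maps_def)
  have fits: "fits (mmp F g) i (mmp F f)" if "g \<in> Maps C" "f \<in> Maps C" "fits g i f" for g f i
    using that mp[of g] mp[of f] by (auto simp: fits_def arity_def)
  have sub: "mmp F (g \<star>[i]\<^bsub>C\<^esub> f) = mmp F g \<star>[i]\<^bsub>D\<^esub> mmp F f"
    if "g \<in> Maps C" "f \<in> Maps C" "fits g i f" "op_ok s (ty g) (arity g) (ty f) (arity f)" for g f i
    using that assms(1) by (auto simp: morphism_def)
  have sub': "mmp G (g \<star>[i]\<^bsub>D\<^esub> f) = mmp G g \<star>[i]\<^bsub>E\<^esub> mmp G f"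
    if "g \<in> Maps D" "f \<in> Maps D" "fits g i f" "op_ok s (ty g) (arity g) (ty f) (arity f)" for g f i
    using that assms(2) by (auto simp: morphism_def)
  have 1: "multi_graph_map C E (comp_multif C G F)"
    using ob ob' mp mp' assms(6)
    by (auto simp: multi_graph_map_def comp_multif_def compose_def maps_def subset_iff)
  have 2: "mmp (comp_multif C G F) (Idm C a) = Idm E (mob (comp_multif C G F) a)" if "a \<in> Obj C" for a
    using that assms(1,2,5) ob by (auto simp: morphism_def comp_multif_def compose_def)
  have 3: "mmp (comp_multif C G F) (\<j>\<^bsub>C\<^esub> f) = \<j>\<^bsub>E\<^esub> (mmp (comp_multif C G F) f)"
    if "f \<in> Maps C" "ty f = Tight" "arity_ok s Loose (arity f)" for f
    using that assms(1,2,4) mp by (auto simp: morphism_def comp_multif_def compose_def)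
  have 4: "mmp (comp_multif C G F) (g \<star>[i]\<^bsub>C\<^esub> f) = mmp (comp_multif C G F) g \<star>[i]\<^bsub>E\<^esub> mmp (comp_multif C G F) f"
    if "g \<in> Maps C" "f \<in> Maps C" "fits g i f" "op_ok s (ty g) (arity g) (ty f) (arity f)" for g f i
    using that sub[OF that] sub'[of "mmp F g" "mmp F f" i] fits[OF that(1-3)] mp assms(3)[OF that]
    by (simp add: comp_multif_def compose_def)
  show ?thesis unfolding morphism_def using 1 2 3 4 by blast
qed

context bounded_multi begin

lemma morphism_comp': "morphism s C D F \<Longrightarrow> morphism s D E G \<Longrightarrow> morphism s C E (comp_multif C G F)"
  using sub jay idm map_wf by (intro morphism_comp) (auto simp: maps_def)

lemma morphism_id: "morphism s C C (id_multif C)"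
  using sub jay idm map_wf
  by (auto simp: morphism_def id_multif_def multi_graph_map_def maps_def subset_iff intro!: map_idI[symmetric])

end

text \<open>Identities and composites of lax monoidal functors satisfy the equations for identities and
  composites of morphisms.  By \<open>H_unique\<close> this is functoriality.\<close>

lemma lax_spec_id:
  assumes "rep_skewmon s C R K"
  shows "lax_spec C R K C R K (id_multif C) (id_lax K)"
proof -
  interpret rep_skewmon s C R K by fact
  have "to_mmap (Id K \<iota>) \<star>[1]\<^bsub>C\<^esub> u = u" using id_subT[OF u_in] by (simp add: K_Id)
  moreover have "to_mmap (Id K (prd R a b)) \<star>[1]\<^bsub>C\<^esub> \<theta> a b = \<theta> a b" if "a \<in> Obj C" "b \<in> Obj C" for a b
    using id_subT[OF th_in[OF that refl]] that by (simp add: K_Id)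
  moreover have "u \<in> Maps C" using mapsD[OF u_in] by simp
  moreover have "\<theta> a b \<in> Maps C" if "a \<in> Obj C" "b \<in> Obj C" for a b
    using mapsD[OF th_in[OF that refl]] by simp
  ultimately show ?thesis
    by (auto simp: lax_spec_def id_lax_def id_multif_def hom_iff K_Ar[symmetric])
qed

lemma lax_spec_comp:
  assumes "rep_laxf s C R K D S L F H" "rep_laxf s D S L E Q N G J"
  shows "lax_spec C R K E Q N (comp_multif C G F) (comp_lax K N J H)"
proof -
  interpret X: rep_laxf s C R K D S L F H by fact
  interpret Y: rep_laxf s D S L E Q N G J by fact
  let ?I = "comp_lax K N J H"
  have uC: "umap R \<in> Maps C" using X.A.mapsD[OF X.A.u_in] by simp
  have tC: "theta R a b \<in> Maps C" if "a \<in> Obj C" "b \<in> Obj C" for a b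
    using X.A.mapsD[OF X.A.th_in[OF that refl]] by simp
  have far: "to_mmap (far ?I f) = mmp (comp_multif C G F) (to_mmap f)" if "f \<in> Ar K" for f
    using that X.H_far[OF that] Y.H_far[of "far H f"]
    by (simp add: comp_lax_def comp_multif_def compose_def X.A.K_Ar)
  have f0: "to_mmap (far J (f0 H) \<cdot>\<^bsub>N\<^esub> f0 J) \<star>[1]\<^bsub>E\<^esub> umap Q = mmp G (mmp F (umap R))"
  proof -
    have "to_mmap (far J (f0 H) \<cdot>\<^bsub>N\<^esub> f0 J) \<star>[1]\<^bsub>E\<^esub> umap Q = to_mmap (far J (f0 H)) \<star>[1]\<^bsub>E\<^esub> (to_mmap (f0 J) \<star>[1]\<^bsub>E\<^esub> umap Q)"
      by (intro Y.B.post_assoc[OF _ _ _ Y.B.u_in]) simp_all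
    also have "\<dots> = mmp G (to_mmap (f0 H) \<star>[1]\<^bsub>D\<^esub> umap S)"
      unfolding Y.H_f0(4) by (intro Y.H_Fm_post[OF _ X.B.u_in]) simp_all
    finally show ?thesis using X.H_f0(4) by simp
  qed
  have f2: "to_mmap (far J (f2 H a b) \<cdot>\<^bsub>N\<^esub> f2 J (mob F a) (mob F b)) \<star>[1]\<^bsub>E\<^esub> theta Q (mob G (mob F a)) (mob G (mob F b))
      = mmp G (mmp F (theta R a b))" if ab: "a \<in> Obj C" "b \<in> Obj C" for a b
  proof -
    have fab: "mob F a \<in> Obj D" "mob F b \<in> Obj D" using ab by simp_all
    have "to_mmap (far J (f2 H a b) \<cdot>\<^bsub>N\<^esub> f2 J (mob F a) (mob F b)) \<star>[1]\<^bsub>E\<^esub> theta Q (mob G (mob F a)) (mob G (mob F b))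
       = to_mmap (far J (f2 H a b)) \<star>[1]\<^bsub>E\<^esub> (to_mmap (f2 J (mob F a) (mob F b)) \<star>[1]\<^bsub>E\<^esub> theta Q (mob G (mob F a)) (mob G (mob F b)))"
      using ab by (intro Y.B.post_assoc[OF _ _ _ Y.B.th_in]) simp_all
    also have "\<dots> = mmp G (to_mmap (f2 H a b) \<star>[1]\<^bsub>D\<^esub> theta S (mob F a) (mob F b))"
      unfolding Y.H_f2(4)[OF fab] using ab by (intro Y.H_Fm_post[OF _ X.B.th_in]) simp_all
    finally show ?thesis using X.H_f2(4)[OF ab] by simp
  qed
  have ext: "far ?I \<in> extensional (Ar K)" "fob ?I = mob (comp_multif C G F)"
    by (simp_all add: comp_lax_def comp_multif_def)
  show ?thesis
    unfolding lax_spec_def using far ext f0 f2 uC tC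
    by (auto simp: comp_lax_def[of K N J H] comp_multif_def compose_def hom_iff)
qed

section \<open>Skew multicategories and short skew multicategories as instances\<close>

lemma sub_type_Tight [simp]: "sub_type x i Tight = x"
  by (cases x) (simp_all add: sub_type_def)

lemma bounded_multi_full:
  assumes "skew_multicategory C"
  shows "bounded_multi False C"
proof -
  interpret skew_multicategory C by fact
  have ar1: "arity f = length (ins f)" for f :: "('a, 'b) mmap" by (simp add: arity_def)
  have id1: "ty (Idm C a) = Tight \<and> Idm C a \<in> Maps C \<and> ins (Idm C a) = [a] \<and> out (Idm C a) = a" if "a \<in> Obj C" for a
    using idm[OF that] by (auto simp: maps_def)
  show ?thesis
  proof
    fix f assume f: "f \<in> Maps C"
    have o: "out f \<in> Obj C" "set (ins f) \<subseteq> Obj C" using map_wf[OF f] by auto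
    have fit: "fits (Idm C (out f)) 1 f" using id1[OF o(1)] by (simp add: fits_def arity_def)
    show "\<j>\<^bsub>C\<^esub> (Idm C (out f)) \<star>[1]\<^bsub>C\<^esub> f = \<j>\<^bsub>C\<^esub> f" if "ty f = Tight"
      using jay_sub_left[OF _ f fit] id1[OF o(1)] id_sub[OF f] that by (simp add: sub_type_def)
    show "\<j>\<^bsub>C\<^esub> (Idm C (out f)) \<star>[1]\<^bsub>C\<^esub> f = f" if "ty f = Loose"
      using jay_sub_left[OF _ f fit] id1[OF o(1)] id_sub[OF f] that by (simp add: sub_type_def)
    show "f \<star>[2]\<^bsub>C\<^esub> \<j>\<^bsub>C\<^esub> (Idm C (ins f ! 1)) = f" if "ty f = Tight" "arity f = 2"
    proof -
      have a: "ins f ! 1 \<in> Obj C" using o(2) that by (auto simp: arity_def)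
      have "fits f 2 (Idm C (ins f ! 1))" using id1[OF a] that by (simp add: fits_def)
      from jay_sub_right[OF f _ this] show ?thesis
        using id1[OF a] sub_id[OF f, of 2] that by (simp add: sub_type_def)
    qed
    show "f \<star>[1]\<^bsub>C\<^esub> \<j>\<^bsub>C\<^esub> (Idm C (ins f ! 0)) = \<j>\<^bsub>C\<^esub> f" if t: "ty f = Tight"
    proof -
      have l: "1 \<le> arity f" using map_wf[OF f] t by simp
      then have a: "ins f ! 0 \<in> Obj C" using o(2) by (cases "ins f") (auto simp: arity_def)
      have "fits f 1 (Idm C (ins f ! 0))" using id1[OF a] l by (simp add: fits_def)
      from jay_sub_right[OF f _ this] show ?thesis
        using id1[OF a] sub_id[OF f, of 1] l t by (simp add: sub_type_def)
    qed
  qed (use map_wf idm jay sub id_sub sub_id sub_assoc sub_commute in \<open>auto simp: arity_ok_def\<close>)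
qed

lemma short_op_not_unary:
  "short_op x n y m \<Longrightarrow> \<not> (x = Tight \<and> n = 1) \<Longrightarrow> \<not> (y = Tight \<and> m = 1) \<Longrightarrow> short_sub x n y m"
  by (auto simp: short_op_def)

lemma short_sub_assoc_cases:
  assumes "short_sub x n Tight m" "short_sub Tight m y k" "short_sub x (n + m - 1) y k"
  shows "x = Tight \<and> n = 2 \<and> m = 2 \<and> (y = Tight \<and> k = 2 \<or> y = Loose \<and> k = 0)"
proof -
  have "x = Tight \<and> n = 2 \<and> m = 2 \<or> n + m - 1 = 4 \<or> x = Loose \<and> n + m - 1 = 2"
    using assms(1) by (auto simp: short_sub_def)
  then show ?thesis using assms(3) by (auto simp: short_sub_def)
qed

lemma short_sub_commute_cases:
  assumes "short_sub x n y m" "short_sub x n z k" "short_sub (sub_type x 1 y) (n + m - 1) z k" "2 \<le> n"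
  shows "x = Tight \<and> n = 2 \<and> (y = Tight \<and> m = 2 \<or> y = Loose \<and> m = 0) \<and>
    (z = Tight \<and> k = 2 \<or> z = Loose \<and> k = 0)"
proof -
  have "x = Tight \<and> n = 2 \<and> (y = Tight \<and> m = 2 \<or> y = Loose \<and> m = 0) \<or>
      n + m - 1 = 4 \<or> sub_type x 1 y = Loose \<and> n + m - 1 = 2"
    using assms(1,4) by (auto simp: short_sub_def)
  then show ?thesis using assms(3) by (auto simp: short_sub_def)
qed

text \<open>An instance of associativity or commutation within the bounds either involves a tight unary map,
  and then belongs to functoriality or (di)naturality, or it is one of the instances listed in axioms
  (A) and (B).\<close>

lemma bounded_multi_short:
  assumes "short_skew_multicategory C"
  shows "bounded_multi True C"
proof -
  interpret short_skew_multicategory C by fact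
  have id1: "ty (Idm C a) = Tight \<and> Idm C a \<in> Maps C \<and> ins (Idm C a) = [a] \<and> out (Idm C a) = a \<and>
      arity (Idm C a) = 1 \<and> Idm C a \<in> maps_n C Tight 1" if "a \<in> Obj C" for a
    using idm[OF that] by (auto simp: maps_def maps_n_def arity_def)
  have T1: "f \<in> maps_n C Tight n" if "f \<in> Maps C" "ty f = Tight" "arity f = n" for f n
    using that by (simp add: maps_n_def arity_def)
  have L0: "f \<in> maps_n C Loose 0" if "f \<in> Maps C" "ty f = Loose" "arity f = 0" for f
    using that by (simp add: maps_n_def arity_def)
  have f1: "fits g i f \<Longrightarrow> arity g = 1 \<Longrightarrow> i = 1" for g i and f :: "('a, 'b) mmap"
    by (auto simp: fits_def)
  show ?thesis
  proof
    fix f assume f: "f \<in> Maps C"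
    show "set (ins f) \<subseteq> Obj C \<and> out f \<in> Obj C \<and> (ty f = Tight \<longrightarrow> 1 \<le> arity f) \<and> arity_ok True (ty f) (arity f)"
      using map_wf[OF f] by (auto simp: arity_ok_def short_arity_def)
    have o: "out f \<in> Obj C" "set (ins f) \<subseteq> Obj C" using map_wf[OF f] by auto
    have fit: "fits (Idm C (out f)) 1 f" using id1[OF o(1)] by (simp add: fits_def arity_def)
    note id = id1[OF o(1)]
    show "\<j>\<^bsub>C\<^esub> (Idm C (out f)) \<star>[1]\<^bsub>C\<^esub> f = \<j>\<^bsub>C\<^esub> f" if t: "ty f = Tight" "arity_ok True Loose (arity f)"
    proof -
      have "arity f = 1 \<or> arity f = 2" using map_wf[OF f] t by (auto simp: short_arity_def)
      then show ?thesis
        using jay_nat_in[of "Idm C (out f)" f 1] jay_comp_2[of "Idm C (out f)" f] id id_act[OF f] T1[OF f t(1)] fit by auto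
    qed
    show "\<j>\<^bsub>C\<^esub> (Idm C (out f)) \<star>[1]\<^bsub>C\<^esub> f = f" if "ty f = Loose" "arity f = 0"
      using jay_comp_0[of "Idm C (out f)" f] id id_act[OF f] L0[OF f that] fit by simp
    show "f \<star>[2]\<^bsub>C\<^esub> \<j>\<^bsub>C\<^esub> (Idm C (ins f ! 1)) = f" if t: "ty f = Tight" "arity f = 2"
    proof -
      have a: "ins f ! 1 \<in> Obj C" using o(2) that by (auto simp: arity_def)
      have "fits f 2 (Idm C (ins f ! 1))" using id1[OF a] that by (simp add: fits_def)
      then show ?thesis
        using jay_sub_2[of f "Idm C (ins f ! 1)"] id1[OF a] act_id[OF f, of 2] T1[OF f t] t by simp
    qed
    show "f \<star>[1]\<^bsub>C\<^esub> \<j>\<^bsub>C\<^esub> (Idm C (ins f ! 0)) = \<j>\<^bsub>C\<^esub> f" if t: "ty f = Tight" "arity_ok True Loose (arity f)"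
    proof -
      have l: "arity f = 1 \<or> arity f = 2" using map_wf[OF f] t by (auto simp: short_arity_def)
      then have a: "ins f ! 0 \<in> Obj C" using o(2) by (cases "ins f") (auto simp: arity_def)
      have "fits f 1 (Idm C (ins f ! 0))" using id1[OF a] l by (auto simp: fits_def)
      then show ?thesis
        using jay_nat_out[of "Idm C (ins f ! 0)" f] jay_sub_1[of f "Idm C (ins f ! 0)"] id1[OF a]
          act_id[OF f, of 1] T1[OF f t(1)] l by auto
    qed
  next
    fix h g f i j
    assume m: "h \<in> Maps C" "g \<in> Maps C" "f \<in> Maps C" and tg: "ty g = Tight" and ft: "fits h i g" "fits g j f"
      and op: "op_ok True (ty h) (arity h) (ty g) (arity g)" "op_ok True (ty g) (arity g) (ty f) (arity f)"
        "op_ok True (ty h) (arity h) (sub_type (ty g) j (ty f)) (arity g + arity f - 1)"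
        "op_ok True (sub_type (ty h) i (ty g)) (arity h + arity g - 1) (ty f) (arity f)"
    have n: "1 \<le> arity h" "1 \<le> arity g" using ft by (auto simp: fits_def)
    let ?T1 = "\<lambda>f. ty f = Tight \<and> arity f = 1"
    \<comment> \<open>the last case is axiom (A), the others have a tight unary map among \<open>h\<close>, \<open>g\<close>, \<open>f\<close>\<close>
    consider "?T1 g" "?T1 h" | "?T1 g" "?T1 f" | "?T1 g" "short_sub (ty h) (arity h) (ty f) (arity f)"
      | "?T1 f" "?T1 h" | "?T1 f" "short_sub (ty h) (arity h) (ty g) (arity g)"
      | "?T1 h" "short_sub (ty g) (arity g) (ty f) (arity f)"
      | "ty h = Tight" "arity h = 2" "arity g = 2" "ty f = Tight \<and> arity f = 2 \<or> ty f = Loose \<and> arity f = 0"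
    proof -
      have sT: "ty g = Tight \<Longrightarrow> sub_type (ty g) j (ty f) = ty f" if "arity g = 1"
        using f1[OF ft(2) that] by simp
      have sT': "sub_type (ty h) i Tight = ty h" by (cases "ty h") (simp_all add: sub_type_def)
      show ?thesis
      proof (cases "?T1 h \<or> ?T1 f")
        case True
        then show ?thesis
          using op tg short_op_not_unary[of "ty h" "arity h" "ty g" "arity g"]
            short_op_not_unary[of "ty g" "arity g" "ty f" "arity f"] that(1-6)
          by (auto simp: op_ok_def)
      next
        case False
        show ?thesis
        proof (cases "arity g = 1")
          case True
          then show ?thesis
            using op(3) tg sT False short_op_not_unary[of "ty h" "arity h" "ty f" "arity f"] that(3)
            by (simp add: op_ok_def)
        next
          case g: False
          have "short_sub (ty h) (arity h) Tight (arity g)" "short_sub Tight (arity g) (ty f) (arity f)"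
            "short_sub (ty h) (arity h + arity g - 1) (ty f) (arity f)"
            using op tg sT' g False n by (auto simp: op_ok_def intro!: short_op_not_unary)
          from short_sub_assoc_cases[OF this] show ?thesis using that(7) by blast
        qed
      qed
    qed
    then show "h \<star>[i]\<^bsub>C\<^esub> (g \<star>[j]\<^bsub>C\<^esub> f) = (h \<star>[i]\<^bsub>C\<^esub> g) \<star>[j + i - 1]\<^bsub>C\<^esub> f"
    proof cases
      case 1
      then show ?thesis using comp_act[OF m(3) T1[OF m(2)] T1[OF m(1)]] ft f1[OF ft(1)] f1[OF ft(2)] by simp
    next
      case 2
      then show ?thesis using act_comp[OF m(1) T1[OF m(2)] T1[OF m(3)] ft(1)] ft f1[OF ft(2)] by simp
    next
      case 3
      then show ?thesis using sub_dinat[OF m(1,3) _ T1[OF m(2)] ft(1)] ft f1[OF ft(2)] by simp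
    next
      case 4
      then show ?thesis using act_act[OF m(2) T1[OF m(3)] T1[OF m(1)] ft(2)] ft f1[OF ft(1)] by simp
    next
      case 5
      then show ?thesis using sub_nat_a[OF m(1,2) ft(1) _ T1[OF m(3)] ft(2)] by simp
    next
      case 6
      then show ?thesis using sub_nat_c[OF m(2,3) ft(2) _ T1[OF m(1)]] ft f1[OF ft(1)] by simp
    next
      case 7
      then show ?thesis using axiom_A[OF T1[OF m(1)] T1[OF m(2) tg] _ ft] T1[OF m(3)] L0[OF m(3)] by auto
    qed
  next
    fix h g f k
    assume m: "h \<in> Maps C" "g \<in> Maps C" "f \<in> Maps C" and ft: "fits h 1 g" "fits h k f" and k: "1 < k"
      and op: "op_ok True (ty h) (arity h) (ty g) (arity g)" "op_ok True (ty h) (arity h) (ty f) (arity f)"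
        "op_ok True (sub_type (ty h) 1 (ty g)) (arity h + arity g - 1) (ty f) (arity f)"
        "op_ok True (sub_type (ty h) k (ty f)) (arity h + arity f - 1) (ty g) (arity g)"
    have n: "2 \<le> arity h" "k \<le> arity h" using ft k by (auto simp: fits_def)
    let ?T1 = "\<lambda>f. ty f = Tight \<and> arity f = 1"
    have wf: "short_arity (ty g) (arity g)" "short_arity (ty f) (arity f)" using m map_wf by auto
    consider "?T1 f" "?T1 g" | "?T1 f" "short_sub (ty h) (arity h) (ty g) (arity g)"
      | "?T1 g" "short_sub (ty h) (arity h) (ty f) (arity f)"
      | "ty h = Tight" "arity h = 2" "k = 2" "ty g = Tight \<and> arity g = 2 \<or> ty g = Loose \<and> arity g = 0"
          "ty f = Tight \<and> arity f = 2 \<or> ty f = Loose \<and> arity f = 0"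
    proof (cases "?T1 f \<or> ?T1 g")
      case True
      then show ?thesis
        using op n short_op_not_unary[of "ty h" "arity h" "ty g" "arity g"]
          short_op_not_unary[of "ty h" "arity h" "ty f" "arity f"] that(1-3)
        by (auto simp: op_ok_def)
    next
      case False
      have "\<not> (sub_type (ty h) 1 (ty g) = Tight \<and> arity h + arity g - 1 = 1)"
        using n False wf by (auto simp: sub_type_def short_arity_def split: if_splits)
      then have "short_sub (ty h) (arity h) (ty g) (arity g)" "short_sub (ty h) (arity h) (ty f) (arity f)"
        "short_sub (sub_type (ty h) 1 (ty g)) (arity h + arity g - 1) (ty f) (arity f)"
        using op False n by (auto simp: op_ok_def intro!: short_op_not_unary)
      from short_sub_commute_cases[OF this n(1)] show ?thesis using that(4) n k by auto
    qed
    then show "(h \<star>[1]\<^bsub>C\<^esub> g) \<star>[k + arity g - 1]\<^bsub>C\<^esub> f = (h \<star>[k]\<^bsub>C\<^esub> f) \<star>[1]\<^bsub>C\<^esub> g"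
    proof cases
      case 1
      then show ?thesis using act_commute[OF m(1) T1[OF m(2)] T1[OF m(3)] ft] k by simp
    next
      case 2
      then show ?thesis using sub_nat_b[OF m(1,2) ft(1) _ T1[OF m(3)] ft(2)] k by simp
    next
      case 3
      then show ?thesis using sub_nat_b[OF m(1,3) ft(2) _ T1[OF m(2)] ft(1)] k by simp
    next
      case 4
      then show ?thesis
        using axiom_B[of h g f] T1[OF m(1)] T1[OF m(2)] L0[OF m(2)] T1[OF m(3)] L0[OF m(3)] ft by auto
    qed
  qed (use idm jay sub id_act act_id in \<open>auto simp: arity_ok_def op_ok_def short_arity_def\<close>)
qed

lemma Us_ob_simps [simp]:
  "Obj (Us_ob C) = Obj C" "Idm (Us_ob C) = Idm C"
  "f \<in> Maps (Us_ob C) \<longleftrightarrow> f \<in> Maps C \<and> short_arity (ty f) (arity f)"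
  "ty f = Tight \<Longrightarrow> arity f \<le> 2 \<Longrightarrow> Jay (Us_ob C) f = Jay C f"
  "short_op (ty g) (arity g) (ty f) (arity f) \<Longrightarrow> Sub (Us_ob C) g i f = Sub C g i f"
  by (simp_all add: Us_ob_def)

lemma maps_Us_ob: "maps (Us_ob C) x as b = (if short_arity x (length as) then maps C x as b else {})"
  by (auto simp: maps_def arity_def)

lemma short_op_unary [simp]:
  "short_arity y m \<Longrightarrow> short_op Tight (Suc 0) y m" "short_arity x n \<Longrightarrow> short_op x n Tight (Suc 0)"
  by (simp_all add: short_op_def)

lemma short_sub_op [simp]: "short_sub x n y m \<Longrightarrow> short_op x n y m"
  by (simp add: short_op_def)

lemma short_sub_arity: "short_sub x n y m \<Longrightarrow> short_arity (sub_type x i y) (n + m - Suc 0)"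
  by (auto simp: short_sub_def short_arity_def sub_type_def)

lemma short_op_arity: "short_op x n y m \<Longrightarrow> 1 \<le> i \<Longrightarrow> i \<le> n \<Longrightarrow> short_arity (sub_type x i y) (n + m - Suc 0)"
  by (auto simp: short_op_def short_sub_arity)

text \<open>Every axiom of a short skew multicategory is an instance of one of a skew multicategory; it has to
  be seen that the operations involved are not cut off by the truncation.\<close>

lemma Us_short:
  assumes "skew_multicategory C"
  shows "short_skew_multicategory (Us_ob C)"
proof -
  interpret skew_multicategory C by fact
  have S [simp]: "g \<star>[i]\<^bsub>C\<^esub> f \<in> Maps C" "ty (g \<star>[i]\<^bsub>C\<^esub> f) = sub_type (ty g) i (ty f)"
    "arity (g \<star>[i]\<^bsub>C\<^esub> f) = arity g + arity f - 1" "out (g \<star>[i]\<^bsub>C\<^esub> f) = out g"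
    if "g \<in> Maps C" "f \<in> Maps C" "fits g i f" for g f i
    using sub[OF that] that by (auto simp: maps_def arity_def sub_ins_def fits_def)
  have J [simp]: "\<j>\<^bsub>C\<^esub> f \<in> Maps C" "ty (\<j>\<^bsub>C\<^esub> f) = Loose" "arity (\<j>\<^bsub>C\<^esub> f) = arity f" "out (\<j>\<^bsub>C\<^esub> f) = out f" "ins (\<j>\<^bsub>C\<^esub> f) = ins f"
    if "f \<in> Maps C" "ty f = Tight" for f
    using jay[OF that] by (auto simp: maps_def arity_def)
  have fJ [simp]: "fits (\<j>\<^bsub>C\<^esub> f) i p \<longleftrightarrow> fits f i p" "fits q i (\<j>\<^bsub>C\<^esub> f) \<longleftrightarrow> fits q i f"
    if "f \<in> Maps C" "ty f = Tight" for f i p q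
    using that by (simp_all add: fits_def)
  have mn: "f \<in> maps_n (Us_ob C) x n \<longleftrightarrow> f \<in> Maps C \<and> ty f = x \<and> arity f = n \<and> short_arity x n" for f x n
    by (auto simp: maps_n_def arity_def)
  have f1: "fits g i f \<Longrightarrow> arity g = Suc 0 \<Longrightarrow> i = Suc 0" for g i and f :: "('a, 'b) mmap"
    by (auto simp: fits_def)
  have aL: "short_arity Loose n \<longleftrightarrow> n \<le> 2" for n by (simp add: short_arity_def)
  have id1: "ty (Idm C a) = Tight \<and> Idm C a \<in> Maps C \<and> arity (Idm C a) = Suc 0" if "a \<in> Obj C" for a
    using idm[OF that] by (auto simp: maps_def arity_def)
  have fs: "fits g i f \<Longrightarrow> 1 \<le> i \<and> i \<le> arity g" for g i and f :: "('a, 'b) mmap" by (simp add: fits_def)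
  show ?thesis
  proof (unfold_locales, goal_cases)
    case (1 f) then show ?case using map_wf by auto
  next
    case (2 a) then show ?case using idm[of a] by (auto simp: maps_Us_ob short_arity_def)
  next
    case (3 f) then show ?case using jay[of f] by (simp add: maps_Us_ob aL arity_def[symmetric])
  next
    case (4 g f i)
    then have "short_arity (sub_type (ty g) i (ty f)) (arity g + arity f - Suc 0)"
      using fs[of g i f] by (intro short_op_arity) auto
    moreover have "length (sub_ins g i f) = arity g + arity f - Suc 0"
      using 4 by (auto simp: sub_ins_def fits_def arity_def)
    ultimately show ?case using 4 sub[of g f i] by (simp add: maps_Us_ob)
  next
    case (5 f) then show ?case using id_sub[of f] id1[of "out f"] map_wf[of f] by auto
  next
    case (6 f i)
    then have "ins f ! (i - 1) \<in> Obj C" using map_wf[of f] by (auto simp: arity_def)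
    then show ?case using sub_id[of f i] id1[of "ins f ! (i - 1)"] 6 by auto
  next
    case (7 f q q')
    then show ?case using sub_assoc[of q' q f 1 1] by (simp add: mn)
  next
    case (8 f p p' i)
    then show ?case using sub_assoc[of f p p' i 1] by (simp add: mn)
  next
    case (9 f p q i)
    then show ?case using sub_assoc[of q f p 1 i] by (simp add: mn)
  next
    case (10 f p p' i k)
    then show ?case using sub_commute[of f p p' i k] sub_commute[of f p' p k i] by (cases "i < k") (auto simp: mn)
  next
    case (11 f q)
    then show ?case using jay_sub_right[of q f 1] by (simp add: mn aL sub_type_def)
  next
    case (12 f p i)
    then show ?case using jay_sub_left[of f p i] by (simp add: mn aL sub_type_def)
  next
    case (13 g f i p k)
    then show ?case using sub_assoc[of g f p i k] short_sub_arity[of "ty g" "arity g" "ty f" "arity f" i] by (simp add: mn)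
  next
    case (14 g f i p k)
    then show ?case using sub_commute[of g f p i k] sub_commute[of g p f k i]
        short_sub_arity[of "ty g" "arity g" "ty f" "arity f" i] by (cases "k < i") (auto simp: mn)
  next
    case (15 g f i q)
    then show ?case using sub_assoc[of q g f 1 i] short_sub_arity[of "ty g" "arity g" "ty f" "arity f" i] by (simp add: mn)
  next
    case (16 g f p i)
    then show ?case using sub_assoc[of g p f i 1] by (simp add: mn)
  next
    case (17 f g h i j)
    then show ?case using sub_assoc[of f g h i j]
      by (auto simp: mn short_op_def short_sub_def sub_type_def)
  next
    case (18 f g h)
    then show ?case using sub_commute[of f g h 1 2]
      by (auto simp: mn short_op_def short_sub_def sub_type_def)
  next
    case (19 g p)
    then show ?case using jay_sub_right[of g p 2] by (auto simp: mn short_op_def short_sub_def sub_type_def)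
  next
    case (20 g p)
    then show ?case using jay_sub_right[of g p 1] by (auto simp: mn short_op_def short_sub_def sub_type_def)
  next
    case (21 p g)
    then show ?case using jay_sub_left[of p g 1] by (auto simp: mn short_op_def short_sub_def sub_type_def)
  next
    case (22 p v)
    then show ?case using jay_sub_left[of p v 1] by (auto simp: mn short_op_def short_sub_def sub_type_def)
  qed
qed

section \<open>Representing data\<close>

lemma represented_short:
  assumes "short_skew_multicategory D" "is_lr_data D R"
  shows "represented True D R"
proof -
  interpret bounded_multi True D by (rule bounded_multi_short[OF assms(1)])
  show ?thesis
    by unfold_locales (use assms(2) in \<open>auto simp: is_lr_data_def arity_ok_def short_arity_def\<close>)
qed

lemma bij_ex1:
  assumes "bij_betw f A B" "b \<in> B"
  shows "\<exists>!a. a \<in> A \<and> f a = b"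
  using assms by (auto simp: bij_betw_def inj_on_def image_iff)

text \<open>The definite descriptions in \<open>Ks_ob\<close> denote, because \<open>\<theta>\<close> and \<open>u\<close> are universal.\<close>

lemma rep_skewmon_Ks_ob:
  assumes "represented True D R"
  shows "rep_skewmon True D R (Ks_ob R D)"
proof -
  interpret represented True D R by fact
  have TA: "to_mmap (to_arr p) = p \<and> to_arr p \<in> hom (Ks_ob R D) a b" if "p \<in> maps D Tight [a] b" for p a b
  proof -
    have "to_mmap (to_arr p) = p" using that by (auto simp: maps_def to_mmap_to_arr)
    moreover have "p \<in> maps_n D Tight 1" using that by (auto simp: maps_def maps_n_def)
    then have "to_arr p \<in> Ar (Ks_ob R D)" by (simp add: Ks_ob_def)
    ultimately show ?thesis using that by (auto simp: hom_iff to_arr_def maps_def)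
  qed
  have Ar: "f \<in> Ar (Ks_ob R D) \<longleftrightarrow> to_mmap f \<in> Maps D" for f
  proof
    assume "f \<in> Ar (Ks_ob R D)"
    then obtain p where p: "f = to_arr p" "p \<in> Maps D" "ty p = Tight" "length (ins p) = 1"
      by (auto simp: maps_n_def Ks_ob_def)
    then obtain a where "ins p = [a]" by (cases "ins p") auto
    then show "to_mmap f \<in> Maps D" using p by (simp add: to_mmap_to_arr)
  next
    assume "to_mmap f \<in> Maps D"
    then have "to_mmap f \<in> maps_n D Tight 1" by (simp add: maps_n_def)
    moreover have "f = to_arr (to_mmap f)" by (simp add: to_arr_def arr.expand)
    ultimately show "f \<in> Ar (Ks_ob R D)" by (auto simp: Ks_ob_def)
  qed
  have T: "to_mmap f \<in> maps D Tight [src f] (tgt f)" if "f \<in> Ar (Ks_ob R D)" for f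
    using that by (simp add: Ar maps_def)
  have ob: "src f \<in> Obj D" "tgt f \<in> Obj D" if "f \<in> Ar (Ks_ob R D)" for f
    using mapsD[OF T[OF that]] by auto
  have bij1: "bij_betw (\<lambda>h. h \<star>[1]\<^bsub>D\<^esub> theta R a b) (maps D Tight [prd R a b] d) (maps D Tight [a, b] d)"
    if "a \<in> Obj D" "b \<in> Obj D" "d \<in> Obj D" for a b d
    using theta_bij[of a b "[]" d] that by simp
  have bij2: "bij_betw (\<lambda>h. h \<star>[1]\<^bsub>D\<^esub> theta R a b) (maps D Tight [prd R a b, c] d) (maps D Tight [a, b, c] d)"
    if "a \<in> Obj D" "b \<in> Obj D" "c \<in> Obj D" "d \<in> Obj D" for a b c d
    using theta_bij[of a b "[c]" d] that by simp
  have biju: "bij_betw (\<lambda>h. h \<star>[1]\<^bsub>D\<^esub> umap R) (maps D Tight [uob R, c] d) (maps D Loose [c] d)"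
    if "c \<in> Obj D" "d \<in> Obj D" for c d
    using umap_bij[of "[c]" d] that by simp
  have the: "to_arr (THE h. h \<in> maps D Tight [a] b \<and> Q h) \<in> hom (Ks_ob R D) a b \<and>
      Q (to_mmap (to_arr (THE h. h \<in> maps D Tight [a] b \<and> Q h)))"
    if "\<exists>!h. h \<in> maps D Tight [a] b \<and> Q h" for a b Q
    using theI'[OF that] TA[OF conjunct1[OF theI'[OF that]]] by simp
  show ?thesis
  proof
    fix f g assume fg: "f \<in> Ar (Ks_ob R D)" "g \<in> Ar (Ks_ob R D)"
    note o = ob[OF fg(1)] ob[OF fg(2)]
    have "theta R (tgt f) (tgt g) \<star>[1]\<^bsub>D\<^esub> to_mmap f \<in> maps D Tight [src f, tgt g] (prd R (tgt f) (tgt g))"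
      using o by (intro sub_in[OF theta_in T[OF fg(1)]]) simp_all
    from sub_in[OF this T[OF fg(2)], of 2 Tight "[src f, src g]"]
    have "(theta R (tgt f) (tgt g) \<star>[1]\<^bsub>D\<^esub> to_mmap f) \<star>[2]\<^bsub>D\<^esub> to_mmap g \<in> maps D Tight [src f, src g] (prd R (tgt f) (tgt g))"
      by simp
    from the[OF bij_ex1[OF bij1 this]] o
    show "f \<otimes>\<^bsub>Ks_ob R D\<^esub> g \<in> hom (Ks_ob R D) (prd R (src f) (src g)) (prd R (tgt f) (tgt g)) \<and>
        to_mmap (f \<otimes>\<^bsub>Ks_ob R D\<^esub> g) \<star>[1]\<^bsub>D\<^esub> theta R (src f) (src g)
          = (theta R (tgt f) (tgt g) \<star>[1]\<^bsub>D\<^esub> to_mmap f) \<star>[2]\<^bsub>D\<^esub> to_mmap g"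
      by (simp add: Ks_ob_def)
  next
    fix a b c assume o: "a \<in> Obj D" "b \<in> Obj D" "c \<in> Obj D"
    have "theta R a (prd R b c) \<star>[2]\<^bsub>D\<^esub> theta R b c \<in> maps D Tight [a, b, c] (prd R a (prd R b c))"
      using o by (intro sub_in[OF theta_in theta_in]) simp_all
    from the[OF bij_ex1[OF bij_betw_trans[OF bij1 bij2] this]] o
    show "\<alpha>\<^bsub>Ks_ob R D\<^esub> a b c \<in> hom (Ks_ob R D) (prd R (prd R a b) c) (prd R a (prd R b c)) \<and>
        (to_mmap (\<alpha>\<^bsub>Ks_ob R D\<^esub> a b c) \<star>[1]\<^bsub>D\<^esub> theta R (prd R a b) c) \<star>[1]\<^bsub>D\<^esub> theta R a b
          = theta R a (prd R b c) \<star>[2]\<^bsub>D\<^esub> theta R b c"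
      by (simp add: Ks_ob_def comp_def)
  next
    fix a assume o: "a \<in> Obj D"
    have "\<j>\<^bsub>D\<^esub> (Idm D a) \<in> maps D Loose [a] a"
      using jay[of "Idm D a"] mapsD[OF idm[OF o]] by simp
    from the[OF bij_ex1[OF bij_betw_trans[OF bij1 biju] this]] o
    show "\<lambda>\<lambda>\<^bsub>Ks_ob R D\<^esub> a \<in> hom (Ks_ob R D) (prd R (uob R) a) a \<and>
        (to_mmap (\<lambda>\<lambda>\<^bsub>Ks_ob R D\<^esub> a) \<star>[1]\<^bsub>D\<^esub> theta R (uob R) a) \<star>[1]\<^bsub>D\<^esub> umap R = \<j>\<^bsub>D\<^esub> (Idm D a)"
      by (simp add: Ks_ob_def comp_def)
    have "theta R a (uob R) \<star>[2]\<^bsub>D\<^esub> umap R \<in> maps D Tight [a] (prd R a (uob R))"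
      using o by (intro sub_in[OF theta_in umap_in]) simp_all
    then show "to_mmap (\<rho>\<^bsub>Ks_ob R D\<^esub> a) = theta R a (uob R) \<star>[2]\<^bsub>D\<^esub> umap R"
      using TA by (simp add: Ks_ob_def)
    show "to_mmap (Id (Ks_ob R D) a) = Idm D a"
      using TA[OF idm[OF o]] by (simp add: Ks_ob_def)
  next
    fix g f assume gf: "g \<in> Ar (Ks_ob R D)" "f \<in> Ar (Ks_ob R D)" "tgt f = src g"
    have "to_mmap g \<star>[1]\<^bsub>D\<^esub> to_mmap f \<in> maps D Tight [src f] (tgt g)"
      using gf by (intro sub_in[OF T T]) simp_all
    then show "to_mmap (g \<cdot>\<^bsub>Ks_ob R D\<^esub> f) = to_mmap g \<star>[1]\<^bsub>D\<^esub> to_mmap f"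
      using TA by (simp add: Ks_ob_def)
  qed (simp_all add: Ar, simp_all add: Ks_ob_def)
qed

text \<open>Truncation does not affect the operations that enter into the description of the skew
  monoidal category.\<close>

lemma rep_skewmon_Us_iff:
  assumes E: "represented False E R" "represented True (Us_ob E) R"
  shows "rep_skewmon True (Us_ob E) R K \<longleftrightarrow> rep_skewmon False E R K"
proof -
  interpret represented False E R by fact
  have so: "short_op Tight (Suc 0) Tight (Suc 0)" "short_op Tight (Suc 0) Tight 2" "short_op Tight 2 Tight (Suc 0)"
    "short_op Tight 2 Tight 2" "short_op Tight 2 Loose 0"
    by (auto simp: short_op_def short_sub_def short_arity_def)
  have th: "ty (theta R a b) = Tight \<and> arity (theta R a b) = 2" if "a \<in> Obj E" "b \<in> Obj E" for a b
    using mapsD[OF theta_in[OF that]] by simp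
  have um: "ty (umap R) = Loose \<and> arity (umap R) = 0" using mapsD[OF umap_in] by simp
  have idm': "ty (Idm E a) = Tight \<and> arity (Idm E a) = Suc 0" if "a \<in> Obj E" for a
    using mapsD[OF idm[OF that]] by simp
  have T1: "arity (to_mmap f) = Suc 0" for f by (simp add: arity_def)
  have ob: "src f \<in> Obj E" "tgt f \<in> Obj E" if "to_mmap f \<in> Maps E" for f
    using map_wf[OF that] by auto
  have 1: "Sub (Us_ob E) (to_mmap f) i (theta R a b) = Sub E (to_mmap f) i (theta R a b)"
    if "a \<in> Obj E" "b \<in> Obj E" for f i a b
    using th[OF that] so by (simp add: T1)
  have 2: "Sub (Us_ob E) (Sub (Us_ob E) (theta R (tgt f) (tgt g)) 1 (to_mmap f)) 2 (to_mmap g)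
      = Sub E (Sub E (theta R (tgt f) (tgt g)) 1 (to_mmap f)) 2 (to_mmap g)"
    if "to_mmap f \<in> Maps E" "to_mmap g \<in> Maps E" for f g
  proof -
    note o = ob[OF that(1)] ob[OF that(2)]
    have m: "Sub E (theta R (tgt f) (tgt g)) 1 (to_mmap f) \<in> maps E Tight [src f, tgt g] (prd R (tgt f) (tgt g))"
      using that o by (intro sub_in[OF theta_in, of _ _ _ Tight "[src f]" "tgt f"]) (simp_all add: maps_def)
    then show ?thesis using th[OF o(2,4)] so mapsD[OF m] by (simp add: T1 numeral_2_eq_2)
  qed
  have 3: "Sub (Us_ob E) (Sub E (to_mmap p) 1 (theta R d c)) 1 e
      = Sub E (Sub E (to_mmap p) 1 (theta R d c)) 1 e"
    if "p \<in> hom K (prd R d c) m" "to_mmap p \<in> Maps E" "d \<in> Obj E" "c \<in> Obj E"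
      "ty e = Tight \<and> arity e = 2 \<or> ty e = Loose \<and> arity e = 0" for p d c m e
  proof -
    have p: "to_mmap p \<in> maps E Tight [prd R d c] m" using that by (auto simp: maps_def hom_iff)
    have m: "Sub E (to_mmap p) 1 (theta R d c) \<in> maps E Tight [d, c] m"
      using that by (intro sub_in[OF p theta_in]) simp_all
    show ?thesis using th[OF that(3,4)] so mapsD[OF m] that(5) by (auto simp: T1 numeral_2_eq_2)
  qed
  have 4: "Sub (Us_ob E) (theta R a b) i (theta R c d) = Sub E (theta R a b) i (theta R c d)"
    if "a \<in> Obj E" "b \<in> Obj E" "c \<in> Obj E" "d \<in> Obj E" for a b c d i
    using th[OF that(1,2)] th[OF that(3,4)] so by simp
  have 5: "Sub (Us_ob E) (theta R a b) i (umap R) = Sub E (theta R a b) i (umap R)"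
    if "a \<in> Obj E" "b \<in> Obj E" for a b i
    using th[OF that] um so by simp
  have 6: "Jay (Us_ob E) (Idm E a) = Jay E (Idm E a)" if "a \<in> Obj E" for a
    using idm'[OF that] by simp
  have 7: "to_mmap f \<in> Maps (Us_ob E) \<longleftrightarrow> to_mmap f \<in> Maps E" for f
    by (simp add: T1 short_arity_def)
  have 8: "Sub (Us_ob E) (to_mmap g) i (to_mmap f) = Sub E (to_mmap g) i (to_mmap f)" for g f i
    by (simp add: T1 so)
  have "rep_skewmon_axioms (Us_ob E) R K \<longleftrightarrow> rep_skewmon_axioms E R K" (is "?L \<longleftrightarrow> ?R")
  proof (cases "\<forall>f. f \<in> Ar K \<longleftrightarrow> to_mmap f \<in> Maps E")
    case True
    have A: "(P \<and> X = Z) = (P \<and> Y = Z)" if "P \<Longrightarrow> X = Y" for P and X Y Z :: "('a, 'b) mmap" using that by auto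
    have a3: "(\<alpha>\<^bsub>K\<^esub> a b c \<in> hom K (prd R (prd R a b) c) (prd R a (prd R b c)) \<and>
        Sub (Us_ob E) (Sub E (to_mmap (\<alpha>\<^bsub>K\<^esub> a b c)) 1 (theta R (prd R a b) c)) 1 (theta R a b) = Z)
      = (\<alpha>\<^bsub>K\<^esub> a b c \<in> hom K (prd R (prd R a b) c) (prd R a (prd R b c)) \<and>
        Sub E (Sub E (to_mmap (\<alpha>\<^bsub>K\<^esub> a b c)) 1 (theta R (prd R a b) c)) 1 (theta R a b) = Z)"
      if "a \<in> Obj E" "b \<in> Obj E" "c \<in> Obj E" for a b c Z
      using that th True by (intro A 3) (auto simp: hom_iff)
    have l3: "(\<lambda>\<lambda>\<^bsub>K\<^esub> a \<in> hom K (prd R (uob R) a) a \<and>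
        Sub (Us_ob E) (Sub E (to_mmap (\<lambda>\<lambda>\<^bsub>K\<^esub> a)) 1 (theta R (uob R) a)) 1 (umap R) = Z)
      = (\<lambda>\<lambda>\<^bsub>K\<^esub> a \<in> hom K (prd R (uob R) a) a \<and>
        Sub E (Sub E (to_mmap (\<lambda>\<lambda>\<^bsub>K\<^esub> a)) 1 (theta R (uob R) a)) 1 (umap R) = Z)"
      if "a \<in> Obj E" for a Z
      using that um True by (intro A 3) (auto simp: hom_iff)
    show ?thesis
      unfolding rep_skewmon_axioms_def using True ob
      by (simp only: 1 2 4 5 6 7 8 a3 l3 Us_ob_simps(1,2) prd_ob uob_ob cong: conj_cong imp_cong)
  next
    case False
    then show ?thesis unfolding rep_skewmon_axioms_def 7 by blast
  qed
  then show ?thesis using E by (simp add: rep_skewmon_def)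
qed

text \<open>Universality is transported along an isomorphism of representing objects.\<close>

lemma universal_transfer:
  assumes ax: "bounded_multi False C"
    and t: "t \<in> maps C x as m" and t': "t' \<in> maps C x as p"
    and k: "k \<in> maps C Tight [m] p" and l: "l \<in> maps C Tight [p] m"
    and kl: "k \<star>[1]\<^bsub>C\<^esub> t = t'" "l \<star>[1]\<^bsub>C\<^esub> k = Idm C m" "k \<star>[1]\<^bsub>C\<^esub> l = Idm C p"
    and bij: "bij_betw (\<lambda>f. f \<star>[1]\<^bsub>C\<^esub> t) (maps C Tight (m # ys) b) X"
  shows "bij_betw (\<lambda>f. f \<star>[1]\<^bsub>C\<^esub> t') (maps C Tight (p # ys) b) X"
proof -
  interpret bounded_multi False C by fact
  have o [simp]: "op_ok False y n z r" for y n z r by (simp add: op_ok_def)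
  have as: "(f \<star>[1]\<^bsub>C\<^esub> q) \<star>[1]\<^bsub>C\<^esub> e = f \<star>[1]\<^bsub>C\<^esub> (q \<star>[1]\<^bsub>C\<^esub> e)"
    if "f \<in> maps C Tight (d # ys) b" "q \<in> maps C Tight [c] d" "e \<in> maps C y cs c" for f q e d c y cs
    by (intro assocT[OF that, symmetric]) simp_all
  have in1: "f \<star>[1]\<^bsub>C\<^esub> q \<in> maps C Tight (c # ys) b"
    if "f \<in> maps C Tight (d # ys) b" "q \<in> maps C Tight [c] d" for f q d c
    by (intro sub_in[OF that]) simp_all
  have id1: "f \<star>[1]\<^bsub>C\<^esub> Idm C d = f" if "f \<in> maps C Tight (d # ys) b" for f d
    using that by (rule sub_idT) simp_all
  have 1: "bij_betw (\<lambda>f. f \<star>[1]\<^bsub>C\<^esub> k) (maps C Tight (p # ys) b) (maps C Tight (m # ys) b)"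
    by (rule bij_betwI[where g = "\<lambda>f. f \<star>[1]\<^bsub>C\<^esub> l"])
      (use in1 k l as[OF _ k l] as[OF _ l k] kl id1 in auto)
  show ?thesis
    using bij_betw_trans[OF 1 bij] as[OF _ k t] kl by (subst bij_betw_cong[of _ _ "(\<lambda>f. f \<star>[1]\<^bsub>C\<^esub> t) \<circ> (\<lambda>f. f \<star>[1]\<^bsub>C\<^esub> k)"]) auto
qed

text \<open>Multimaps that are universal without further inputs, for the same list, differ by an isomorphism.\<close>

lemma universal_unique:
  assumes ax: "bounded_multi False C"
    and t: "t \<in> maps C x as m" and t': "t' \<in> maps C x as p"
    and bt: "\<And>d. d \<in> Obj C \<Longrightarrow> bij_betw (\<lambda>f. f \<star>[1]\<^bsub>C\<^esub> t) (maps C Tight [m] d) (maps C x as d)"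
    and bt': "\<And>d. d \<in> Obj C \<Longrightarrow> bij_betw (\<lambda>f. f \<star>[1]\<^bsub>C\<^esub> t') (maps C Tight [p] d) (maps C x as d)"
  obtains k l where "k \<in> maps C Tight [m] p" "l \<in> maps C Tight [p] m"
    "k \<star>[1]\<^bsub>C\<^esub> t = t'" "l \<star>[1]\<^bsub>C\<^esub> k = Idm C m" "k \<star>[1]\<^bsub>C\<^esub> l = Idm C p"
proof -
  interpret bounded_multi False C by fact
  have ob: "m \<in> Obj C" "p \<in> Obj C" using mapsD[OF t] mapsD[OF t'] by auto
  have o [simp]: "op_ok False y n z r" for y n z r by (simp add: op_ok_def)
  obtain k where k: "k \<in> maps C Tight [m] p" "k \<star>[1]\<^bsub>C\<^esub> t = t'" using bij_ex1[OF bt t'] ob by auto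
  obtain l where l: "l \<in> maps C Tight [p] m" "l \<star>[1]\<^bsub>C\<^esub> t' = t" using bij_ex1[OF bt' t] ob by auto
  have lk: "l \<star>[1]\<^bsub>C\<^esub> k \<in> maps C Tight [m] m" and kl: "k \<star>[1]\<^bsub>C\<^esub> l \<in> maps C Tight [p] p"
    using sub_in[OF l(1) k(1)] sub_in[OF k(1) l(1)] by simp_all
  have "(l \<star>[1]\<^bsub>C\<^esub> k) \<star>[1]\<^bsub>C\<^esub> t = Idm C m \<star>[1]\<^bsub>C\<^esub> t"
    using assocT[OF l(1) k(1) t, of 1 1 1] k l id_subT[OF t] by simp
  then have 1: "l \<star>[1]\<^bsub>C\<^esub> k = Idm C m"
    using bt[OF ob(1)] lk idm[OF ob(1)] by (auto simp: bij_betw_def dest: inj_onD)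
  have "(k \<star>[1]\<^bsub>C\<^esub> l) \<star>[1]\<^bsub>C\<^esub> t' = Idm C p \<star>[1]\<^bsub>C\<^esub> t'"
    using assocT[OF k(1) l(1) t', of 1 1 1] k l id_subT[OF t'] by simp
  then have 2: "k \<star>[1]\<^bsub>C\<^esub> l = Idm C p"
    using bt'[OF ob(2)] kl idm[OF ob(2)] by (auto simp: bij_betw_def dest: inj_onD)
  show thesis by (rule that[OF k(1) l(1) k(2) 1 2])
qed

text \<open>For the binary and nullary maps that may represent, truncation keeps the universal property as long
  as the multimaps concerned are short.\<close>

lemma Us_bij:
  assumes t: "t \<in> maps C x as m" and r: "short_arity x (length as + length ys)" and n: "x = Tight \<Longrightarrow> length as = 2"
    "x = Loose \<Longrightarrow> as = []"
  shows "bij_betw (\<lambda>f. Sub (Us_ob C) f 1 t) (maps (Us_ob C) Tight (m # ys) b) (maps (Us_ob C) x (as @ ys) b)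
    \<longleftrightarrow> bij_betw (\<lambda>f. f \<star>[1]\<^bsub>C\<^esub> t) (maps C Tight (m # ys) b) (maps C x (as @ ys) b)"
proof -
  have 1: "short_arity Tight (Suc (length ys))" using r n by (cases x) (auto simp: short_arity_def)
  have "length ys \<le> 2" using r n by (cases x) (auto simp: short_arity_def)
  then have "length ys = 0 \<or> length ys = Suc 0 \<or> length ys = 2" by arith
  then have "short_op Tight (Suc (length ys)) x (length as)"
    using n by (cases x) (auto simp: short_op_def short_sub_def short_arity_def)
  then have "Sub (Us_ob C) f 1 t = f \<star>[1]\<^bsub>C\<^esub> t" if "f \<in> maps C Tight (m # ys) b" for f
    using that t by (intro Us_ob_simps(5)) (auto simp: maps_def arity_def)
  moreover have "maps (Us_ob C) Tight (m # ys) b = maps C Tight (m # ys) b" "maps (Us_ob C) x (as @ ys) b = maps C x (as @ ys) b"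
    using 1 r by (simp_all add: maps_Us_ob)
  ultimately show ?thesis
    using bij_betw_cong[of "maps C Tight (m # ys) b" "\<lambda>f. Sub (Us_ob C) f 1 t" "\<lambda>f. f \<star>[1]\<^bsub>C\<^esub> t"] by simp
qed

lemma Us_left_representable:
  assumes "skew_multicategory C" "left_representable C"
  shows "short_left_representable (Us_ob C)"
proof -
  let ?U = "\<lambda>x as m t. t \<in> maps C x as m \<and> m \<in> Obj C \<and> (\<forall>ys b. set ys \<subseteq> Obj C \<and> b \<in> Obj C \<longrightarrow>
     bij_betw (\<lambda>f. f \<star>[1]\<^bsub>C\<^esub> t) (maps C Tight (m # ys) b) (maps C x (as @ ys) b))"
  have "\<exists>m t. ?U Tight [a, b] m t" if "a \<in> Obj C" "b \<in> Obj C" for a b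
    using assms(2) that unfolding left_representable_def
    by (elim allE[where x = Tight] allE[where x = "[a, b]"]) auto
  then have "\<forall>a b. \<exists>m t. a \<in> Obj C \<and> b \<in> Obj C \<longrightarrow> ?U Tight [a, b] m t" by blast
  then obtain m t where t: "\<And>a b. a \<in> Obj C \<Longrightarrow> b \<in> Obj C \<Longrightarrow> ?U Tight [a, b] (m a b) (t a b)" by metis
  obtain n v where v: "?U Loose [] n v"
    using assms(2) unfolding left_representable_def
    by (elim allE[where x = Loose] allE[where x = "[]"]) auto
  let ?R = "\<lparr>prd = m, theta = t, uob = n, umap = v\<rparr>"
  have "is_lr_data (Us_ob C) ?R"
    unfolding is_lr_data_def lr_data.simps Us_ob_simps
  proof (intro conjI ballI allI impI)
    fix a b assume o: "a \<in> Obj C" "b \<in> Obj C"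
    show "m a b \<in> Obj C" using t[OF o] by blast
    show "t a b \<in> maps (Us_ob C) Tight [a, b] (m a b)" using t[OF o] by (simp add: maps_Us_ob short_arity_def)
    fix xs d assume x: "set xs \<subseteq> Obj C \<and> length xs \<le> 2 \<and> d \<in> Obj C"
    then show "bij_betw (\<lambda>f. f \<star>[1]\<^bsub>Us_ob C\<^esub> t a b) (maps (Us_ob C) Tight (m a b # xs) d) (maps (Us_ob C) Tight (a # b # xs) d)"
      using t[OF o] Us_bij[of "t a b" C Tight "[a, b]" "m a b" xs d] by (simp add: short_arity_def)
  next
    show "n \<in> Obj C" "v \<in> maps (Us_ob C) Loose [] n" using v by (simp_all add: maps_Us_ob short_arity_def)
    fix xs d assume x: "set xs \<subseteq> Obj C \<and> length xs \<le> 2 \<and> d \<in> Obj C"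
    then show "bij_betw (\<lambda>f. f \<star>[1]\<^bsub>Us_ob C\<^esub> v) (maps (Us_ob C) Tight (n # xs) d) (maps (Us_ob C) Loose xs d)"
      using v Us_bij[of v C Loose "[]" n xs d] by (simp add: short_arity_def)
  qed
  then show ?thesis by (auto simp: short_left_representable_def)
qed

text \<open>Data that represent the short multimaps represent all of them.  A universal multimap for all
  arities exists by assumption; the given one is isomorphic to it by the universal property for unary
  maps, which concerns short multimaps alone.\<close>

lemma represented_full:
  assumes "skew_multicategory C" "left_representable C" "is_lr_data (Us_ob C) R"
  shows "represented False C R"
proof -
  have ax: "bounded_multi False C" by (rule bounded_multi_full[OF assms(1)])
  interpret bounded_multi False C by (rule ax)
  have universal_bij: "bij_betw (\<lambda>f. f \<star>[1]\<^bsub>C\<^esub> t') (maps C Tight (p # ys) b) (maps C x (as @ ys) b)"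
    if t': "t' \<in> maps C x as p" and short: "x = Tight \<Longrightarrow> length as = 2" "x = Loose \<Longrightarrow> as = []"
      and b': "\<And>d. d \<in> Obj C \<Longrightarrow> bij_betw (\<lambda>f. Sub (Us_ob C) f 1 t') (maps (Us_ob C) Tight [p] d) (maps (Us_ob C) x as d)"
      and o: "set ys \<subseteq> Obj C" "b \<in> Obj C"
    for t' x as p ys b
  proof -
    have as: "set as \<subseteq> Obj C" using mapsD[OF t'] by auto
    have "x = Tight \<longrightarrow> 1 \<le> length as" using short by auto
    then obtain m t where m: "m \<in> Obj C" "t \<in> maps C x as m"
      and bt: "\<And>ys b. set ys \<subseteq> Obj C \<Longrightarrow> b \<in> Obj C \<Longrightarrow> bij_betw (\<lambda>f. f \<star>[1]\<^bsub>C\<^esub> t) (maps C Tight (m # ys) b) (maps C x (as @ ys) b)"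
      using assms(2) as unfolding left_representable_def by meson
    have sa: "short_arity x (length as + length [])" using short by (cases x) (auto simp: short_arity_def)
    have 1: "bij_betw (\<lambda>f. f \<star>[1]\<^bsub>C\<^esub> t) (maps C Tight [m] d) (maps C x as d)" if "d \<in> Obj C" for d
      using bt[of "[]" d] that by simp
    have 2: "bij_betw (\<lambda>f. f \<star>[1]\<^bsub>C\<^esub> t') (maps C Tight [p] d) (maps C x as d)" if "d \<in> Obj C" for d
      using b'[OF that] Us_bij[OF t' sa short, of d] by simp
    obtain k l where "k \<in> maps C Tight [m] p" "l \<in> maps C Tight [p] m"
      "k \<star>[1]\<^bsub>C\<^esub> t = t'" "l \<star>[1]\<^bsub>C\<^esub> k = Idm C m" "k \<star>[1]\<^bsub>C\<^esub> l = Idm C p"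
      using universal_unique[OF ax m(2) t' 1 2] by blast
    then show ?thesis using universal_transfer[OF ax m(2) t'] bt[OF o] by blast
  qed
  have th: "theta R a b \<in> maps C Tight [a, b] (prd R a b)" if "a \<in> Obj C" "b \<in> Obj C" for a b
    using assms(3) that by (simp add: is_lr_data_def maps_Us_ob short_arity_def)
  have um: "umap R \<in> maps C Loose [] (uob R)"
    using assms(3) by (simp add: is_lr_data_def maps_Us_ob short_arity_def)
  show ?thesis
  proof
    fix a b assume o: "a \<in> Obj C" "b \<in> Obj C"
    show "prd R a b \<in> Obj C" using assms(3) o by (simp add: is_lr_data_def)
    show "theta R a b \<in> maps C Tight [a, b] (prd R a b)" by (rule th[OF o])
    fix xs d assume x: "set xs \<subseteq> Obj C" "d \<in> Obj C"
    have "bij_betw (\<lambda>f. Sub (Us_ob C) f 1 (theta R a b)) (maps (Us_ob C) Tight [prd R a b] d) (maps (Us_ob C) Tight [a, b] d)"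
      if "d \<in> Obj C" for d
      using assms(3) o that unfolding is_lr_data_def by (auto dest!: spec[of _ "[]"])
    from universal_bij[OF th[OF o] _ _ this x]
    show "bij_betw (\<lambda>f. f \<star>[1]\<^bsub>C\<^esub> theta R a b) (maps C Tight (prd R a b # xs) d) (maps C Tight (a # b # xs) d)"
      by simp
  next
    show "uob R \<in> Obj C" using assms(3) by (simp add: is_lr_data_def)
    show "umap R \<in> maps C Loose [] (uob R)" by (rule um)
    fix xs d assume x: "set xs \<subseteq> Obj C" "d \<in> Obj C"
    have "bij_betw (\<lambda>f. Sub (Us_ob C) f 1 (umap R)) (maps (Us_ob C) Tight [uob R] d) (maps (Us_ob C) Loose [] d)"
      if "d \<in> Obj C" for d
      using assms(3) that unfolding is_lr_data_def by (auto dest!: spec[of _ "[]"])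
    from universal_bij[OF um _ _ this x]
    show "bij_betw (\<lambda>f. f \<star>[1]\<^bsub>C\<^esub> umap R) (maps C Tight (uob R # xs) d) (maps C Loose xs d)"
      by simp
  qed
qed

text \<open>The identities, as universal multimaps of \<open>M_ob C\<close>.\<close>

definition M_lr :: "('o, 'm) skewmon \<Rightarrow> ('o, 'm) lr_data" where
  "M_lr C = \<lparr>prd = Ten C, theta = (\<lambda>a b. MMap Tight [a, b] (a \<odot>\<^bsub>C\<^esub> b) (lab (Id C (a \<odot>\<^bsub>C\<^esub> b)))),
     uob = \<I>\<^bsub>C\<^esub>, umap = MMap Loose [] \<I>\<^bsub>C\<^esub> (lab (Id C \<I>\<^bsub>C\<^esub>))\<rparr>"

text \<open>For the canonical representing data of \<open>M_ob C\<close>, the skew monoidal category that they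
  describe is \<open>C\<close> itself.\<close>

lemma (in skew_mon) rep_skewmon_M_ob: "rep_skewmon False (M_ob C) (M_lr C) C"
proof -
  interpret bounded_multi False "M_ob C" by (rule bounded_multi_full[OF M_skew_multicategory])
  let ?R = "M_lr C"
  have th: "theta ?R a b = id_mmap Tight [a, b]" and um: "umap ?R = id_mmap Loose []" for a b
    by (simp_all add: M_lr_def id_mmap_def)
  have pu [simp]: "prd ?R = Ten C" "uob ?R = \<I>" by (simp_all add: M_lr_def)
  have bT: "arr_of C (to_mmap f) = f" for f by (intro arr_eqI) simp_all
  have mT: "ismap (to_mmap f) \<longleftrightarrow> f \<in> Ar C" for f
  proof
    assume "ismap (to_mmap f)" then show "f \<in> Ar C" using ismapD(2)[of "to_mmap f"] bT by simp
  next
    assume "f \<in> Ar C" then show "ismap (to_mmap f)" by (intro ismapI) (simp_all add: bT)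
  qed
  have bt: "arr_of C (id_mmap Tight [a, b]) = Id C (a \<odot> b)" "ismap (id_mmap Tight [a, b])" if "a \<in> Ob C" "b \<in> Ob C" for a b
    using id_mmap_map[of "[a, b]" Tight] that by simp_all
  have bu: "arr_of C (id_mmap Loose []) = Id C \<I>" "ismap (id_mmap Loose [])"
    using id_mmap_map[of "[]" Loose] by simp_all
  interpret represented False "M_ob C" ?R
  proof
    show "umap ?R \<in> maps (M_ob C) Loose [] (uob ?R)" using bu by (simp add: um maps_def)
  next
    fix a b assume "a \<in> Obj (M_ob C)" "b \<in> Obj (M_ob C)"
    then show "theta ?R a b \<in> maps (M_ob C) Tight [a, b] (prd ?R a b)" using bt by (simp add: th maps_def)
    fix xs d assume "set xs \<subseteq> Obj (M_ob C)"
    then show "bij_betw (\<lambda>f. Sub (M_ob C) f 1 (theta ?R a b)) (maps (M_ob C) Tight (prd ?R a b # xs) d) (maps (M_ob C) Tight (a # b # xs) d)"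
      using id_mmap_bij[of "[a, b]" Tight xs d] \<open>a \<in> _\<close> \<open>b \<in> _\<close> by (simp add: th)
  next
    fix xs d assume "set xs \<subseteq> Obj (M_ob C)"
    then show "bij_betw (\<lambda>f. Sub (M_ob C) f 1 (umap ?R)) (maps (M_ob C) Tight (uob ?R # xs) d) (maps (M_ob C) Loose xs d)"
      using id_mmap_bij[of "[]" Loose xs d] by (simp add: um)
  qed simp_all
  show ?thesis
  proof
    fix g f assume gf: "g \<in> Ar C" "f \<in> Ar C" "tgt f = src g"
    have "ins (to_mmap g) = [] @ out (to_mmap f) # []" using gf by simp
    note r = sub_M[OF mT[THEN iffD2, OF gf(1)] mT[THEN iffD2, OF gf(2)] this refl]
    show "to_mmap (g \<cdot> f) = Sub (M_ob C) (to_mmap g) 1 (to_mmap f)"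
      using r gf by (intro mmap_eqI[where C = C]) (simp_all add: bT plug_def numeral_2_eq_2 del: M_ob_simps)
  next
    fix f g assume fg: "f \<in> Ar C" "g \<in> Ar C"
    let ?t = "id_mmap Tight [src f, src g]" and ?t' = "id_mmap Tight [tgt f, tgt g]"
    have o: "src f \<in> Ob C" "src g \<in> Ob C" "tgt f \<in> Ob C" "tgt g \<in> Ob C" using fg by auto
    have "ins (to_mmap (f \<otimes> g)) = [] @ out ?t # []" using fg by simp
    note l = sub_M[OF mT[THEN iffD2, OF ten_simps(1)[OF fg]] bt(2)[OF o(1,2)] this refl]
    have "ins ?t' = [] @ out (to_mmap f) # [tgt g]" by simp
    note r1 = sub_M[OF bt(2)[OF o(3,4)] mT[THEN iffD2, OF fg(1)] this refl]
    define s where "s = Sub (M_ob C) ?t' 1 (to_mmap f)"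
    have s: "ismap s" "ins s = [src f, tgt g]" "out s = tgt f \<odot> tgt g" "ty s = Tight" "arr_of C s = f \<otimes> Id C (tgt g)"
      using r1 fg o by (simp_all add: s_def bT plug_def bt)
    have "ins s = [src f] @ out (to_mmap g) # []" using s by simp
    note r2 = sub_M[OF s(1) mT[THEN iffD2, OF fg(2)] this refl]
    have "Sub (M_ob C) (to_mmap (f \<otimes> g)) 1 ?t = Sub (M_ob C) s 2 (to_mmap g)"
      using l r2 s fg o ten_interchange(2)[OF fg]
      by (intro mmap_eqI[where C = C]) (simp_all add: bT plug_def bt gather_def numeral_2_eq_2 del: M_ob_simps)
    then show "f \<otimes> g \<in> hom C (prd ?R (src f) (src g)) (prd ?R (tgt f) (tgt g)) \<and>
        Sub (M_ob C) (to_mmap (f \<otimes> g)) 1 (theta ?R (src f) (src g))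
          = Sub (M_ob C) (Sub (M_ob C) (theta ?R (tgt f) (tgt g)) 1 (to_mmap f)) 2 (to_mmap g)"
      using fg by (simp add: hom_iff th s_def numeral_2_eq_2)
  next
    fix a b c assume "a \<in> Obj (M_ob C)" "b \<in> Obj (M_ob C)" "c \<in> Obj (M_ob C)"
    then have o: "a \<in> Ob C" "b \<in> Ob C" "c \<in> Ob C" by simp_all
    let ?A = "\<alpha> a b c"
    define s where "s = Sub (M_ob C) (to_mmap ?A) 1 (id_mmap Tight [a \<odot> b, c])"
    have s: "ismap s" "ins s = [a \<odot> b, c]" "out s = a \<odot> (b \<odot> c)" "ty s = Tight" "arr_of C s = ?A"
      using sub_M[of "to_mmap ?A" "id_mmap Tight [a \<odot> b, c]" "[]" "[]" 1] o
      by (simp_all add: s_def mT bT plug_def bt)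
    have "ins s = [] @ out (id_mmap Tight [a, b]) # [c]" using s by simp
    note l = sub_M[OF s(1) bt(2)[OF o(1,2)] this refl]
    have "ins (id_mmap Tight [a, b \<odot> c]) = [a] @ out (id_mmap Tight [b, c]) # []" by simp
    note r = sub_M[OF bt(2)[OF o(1) ten_ob[OF o(2,3)]] bt(2)[OF o(2,3)] this refl]
    have "Sub (M_ob C) s 1 (id_mmap Tight [a, b]) = Sub (M_ob C) (id_mmap Tight [a, b \<odot> c]) 2 (id_mmap Tight [b, c])"
      using l r s o
      by (intro mmap_eqI[where C = C]) (simp_all add: plug_def bt gather_def numeral_2_eq_2 del: M_ob_simps)
    then show "?A \<in> hom C (prd ?R (prd ?R a b) c) (prd ?R a (prd ?R b c)) \<and>
        Sub (M_ob C) (Sub (M_ob C) (to_mmap ?A) 1 (theta ?R (prd ?R a b) c)) 1 (theta ?R a b)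
          = Sub (M_ob C) (theta ?R a (prd ?R b c)) 2 (theta ?R b c)"
      using o by (simp add: hom_iff th s_def)
  next
    fix a assume "a \<in> Obj (M_ob C)"
    then have o: "a \<in> Ob C" by simp
    let ?l = "\<lambda>\<lambda> a"
    define s where "s = Sub (M_ob C) (to_mmap ?l) 1 (id_mmap Tight [\<I>, a])"
    have s: "ismap s" "ins s = [\<I>, a]" "out s = a" "ty s = Tight" "arr_of C s = ?l"
      using sub_M[of "to_mmap ?l" "id_mmap Tight [\<I>, a]" "[]" "[]" 1] o
      by (simp_all add: s_def mT bT plug_def bt)
    have "ins s = [] @ out (id_mmap Loose []) # [a]" using s by simp
    note l = sub_M[OF s(1) bu(2) this refl]
    have "Sub (M_ob C) s 1 (id_mmap Loose []) = Jay (M_ob C) (Idm (M_ob C) a)"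
      using l s o jay_M(1)[OF idm_M(2)[OF o]] idm_M(1)[OF o]
      by (intro mmap_eqI[where C = C]) (simp_all add: plug_def bu del: M_ob_simps(1-4))
    then show "?l \<in> hom C (prd ?R (uob ?R) a) a \<and>
        Sub (M_ob C) (Sub (M_ob C) (to_mmap ?l) 1 (theta ?R (uob ?R) a)) 1 (umap ?R) = Jay (M_ob C) (Idm (M_ob C) a)"
      using o by (simp add: hom_iff th um s_def)
    have "ins (id_mmap Tight [a, \<I>]) = [a] @ out (id_mmap Loose []) # []" by simp
    note r = sub_M[OF bt(2)[OF o unit_ob] bu(2) this refl]
    show "to_mmap (\<rho> a) = Sub (M_ob C) (theta ?R a (uob ?R)) 2 (umap ?R)"
      unfolding th um pu using r o
      by (intro mmap_eqI[where C = C]) (simp_all add: plug_def bt bu bT gather_def numeral_2_eq_2 del: M_ob_simps)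
    show "to_mmap (Id C a) = Idm (M_ob C) a"
      using o by (intro mmap_eqI[where C = C]) (simp_all add: bT idm_M)
  qed (simp_all add: mT)
qed

section \<open>Generalities on functors and natural isomorphisms\<close>

lemma is_functorI:
  assumes "\<And>a. a \<in> Ob C \<Longrightarrow> fob F a \<in> Ob D"
    "\<And>f. f \<in> Ar C \<Longrightarrow> far F f \<in> hom D (fob F (src f)) (fob F (tgt f))"
    "\<And>a. a \<in> Ob C \<Longrightarrow> far F (Id C a) = Id D (fob F a)"
    "\<And>g f. \<lbrakk>g \<in> Ar C; f \<in> Ar C; tgt f = src g\<rbrakk> \<Longrightarrow> far F (g \<cdot>\<^bsub>C\<^esub> f) = far F g \<cdot>\<^bsub>D\<^esub> far F f"
  shows "is_functor C D F"
  using assms by (simp add: is_functor_def)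

lemma comp_is_functor:
  assumes "is_functor C D F" "is_functor D E G"
  shows "is_functor C E (comp_fctr G F)"
  using assms by (auto simp: is_functor_def comp_fctr_def hom_iff)

lemma id_is_functor: "category C \<Longrightarrow> is_functor C C id_fctr"
  using category.arr_ob by (fastforce simp: is_functor_def id_fctr_def hom_iff)

lemma nat_iso_sym:
  assumes "category D" "is_functor C D F" "is_functor C D G" "nat_iso C D F G \<eta>" "category C"
  shows "\<exists>\<epsilon>. nat_iso C D G F \<epsilon>"
proof -
  interpret category D by fact
  have "\<forall>a. \<exists>g. a \<in> Ob C \<longrightarrow> g \<in> hom D (fob G a) (fob F a) \<and> g \<cdot>\<^bsub>D\<^esub> \<eta> a = Id D (fob F a) \<and> \<eta> a \<cdot>\<^bsub>D\<^esub> g = Id D (fob G a)"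
    using assms(4) by (fastforce simp: nat_iso_def is_iso_def hom_iff)
  then obtain \<epsilon> where e: "\<And>a. a \<in> Ob C \<Longrightarrow> \<epsilon> a \<in> hom D (fob G a) (fob F a) \<and>
      \<epsilon> a \<cdot>\<^bsub>D\<^esub> \<eta> a = Id D (fob F a) \<and> \<eta> a \<cdot>\<^bsub>D\<^esub> \<epsilon> a = Id D (fob G a)" by metis
  have h: "\<And>a. a \<in> Ob C \<Longrightarrow> \<eta> a \<in> hom D (fob F a) (fob G a)" using assms(4) by (simp add: nat_iso_def)
  have "is_iso D (\<epsilon> a)" if "a \<in> Ob C" for a
    using e[OF that] h[OF that] by (auto simp: is_iso_def hom_iff)
  moreover have "far F f \<cdot>\<^bsub>D\<^esub> \<epsilon> (src f) = \<epsilon> (tgt f) \<cdot>\<^bsub>D\<^esub> far G f" if f: "f \<in> Ar C" for f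
  proof -
    let ?a = "src f" and ?b = "tgt f"
    have o: "?a \<in> Ob C" "?b \<in> Ob C" using category.arr_ob[OF assms(5) f] by auto
    have F: "far F f \<in> Ar D" "src (far F f) = fob F ?a" "tgt (far F f) = fob F ?b"
      and G: "far G f \<in> Ar D" "src (far G f) = fob G ?a" "tgt (far G f) = fob G ?b"
      using assms(2,3) f by (auto simp: is_functor_def hom_iff)
    have ea: "\<epsilon> ?a \<in> Ar D" "src (\<epsilon> ?a) = fob G ?a" "tgt (\<epsilon> ?a) = fob F ?a"
      and eb: "\<epsilon> ?b \<in> Ar D" "src (\<epsilon> ?b) = fob G ?b" "tgt (\<epsilon> ?b) = fob F ?b"
      and ha: "\<eta> ?a \<in> Ar D" "src (\<eta> ?a) = fob F ?a" "tgt (\<eta> ?a) = fob G ?a"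
      and hb: "\<eta> ?b \<in> Ar D" "src (\<eta> ?b) = fob F ?b" "tgt (\<eta> ?b) = fob G ?b"
      using e[OF o(1)] e[OF o(2)] h[OF o(1)] h[OF o(2)] by (auto simp: hom_iff)
    have nat: "far G f \<cdot>\<^bsub>D\<^esub> \<eta> ?a = \<eta> ?b \<cdot>\<^bsub>D\<^esub> far F f" using assms(4) f by (simp add: nat_iso_def)
    have "\<epsilon> ?b \<cdot>\<^bsub>D\<^esub> far G f = \<epsilon> ?b \<cdot>\<^bsub>D\<^esub> (far G f \<cdot>\<^bsub>D\<^esub> (\<eta> ?a \<cdot>\<^bsub>D\<^esub> \<epsilon> ?a))"
      using e[OF o(1)] G by simp
    also have "\<dots> = \<epsilon> ?b \<cdot>\<^bsub>D\<^esub> (\<eta> ?b \<cdot>\<^bsub>D\<^esub> (far F f \<cdot>\<^bsub>D\<^esub> \<epsilon> ?a))"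
      using nat F G ea ha hb by (intro arg_cong[where f = "\<lambda>z. _ \<cdot>\<^bsub>D\<^esub> z"] comp_cong_right) simp_all
    also have "\<dots> = (\<epsilon> ?b \<cdot>\<^bsub>D\<^esub> \<eta> ?b) \<cdot>\<^bsub>D\<^esub> (far F f \<cdot>\<^bsub>D\<^esub> \<epsilon> ?a)"
      using F ea eb hb by (simp add: comp_assoc)
    also have "\<dots> = far F f \<cdot>\<^bsub>D\<^esub> \<epsilon> ?a"
      using e[OF o(2)] F ea by simp
    finally show ?thesis ..
  qed
  ultimately show ?thesis using e by (auto simp: nat_iso_def)
qed

lemma equivalenceI:
  assumes "category C" "category D" "is_functor C D F" "is_functor D C G"
    "\<exists>\<eta>. nat_iso C C id_fctr (comp_fctr G F) \<eta>" "\<exists>\<epsilon>. nat_iso D D (comp_fctr F G) id_fctr \<epsilon>"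
  shows "equivalence C D F"
  using assms unfolding equivalence_def by blast

section \<open>The categories\<close>

definition multi_cat :: "bool \<Rightarrow> (('o, 'm) multi \<Rightarrow> bool) \<Rightarrow> (('o, 'm) multi, ('o, 'm) multif) cat" where
  "multi_cat s P = \<lparr>Ob = {C. P C}, Ar = {Arr C D F | C D F. P C \<and> P D \<and> morphism s C D F},
     Id = (\<lambda>C. Arr C C (id_multif C)),
     Comp = (\<lambda>G F. Arr (src F) (tgt G) (comp_multif (src F) (lab G) (lab F)))\<rparr>"

abbreviation "skew_lr C \<equiv> skew_multicategory C \<and> left_representable C"
abbreviation "short_lr C \<equiv> short_skew_multicategory C \<and> short_left_representable C"

lemma SkMulti_multi_cat: "SkMulti_lr = multi_cat False skew_lr"
  by (simp add: SkMulti_lr_def multi_cat_def multifunctor_iff conj_assoc)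

lemma ShSkMulti_multi_cat: "ShSkMulti_lr = multi_cat True short_lr"
  by (simp add: ShSkMulti_lr_def multi_cat_def short_multifunctor_iff conj_assoc)

lemma multi_cat_Ar: "f \<in> Ar (multi_cat s P) \<longleftrightarrow> P (src f) \<and> P (tgt f) \<and> morphism s (src f) (tgt f) (lab f)"
  by (cases f) (auto simp: multi_cat_def)

lemma morphismD:
  assumes "morphism s C D F"
  shows "mob F \<in> extensional (Obj C)" "mmp F \<in> extensional (Maps C)" "a \<in> Obj C \<Longrightarrow> mob F a \<in> Obj D"
    "f \<in> Maps C \<Longrightarrow> mmp F f \<in> Maps D"
  using assms by (auto simp: morphism_def multi_graph_map_def maps_def PiE_def)

lemma comp_id_multif:
  assumes "morphism s C D F"
  shows "comp_multif C (id_multif D) F = F" "comp_multif C F (id_multif C) = F"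
  using morphismD[OF assms]
  by (auto simp: comp_multif_def id_multif_def fun_eq_iff compose_def extensional_def intro!: multif.equality)

lemma comp_multif_assoc:
  assumes "morphism s C D F"
  shows "comp_multif C (comp_multif D H G) F = comp_multif C H (comp_multif C G F)"
  using morphismD[OF assms] by (auto simp: comp_multif_def fun_eq_iff compose_def)

lemma multi_cat_category:
  assumes "\<And>C. P C \<Longrightarrow> bounded_multi s C"
  shows "category (multi_cat s P)"
proof
  fix a assume "a \<in> Ob (multi_cat s P)"
  then have a: "P a" by (simp add: multi_cat_def)
  then show "Id (multi_cat s P) a \<in> hom (multi_cat s P) a a"
    using bounded_multi.morphism_id[OF assms[OF a]] by (simp add: hom_iff multi_cat_Ar) (simp add: multi_cat_def)
next
  fix g f assume f: "g \<in> Ar (multi_cat s P)" "f \<in> Ar (multi_cat s P)" "tgt f = src g"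
  then show "g \<cdot>\<^bsub>multi_cat s P\<^esub> f \<in> hom (multi_cat s P) (src f) (tgt g)"
    using bounded_multi.morphism_comp'[OF assms, of "src f" "tgt f" "lab f" "tgt g" "lab g"]
    by (simp add: hom_iff multi_cat_Ar) (simp add: multi_cat_def)
next
  fix f assume f: "f \<in> Ar (multi_cat s P)"
  then have m: "morphism s (src f) (tgt f) (lab f)" by (simp add: multi_cat_Ar)
  show "src f \<in> Ob (multi_cat s P) \<and> tgt f \<in> Ob (multi_cat s P)" using f by (simp add: multi_cat_Ar) (simp add: multi_cat_def)
  show "Id (multi_cat s P) (tgt f) \<cdot>\<^bsub>multi_cat s P\<^esub> f = f" "f \<cdot>\<^bsub>multi_cat s P\<^esub> Id (multi_cat s P) (src f) = f"
    using comp_id_multif[OF m] by (cases f; simp add: multi_cat_def)+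
next
  fix h g f assume f: "h \<in> Ar (multi_cat s P)" "g \<in> Ar (multi_cat s P)" "f \<in> Ar (multi_cat s P)" "tgt f = src g" "tgt g = src h"
  then have "morphism s (src f) (src g) (lab f)" by (simp add: multi_cat_Ar)
  from comp_multif_assoc[OF this] show "h \<cdot>\<^bsub>multi_cat s P\<^esub> g \<cdot>\<^bsub>multi_cat s P\<^esub> f = h \<cdot>\<^bsub>multi_cat s P\<^esub> (g \<cdot>\<^bsub>multi_cat s P\<^esub> f)"
    by (simp add: multi_cat_def)
qed

text \<open>The inverse of a bijection that preserves the operations preserves them as well.\<close>

lemma iso_multi_cat:
  assumes P: "P C" "P D" and ax: "bounded_multi s C" "bounded_multi s D" and F: "morphism s C D F"
    and ob: "mob F = restrict (\<lambda>a. a) (Obj C)" "Obj C = Obj D" and bij: "bij_betw (mmp F) (Maps C) (Maps D)"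
  shows "is_iso (multi_cat s P) (Arr C D F)"
proof -
  interpret C: bounded_multi s C by fact
  interpret D: bounded_multi s D by fact
  let ?i = "inv_into (Maps C) (mmp F)"
  define G where "G = \<lparr>mob = restrict (\<lambda>a. a) (Obj D), mmp = restrict ?i (Maps D)\<rparr>"
  have i: "?i f \<in> Maps C" "mmp F (?i f) = f" if "f \<in> Maps D" for f
    using bij that by (auto simp: bij_betw_def inv_into_into f_inv_into_f)
  have inj: "inj_on (mmp F) (Maps C)" using bij by (simp add: bij_betw_def)
  have mid: "map (mob F) as = as" if "set as \<subseteq> Obj C" for as
    using that ob by (intro map_idI) auto
  have sh: "ty (mmp F f) = ty f \<and> ins (mmp F f) = ins f \<and> out (mmp F f) = out f \<and> arity (mmp F f) = arity f" if "f \<in> Maps C" for f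
    using F that C.map_wf[OF that] mid[of "ins f"] ob by (auto simp: morphism_def multi_graph_map_def maps_def arity_def)
  have ish: "ty (?i f) = ty f \<and> ins (?i f) = ins f \<and> out (?i f) = out f \<and> arity (?i f) = arity f" if "f \<in> Maps D" for f
    using sh[OF i(1)[OF that]] i(2)[OF that] by simp
  have "morphism s D C G"
    unfolding morphism_def
  proof (intro conjI ballI allI impI)
    have "map (mob G) (ins f) = ins f" "mob G (out f) = out f" if "f \<in> Maps D" for f
      using D.map_wf[OF that] by (auto simp: G_def intro!: map_idI)
    then show "multi_graph_map D C G"
      using i ish ob by (auto simp: multi_graph_map_def maps_def) (auto simp: G_def)
  next
    fix a assume a: "a \<in> Obj D"
    have "Idm C a \<in> Maps C" "mmp F (Idm C a) = Idm D a" "Idm D a \<in> Maps D"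
      using a ob F C.idm[of a] D.idm[of a] by (auto simp: morphism_def maps_def)
    then show "mmp G (Idm D a) = Idm C (mob G a)"
      using a inj by (simp add: G_def) (metis inv_into_f_f)
  next
    fix f assume f: "f \<in> Maps D" and t: "ty f = Tight \<and> arity_ok s Loose (arity f)"
    have "\<j>\<^bsub>D\<^esub> f \<in> Maps D" using D.jay[OF f] t by (simp add: maps_def)
    moreover have "\<j>\<^bsub>C\<^esub> (?i f) \<in> Maps C" using C.jay[OF i(1)[OF f]] ish[OF f] t by (simp add: maps_def)
    moreover have "mmp F (\<j>\<^bsub>C\<^esub> (?i f)) = \<j>\<^bsub>D\<^esub> f" using F i[OF f] ish[OF f] t by (simp add: morphism_def)
    ultimately show "mmp G (\<j>\<^bsub>D\<^esub> f) = \<j>\<^bsub>C\<^esub> (mmp G f)"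
      using f inj by (simp add: G_def) (metis inv_into_f_f)
  next
    fix g f k assume gf: "g \<in> Maps D" "f \<in> Maps D" and op: "fits g k f \<and> op_ok s (ty g) (arity g) (ty f) (arity f)"
    have fit: "fits (?i g) k (?i f)" using op ish[OF gf(1)] ish[OF gf(2)] by (simp add: fits_def)
    have "g \<star>[k]\<^bsub>D\<^esub> f \<in> Maps D" using D.sub[OF gf] op by (simp add: maps_def)
    moreover have "?i g \<star>[k]\<^bsub>C\<^esub> ?i f \<in> Maps C"
      using C.sub[OF i(1)[OF gf(1)] i(1)[OF gf(2)] fit] op ish[OF gf(1)] ish[OF gf(2)] by (simp add: maps_def)
    moreover have "mmp F (?i g \<star>[k]\<^bsub>C\<^esub> ?i f) = g \<star>[k]\<^bsub>D\<^esub> f"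
      using F i[OF gf(1)] i[OF gf(2)] fit op ish[OF gf(1)] ish[OF gf(2)] by (simp add: morphism_def)
    ultimately show "mmp G (g \<star>[k]\<^bsub>D\<^esub> f) = mmp G g \<star>[k]\<^bsub>C\<^esub> mmp G f"
      using gf inj by (simp add: G_def) (metis inv_into_f_f)
  qed
  moreover have "comp_multif C G F = id_multif C"
    using morphismD(3,4)[OF F] ob inj
    by (auto simp: comp_multif_def id_multif_def G_def fun_eq_iff compose_def)
  moreover have "comp_multif D F G = id_multif D"
    using i ob by (auto simp: comp_multif_def id_multif_def G_def fun_eq_iff compose_def)
  ultimately show ?thesis
    using P F unfolding is_iso_def
    by (intro conjI bexI[of _ "Arr D C G"]) (auto simp: multi_cat_Ar hom_iff, simp_all add: multi_cat_def)
qed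

section \<open>Truncation is a functor\<close>

text \<open>The operations of the truncation are restrictions of operations that a multifunctor preserves.\<close>

lemma Us_mor_morphism:
  assumes "skew_multicategory C" "morphism False C D F"
  shows "morphism True (Us_ob C) (Us_ob D) (Us_mor C F)"
proof -
  interpret bounded_multi False C by (rule bounded_multi_full[OF assms(1)])
  have op: "op_ok False x n y m" "arity_ok False x n" for x n y m by (simp_all add: op_ok_def arity_ok_def)
  have sh: "mmp F f \<in> Maps D \<and> ty (mmp F f) = ty f \<and> arity (mmp F f) = arity f" if "f \<in> Maps C" for f
    using assms(2) that by (auto simp: morphism_def multi_graph_map_def maps_def arity_def)
  have 1: "multi_graph_map (Us_ob C) (Us_ob D) (Us_mor C F)"
    using assms(2) sh by (auto simp: morphism_def multi_graph_map_def maps_def Us_mor_def)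
  have 2: "mmp (Us_mor C F) (Idm (Us_ob C) a) = Idm (Us_ob D) (mob (Us_mor C F) a)" if "a \<in> Obj C" for a
  proof -
    have "Idm C a \<in> Maps (Us_ob C)" using mapsD[OF idm[OF that]] by (simp add: short_arity_def)
    then show ?thesis using assms(2) that by (simp add: Us_mor_def morphism_def del: Us_ob_simps(3))
  qed
  have 3: "mmp (Us_mor C F) (Jay (Us_ob C) f) = Jay (Us_ob D) (mmp (Us_mor C F) f)"
    if f: "f \<in> Maps (Us_ob C)" "ty f = Tight" "arity_ok True Loose (arity f)" for f
  proof -
    have l: "arity f \<le> 2" using f(3) by simp
    have "Jay C f \<in> Maps (Us_ob C)"
      using mapsD[OF jay[of f]] f l by (simp add: op short_arity_def arity_def[symmetric])
    then show ?thesis using assms(2) f l sh[of f] by (simp add: Us_mor_def morphism_def op)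
  qed
  have 4: "mmp (Us_mor C F) (Sub (Us_ob C) g i f) = Sub (Us_ob D) (mmp (Us_mor C F) g) i (mmp (Us_mor C F) f)"
    if gf: "g \<in> Maps (Us_ob C)" "f \<in> Maps (Us_ob C)" "fits g i f" "op_ok True (ty g) (arity g) (ty f) (arity f)" for g f i
  proof -
    interpret U: short_skew_multicategory "Us_ob C" by (rule Us_short[OF assms(1)])
    have so: "short_op (ty g) (arity g) (ty f) (arity f)" using gf(4) by (simp add: op_ok_def)
    have "Sub (Us_ob C) g i f \<in> Maps (Us_ob C)" using U.sub[OF gf(1-3) so] unfolding maps_def by blast
    then have "Sub C g i f \<in> Maps (Us_ob C)" using so by simp
    moreover have "Sub (Us_ob D) (mmp F g) i (mmp F f) = Sub D (mmp F g) i (mmp F f)"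
      using so sh[of g] sh[of f] gf by (intro Us_ob_simps(5)) simp
    ultimately show ?thesis
      using assms(2) gf so by (simp add: Us_mor_def morphism_def op)
  qed
  show ?thesis using 1 2 3 4 unfolding morphism_def Us_ob_simps(1) by blast
qed

lemma Us_objects: "skew_lr C \<Longrightarrow> short_lr (Us_ob C)"
  using Us_short Us_left_representable by blast

lemma Us_mor_comp:
  assumes "morphism False C D F"
  shows "Us_mor C (comp_multif C G F) = comp_multif (Us_ob C) (Us_mor D G) (Us_mor C F)"
proof -
  have "mmp F f \<in> Maps (Us_ob D)" if "f \<in> Maps (Us_ob C)" for f
    using assms that by (auto simp: morphism_def multi_graph_map_def maps_def arity_def)
  then show ?thesis
    by (auto simp: Us_mor_def comp_multif_def compose_def fun_eq_iff simp del: Us_ob_simps(3))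
      (auto)
qed

lemma Us_functor: "is_functor SkMulti_lr ShSkMulti_lr Us"
  unfolding SkMulti_multi_cat ShSkMulti_multi_cat
proof (rule is_functorI)
  show "fob Us C \<in> Ob (multi_cat True short_lr)" if "C \<in> Ob (multi_cat False skew_lr)" for C :: "('a, 'b) multi"
    using that Us_objects[of C] by (simp add: multi_cat_def Us_def)
  show "far Us f \<in> hom (multi_cat True short_lr) (fob Us (src f)) (fob Us (tgt f))"
    if "f \<in> Ar (multi_cat False skew_lr)" for f :: "(('a, 'b) multi, ('a, 'b) multif) arr"
    using that Us_objects[of "src f"] Us_objects[of "tgt f"] Us_mor_morphism[of "src f" "tgt f" "lab f"]
    by (simp add: hom_iff multi_cat_Ar Us_def)
  show "far Us (Id (multi_cat False skew_lr) C) = Id (multi_cat True short_lr) (fob Us C)" for C :: "('a, 'b) multi"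
    by (auto simp: multi_cat_def Us_def Us_mor_def id_multif_def fun_eq_iff)
  show "far Us (g \<cdot>\<^bsub>multi_cat False skew_lr\<^esub> f) = far Us g \<cdot>\<^bsub>multi_cat True short_lr\<^esub> far Us f"
    if "f \<in> Ar (multi_cat False skew_lr)" "tgt f = src g" for f g :: "(('a, 'b) multi, ('a, 'b) multif) arr"
    using that Us_mor_comp[of "src f" "tgt f" "lab f" "lab g"] by (simp add: multi_cat_Ar) (simp add: multi_cat_def Us_def)
qed

section \<open>The category of skew monoidal categories\<close>

lemma rep_laxf_I:
  assumes "rep_skewmon s C R K" "rep_skewmon s D S L" "morphism s C D F" "lax_spec C R K D S L F H"
  shows "rep_laxf s C R K D S L F H"
  using assms by (simp add: rep_laxf_def rep_morphism_def rep_morphism_axioms_def rep_laxf_axioms_def)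

lemma rep_laxf_unique:
  assumes "rep_laxf s C R K D S L F H" "rep_laxf s C R K D S L F H'"
  shows "H = H'"
  using rep_laxf.H_unique[OF assms(2) rep_laxf.H[OF assms(1)]] .

lemma rep_laxf_comp:
  assumes "rep_laxf s C R K D S L F H" "rep_laxf s D S L E Q N G J"
  shows "rep_laxf s C R K E Q N (comp_multif C G F) (comp_lax K N J H)"
proof -
  interpret X: rep_laxf s C R K D S L F H by fact
  interpret Y: rep_laxf s D S L E Q N G J by fact
  show ?thesis
    using lax_spec_comp[OF assms] X.A.morphism_comp'[OF X.F Y.F] X.A.rep_skewmon_axioms Y.B.rep_skewmon_axioms
    by (intro rep_laxf_I) (unfold_locales)
qed

lemma rep_laxf_id:
  assumes "rep_skewmon s C R K"
  shows "rep_laxf s C R K C R K (id_multif C) (id_lax K)"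
proof -
  interpret rep_skewmon s C R K by fact
  show ?thesis by (intro rep_laxf_I assms morphism_id lax_spec_id[OF assms])
qed

lemma rep_laxf_Ks:
  assumes "rep_skewmon s C R K" "rep_skewmon s D S L" "morphism s C D F"
  shows "rep_laxf s C R K D S L F (Ks_mor R C S D F)"
  using assms rep_morphism.Ks_mor_spec[of s C R K D S L F]
  by (intro rep_laxf_I) (simp_all add: rep_morphism_def rep_morphism_axioms_def)

text \<open>A lax monoidal functor is the one determined by the multifunctor that it induces.  This gives
  access to the uniqueness argument for arbitrary lax monoidal functors.\<close>

lemma rep_laxf_M:
  assumes "lax_monoidal C D F"
  shows "rep_laxf False (M_ob C) (M_lr C) C (M_ob D) (M_lr D) D (M_mor C D F) F"
proof (rule rep_laxf_I)
  interpret lax C D F using assms by (simp add: lax_iff)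
  show c: "rep_skewmon False (M_ob C) (M_lr C) C" "rep_skewmon False (M_ob D) (M_lr D) D"
    by (rule C.rep_skewmon_M_ob, rule D.rep_skewmon_M_ob)
  show "morphism False (M_ob C) (M_ob D) (M_mor C D F)" using M_multifunctor by (simp add: multifunctor_iff)
  have bT: "arr_of X (to_mmap f) = f" for X f by (intro arr_eqI) simp_all
  have mT: "C.ismap (to_mmap f)" if "f \<in> Ar C" for f using that rep_skewmon.K_Ar[OF c(1)] by simp
  have mT': "D.ismap (to_mmap f)" if "f \<in> Ar D" for f using that rep_skewmon.K_Ar[OF c(2)] by simp
  have th: "theta (M_lr X) a b = skew_mon.id_mmap X Tight [a, b]" "umap (M_lr X) = skew_mon.id_mmap X Loose []"
    if "skew_mon X" for X a b
    using that by (simp_all add: M_lr_def skew_mon.id_mmap_def)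
  have sk: "skew_mon C" "skew_mon D" by unfold_locales
  have pu [simp]: "prd (M_lr X) = Ten X" "uob (M_lr X) = \<I>\<^bsub>X\<^esub>" for X :: "('a, 'b) skewmon" by (simp_all add: M_lr_def)
  have far: "to_mmap (Fa f) = mmp (M_mor C D F) (to_mmap f)" if f: "f \<in> Ar C" for f
  proof -
    have "to_mmap (Fa f) = MF (to_mmap f)"
      using f arr_of_M_map[OF mT[OF f]] by (intro mmap_eqI[where C = D]) (simp_all add: bT f2_ins_def)
    then show ?thesis using mT[OF f] by (simp add: M_mor_def)
  qed
  let ?u = "C.id_mmap Loose []" and ?u' = "D.id_mmap Loose []"
  note u = C.id_mmap_map[of "[]" Loose, simplified] and u' = D.id_mmap_map[of "[]" Loose, simplified]
  have f0: "Sub (M_ob D) (to_mmap (f0 F)) 1 ?u' = mmp (M_mor C D F) ?u"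
  proof -
    have "ins (to_mmap (f0 F)) = [] @ out ?u' # []" by simp
    note r = D.sub_M[OF mT'[OF f0_arr(1)] u'(2) this refl]
    have "Sub (M_ob D) (to_mmap (f0 F)) 1 ?u' = MF ?u"
      using r arr_of_M_map[OF u(2)] u u' by (intro mmap_eqI[where C = D]) (simp_all add: bT plug_def f2_ins_def del: M_ob_simps)
    then show ?thesis using u by (simp add: M_mor_def)
  qed
  have f2: "Sub (M_ob D) (to_mmap (f2 F a b)) 1 (D.id_mmap Tight [Fo a, Fo b]) = mmp (M_mor C D F) (C.id_mmap Tight [a, b])"
    if ab: "a \<in> Ob C" "b \<in> Ob C" for a b
  proof -
    let ?t = "C.id_mmap Tight [a, b]" and ?t' = "D.id_mmap Tight [Fo a, Fo b]"
    have t: "arr_of C ?t = Id C (a \<odot>\<^bsub>C\<^esub> b)" "C.ismap ?t" using C.id_mmap_map[of "[a, b]" Tight] ab by simp_all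
    have t': "arr_of D ?t' = Id D (Fo a \<odot>\<^bsub>D\<^esub> Fo b)" "D.ismap ?t'" using D.id_mmap_map[of "[Fo a, Fo b]" Tight] ab by simp_all
    have "ins (to_mmap (f2 F a b)) = [] @ out ?t' # []" using ab by simp
    note r = D.sub_M[OF mT'[OF f2_arr(1)[OF ab]] t'(2) this refl]
    have "Sub (M_ob D) (to_mmap (f2 F a b)) 1 ?t' = MF ?t"
      using r arr_of_M_map[OF t(2)] t t' ab by (intro mmap_eqI[where C = D]) (simp_all add: bT plug_def f2_ins_def del: M_ob_simps)
    then show ?thesis using t by (simp add: M_mor_def)
  qed
  show "lax_spec (M_ob C) (M_lr C) C (M_ob D) (M_lr D) D (M_mor C D F) F"
    unfolding lax_spec_def th[OF sk(1)] th[OF sk(2)] pu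
    using ext far f0 f2 by (auto simp: hom_iff) (auto simp: M_mor_def)
qed

lemma rep_laxf_lax: "rep_laxf s C R K D S L F H \<Longrightarrow> lax_monoidal K L H"
  by (rule rep_laxf.H_lax)

lemma SkMon_Ar: "f \<in> Ar SkMon \<longleftrightarrow> lax_monoidal (src f) (tgt f) (lab f)"
  by (cases f) (auto simp: SkMon_def)

lemma SkMon_Ob: "C \<in> Ob SkMon \<longleftrightarrow> skew_monoidal C"
  by (simp add: SkMon_def)

lemma M_rep_skewmon: "skew_monoidal C \<Longrightarrow> rep_skewmon False (M_ob C) (M_lr C) C"
  using skew_mon.rep_skewmon_M_ob by (simp add: skew_mon_iff)

lemma lax_skew: "lax_monoidal C D F \<Longrightarrow> skew_monoidal C \<and> skew_monoidal D"
  by (simp add: lax_monoidal_def)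

text \<open>Both sides of each category law satisfy the equations of \<open>lax_spec\<close> for the same multifunctor.\<close>

theorem SkMon_category: "category (SkMon :: (('o, 'm) skewmon, ('o, 'm) laxf) cat)"
proof
  fix f :: "(('o, 'm) skewmon, ('o, 'm) laxf) arr" assume "f \<in> Ar SkMon"
  then have f: "lax_monoidal (src f) (tgt f) (lab f)" by (simp add: SkMon_Ar)
  note s = lax_skew[OF f] and m = rep_laxf_M[OF f]
  show "src f \<in> Ob SkMon \<and> tgt f \<in> Ob SkMon" using s by (simp add: SkMon_Ob)
  have mf: "morphism False (M_ob (src f)) (M_ob (tgt f)) (M_mor (src f) (tgt f) (lab f))"
    using m by (simp add: rep_laxf_def rep_morphism_def rep_morphism_axioms_def)
  have "rep_laxf False (M_ob (src f)) (M_lr (src f)) (src f) (M_ob (tgt f)) (M_lr (tgt f)) (tgt f)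
      (M_mor (src f) (tgt f) (lab f)) (comp_lax (src f) (tgt f) (id_lax (tgt f)) (lab f))"
    using rep_laxf_comp[OF m rep_laxf_id[OF M_rep_skewmon]] s comp_id_multif(1)[OF mf] by simp
  from rep_laxf_unique[OF this m] show "Id SkMon (tgt f) \<cdot>\<^bsub>SkMon\<^esub> f = f"
    by (cases f) (simp add: SkMon_def)
  have "rep_laxf False (M_ob (src f)) (M_lr (src f)) (src f) (M_ob (tgt f)) (M_lr (tgt f)) (tgt f)
      (M_mor (src f) (tgt f) (lab f)) (comp_lax (src f) (tgt f) (lab f) (id_lax (src f)))"
    using rep_laxf_comp[OF rep_laxf_id[OF M_rep_skewmon] m] s comp_id_multif(2)[OF mf] by simp
  from rep_laxf_unique[OF this m] show "f \<cdot>\<^bsub>SkMon\<^esub> Id SkMon (src f) = f"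
    by (cases f) (simp add: SkMon_def)
next
  fix a :: "('o, 'm) skewmon" assume "a \<in> Ob SkMon"
  then have "lax_monoidal a a (id_lax a)" using rep_laxf_lax[OF rep_laxf_id[OF M_rep_skewmon]] by (simp add: SkMon_Ob)
  then show "Id SkMon a \<in> hom SkMon a a" by (simp add: hom_iff SkMon_Ar) (simp add: SkMon_def)
next
  fix g f :: "(('o, 'm) skewmon, ('o, 'm) laxf) arr"
  assume gf: "g \<in> Ar SkMon" "f \<in> Ar SkMon" "tgt f = src g"
  then have "lax_monoidal (src f) (tgt g) (comp_lax (src f) (tgt g) (lab g) (lab f))"
    using rep_laxf_lax[OF rep_laxf_comp[OF rep_laxf_M rep_laxf_M]] by (simp add: SkMon_Ar)
  then show "g \<cdot>\<^bsub>SkMon\<^esub> f \<in> hom SkMon (src f) (tgt g)"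
    by (simp add: hom_iff SkMon_Ar) (simp add: SkMon_def)
next
  fix h g f :: "(('o, 'm) skewmon, ('o, 'm) laxf) arr"
  assume hgf: "h \<in> Ar SkMon" "g \<in> Ar SkMon" "f \<in> Ar SkMon" "tgt f = src g" "tgt g = src h"
  have m: "rep_laxf False (M_ob (src f)) (M_lr (src f)) (src f) (M_ob (src g)) (M_lr (src g)) (src g) (M_mor (src f) (src g) (lab f)) (lab f)"
    "rep_laxf False (M_ob (src g)) (M_lr (src g)) (src g) (M_ob (src h)) (M_lr (src h)) (src h) (M_mor (src g) (src h) (lab g)) (lab g)"
    "rep_laxf False (M_ob (src h)) (M_lr (src h)) (src h) (M_ob (tgt h)) (M_lr (tgt h)) (tgt h) (M_mor (src h) (tgt h) (lab h)) (lab h)"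
    using hgf rep_laxf_M[of "src f" "tgt f" "lab f"] rep_laxf_M[of "src g" "tgt g" "lab g"] rep_laxf_M[of "src h" "tgt h" "lab h"]
    by (simp_all add: SkMon_Ar)
  have mf: "morphism False (M_ob (src f)) (M_ob (src g)) (M_mor (src f) (src g) (lab f))"
    using m(1) by (simp add: rep_laxf_def rep_morphism_def rep_morphism_axioms_def)
  from rep_laxf_unique[OF rep_laxf_comp[OF m(1) rep_laxf_comp[OF m(2,3)], unfolded comp_multif_assoc[OF mf]]
      rep_laxf_comp[OF rep_laxf_comp[OF m(1,2)] m(3)]]
  show "h \<cdot>\<^bsub>SkMon\<^esub> g \<cdot>\<^bsub>SkMon\<^esub> f = h \<cdot>\<^bsub>SkMon\<^esub> (g \<cdot>\<^bsub>SkMon\<^esub> f)"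
    using hgf(4,5) by (simp add: SkMon_def)
qed

definition M_fctr :: "(('o, 'm) skewmon, ('o, 'm) laxf, ('o, 'm) multi, ('o, 'm) multif) fctr" where
  "M_fctr = \<lparr>fob = M_ob, far = (\<lambda>F. Arr (M_ob (src F)) (M_ob (tgt F)) (M_mor (src F) (tgt F) (lab F)))\<rparr>"

lemma M_objects: "skew_monoidal C \<Longrightarrow> skew_lr (M_ob C)"
  by (simp add: skew_mon_iff skew_mon.M_skew_multicategory skew_mon.M_left_representable)

lemma M_functor: "is_functor SkMon SkMulti_lr M_fctr"
  unfolding SkMulti_multi_cat
proof (rule is_functorI)
  show "fob M_fctr C \<in> Ob (multi_cat False skew_lr)" if "C \<in> Ob SkMon" for C :: "('a, 'b) skewmon"
    using that M_objects by (simp add: multi_cat_def M_fctr_def SkMon_Ob)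
  show "far M_fctr f \<in> hom (multi_cat False skew_lr) (fob M_fctr (src f)) (fob M_fctr (tgt f))"
    if "f \<in> Ar SkMon" for f :: "(('a, 'b) skewmon, ('a, 'b) laxf) arr"
  proof -
    have f: "lax_monoidal (src f) (tgt f) (lab f)" using that by (simp add: SkMon_Ar)
    have "morphism False (M_ob (src f)) (M_ob (tgt f)) (M_mor (src f) (tgt f) (lab f))"
      using lax.M_multifunctor f by (simp add: lax_iff multifunctor_iff)
    then show ?thesis using lax_skew[OF f] by (simp add: hom_iff multi_cat_Ar M_fctr_def M_objects)
  qed
  show "far M_fctr (Id SkMon C) = Id (multi_cat False skew_lr) (fob M_fctr C)" if "C \<in> Ob SkMon" for C :: "('a, 'b) skewmon"
    using that M_mor_id[of C] by (simp add: SkMon_Ob) (simp add: SkMon_def multi_cat_def M_fctr_def)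
  show "far M_fctr (g \<cdot>\<^bsub>SkMon\<^esub> f) = far M_fctr g \<cdot>\<^bsub>multi_cat False skew_lr\<^esub> far M_fctr f"
    if "g \<in> Ar SkMon" "f \<in> Ar SkMon" "tgt f = src g" for f g :: "(('a, 'b) skewmon, ('a, 'b) laxf) arr"
    using that M_mor_comp[of "src f" "src g" "lab f" "tgt g" "lab g"] by (simp add: SkMon_Ar) (simp add: SkMon_def multi_cat_def M_fctr_def)
qed

section \<open>The comparison isomorphisms\<close>

definition trunc :: "bool \<Rightarrow> ('o, 'm) multi \<Rightarrow> ('o, 'm) multi" where
  "trunc s X = (if s then Us_ob X else X)"

definition trunc_mor :: "bool \<Rightarrow> ('o, 'm) multi \<Rightarrow> ('o, 'm) multif \<Rightarrow> ('o, 'm) multif" where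
  "trunc_mor s X F = (if s then Us_mor X F else F)"

definition realize_mor :: "bool \<Rightarrow> ('o, 'm) multi \<Rightarrow> ('o, 'm) lr_data \<Rightarrow> ('o, 'm) skewmon \<Rightarrow> ('o, 'm) multif" where
  "realize_mor s C R K = \<lparr>mob = restrict (\<lambda>a. a) (Obj C), mmp = restrict (realize C R K) (Maps (trunc s (M_ob K)))\<rparr>"

lemma trunc_Maps: "f \<in> Maps (trunc s X) \<longleftrightarrow> f \<in> Maps X \<and> arity_ok s (ty f) (arity f)"
  by (simp add: trunc_def arity_ok_def)

lemma trunc_simps [simp]:
  "Obj (trunc s X) = Obj X" "Idm (trunc s X) = Idm X"
  "ty f = Tight \<Longrightarrow> arity_ok s Loose (arity f) \<Longrightarrow> Jay (trunc s X) f = Jay X f"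
  "op_ok s (ty g) (arity g) (ty f) (arity f) \<Longrightarrow> Sub (trunc s X) g i f = Sub X g i f"
  by (auto simp: trunc_def op_ok_def)

lemma trunc_bounded_multi: "skew_multicategory X \<Longrightarrow> bounded_multi s (trunc s X)"
  using bounded_multi_full bounded_multi_short[OF Us_short] by (cases s) (simp_all add: trunc_def)

lemma (in rep_skewmon) realize_mor:
  shows "morphism s (trunc s (M_ob K)) C (realize_mor s C R K)"
    "bij_betw (mmp (realize_mor s C R K)) (Maps (trunc s (M_ob K))) (Maps C)"
proof -
  let ?X = "trunc s (M_ob K)"
  interpret X: bounded_multi s ?X by (rule trunc_bounded_multi[OF KM.M_skew_multicategory])
  have mX: "f \<in> Maps ?X \<longleftrightarrow> KM.ismap f \<and> arity_ok s (ty f) (arity f)" for f by (rule trunc_Maps)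
  have "{f. KM.ismap f \<and> arity_ok s (ty f) (arity f)} = Maps ?X" using mX by auto
  then have b: "bij_betw EE (Maps ?X) (Maps C)" using realize_bij by simp
  then show "bij_betw (mmp (realize_mor s C R K)) (Maps ?X) (Maps C)"
    by (subst bij_betw_cong[of _ _ EE]) (simp_all add: realize_mor_def)
  have e: "mmp (realize_mor s C R K) f = EE f" if "f \<in> Maps ?X" for f using that by (simp add: realize_mor_def)
  have ob: "mob (realize_mor s C R K) a = a" if "a \<in> Obj C" for a using that by (simp add: realize_mor_def)
  have mid: "map (mob (realize_mor s C R K)) as = as" if "set as \<subseteq> Obj C" for as
    using that ob by (intro map_idI) auto
  show "morphism s ?X C (realize_mor s C R K)"
    unfolding morphism_def
  proof (intro conjI ballI allI impI)
    have "mob (realize_mor s C R K) \<in> Obj ?X \<rightarrow>\<^sub>E Obj C" by (auto simp: realize_mor_def)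
    moreover have "mmp (realize_mor s C R K) \<in> extensional (Maps ?X)" by (simp add: realize_mor_def)
    moreover have "mmp (realize_mor s C R K) f \<in> maps C (ty f) (map (mob (realize_mor s C R K)) (ins f)) (mob (realize_mor s C R K) (out f))"
      if f: "f \<in> Maps ?X" for f
      using realize_in(2)[of f] f mX[of f] KM.ismapD[of f] e[OF f] mid[of "ins f"] ob[of "out f"] by simp
    ultimately show "multi_graph_map ?X C (realize_mor s C R K)" by (simp add: multi_graph_map_def)
  next
    fix a assume "a \<in> Obj ?X"
    then have a: "a \<in> Obj C" by simp
    have "Idm (M_ob K) a \<in> Maps ?X" using X.idm[of a] a by (simp add: maps_def)
    then show "mmp (realize_mor s C R K) (Idm ?X a) = Idm C (mob (realize_mor s C R K) a)" using e realize_idm[OF a] ob[OF a] by simp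
  next
    fix f assume f: "f \<in> Maps ?X" "ty f = Tight \<and> arity_ok s Loose (arity f)"
    have "Jay ?X f \<in> Maps ?X" using X.jay[OF f(1)] f(2) by (simp add: maps_def)
    then show "mmp (realize_mor s C R K) (Jay ?X f) = \<j> (mmp (realize_mor s C R K) f)"
      using f e realize_jay[of f] mX[of f] by simp
  next
    fix g f i assume gf: "g \<in> Maps ?X" "f \<in> Maps ?X" and op: "fits g i f \<and> op_ok s (ty g) (arity g) (ty f) (arity f)"
    have "Sub ?X g i f \<in> Maps ?X" using X.sub[OF gf] op by (simp add: maps_def)
    then show "mmp (realize_mor s C R K) (Sub ?X g i f) = mmp (realize_mor s C R K) g \<star>[i] mmp (realize_mor s C R K) f"
      using gf e op realize_sub[of g f i] mX[of f] mX[of g] by simp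
  qed
qed

lemma (in rep_laxf) realize_mor_natural:
  "comp_multif (trunc s (M_ob K)) F (realize_mor s C R K)
    = comp_multif (trunc s (M_ob K)) (realize_mor s D S L) (trunc_mor s (M_ob K) (M_mor K L H))"
proof -
  let ?X = "trunc s (M_ob K)"
  have "mmp F (mmp (realize_mor s C R K) f) = mmp (realize_mor s D S L) (mmp (trunc_mor s (M_ob K) (M_mor K L H)) f)"
    if f: "f \<in> Maps ?X" for f
  proof -
    have m: "A.KM.ismap f" "arity_ok s (ty f) (arity f)" using f by (simp_all add: trunc_Maps)
    have 1: "mmp (trunc_mor s (M_ob K) (M_mor K L H)) f = M_map K L H f"
      using m by (simp add: trunc_mor_def M_mor_def Us_mor_def arity_ok_def)
    have "M_map K L H f \<in> Maps (trunc s (M_ob L))"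
      using HL.arr_of_M_map(2)[OF m(1)] m(2) by (simp add: trunc_Maps arity_def)
    then show ?thesis unfolding 1 using f realize_natural[OF m] by (simp add: realize_mor_def)
  qed
  moreover have "mob F a = mob (realize_mor s D S L) (mob (trunc_mor s (M_ob K) (M_mor K L H)) a)" if "a \<in> Obj C" for a
    using that by (simp add: realize_mor_def trunc_mor_def Us_mor_def M_mor_def)
  ultimately show ?thesis
    by (auto simp: comp_multif_def compose_def fun_eq_iff) (auto simp: realize_mor_def)
qed

text \<open>The equations of \<open>lax_spec\<close> concern short multimaps and operations of the truncation only.\<close>

lemma lax_spec_Us:
  assumes C: "rep_skewmon False C R K" and D: "rep_skewmon False D S L" and F: "morphism False C D F"
    and H: "lax_spec (Us_ob C) R K (Us_ob D) S L (Us_mor C F) H"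
  shows "lax_spec C R K D S L F H"
proof -
  interpret rep_morphism False C R K D S L F using C D F by (simp add: rep_morphism_def rep_morphism_axioms_def)
  have so: "short_op Tight (Suc 0) Tight 2" "short_op Tight (Suc 0) Loose 0"
    by (auto simp: short_op_def short_sub_def short_arity_def)
  have T1: "arity (to_mmap f) = Suc 0" for f by (simp add: arity_def)
  have thD: "ty (theta S (Fo a) (Fo b)) = Tight \<and> arity (theta S (Fo a) (Fo b)) = 2" if "a \<in> Obj C" "b \<in> Obj C" for a b
    using B.mapsD[OF B.theta_in[of "Fo a" "Fo b"]] that by simp
  have th: "theta R a b \<in> Maps (Us_ob C)" if "a \<in> Obj C" "b \<in> Obj C" for a b
    using A.mapsD[OF A.theta_in[OF that]] by (simp add: short_arity_def)
  have um: "umap R \<in> Maps (Us_ob C)" "ty (umap S) = Loose" "arity (umap S) = 0"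
    using A.mapsD[OF A.umap_in] B.mapsD[OF B.umap_in] by (simp_all add: short_arity_def)
  have 1: "Sub (Us_ob D) (to_mmap f) 1 (theta S (Fo a) (Fo b)) = Sub D (to_mmap f) 1 (theta S (Fo a) (Fo b))"
    if "a \<in> Obj C" "b \<in> Obj C" for f a b
    using thD[OF that] so by (intro Us_ob_simps(5)) (simp add: T1)
  have 2: "Sub (Us_ob D) (to_mmap f) 1 (umap S) = Sub D (to_mmap f) 1 (umap S)" for f
    using um so by (intro Us_ob_simps(5)) (simp add: T1)
  have 3: "mmp (Us_mor C F) (theta R a b) = mmp F (theta R a b)" if "a \<in> Obj C" "b \<in> Obj C" for a b
    using th[OF that] by (simp add: Us_mor_def)
  have 4: "mmp (Us_mor C F) (umap R) = mmp F (umap R)" using um by (simp add: Us_mor_def)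
  have 5: "mmp (Us_mor C F) (to_mmap f) = mmp F (to_mmap f)" if "f \<in> Ar K" for f
    using that by (simp add: Us_mor_def A.K_Ar T1 short_arity_def)
  have 6: "mob (Us_mor C F) = mob F" by (simp add: Us_mor_def)
  show ?thesis
    using H 1 2 3 4 5 unfolding lax_spec_def 6 Us_ob_simps(1) by auto
qed

section \<open>The equivalences\<close>

context
  fixes ch :: "('o, 'm) multi \<Rightarrow> ('o, 'm) lr_data"
  assumes ch: "\<And>C. short_skew_multicategory C \<Longrightarrow> short_left_representable C \<Longrightarrow> is_lr_data C (ch C)"
begin

abbreviation "KK D \<equiv> Ks_ob (ch D) D"

lemma rep_skewmon_short: "short_lr D \<Longrightarrow> rep_skewmon True D (ch D) (KK D)"
  using rep_skewmon_Ks_ob[OF represented_short] ch by blast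

text \<open>The representing data chosen for the truncation of \<open>E\<close> represent all multimaps of \<open>E\<close>, and its skew
  monoidal category is described by the same equations in \<open>E\<close>.\<close>

lemma rep_skewmon_full:
  assumes "skew_lr E"
  shows "rep_skewmon False E (ch (Us_ob E)) (KK (Us_ob E))"
proof -
  have U: "short_lr (Us_ob E)" by (rule Us_objects[OF assms])
  then have d: "is_lr_data (Us_ob E) (ch (Us_ob E))" using ch by blast
  show ?thesis
    using rep_skewmon_Us_iff[OF represented_full represented_short] rep_skewmon_short[OF U] U d assms by blast
qed

lemma Ks_rep_laxf:
  assumes "short_lr C" "short_lr D" "morphism True C D F"
  shows "rep_laxf True C (ch C) (KK C) D (ch D) (KK D) F (Ks_mor (ch C) C (ch D) D F)"
  using assms rep_laxf_Ks rep_skewmon_short by blast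

lemma Ks_Us_rep_laxf:
  assumes "skew_lr C" "skew_lr D" "morphism False C D F"
  shows "rep_laxf False C (ch (Us_ob C)) (KK (Us_ob C)) D (ch (Us_ob D)) (KK (Us_ob D)) F
    (Ks_mor (ch (Us_ob C)) (Us_ob C) (ch (Us_ob D)) (Us_ob D) (Us_mor C F))"
proof -
  have "rep_laxf True (Us_ob C) (ch (Us_ob C)) (KK (Us_ob C)) (Us_ob D) (ch (Us_ob D)) (KK (Us_ob D)) (Us_mor C F)
    (Ks_mor (ch (Us_ob C)) (Us_ob C) (ch (Us_ob D)) (Us_ob D) (Us_mor C F))"
    using assms Us_objects Us_mor_morphism by (intro Ks_rep_laxf) auto
  then show ?thesis
    using lax_spec_Us[OF rep_skewmon_full[OF assms(1)] rep_skewmon_full[OF assms(2)] assms(3)] assms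
    by (intro rep_laxf_I rep_skewmon_full) (auto dest: rep_laxf.H)
qed

lemma Ks_functor: "is_functor ShSkMulti_lr SkMon (Ks ch)"
  unfolding ShSkMulti_multi_cat
proof (rule is_functorI)
  fix D :: "('o, 'm) multi" assume "D \<in> Ob (multi_cat True short_lr)"
  then have D: "short_lr D" by (simp add: multi_cat_def)
  show "fob (Ks ch) D \<in> Ob SkMon"
    using rep_skewmon.K_skew_monoidal[OF rep_skewmon_short[OF D]] by (simp add: Ks_def SkMon_Ob)
  have "Ks_mor (ch D) D (ch D) D (id_multif D) = id_lax (KK D)"
    using D bounded_multi.morphism_id[OF bounded_multi_short] rep_skewmon_short[OF D]
    by (intro rep_laxf_unique[OF Ks_rep_laxf rep_laxf_id]) auto
  then show "far (Ks ch) (Id (multi_cat True short_lr) D) = Id SkMon (fob (Ks ch) D)"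
    by (simp add: multi_cat_def Ks_def SkMon_def)
next
  fix f :: "(('o, 'm) multi, ('o, 'm) multif) arr" assume "f \<in> Ar (multi_cat True short_lr)"
  then show "far (Ks ch) f \<in> hom SkMon (fob (Ks ch) (src f)) (fob (Ks ch) (tgt f))"
    using rep_laxf_lax[OF Ks_rep_laxf] by (simp add: multi_cat_Ar hom_iff SkMon_Ar Ks_def)
next
  fix g f :: "(('o, 'm) multi, ('o, 'm) multif) arr"
  assume "g \<in> Ar (multi_cat True short_lr)" "f \<in> Ar (multi_cat True short_lr)" "tgt f = src g"
  then have m: "short_lr (src f)" "short_lr (src g)" "short_lr (tgt g)" "morphism True (src f) (src g) (lab f)" "morphism True (src g) (tgt g) (lab g)"
    by (auto simp: multi_cat_Ar)
  have "morphism True (src f) (tgt g) (comp_multif (src f) (lab g) (lab f))"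
    using m bounded_multi.morphism_comp'[OF bounded_multi_short] by blast
  from rep_laxf_unique[OF Ks_rep_laxf[OF m(1,3) this] rep_laxf_comp[OF Ks_rep_laxf[OF m(1,2,4)] Ks_rep_laxf[OF m(2,3,5)]]]
  show "far (Ks ch) (g \<cdot>\<^bsub>multi_cat True short_lr\<^esub> f) = far (Ks ch) g \<cdot>\<^bsub>SkMon\<^esub> far (Ks ch) f"
    using \<open>tgt f = src g\<close> by (simp add: multi_cat_def Ks_def SkMon_def)
qed

text \<open>The comparison \<open>realize\<close>, for short multicategories and, in the next lemma, for skew
  multicategories.\<close>

lemma Us_M_Ks_iso: "nat_iso ShSkMulti_lr ShSkMulti_lr (comp_fctr (comp_fctr Us M_fctr) (Ks ch)) id_fctr
    (\<lambda>D. Arr (Us_ob (M_ob (KK D))) D (realize_mor True D (ch D) (KK D)))"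
  unfolding ShSkMulti_multi_cat nat_iso_def
proof (intro conjI ballI)
  fix D :: "('o, 'm) multi" assume "D \<in> Ob (multi_cat True short_lr)"
  then have D: "short_lr D" by (simp add: multi_cat_def)
  interpret rep_skewmon True D "ch D" "KK D" by (rule rep_skewmon_short[OF D])
  have X: "short_lr (Us_ob (M_ob (KK D)))" using Us_objects[OF M_objects[OF K_skew_monoidal]] .
  have t: "trunc True Y = Us_ob Y" for Y :: "('o, 'm) multi" by (simp add: trunc_def)
  note E = realize_mor[unfolded t]
  show "Arr (Us_ob (M_ob (KK D))) D (realize_mor True D (ch D) (KK D))
      \<in> hom (multi_cat True short_lr) (fob (comp_fctr (comp_fctr Us M_fctr) (Ks ch)) D) (fob id_fctr D)"
    using D X E by (simp add: hom_iff multi_cat_Ar comp_fctr_def id_fctr_def Us_def M_fctr_def Ks_def)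
  show "is_iso (multi_cat True short_lr) (Arr (Us_ob (M_ob (KK D))) D (realize_mor True D (ch D) (KK D)))"
    using D X E bounded_multi_short[of D] bounded_multi_short[of "Us_ob (M_ob (KK D))"]
    by (intro iso_multi_cat) (simp_all, simp add: realize_mor_def)
next
  fix F :: "(('o, 'm) multi, ('o, 'm) multif) arr" assume "F \<in> Ar (multi_cat True short_lr)"
  then have F: "short_lr (src F)" "short_lr (tgt F)" "morphism True (src F) (tgt F) (lab F)" by (auto simp: multi_cat_Ar)
  from rep_laxf.realize_mor_natural[OF Ks_rep_laxf[OF F]]
  show "far id_fctr F \<cdot>\<^bsub>multi_cat True short_lr\<^esub> Arr (Us_ob (M_ob (KK (src F)))) (src F) (realize_mor True (src F) (ch (src F)) (KK (src F)))
      = Arr (Us_ob (M_ob (KK (tgt F)))) (tgt F) (realize_mor True (tgt F) (ch (tgt F)) (KK (tgt F))) \<cdot>\<^bsub>multi_cat True short_lr\<^esub>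
          far (comp_fctr (comp_fctr Us M_fctr) (Ks ch)) F"
    by (simp add: multi_cat_def comp_fctr_def id_fctr_def Us_def M_fctr_def Ks_def trunc_def trunc_mor_def)
qed

lemma M_Ks_Us_iso: "nat_iso SkMulti_lr SkMulti_lr (comp_fctr (comp_fctr M_fctr (Ks ch)) Us) id_fctr
    (\<lambda>D. Arr (M_ob (KK (Us_ob D))) D (realize_mor False D (ch (Us_ob D)) (KK (Us_ob D))))"
  unfolding SkMulti_multi_cat nat_iso_def
proof (intro conjI ballI)
  fix D :: "('o, 'm) multi" assume "D \<in> Ob (multi_cat False skew_lr)"
  then have D: "skew_lr D" by (simp add: multi_cat_def)
  let ?K = "KK (Us_ob D)"
  interpret rep_skewmon False D "ch (Us_ob D)" ?K by (rule rep_skewmon_full[OF D])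
  have X: "skew_lr (M_ob ?K)" using M_objects[OF K_skew_monoidal] .
  have t: "trunc False Y = Y" for Y :: "('o, 'm) multi" by (simp add: trunc_def)
  note E = realize_mor[unfolded t]
  show "Arr (M_ob ?K) D (realize_mor False D (ch (Us_ob D)) ?K)
      \<in> hom (multi_cat False skew_lr) (fob (comp_fctr (comp_fctr M_fctr (Ks ch)) Us) D) (fob id_fctr D)"
    using D X E by (simp add: hom_iff multi_cat_Ar comp_fctr_def id_fctr_def Us_def M_fctr_def Ks_def)
  show "is_iso (multi_cat False skew_lr) (Arr (M_ob ?K) D (realize_mor False D (ch (Us_ob D)) ?K))"
    using D X E bounded_multi_full[of D] bounded_multi_full[of "M_ob ?K"]
    by (intro iso_multi_cat) (simp_all, simp add: realize_mor_def)
next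
  fix F :: "(('o, 'm) multi, ('o, 'm) multif) arr" assume "F \<in> Ar (multi_cat False skew_lr)"
  then have F: "skew_lr (src F)" "skew_lr (tgt F)" "morphism False (src F) (tgt F) (lab F)" by (auto simp: multi_cat_Ar)
  from rep_laxf.realize_mor_natural[OF Ks_Us_rep_laxf[OF F]]
  show "far id_fctr F \<cdot>\<^bsub>multi_cat False skew_lr\<^esub> Arr (M_ob (KK (Us_ob (src F)))) (src F) (realize_mor False (src F) (ch (Us_ob (src F))) (KK (Us_ob (src F))))
      = Arr (M_ob (KK (Us_ob (tgt F)))) (tgt F) (realize_mor False (tgt F) (ch (Us_ob (tgt F))) (KK (Us_ob (tgt F)))) \<cdot>\<^bsub>multi_cat False skew_lr\<^esub>
          far (comp_fctr (comp_fctr M_fctr (Ks ch)) Us) F"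
    by (simp add: multi_cat_def comp_fctr_def id_fctr_def Us_def M_fctr_def Ks_def trunc_def trunc_mor_def)
qed

text \<open>The multicategory \<open>M_ob C\<close> has two choices of representing data, with skew monoidal categories
  \<open>Ks_ob\<close> of its truncation and \<open>C\<close>.  The comparison is the lax monoidal functor determined by the
  identity morphism; it is inverse to the one in the opposite direction by uniqueness.\<close>

definition J_mor :: "('o, 'm) skewmon \<Rightarrow> ('o, 'm) laxf" where
  "J_mor C = Ks_mor (ch (Us_ob (M_ob C))) (M_ob C) (M_lr C) (M_ob C) (id_multif (M_ob C))"

lemma Ks_Us_M_iso: "nat_iso SkMon SkMon (comp_fctr (Ks ch) (comp_fctr Us M_fctr)) id_fctr
    (\<lambda>C. Arr (KK (Us_ob (M_ob C))) C (J_mor C))"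
  unfolding nat_iso_def
proof (intro conjI ballI)
  fix C :: "('o, 'm) skewmon" assume "C \<in> Ob SkMon"
  then have C: "skew_monoidal C" by (simp add: SkMon_Ob)
  let ?X = "M_ob C" and ?K = "KK (Us_ob (M_ob C))" and ?R = "ch (Us_ob (M_ob C))"
  let ?I = "Ks_mor (M_lr C) ?X ?R ?X (id_multif ?X)"
  note k = rep_skewmon_full[OF M_objects[OF C]] M_rep_skewmon[OF C]
  have i: "morphism False ?X ?X (id_multif ?X)" using M_objects[OF C] bounded_multi.morphism_id[OF bounded_multi_full] by blast
  have J: "rep_laxf False ?X ?R ?K ?X (M_lr C) C (id_multif ?X) (J_mor C)"
    unfolding J_mor_def using k i by (intro rep_laxf_Ks)
  have I: "rep_laxf False ?X (M_lr C) C ?X ?R ?K (id_multif ?X) ?I"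
    using k i by (intro rep_laxf_Ks)
  have "comp_lax ?K ?K ?I (J_mor C) = id_lax ?K"
    using rep_laxf_unique[OF rep_laxf_comp[OF J I, unfolded comp_id_multif(1)[OF i]] rep_laxf_id[OF k(1)]] .
  moreover have "comp_lax C C (J_mor C) ?I = id_lax C"
    using rep_laxf_unique[OF rep_laxf_comp[OF I J, unfolded comp_id_multif(1)[OF i]] rep_laxf_id[OF k(2)]] .
  ultimately show "is_iso SkMon (Arr ?K C (J_mor C))"
    using rep_laxf_lax[OF J] rep_laxf_lax[OF I] unfolding is_iso_def
    by (intro conjI bexI[of _ "Arr C ?K ?I"]) (simp_all add: hom_iff SkMon_Ar, simp_all add: SkMon_def)
  show "Arr ?K C (J_mor C) \<in> hom SkMon (fob (comp_fctr (Ks ch) (comp_fctr Us M_fctr)) C) (fob id_fctr C)"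
    using rep_laxf_lax[OF J] by (simp add: hom_iff SkMon_Ar comp_fctr_def id_fctr_def Us_def M_fctr_def Ks_def)
next
  fix F :: "(('o, 'm) skewmon, ('o, 'm) laxf) arr" assume "F \<in> Ar SkMon"
  then have F: "lax_monoidal (src F) (tgt F) (lab F)" by (simp add: SkMon_Ar)
  let ?C = "src F" and ?D = "tgt F"
  let ?X = "M_ob ?C" and ?K = "KK (Us_ob (M_ob ?C))" and ?R = "ch (Us_ob (M_ob ?C))"
  let ?Y = "M_ob ?D" and ?L = "KK (Us_ob (M_ob ?D))" and ?S = "ch (Us_ob (M_ob ?D))"
  let ?F = "M_mor ?C ?D (lab F)"
  have C: "skew_monoidal ?C" and D: "skew_monoidal ?D" using lax_skew[OF F] by auto
  have m: "morphism False ?X ?Y ?F" using lax.M_multifunctor F by (simp add: lax_iff multifunctor_iff)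
  have i: "morphism False ?X ?X (id_multif ?X)" "morphism False ?Y ?Y (id_multif ?Y)"
    using M_objects[OF C] M_objects[OF D] bounded_multi.morphism_id[OF bounded_multi_full] by blast+
  have J: "rep_laxf False ?X ?R ?K ?X (M_lr ?C) ?C (id_multif ?X) (J_mor ?C)"
    "rep_laxf False ?Y ?S ?L ?Y (M_lr ?D) ?D (id_multif ?Y) (J_mor ?D)"
    unfolding J_mor_def using rep_skewmon_full[OF M_objects[OF C]] M_rep_skewmon[OF C] rep_skewmon_full[OF M_objects[OF D]] M_rep_skewmon[OF D] i
    by (intro rep_laxf_Ks; simp)+
  note A = rep_laxf_comp[OF J(1) rep_laxf_M[OF F], unfolded comp_id_multif(2)[OF m]]
  note B = rep_laxf_comp[OF Ks_Us_rep_laxf[OF M_objects[OF C] M_objects[OF D] m] J(2), unfolded comp_id_multif(1)[OF m]]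
  from rep_laxf_unique[OF A B]
  show "far id_fctr F \<cdot>\<^bsub>SkMon\<^esub> Arr ?K ?C (J_mor ?C)
      = Arr ?L ?D (J_mor ?D) \<cdot>\<^bsub>SkMon\<^esub> far (comp_fctr (Ks ch) (comp_fctr Us M_fctr)) F"
    by (simp add: SkMon_def comp_fctr_def id_fctr_def Us_def M_fctr_def Ks_def)
qed

end

lemma SkMulti_category: "category (SkMulti_lr :: (('o, 'm) multi, ('o, 'm) multif) cat)"
  unfolding SkMulti_multi_cat by (rule multi_cat_category) (auto intro: bounded_multi_full)

lemma ShSkMulti_category: "category (ShSkMulti_lr :: (('o, 'm) multi, ('o, 'm) multif) cat)"
  unfolding ShSkMulti_multi_cat by (rule multi_cat_category) (auto intro: bounded_multi_short)

theorem theorem5p12: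
  fixes ch :: "('o, 'm) multi \<Rightarrow> ('o, 'm) lr_data"
  assumes "\<And>C. short_skew_multicategory C \<Longrightarrow> short_left_representable C \<Longrightarrow> is_lr_data C (ch C)"
  shows "equivalence
           (ShSkMulti_lr :: (('o, 'm) multi, ('o, 'm) multif) cat)
           (SkMon :: (('o, 'm) skewmon, ('o, 'm) laxf) cat)
           (Ks ch)
       \<and> equivalence
           (SkMulti_lr :: (('o, 'm) multi, ('o, 'm) multif) cat)
           (ShSkMulti_lr :: (('o, 'm) multi, ('o, 'm) multif) cat)
           Us"
proof
  have Ks: "is_functor ShSkMulti_lr SkMon (Ks ch)"
    by (rule Ks_functor) (rule assms)
  note KsM = comp_is_functor[OF Ks M_functor] and UsM = comp_is_functor[OF M_functor Us_functor]
  have "\<exists>\<epsilon>. nat_iso ShSkMulti_lr ShSkMulti_lr (comp_fctr (comp_fctr Us M_fctr) (Ks ch)) id_fctr \<epsilon>"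
    by (rule exI, rule Us_M_Ks_iso) (rule assms)
  then obtain \<epsilon> where e: "nat_iso ShSkMulti_lr ShSkMulti_lr (comp_fctr (comp_fctr Us M_fctr) (Ks ch)) id_fctr \<epsilon>" ..
  have "\<exists>\<epsilon>. nat_iso SkMulti_lr SkMulti_lr (comp_fctr (comp_fctr M_fctr (Ks ch)) Us) id_fctr \<epsilon>"
    by (rule exI, rule M_Ks_Us_iso) (rule assms)
  then obtain \<zeta> where z: "nat_iso SkMulti_lr SkMulti_lr (comp_fctr (comp_fctr M_fctr (Ks ch)) Us) id_fctr \<zeta>" ..
  have c: "\<exists>\<epsilon>. nat_iso SkMon SkMon (comp_fctr (Ks ch) (comp_fctr Us M_fctr)) id_fctr \<epsilon>"
    by (rule exI, rule Ks_Us_M_iso) (rule assms)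
  show "equivalence ShSkMulti_lr SkMon (Ks ch)"
    using nat_iso_sym[OF ShSkMulti_category comp_is_functor[OF Ks UsM] id_is_functor[OF ShSkMulti_category] e ShSkMulti_category]
    by (intro equivalenceI[OF ShSkMulti_category SkMon_category Ks UsM _ c])
  have "comp_fctr (comp_fctr Us M_fctr) (Ks ch) = comp_fctr Us (comp_fctr M_fctr (Ks ch))"
    by (simp add: comp_fctr_def comp_assoc)
  then have e': "\<exists>\<epsilon>. nat_iso ShSkMulti_lr ShSkMulti_lr (comp_fctr Us (comp_fctr M_fctr (Ks ch))) id_fctr \<epsilon>"
    using e by auto
  show "equivalence (SkMulti_lr :: (('o, 'm) multi, ('o, 'm) multif) cat) ShSkMulti_lr Us"
    using nat_iso_sym[OF SkMulti_category comp_is_functor[OF Us_functor KsM] id_is_functor[OF SkMulti_category] z SkMulti_category]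
    by (intro equivalenceI[OF SkMulti_category ShSkMulti_category Us_functor KsM _ e'])
qed

end
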